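(* Let $u$ be a nonconstant real symmetric inner function and let $B_1,B_2\in\mathcal{H}(u)$, neither of which is a constant multiple of $D$. Then $B_1B_2\in\mathcal{T}(u)$ if and only if there is $\alpha\in\widehat{\mathbb{C}}=\mathbb{C}\cup\{\infty\}$ such that $B_1\in\mathcal{B}_u^\alpha D$ and $B_2\in D\mathcal{B}_u^\alpha$. Moreover, for such $\alpha$: (1) if $|\alpha|=1$, then $B_1=\Phi(S_u^\alpha)D$ and $B_2=D\Psi(S_u^\alpha)$ with $\Phi,\Psi\in L^\infty(\mu_\alpha)$, and $B_1B_2=(\Phi\Psi)(S_u^\alpha)$; (2) if $|\alpha|<1$, then $$B_1=A^u_{\frac{\Psi_1}{1-\alpha\overline u}}D=B^u_{\frac{\overline{u\widehat{\Psi_1}}}{1-\alpha u}},\qquad B_2=DA^u_{\frac{\Psi_2}{1-\alpha\overline u}}=B^u_{\frac{\overline u\Psi_2}{1-\alpha\overline u}}$$ with $\Psi_1,\Psi_2\in H^\infty$, and $B_1B_2=A^u_{\frac{\Psi_1\Psi_2}{1-\alpha\overline u}}$; (3) if $|\alpha|>1$, then $$B_1=A^u_{\frac{\alpha\overline{\Psi_1}}{\alpha-u}}D=B^u_{\frac{\alpha\overline u\widehat{\Psi_1}}{\alpha-\overline u}},\qquad B_2=DA^u_{\frac{\alpha\overline{\Psi_2}}{\alpha-u}}=B^u_{\frac{\alpha\overline u\,\overline{\Psi_2}}{\alpha-u}}$$ with $\Psi_1,\Psi_2\in H^\infty$, and $B_1B_2=A^u_{\frac{\alpha\overline{\Ps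i_1\Psi_2}}{\alpha-u}}$.
   Context: $L^2=L^2(\mathbb{T})$, $H^2\subset L^2$ is the Hardy space, $H^\infty$ the bounded analytic functions on $\mathbb{D}$, $P:L^2\to H^2$ the orthogonal projection. For an inner function $u$, $K_u=H^2\ominus uH^2$ with orthogonal projection $P_u:L^2\to K_u$; $C_uf=u\,\overline{zf}$ (on $\mathbb{T}$) is a conjugation on $K_u$; $Uf(z)=\widehat f(z)=\overline{f(\overline z)}$. $u$ is real symmetric if $u=\widehat u$; then $U$ maps $K_u$ onto $K_u$ and $D:=C_uU$ is a linear operator on $K_u$ with $D=D^*$, $D^2=I$. $J:L^2\to L^2$ is $Jf(z)=\overline zf(\overline z)$. For $\phi\in L^2$, the densely defined operators $A^u_\phi f=P_u(\phi f)$ and $B^u_\phi f=P_uJ(I-P)(\phi f)$ on $K_u$ are the truncated Toeplitz and truncated Hankel operators; $\mathcal{T}(u)$ and $\mathcal{H}(u)$ are the spaces of all bounded ones, respectively. $(f\otimes g)h=\langle h,g\rangle f$. $k_0^u=1-\overline{u(0)}u$, $\widetilde{k_0^u}=C_uk_0^u=(u-u(0))/z$. $S_uf=P_u(zf)$ on $K_u$, and for $|\alpha|\le1$, $S_u^\alpha=S_u+\frac{\alpha}{1-\alpha\overline{u(0)}}\,k_0^u\otimes\widetilde{k_0^u}$, which is unitary for $|\alpha|=1$. For $\alpha\in\mathbb{C}$, $\mathcal{B}_u^\alpha=\{A^u_{\varphi+\alpha\overline{S_uC_u\varphi}+c}\in\mathcal{T}(u):\varphi\in K_u,\ c\in\mathbb{C}\}$,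 and $\mathcal{B}_u^\infty=\{A^u_{\overline\varphi}\in\mathcal{T}(u):\varphi\in K_u\}$. For a set $\mathcal{B}$ of operators, $D\mathcal{B}=\{DA:A\in\mathcal{B}\}$ and $\mathcal{B}D=\{AD:A\in\mathcal{B}\}$. For $|\alpha|=1$, $\mu_\alpha$ is the Clark measure: the finite positive Borel measure on $\mathbb{T}$ whose Poisson integral is $\frac{1-|u|^2}{|\alpha-u|^2}$; $\Phi(S_u^\alpha)$ for $\Phi\in L^\infty(\mu_\alpha)$ is given by the spectral functional calculus. For $\alpha=\infty$ (counted among $|\alpha|>1$), $\frac{\alpha}{\alpha-u}$ and $\frac{\alpha}{\alpha-\overline u}$ are read as $1$. *)

theory Defs
  imports "HOL-Analysis.Analysis"
begin

text \<open>
  Functions on the unit circle are represented by functions \<^typ>\<open>complex \<Rightarrow> complex\<close>, of which only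
  the values on the circle matter.  There is no quotient: elements of the spaces below
  are representatives, and equality in \<open>L\<^sup>2\<close> is equality almost everywhere.
\<close>

section \<open>The spaces \<open>L\<^sup>2\<close>, \<open>H\<^sup>2\<close>, \<open>H\<^sup>\<infinity>\<close>\<close>

text \<open>Normalized arc length, as a measure whose space is the circle itself and not the whole plane.\<close>

definition circle :: "complex measure" where
  "circle = distr (uniform_measure lborel {0..2*pi}) (restrict_space borel (sphere 0 1)) cis"

lemma space_circle: "space circle = sphere 0 1"
  by (simp add: circle_def space_restrict_space)

lemma sets_circle: "sets circle = sets (restrict_space borel (sphere 0 1))"
  by (simp add: circle_def)

lemma cis_measurable: "cis \<in> uniform_measure lborel {0..2*pi} \<rightarrow>\<^sub>M restrict_space borel (sphere 0 1)"
proof -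
  have "cis \<in> borel_measurable borel"
    by (intro borel_measurable_continuous_onI continuous_intros)
  then show ?thesis
    by (intro measurable_restrict_space2) (auto simp: measurable_def)
qed

lemma emeasure_circle: "emeasure circle (sphere 0 1) = 1"
proof -
  have "sphere (0::complex) 1 \<in> sets (restrict_space borel (sphere 0 1))"
    using sets.top[of "restrict_space borel (sphere (0::complex) 1)"]
    by (simp add: space_restrict_space)
  then have "emeasure circle (sphere 0 1)
      = emeasure (uniform_measure lborel {0..2*pi}) (cis -` sphere 0 1 \<inter> UNIV)"
    unfolding circle_def by (subst emeasure_distr[OF cis_measurable]) auto
  also have "cis -` sphere 0 1 \<inter> UNIV = (UNIV :: real set)" by auto
  also have "emeasure (uniform_measure lborel {0..2*pi}) UNIV = 1"
    by (subst emeasure_uniform_measure) (auto intro!: ennreal_divide_self)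
  finally show ?thesis .
qed

definition ae_eq :: "(complex \<Rightarrow> complex) \<Rightarrow> (complex \<Rightarrow> complex) \<Rightarrow> bool"  (infix \<open>\<doteq>\<close> 50) where
  "f \<doteq> g \<longleftrightarrow> (AE z in circle. f z = g z)"

definition L2 :: "(complex \<Rightarrow> complex) set" where
  "L2 = {f \<in> borel_measurable circle. integrable circle (\<lambda>z. (cmod (f z))\<^sup>2)}"

definition Linfty :: "complex measure \<Rightarrow> (complex \<Rightarrow> complex) set" where
  "Linfty M = {f \<in> borel_measurable M. \<exists>C. AE z in M. cmod (f z) \<le> C}"

definition ip :: "(complex \<Rightarrow> complex) \<Rightarrow> (complex \<Rightarrow> complex) \<Rightarrow> complex" where
  "ip f g = (LINT z|circle. f z * cnj (g z))"

definition L2norm :: "(complex \<Rightarrow> complex) \<Rightarrow> real" where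
  "L2norm f = sqrt (LINT z|circle. (cmod (f z))\<^sup>2)"

text \<open>Orthogonal projection onto a closed subspace \<open>M\<close>; the value is determined up to \<open>\<doteq>\<close>.\<close>

definition proj :: "(complex \<Rightarrow> complex) set \<Rightarrow> (complex \<Rightarrow> complex) \<Rightarrow> complex \<Rightarrow> complex" where
  "proj M f = (SOME g. g \<in> M \<and> (\<forall>h\<in>M. ip (\<lambda>z. f z - g z) h = 0))"

text \<open>The integral of \<open>f z * z ^ Suc n\<close> is the Fourier coefficient of \<open>f\<close> of index \<open>- (n + 1)\<close>.\<close>

definition H2 :: "(complex \<Rightarrow> complex) set" where
  "H2 = {f \<in> L2. \<forall>n::nat. (LINT z|circle. f z * z ^ Suc n) = 0}"

definition Hinfty :: "(complex \<Rightarrow> complex) set" where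
  "Hinfty = {f. f holomorphic_on ball 0 1 \<and> bounded (f ` ball 0 1)}"

text \<open>
  Functions in \<open>Hinfty\<close> (in particular inner functions) live on the open disc; \<open>bv f\<close> is the
  function of radial boundary values on the circle, which exist almost everywhere.
\<close>

definition bv :: "(complex \<Rightarrow> complex) \<Rightarrow> complex \<Rightarrow> complex" where
  "bv f z = Lim (at_left (1::real)) (\<lambda>r. f (of_real r * z))"

definition inner_function :: "(complex \<Rightarrow> complex) \<Rightarrow> bool" where
  "inner_function u \<longleftrightarrow> u \<in> Hinfty \<and> (AE z in circle. cmod (bv u z) = 1)"

definition hat :: "(complex \<Rightarrow> complex) \<Rightarrow> complex \<Rightarrow> complex" where
  "hat f z = cnj (f (cnj z))"

definition real_symmetric :: "(complex \<Rightarrow> complex) \<Rightarrow> bool" where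
  "real_symmetric u \<longleftrightarrow> (\<forall>z\<in>ball 0 1. u z = hat u z)"

section \<open>The model space and its operators\<close>

definition Ku :: "(complex \<Rightarrow> complex) \<Rightarrow> (complex \<Rightarrow> complex) set" where
  "Ku u = {f \<in> H2. \<forall>g\<in>H2. ip f (\<lambda>z. bv u z * g z) = 0}"

definition conj_op :: "(complex \<Rightarrow> complex) \<Rightarrow> (complex \<Rightarrow> complex) \<Rightarrow> complex \<Rightarrow> complex" where
  "conj_op u f z = bv u z * cnj (z * f z)"

definition D_op :: "(complex \<Rightarrow> complex) \<Rightarrow> (complex \<Rightarrow> complex) \<Rightarrow> complex \<Rightarrow> complex" where
  "D_op u f = conj_op u (hat f)"

definition J_op :: "(complex \<Rightarrow> complex) \<Rightarrow> complex \<Rightarrow> complex" where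
  "J_op f z = cnj z * f (cnj z)"

text \<open>
  An operator on \<open>Ku u\<close> is a map on functions of which only the values on \<open>Ku u\<close> matter.
  Linearity up to \<open>\<doteq>\<close> and boundedness make a bounded operator respect \<open>\<doteq>\<close>.
\<close>

type_synonym oper = "(complex \<Rightarrow> complex) \<Rightarrow> complex \<Rightarrow> complex"

definition op_eq :: "(complex \<Rightarrow> complex) \<Rightarrow> oper \<Rightarrow> oper \<Rightarrow> bool" where
  "op_eq u S T \<longleftrightarrow> (\<forall>f\<in>Ku u. S f \<doteq> T f)"

definition bounded_op :: "(complex \<Rightarrow> complex) \<Rightarrow> oper \<Rightarrow> bool" where
  "bounded_op u A \<longleftrightarrow>
     (\<forall>f\<in>Ku u. A f \<in> Ku u) \<and>
     (\<forall>f\<in>Ku u. \<forall>g\<in>Ku u. A (\<lambda>z. f z + g z) \<doteq> (\<lambda>z. A f z + A g z)) \<and>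
     (\<forall>f\<in>Ku u. \<forall>c. A (\<lambda>z. c * f z) \<doteq> (\<lambda>z. c * A f z)) \<and>
     (\<exists>C. \<forall>f\<in>Ku u. L2norm (A f) \<le> C * L2norm f)"

definition TTO :: "(complex \<Rightarrow> complex) \<Rightarrow> (complex \<Rightarrow> complex) \<Rightarrow> oper" where
  "TTO u \<phi> f = proj (Ku u) (\<lambda>z. \<phi> z * f z)"

definition THO :: "(complex \<Rightarrow> complex) \<Rightarrow> (complex \<Rightarrow> complex) \<Rightarrow> oper" where
  "THO u \<phi> f = proj (Ku u) (J_op (\<lambda>z. \<phi> z * f z - proj H2 (\<lambda>z. \<phi> z * f z) z))"

text \<open>
  For \<open>\<phi> \<in> L2\<close> the operators \<open>TTO u \<phi>\<close> and \<open>THO u \<phi>\<close> are meaningful on the dense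
  subspace of bounded functions in \<open>Ku u\<close>.  They are bounded if and only if they agree there with a
  (necessarily unique) bounded operator \<open>A\<close> on \<open>Ku u\<close>, with which they are then identified.
\<close>

definition extends_to :: "(complex \<Rightarrow> complex) \<Rightarrow> oper \<Rightarrow> oper \<Rightarrow> bool" where
  "extends_to u T A \<longleftrightarrow> bounded_op u A \<and> (\<forall>f \<in> Ku u \<inter> Linfty circle. A f \<doteq> T f)"

definition toeplitz_space :: "(complex \<Rightarrow> complex) \<Rightarrow> oper set" where
  "toeplitz_space u = {A. \<exists>\<phi>\<in>L2. extends_to u (TTO u \<phi>) A}"

definition hankel_space :: "(complex \<Rightarrow> complex) \<Rightarrow> oper set" where
  "hankel_space u = {B. \<exists>\<phi>\<in>L2. extends_to u (THO u \<phi>) B}"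

definition k0 :: "(complex \<Rightarrow> complex) \<Rightarrow> complex \<Rightarrow> complex" where
  "k0 u z = 1 - cnj (u 0) * bv u z"

definition k0_tilde :: "(complex \<Rightarrow> complex) \<Rightarrow> complex \<Rightarrow> complex" where
  "k0_tilde u = conj_op u (k0 u)"

definition tensor :: "(complex \<Rightarrow> complex) \<Rightarrow> (complex \<Rightarrow> complex) \<Rightarrow> oper" where
  "tensor f g h = (\<lambda>z. ip h g * f z)"

definition shift :: "(complex \<Rightarrow> complex) \<Rightarrow> oper" where
  "shift u f = proj (Ku u) (\<lambda>z. z * f z)"

definition mod_shift :: "(complex \<Rightarrow> complex) \<Rightarrow> complex \<Rightarrow> oper" where
  "mod_shift u \<alpha> f =
     (\<lambda>z. shift u f z + \<alpha> / (1 - \<alpha> * cnj (u 0)) * tensor (k0 u) (k0_tilde u) f z)"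

section \<open>The classes \<open>\<B>\<^sub>u\<^sup>\<alpha>\<close>\<close>

datatype ext_complex = Fin complex | Infty

fun sedlock :: "(complex \<Rightarrow> complex) \<Rightarrow> ext_complex \<Rightarrow> oper set" where
  "sedlock u (Fin \<alpha>) =
     {A. \<exists>\<phi>\<in>Ku u. \<exists>c. extends_to u
        (TTO u (\<lambda>z. \<phi> z + \<alpha> * cnj (shift u (conj_op u \<phi>) z) + c)) A}"
| "sedlock u Infty = {A. \<exists>\<phi>\<in>Ku u. extends_to u (TTO u (\<lambda>z. cnj (\<phi> z))) A}"

definition D_times :: "(complex \<Rightarrow> complex) \<Rightarrow> oper set \<Rightarrow> oper set" where
  "D_times u \<B> = {B. \<exists>A\<in>\<B>. op_eq u B (D_op u \<circ> A)}"

definition times_D :: "(complex \<Rightarrow> complex) \<Rightarrow> oper set \<Rightarrow> oper set" where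
  "times_D u \<B> = {B. \<exists>A\<in>\<B>. op_eq u B (A \<circ> D_op u)}"

fun outside_disc :: "ext_complex \<Rightarrow> bool" where
  "outside_disc (Fin \<alpha>) \<longleftrightarrow> cmod \<alpha> > 1"
| "outside_disc Infty \<longleftrightarrow> True"

text \<open>The quotient \<open>\<alpha> / (\<alpha> - w)\<close>, read as \<open>1\<close> for \<open>\<alpha> = \<infinity>\<close>.\<close>

fun quot :: "ext_complex \<Rightarrow> complex \<Rightarrow> complex" where
  "quot (Fin \<alpha>) w = \<alpha> / (\<alpha> - w)"
| "quot Infty w = 1"

section \<open>Clark measures and the spectral functional calculus\<close>

definition clark_measure :: "(complex \<Rightarrow> complex) \<Rightarrow> complex \<Rightarrow> complex measure" where
  "clark_measure u \<alpha> = (THE \<mu>. sets \<mu> = sets circle \<and> finite_measure \<mu> \<and>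
     (\<forall>w\<in>ball 0 1. (LINT z|\<mu>. (1 - (cmod w)\<^sup>2) / (cmod (z - w))\<^sup>2)
        = (1 - (cmod (u w))\<^sup>2) / (cmod (\<alpha> - u w))\<^sup>2))"

text \<open>The scalar measure \<open>A \<mapsto> \<langle>E(A)f, f\<rangle>\<close> of a projection-valued measure \<open>E\<close>.\<close>

definition scalar_measure :: "(complex set \<Rightarrow> oper) \<Rightarrow> (complex \<Rightarrow> complex) \<Rightarrow> complex measure" where
  "scalar_measure E f =
     measure_of (sphere 0 1) (sets circle) (\<lambda>A. ennreal (Re (ip (E A f) f)))"

text \<open>
  \<open>E\<close> is the spectral measure of the unitary operator \<open>S\<close> on \<open>Ku u\<close>: a measure on the Borel
  sets of the circle whose values are orthogonal projections in \<open>Ku u\<close>, with \<open>S = \<integral> z dE(z)\<close>.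
  Idempotency of \<open>E A\<close> is the case \<open>A = A'\<close> of multiplicativity.  By polarization it suffices
  to state countable additivity and \<open>S = \<integral> z dE(z)\<close> for the quadratic forms.
\<close>

definition spectral_measure ::
    "(complex \<Rightarrow> complex) \<Rightarrow> oper \<Rightarrow> (complex set \<Rightarrow> oper) \<Rightarrow> bool" where
  "spectral_measure u S E \<longleftrightarrow>
     (\<forall>A\<in>sets circle. bounded_op u (E A) \<and> (\<forall>f\<in>Ku u. \<forall>g\<in>Ku u. ip (E A f) g = ip f (E A g))) \<and>
     (\<forall>A\<in>sets circle. \<forall>A'\<in>sets circle. op_eq u (E A \<circ> E A') (E (A \<inter> A'))) \<and>
     op_eq u (E (sphere 0 1)) id \<and>
     (\<forall>f\<in>Ku u. \<forall>A. range A \<subseteq> sets circle \<and> disjoint_family A \<longrightarrow>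
        (\<lambda>n::nat. ip (E (A n) f) f) sums ip (E (\<Union>n. A n) f) f) \<and>
     (\<forall>f\<in>Ku u. ip (S f) f = (LINT z|scalar_measure E f. z))"

text \<open>
  \<open>\<Phi>(S) = \<integral> \<Phi> dE\<close>; again the quadratic form \<open>f \<mapsto> \<langle>\<Phi>(S)f, f\<rangle>\<close> determines the operator.
\<close>

definition fun_calc :: "(complex \<Rightarrow> complex) \<Rightarrow> oper \<Rightarrow> (complex \<Rightarrow> complex) \<Rightarrow> oper" where
  "fun_calc u S \<Phi> = (SOME T. bounded_op u T \<and>
     (\<exists>E. spectral_measure u S E \<and>
        (\<forall>f\<in>Ku u. ip (T f) f = (LINT z|scalar_measure E f. \<Phi> z))))"

end

theory Submission
 imports Defs "HOL-Probability.Probability" "HOL-Complex_Analysis.Complex_Analysis"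
begin

text \<open>
 Elements of \<open>L\<^sup>2\<close> are made into a Hilbert space \<open>hl2\<close> of classes, on which \<open>L\<close> denotes the backward shift.
 A bounded \<open>A\<close> on \<open>K\<^sub>u\<close> is a truncated Toeplitz operator iff
 \<open>\<langle>A f, g\<rangle> - \<langle>A (L f), L g\<rangle> = f(0) \<langle>\<phi>, g\<rangle> + cnj (g(0)) \<langle>f, \<eta>\<rangle>\<close> for some \<open>\<phi>, \<eta>\<close> in \<open>K\<^sub>u\<close>. Evaluating
 this form for a product of two such operators forces, unless one of them is scalar, \<open>\<phi>\<close> and
 \<open>S C \<eta>\<close> of the two factors to be proportional with a common ratio \<open>\<alpha>\<close>; this is the Sedlock class
 of \<open>\<alpha>\<close>, which for \<open>\<bar>\<alpha>\<bar> <= 1\<close> is the commutant of \<open>S\<^sub>u\<^sup>\<alpha>\<close>. For \<open>\<bar>\<alpha>\<bar> < 1\<close> the symbol in \<open>H\<^sup>\<infinity>\<close> comes from a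
 lurking isometry (commutant lifting), for \<open>\<bar>\<alpha>\<bar> > 1\<close> from taking adjoints, and for \<open>\<bar>\<alpha>\<bar> = 1\<close> the unitary
 \<open>S\<^sub>u\<^sup>\<alpha>\<close> becomes multiplication by \<open>z\<close> on \<open>L\<^sup>2(\<mu>\<^sub>\<alpha>)\<close>, whose commutant consists of multiplication operators.
 Multiplication by \<open>D\<close> exchanges truncated Hankel and truncated Toeplitz operators.
\<close>

text \<open>Powers of \<open>L\<close> tend strongly to 0, so the form \<open>dA A\<close>
  determines \<open>A\<close> by telescoping. This circumvents the obstacle that symbols are only
  square integrable and describe the operators only on bounded functions: they never have to be
  multiplied with each other. For f(0) = g(0) = 0 the form of a product is a difference of two
  rank-one forms, and such a difference vanishes only if the factors match up to a scalar; this
  scalar is \<alpha>. Conditions on \<phi> and \<eta> are tested only against functions vanishing at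
  0, because a multiple of \<open>k0\<close> can be moved from one vector to the other. For
  \<bar>\<alpha>\<bar> = 1 a further obstacle is that \<open>fun_calc\<close> picks an arbitrary
  spectral measure, of which only the first moment is prescribed. Its higher moments have to be
  found before it can be identified; Riemann sums over disjoint cells do this, since their powers
  are again Riemann sums.\<close>

notation LIMSEQ (infix "---->" 60) and tendsto (infixr "--->" 55) and iff (infixr "<->" 25)

abbreviation "sph \<equiv> sphere (0::complex) 1"
abbreviation "Bm \<equiv> borel_measurable circle"

lemmas integral_eqI = Bochner_Integration.integral_cong and integrable_le = Bochner_Integration.integrable_bound
  and LINT_cnj = Bochner_Integration.integral_cnj

section \<open>Measures on the circle\<close>

lemma sets_circle_iff: "A : sets circle <-> A : sets borel & A \<subseteq> sph"
 by (auto simp: sets_circle sets_restrict_space_iff)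

lemma borel_measurable_circle:
 "f : borel_measurable borel ==> sets M = sets circle ==> f : borel_measurable M"
 using measurable_restrict_space1[of f borel borel "sph"]
 by (metis measurable_cong_sets sets_circle)

lemma continuous_measurable_circle:
 fixes f :: "complex => 'b::topological_space"
 shows "continuous_on UNIV f ==> sets M = sets circle ==> f : borel_measurable M"
 by (rule borel_measurable_circle[OF borel_measurable_continuous_onI])

lemma measurable_cnj [measurable]: "cnj : borel_measurable borel"
 by (intro borel_measurable_continuous_onI continuous_intros)

lemma circle_cnj: "z : sph ==> cnj z * z = 1" for z :: complex
 by (simp add: complex_norm_square [symmetric] mult.commute)

lemma integrable_bounded_circle:
 fixes f :: "complex => 'b::{banach, second_countable_topology}"
 assumes "finite_measure M" "sets M = sets circle" "f : borel_measurable M"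
  "!!z. z : sph ==> norm (f z) <= B"
 shows "integrable M f"
proof -
 interpret finite_measure M by fact
 have sp: "space M = sph" using sets_eq_imp_space_eq[OF assms(2)] by (auto simp: space_circle)
 show ?thesis by (rule integrable_const_bound[where B=B]) (use assms sp in auto)
qed

text \<open>On the circle \<open>cnj z * z = 1\<close> reduces every mixed monomial to a power of
  \<open>z\<close> or of \<open>cnj z\<close>, and the latter has the conjugate moment. Polynomials
  in the real coordinates are polynomials in \<open>z\<close> and \<open>cnj z\<close>, so an
  induction over their construction finishes.\<close>

lemma integral_polynomial_cong:
 fixes g :: "complex => real"
 assumes sets: "sets \<mu> = sets circle" "sets \<nu> = sets circle"
  and fin: "finite_measure \<mu>" "finite_measure \<nu>"
  and mom: "!!n::nat. (LINT z|\<mu>. z ^ n) = (LINT z|\<nu>. z ^ n)"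
  and g: "real_polynomial_function g"
 shows "(LINT z|\<mu>. g z) = (LINT z|\<nu>. g z)"
proof -
 have sp: "space \<mu> = sph" "space \<nu> = sph"
  using sets_eq_imp_space_eq[OF sets(1)] sets_eq_imp_space_eq[OF sets(2)] by (auto simp: space_circle)
 \<comment> \<open>\<open>Q\<close> asks for all mixed moments of \<open>h\<close> at once; only
   then is it closed under multiplication by \<open>z\<close> and \<open>cnj z\<close>, hence by
   real polynomial functions.\<close>
 define Q where "Q h <-> continuous_on UNIV h & (ALL N k. (LINT z|\<mu>. h z * (cnj z ^ N * z ^ k)) = (LINT z|\<nu>. h z * (cnj z ^ N * z ^ k)))"
  for h :: "complex => complex"
 have int: "integrable M (%z. h z * (cnj z ^ N * z ^ k))"
  if "continuous_on UNIV h" "finite_measure M" "sets M = sets circle" for M h N k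
 proof -
  have "compact ((%z. h z * (cnj z ^ N * z ^ k)) ` sph)"
   by (intro compact_continuous_image continuous_intros continuous_on_subset[OF that(1)]) auto
  from compact_imp_bounded[OF this] obtain B where "ALL z:sph. norm (h z * (cnj z ^ N * z ^ k)) <= B"
   unfolding bounded_iff by auto
  thus ?thesis using that
   by (intro integrable_bounded_circle[of M _ B] continuous_measurable_circle continuous_intros) auto
 qed
 have "(LINT z|\<mu>. cnj z ^ N * z ^ k) = (LINT z|\<nu>. cnj z ^ N * z ^ k)" for N k
 proof (induction N arbitrary: k)
  case (Suc N)
  have c: "(LINT z|M. cnj z ^ n) = cnj (LINT z|M. z ^ n)" for M :: "complex measure" and n
   by (simp flip: complex_cnj_power)
  have "(LINT z|M. cnj z ^ Suc N * z ^ Suc j) = (LINT z|M. cnj z ^ N * z ^ j)" if "space M = sph" for M j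
  proof (rule integral_eqI)
   fix z assume "z : space M"
   hence "cnj z * z = 1" by (simp add: that circle_cnj)
   moreover have "cnj z ^ Suc N * z ^ Suc j = (cnj z * z) * (cnj z ^ N * z ^ j)" by simp
   ultimately show "cnj z ^ Suc N * z ^ Suc j = cnj z ^ N * z ^ j" by simp
  qed simp
  thus ?case using Suc sp c[of _ "Suc N"] mom by (cases k) (simp_all del: power_Suc)
 qed (simp add: mom)
 hence Q1: "Q (%_. 1)" by (simp add: Q_def)
 have Qadd: "Q (%z. f z + h z)" if "Q f" "Q h" for f h
  using that by (simp add: Q_def distrib_right int fin sets continuous_on_add)
 have Qc: "Q (%z. c * h z)" if "Q h" for h c
  using that by (simp add: Q_def mult.assoc continuous_on_mult_left)
 have Qz: "Q (%z. z * h z)" "Q (%z. cnj z * h z)" if "Q h" for h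
 proof -
  have e: "z * h z * (cnj z ^ N * z ^ k) = h z * (cnj z ^ N * z ^ Suc k)"
   "cnj z * h z * (cnj z ^ N * z ^ k) = h z * (cnj z ^ Suc N * z ^ k)" for z N k by (simp_all add: ac_simps)
  show "Q (%z. z * h z)" "Q (%z. cnj z * h z)"
   using that unfolding Q_def e by (auto simp del: power_Suc intro!: continuous_intros)
 qed
 have "Q h ==> Q (%z. of_real (g z) * h z)" for h using g
 proof (induction arbitrary: h)
  case (linear f)
  \<comment> \<open>The decomposition \<open>Re z = (z + cnj z) / 2\<close>,
    \<open>Im z = \<i> * (cnj z - z) / 2\<close>, weighted with \<open>f 1\<close> and
    \<open>f \<i>\<close>.\<close>
  let ?a = "complex_of_real (f 1 / 2)" and ?b = "\<i> * complex_of_real (f \<i> / 2)"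
  have "complex_of_real (f z) = (?a * z + ?a * cnj z) + (- ?b * z + ?b * cnj z)" for z
  proof -
   have "z = Re z *\<^sub>R 1 + Im z *\<^sub>R \<i>" by (simp add: complex_eq_iff)
   hence "f z = f (Re z *\<^sub>R 1 + Im z *\<^sub>R \<i>)" by presburger
   also have "... = Re z * f 1 + Im z * f \<i>"
    using bounded_linear.linear[OF linear(1)] by (simp only: linear_add linear_scale real_scaleR_def)
   finally show ?thesis by (simp add: complex_eq_iff)
  qed
  hence "of_real (f z) * h z = (?a * (z * h z) + ?a * (cnj z * h z)) + (- ?b * (z * h z) + ?b * (cnj z * h z))" for z
   by (simp only: distrib_right mult.assoc)
  thus ?case using linear(2) by (simp only:) (intro Qadd Qc Qz)
 next
  case (add f g) thus ?case using Qadd[OF add(3)[OF add(5)] add(4)[OF add(5)]] by (simp add: distrib_right)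
 next
  case (mult f g) thus ?case by (simp add: mult.assoc)
 qed (simp add: Qc)
 from this[OF Q1] have "Q (%z. of_real (g z))" by simp
 hence "(LINT z|\<mu>. complex_of_real (g z) * (cnj z ^ 0 * z ^ 0)) = (LINT z|\<nu>. of_real (g z) * (cnj z ^ 0 * z ^ 0))"
  unfolding Q_def by blast
 thus ?thesis by simp
qed

text \<open>The tent functions \<open>1 - n * infdist z C\<close>, cut off at 0, decrease to the
  indicator of \<open>C\<close>. Each is replaced by a polynomial with error below
  \<open>1 / (n + 1)\<close>, so the integrals of these polynomials converge to the measure of the
  closed set.\<close>

lemma emeasure_closed_eq_moments:
 assumes sets: "sets \<mu> = sets circle" "sets \<nu> = sets circle"
  and fin: "finite_measure \<mu>" "finite_measure \<nu>"
  and mom: "!!n::nat. (LINT z|\<mu>. z ^ n) = (LINT z|\<nu>. z ^ n)"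
  and C: "closed C"
 shows "measure \<mu> (C \<inter> sph) = measure \<nu> (C \<inter> sph)"
proof (cases "C = {}")
 case False
 have sp: "space \<mu> = sph" "space \<nu> = sph"
  using sets_eq_imp_space_eq[OF sets(1)] sets_eq_imp_space_eq[OF sets(2)] by (auto simp: space_circle)
 define f where "f n z = max 0 (1 - real n * infdist z C)" for n z
 have cont: "continuous_on UNIV (f n)" for n unfolding f_def by (intro continuous_intros)
 have lim: "(%n. f n z) ----> indicator C z" for z
 proof (cases "z : C")
  case True thus ?thesis by (simp add: f_def)
 next
  case False
  hence d: "infdist z C > 0" using C \<open>C ~= {}\<close>
   by (metis in_closed_iff_infdist_zero infdist_nonneg order_le_less)
  have "eventually (%n. f n z = 0) sequentially"
  proof -
   obtain N where N: "1 < real N * infdist z C" using d reals_Archimedean3 by blast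
   show ?thesis unfolding eventually_sequentially
   proof (intro exI[of _ N] allI impI)
    fix n assume "N <= n"
    hence "real N * infdist z C <= real n * infdist z C" using d by (intro mult_right_mono) auto
    thus "f n z = 0" using N by (simp add: f_def)
   qed
  qed
  thus ?thesis using False by (simp add: tendsto_eventually)
 qed
 have "EX g. real_polynomial_function g & (ALL z:sph. \<bar>f n z - g z\<bar> < inverse (real (Suc n)))" for n
  using Stone_Weierstrass_real_polynomial_function[of "sph" "f n" "inverse (real (Suc n))"] continuous_on_subset[OF cont]
  by (metis compact_sphere inverse_positive_iff_positive of_nat_0_less_iff subset_UNIV zero_less_Suc)
 then obtain g where g: "!!n. real_polynomial_function (g n)" "!!n z. z : sph ==> \<bar>f n z - g n z\<bar> < inverse (real (Suc n))"
  by metis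
 have conv: "(%n. LINT z|M. g n z) ----> measure M (C \<inter> sph)"
  if "finite_measure M" "sets M = sets circle" "space M = sph" for M
 proof -
  interpret finite_measure M by fact
  have "(%n. LINT z|M. g n z) ----> (LINT z|M. indicator C z)"
  proof (rule integral_dominated_convergence[where w="%_. 2"])
   show "(indicator C :: complex => real) : borel_measurable M"
    by (rule borel_measurable_circle) (use that C in auto)
   show "g n : borel_measurable M" for n
    using continuous_on_polymonial_function[of "g n"] g(1) that(2)
    by (intro continuous_measurable_circle) (simp_all add: real_polynomial_function_eq)
   show "AE z in M. (%n. g n z) ----> indicator C z"
   proof (rule AE_I2)
    fix z assume "z : space M"
    hence "ALL n. norm (f n z - g n z) <= inverse (real (Suc n))" using g(2) that(3) by (simp add: less_imp_le)
    hence "(%n. f n z - g n z) ----> 0"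
     by (intro Lim_null_comparison[OF _ LIMSEQ_inverse_real_of_nat] always_eventually)
    from tendsto_diff[OF lim[of z] this] show "(%n. g n z) ----> indicator C z" by simp
   qed
   show "AE z in M. norm (g n z) <= 2" for n
   proof (rule AE_I2)
    fix z assume "z : space M"
    hence "\<bar>f n z - g n z\<bar> < inverse (real (Suc n))" using g(2) that(3) by simp
    moreover have "inverse (real (Suc n)) <= 1" by (simp add: inverse_le_1_iff)
    moreover have "0 <= f n z" "f n z <= 1" by (auto simp: f_def infdist_nonneg)
    ultimately show "norm (g n z) <= 2" by simp
   qed
  qed simp
  moreover have "(LINT z|M. indicator C z) = measure M (C \<inter> sph)"
   using that(3) by (simp add: Int_commute)
  ultimately show ?thesis by simp
 qed
 show ?thesis
  using conv[OF fin(1) sets(1) sp(1)] conv[OF fin(2) sets(2) sp(2)]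
   integral_polynomial_cong[OF sets fin mom g(1)] LIMSEQ_unique by auto
qed simp

text \<open>Traces of closed sets on the circle form an intersection-stable generator of its Borel
  sets. Nonnegative exponents suffice because the moments of a positive measure at negative
  exponents are the conjugate ones.\<close>

theorem measure_eq_moments:
 assumes sets: "sets \<mu> = sets circle" "sets \<nu> = sets circle"
  and fin: "finite_measure \<mu>" "finite_measure \<nu>"
  and mom: "!!n::nat. (LINT z|\<mu>. z ^ n) = (LINT z|\<nu>. z ^ n)"
 shows "\<mu> = \<nu>"
proof -
 interpret m: finite_measure \<mu> by fact
 interpret n: finite_measure \<nu> by fact
 let ?E = "{C \<inter> sph | C. closed C} :: complex set set"
 have sp: "space \<mu> = sph" using sets_eq_imp_space_eq[OF sets(1)] by (auto simp: space_circle)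
 have S: "sets circle = sigma_sets (sph) ?E"
 proof -
  have "sets circle = (\<inter>) (sph) ` sigma_sets UNIV (Collect closed)"
   by (simp add: sets_circle sets_restrict_space borel_eq_closed)
  also have "... = sigma_sets (sph) ((\<inter>) (sph) ` Collect closed)"
   by (rule sigma_sets_Int) (auto intro: sigma_sets.Basic)
  also have "(\<inter>) (sph) ` Collect closed = ?E" by auto
  finally show ?thesis .
 qed
 show ?thesis
 proof (rule measure_eqI_generator_eq[where E="?E" and \<Omega>="sph" and A="%_. sph"])
  show "Int_stable ?E" unfolding Int_stable_def
  proof safe
   fix C C' :: "complex set" assume "closed C" "closed C'"
   thus "EX Ca. C \<inter> sph \<inter> (C' \<inter> sph) = Ca \<inter> sph & closed Ca"
    by (intro exI[of _ "C \<inter> C'"]) auto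
  qed
  show "emeasure \<mu> X = emeasure \<nu> X" if "X : ?E" for X
   using that emeasure_closed_eq_moments[OF sets fin mom]
   by (auto simp: m.emeasure_eq_measure n.emeasure_eq_measure)
  show "range (%_. sph) \<subseteq> ?E" by (auto intro!: exI[of _ UNIV])
 qed (use sets S in \<open>auto simp: m.emeasure_eq_measure\<close>)
qed

text \<open>The positive and the negative part of \<open>g\<close> are densities of two finite
  measures with the same moments, so they agree almost everywhere.\<close>

lemma AE_zero_real_moments:
 fixes g :: "complex => real"
 assumes sets: "sets \<mu> = sets circle" and fin: "finite_measure \<mu>" and g: "integrable \<mu> g"
  and 0: "!!n::nat. (LINT z|\<mu>. of_real (g z) * z ^ n) = 0"
 shows "AE z in \<mu>. g z = 0"
proof -
 interpret m: finite_measure \<mu> by fact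
 have sp: "space \<mu> = sph" using sets_eq_imp_space_eq[OF sets] by (auto simp: space_circle)
 have gm[measurable]: "g : borel_measurable \<mu>" using g by (rule borel_measurable_integrable)
 let ?p = "%z. max 0 (g z)" and ?n = "%z. max 0 (- g z)"
 have ip: "integrable \<mu> ?p" "integrable \<mu> ?n" using g by auto
 have ip': "integrable \<mu> (%z. of_real (h z) * z ^ n)" if "integrable \<mu> h" for h :: "complex => real" and n
 proof (rule integrable_le[OF that])
  have "(%z::complex. z ^ n) : borel_measurable \<mu>"
   by (rule continuous_measurable_circle[OF _ sets]) (intro continuous_intros)
  thus "(%z. complex_of_real (h z) * z ^ n) : borel_measurable \<mu>"
   using that by measurable
 qed (use sp in \<open>auto simp: norm_mult norm_power\<close>)
 have fin': "finite_measure (density \<mu> (%z. ennreal (h z)))" if "integrable \<mu> h" for h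
 proof (rule finite_measureI)
  have "(\<integral>\<^sup>+z. ennreal (h z) \<partial>\<mu>) <= (\<integral>\<^sup>+z. ennreal (norm (h z)) \<partial>\<mu>)"
   by (intro nn_integral_mono ennreal_leI) auto
  also have "... < \<infinity>" using that by (simp add: integrable_iff_bounded)
  finally show "emeasure (density \<mu> (%z. ennreal (h z))) (space (density \<mu> (%z. ennreal (h z)))) ~= \<infinity>"
   using that by (simp add: emeasure_density cong: nn_integral_cong)
 qed
 have mom: "(LINT z|density \<mu> (%z. ennreal (h z)). z ^ n) = (LINT z|\<mu>. of_real (h z) * z ^ n)"
  if "integrable \<mu> h" "!!z. h z >= 0" for h n
 proof -
  have "(%z::complex. z ^ n) : borel_measurable \<mu>"
   by (rule continuous_measurable_circle[OF _ sets]) (intro continuous_intros)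
  thus ?thesis using that
   by (subst integral_density) (auto simp: scaleR_conv_of_real)
 qed
 have "density \<mu> (%z. ennreal (?p z)) = density \<mu> (%z. ennreal (?n z))"
 proof (rule measure_eq_moments)
  fix n :: nat
  have "(LINT z|\<mu>. of_real (?p z) * z ^ n) - (LINT z|\<mu>. of_real (?n z) * z ^ n)
   = (LINT z|\<mu>. of_real (?p z) * z ^ n - of_real (?n z) * z ^ n)"
   using ip' ip by simp
  also have "... = (LINT z|\<mu>. of_real (g z) * z ^ n)"
   by (rule integral_eqI) (auto simp: max_def)
  finally show "(LINT z|density \<mu> (%z. ennreal (?p z)). z ^ n) = (LINT z|density \<mu> (%z. ennreal (?n z)). z ^ n)"
   using 0[of n] mom[OF ip(1), of n] mom[OF ip(2), of n] by simp
 qed (use sets fin'[OF ip(1)] fin'[OF ip(2)] in simp_all)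
 hence "AE z in \<mu>. ennreal (?p z) = ennreal (?n z)"
  by (subst (asm) m.density_unique_iff) auto
 thus ?thesis
  by eventually_elim (auto simp: max_def split: if_splits)
qed

text \<open>A complex \<open>g\<close> calls for exponents of both signs: the moments of its real
  and imaginary part mix those of \<open>g\<close> and of \<open>cnj g\<close>.\<close>

lemma AE_zero_moments:
 fixes g :: "complex => complex"
 assumes sets: "sets \<mu> = sets circle" and fin: "finite_measure \<mu>" and g: "integrable \<mu> g"
  and 0: "!!n::nat. (LINT z|\<mu>. g z * z ^ n) = 0" and 1: "!!n::nat. (LINT z|\<mu>. g z * cnj z ^ n) = 0"
 shows "AE z in \<mu>. g z = 0"
proof -
 have sp: "space \<mu> = sph" using sets_eq_imp_space_eq[OF sets] by (auto simp: space_circle)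
 have m: "(%z::complex. z ^ n) : borel_measurable \<mu>" "(%z::complex. cnj z ^ n) : borel_measurable \<mu>" for n
   by (rule continuous_measurable_circle[OF _ sets], intro continuous_intros)+
 have [measurable]: "g : borel_measurable \<mu>" using g by (rule borel_measurable_integrable)
 have i: "integrable \<mu> (%z. g z * z ^ n)" "integrable \<mu> (%z. cnj (g z) * z ^ n)" for n
  using m(1)[of n] by (auto intro!: integrable_le[OF g] borel_measurable_times measurable_compose[OF _ measurable_cnj] simp: norm_mult norm_power sp)
 have c: "(LINT z|\<mu>. cnj (g z) * z ^ n) = 0" for n
 proof -
  have "(LINT z|\<mu>. cnj (g z) * z ^ n) = cnj (LINT z|\<mu>. g z * cnj z ^ n)"
   by (simp flip: LINT_cnj)
  thus ?thesis using 1 by simp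
 qed
 have "AE z in \<mu>. Re (g z) = 0"
 proof (rule AE_zero_real_moments[OF sets fin])
  show "integrable \<mu> (%z. Re (g z))" using g by auto
  fix n
  have "(LINT z|\<mu>. of_real (Re (g z)) * z ^ n) = (LINT z|\<mu>. (g z * z ^ n + cnj (g z) * z ^ n) / 2)"
   by (rule integral_eqI) (auto simp: complex_eq_iff algebra_simps)
  also have "... = 0" using i 0 c by simp
  finally show "(LINT z|\<mu>. of_real (Re (g z)) * z ^ n) = 0" .
 qed
 moreover have "AE z in \<mu>. Im (g z) = 0"
 proof (rule AE_zero_real_moments[OF sets fin])
  show "integrable \<mu> (%z. Im (g z))" using g by auto
  fix n
  have "(LINT z|\<mu>. of_real (Im (g z)) * z ^ n) = (LINT z|\<mu>. (g z * z ^ n - cnj (g z) * z ^ n) / (2 * \<i>))"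
  proof (rule integral_eqI)
   fix z
   have "of_real (Im (g z)) = (g z - cnj (g z)) / (2 * \<i>)" by (simp add: complex_diff_cnj complex_eq_iff)
   thus "of_real (Im (g z)) * z ^ n = (g z * z ^ n - cnj (g z) * z ^ n) / (2 * \<i>)"
    by (simp add: left_diff_distrib)
  qed simp
  also have "... = 0" using i 0 c by simp
  finally show "(LINT z|\<mu>. of_real (Im (g z)) * z ^ n) = 0" .
 qed
 ultimately show ?thesis by eventually_elim (auto simp: complex_eq_iff)
qed

lemma prob_space_circle: "prob_space circle"
 by (rule prob_spaceI) (simp add: space_circle emeasure_circle)

interpretation circle: prob_space circle by (rule prob_space_circle)

lemma cis_measurable_circle: "cis : borel \<rightarrow>\<^sub>M circle"
 using cis_measurable by (auto simp: measurable_def sets_circle space_circle)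

lemma integral_circle:
 fixes f :: "complex => 'b::{banach, second_countable_topology}"
 assumes "f : Bm"
 shows "(LINT z|circle. f z) = (1 / (2*pi)) *\<^sub>R (LINT t:{0..2*pi}|lborel. f (cis t))"
proof -
 have f: "f : borel_measurable (restrict_space borel (sph))"
  using assms by (metis measurable_cong_sets sets_circle)
 have "(LINT z|circle. f z) = (LINT t|uniform_measure lborel {0..2*pi}. f (cis t))"
  unfolding circle_def using cis_measurable f by (rule integral_distr)
 also have "uniform_measure lborel {0..2*pi} = density lborel (%t. ennreal (indicator {0..2*pi} t / (2*pi)))"
  unfolding uniform_measure_def
  by (intro density_cong) (auto simp: indicator_def divide_ennreal ennreal_1[symmetric] simp del: ennreal_1)
 also have "(LINT t|.... f (cis t)) = (LINT t|lborel. (indicator {0..2*pi} t / (2*pi)) *\<^sub>R f (cis t))"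
 proof (rule integral_density)
  show "(%t. f (cis t)) : borel_measurable lborel"
   using measurable_compose[OF cis_measurable_circle assms] by simp
 qed auto
 also have "... = (LINT t|lborel. (1 / (2*pi)) *\<^sub>R (indicator {0..2*pi} t *\<^sub>R f (cis t)))"
  by (rule integral_eqI) auto
 also have "... = (1 / (2*pi)) *\<^sub>R (LINT t:{0..2*pi}|lborel. f (cis t))"
  unfolding set_lebesgue_integral_def by (rule integral_scaleR_right)
 finally show ?thesis .
qed

lemma circle_moment: "(LINT z|circle. z ^ n) = (if n = 0 then 1 else 0)"
proof (cases "n = 0")
 case True thus ?thesis using circle.prob_space by simp
next
 case False
 have m: "(%z. z ^ n) : Bm"
  by (rule continuous_measurable_circle[OF _ refl]) (intro continuous_intros)
 have "(LINT t:{0..2*pi}|lborel. cis t ^ n) = cis (real n * (2*pi)) / (\<i> * n) - cis (real n * 0) / (\<i> * n)"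
  unfolding set_lebesgue_integral_def
 proof (rule integral_FTC_atLeastAtMost)
  show "((%t. cis (n * t) / (\<i> * n)) has_vector_derivative cis t ^ n) (at t within {0..2*pi})" for t
  proof -
   have "((%w. exp (\<i> * (of_nat n * w)) / (\<i> * n)) has_field_derivative exp (\<i> * (of_nat n * t))) (at (complex_of_real t))"
    using False by (auto intro!: derivative_eq_intros simp: field_simps)
   hence "((%t. exp (\<i> * (of_nat n * complex_of_real t)) / (\<i> * n)) has_vector_derivative exp (\<i> * (of_nat n * t))) (at t)"
    by (rule has_vector_derivative_real_field)
   thus ?thesis
    unfolding Complex.DeMoivre unfolding cis_conv_exp of_real_mult of_real_of_nat_eq by (rule has_vector_derivative_at_within)
  qed
 qed (auto intro!: continuous_intros)
 also have "cis (n * (2*pi)) = 1"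
  using Complex.DeMoivre[of "2*pi" n] by simp
 finally show ?thesis using False by (simp add: integral_circle[OF m])
qed

lemma measurable_cnj_circle: "cnj : circle \<rightarrow>\<^sub>M circle"
proof -
 have "cnj : Bm"
  by (rule continuous_measurable_circle[OF _ refl]) (intro continuous_intros)
 hence "cnj : circle \<rightarrow>\<^sub>M restrict_space borel (sph)"
  by (intro measurable_restrict_space2) (auto simp: space_circle)
 thus ?thesis using measurable_cong_sets[OF refl sets_circle] by blast
qed

text \<open>Reflection conjugates the moments, and the moments 1, 0, 0, ... of arc length are
  real.\<close>

lemma distr_cnj_circle: "distr circle circle cnj = circle"
proof (rule measure_eq_moments)
 interpret prob_space "distr circle circle cnj"
  by (rule circle.prob_space_distr[OF measurable_cnj_circle])
 show "finite_measure (distr circle circle cnj)" by unfold_locales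
 show "finite_measure circle" by unfold_locales
 fix n
 have m: "(%z. z ^ n) : Bm"
  by (rule continuous_measurable_circle[OF _ refl]) (intro continuous_intros)
 have "(LINT z|distr circle circle cnj. z ^ n) = (LINT z|circle. cnj (z ^ n))"
  by (subst integral_distr[OF measurable_cnj_circle m]) simp
 also have "... = cnj (LINT z|circle. z ^ n)" by (rule LINT_cnj)
 finally show "(LINT z|distr circle circle cnj. z ^ n) = (LINT z|circle. z ^ n)" by (simp add: circle_moment)
qed simp_all

lemma integral_circle_cnj:
 fixes f :: "complex => 'b::{banach, second_countable_topology}"
 assumes "f : Bm"
 shows "(LINT z|circle. f (cnj z)) = (LINT z|circle. f z)"
 using integral_distr[OF measurable_cnj_circle assms] by (simp add: distr_cnj_circle)

lemma AE_circle_cnj: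
 assumes "AE z in circle. P z" shows "AE z in circle. P (cnj z)"
 using AE_distrD[OF measurable_cnj_circle, of P] assms by (simp only: distr_cnj_circle)

section \<open>The Hilbert space \<open>L\<^sup>2\<close> of the circle\<close>

text \<open>General in the measure, because arc length and the measure \<open>mu\<close> of the
  spectral representation are treated by the same facts.\<close>

definition l2 :: "'a measure => ('a => complex) set" where
 "l2 M = {f : borel_measurable M. integrable M (%z. (cmod (f z))^2)}"

lemma L2_eq_l2: "L2 = l2 circle"
 by (simp add: L2_def l2_def)

lemma l2_measurable [measurable_dest]: "f : l2 M ==> f : borel_measurable M"
 by (simp add: l2_def)

lemma l2_integrable: "f : l2 M ==> integrable M (%z. (cmod (f z))^2)"
 by (simp add: l2_def)

lemma l2I: "f : borel_measurable M ==> integrable M (%z. (cmod (f z))^2) ==> f : l2 M"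
 by (simp add: l2_def)

lemma l2_zero: "(%z. 0) : l2 M"
 by (simp add: l2_def)

lemma cmod_add_sq_le: "(cmod (a + b))^2 <= 2 * (cmod a)^2 + 2 * (cmod b)^2"
proof -
 have "(cmod (a + b))^2 <= (cmod a + cmod b)^2" by (simp add: norm_triangle_ineq power_mono)
 also have "... <= 2 * (cmod a)^2 + 2 * (cmod b)^2"
  using sum_squares_bound[of "cmod a" "cmod b"] by (simp add: power2_sum)
 finally show ?thesis .
qed

lemma l2_add: assumes "f : l2 M" "g : l2 M" shows "(%z. f z + g z) : l2 M"
proof (rule l2I)
 show "integrable M (%z. (cmod (f z + g z))^2)"
  by (rule integrable_le[of M "%z. 2 * (cmod (f z))^2 + 2 * (cmod (g z))^2"])
   (use assms l2_integrable[OF assms(1)] l2_integrable[OF assms(2)] cmod_add_sq_le in auto)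
qed (use assms in measurable)

lemma l2_bounded_mult:
 assumes f: "f : l2 M" and h: "h : borel_measurable M" "AE z in M. cmod (h z) <= C"
 shows "(%z. h z * f z) : l2 M"
proof (rule l2I)
 show "integrable M (%z. (cmod (h z * f z))^2)"
 proof (rule integrable_le[of M "%z. C\<^sup>2 * (cmod (f z))^2"])
  show "AE z in M. norm ((cmod (h z * f z))^2) <= norm (C\<^sup>2 * (cmod (f z))^2)"
   using h(2) by eventually_elim (auto simp: norm_mult power_mult_distrib intro!: mult_right_mono power_mono)
 qed (use f h l2_integrable[OF f] in auto)
qed (use assms in measurable)

lemma l2_cmult: "f : l2 M ==> (%z. c * f z) : l2 M"
 by (rule l2_bounded_mult[where C="cmod c"]) auto

lemma l2_uminus: "f : l2 M ==> (%z. - f z) : l2 M"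
 using l2_cmult[of f M "-1"] by simp

lemma l2_diff: "f : l2 M ==> g : l2 M ==> (%z. f z - g z) : l2 M"
 using l2_add[OF _ l2_uminus] by fastforce

lemma l2_cnj: "f : l2 M ==> (%z. cnj (f z)) : l2 M"
 by (auto simp: l2_def intro: measurable_compose[OF _ measurable_cnj])

lemma l2_mult_integrable:
 assumes "f : l2 M" "g : l2 M" shows "integrable M (%z. f z * g z)"
proof (rule integrable_le[of M "%z. (cmod (f z))^2 + (cmod (g z))^2"])
 have "cmod a * cmod b <= (cmod a)^2 + (cmod b)^2" for a b
  using sum_squares_bound[of "cmod a" "cmod b"] mult_nonneg_nonneg[of "cmod a" "cmod b", OF norm_ge_zero norm_ge_zero]
  by linarith
 thus "AE z in M. norm (f z * g z) <= norm ((cmod (f z))^2 + (cmod (g z))^2)"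
  by (auto simp: norm_mult)
qed (use assms l2_integrable[OF assms(1)] l2_integrable[OF assms(2)] in auto)

lemma l2_inner_integrable: "f : l2 M ==> g : l2 M ==> integrable M (%z. f z * cnj (g z))"
 using l2_mult_integrable[OF _ l2_cnj] by blast

text \<open>The weights \<open>2 ^ k\<close> leave a convergent series of integrals, so
  \<open>2 ^ k * (cmod (d k z))^2\<close> tends to 0 almost everywhere. From then on the terms lie
  below a geometric series of ratio \<open>1 / sqrt 2\<close>.\<close>

lemma AE_le_4_pow:
 fixes d :: "nat => 'a => complex"
 assumes d: "!!k. d k : l2 M" and b: "!!k. (LINT z|M. (cmod (d k z))^2) <= (1/4) ^ k"
 shows "AE z in M. summable (%k. d k z)"
proof -
 have [measurable]: "d k : borel_measurable M" for k using d by measurable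
 have "(\<integral>\<^sup>+z. (\<Sum>k. ennreal (2 ^ k * (cmod (d k z))^2)) \<partial>M) = (\<Sum>k. \<integral>\<^sup>+z. ennreal (2 ^ k * (cmod (d k z))^2) \<partial>M)"
  by (rule nn_integral_suminf) measurable
 also have "... <= (\<Sum>k. ennreal ((1/2) ^ k))"
 proof (rule suminf_le)
  fix k
  have "(\<integral>\<^sup>+z. ennreal (2 ^ k * (cmod (d k z))^2) \<partial>M) = ennreal (LINT z|M. 2 ^ k * (cmod (d k z))^2)"
   by (rule nn_integral_eq_integral) (use l2_integrable[OF d] in auto)
  also have "... <= ennreal (2 ^ k * (1/4) ^ k)"
   using b[of k] by (intro ennreal_leI) simp
  also have "(2::real) ^ k * (1/4) ^ k = (1/2) ^ k" by (simp flip: power_mult_distrib)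
  finally show "(\<integral>\<^sup>+z. ennreal (2 ^ k * (cmod (d k z))^2) \<partial>M) <= ennreal ((1/2) ^ k)" .
 qed auto
 also have "... = ennreal (\<Sum>k. (1/2) ^ k)"
  by (rule suminf_ennreal2) auto
 also have "... < \<infinity>" by simp
 finally have "AE z in M. (\<Sum>k. ennreal (2 ^ k * (cmod (d k z))^2)) ~= \<infinity>"
  by (intro nn_integral_noteq_infinite) auto
 thus ?thesis
 proof eventually_elim
  fix z assume fin: "(\<Sum>k. ennreal (2 ^ k * (cmod (d k z))^2)) ~= \<infinity>"
  hence "summable (%k. 2 ^ k * (cmod (d k z))^2)"
   by (intro summable_suminf_not_top) auto
  hence "(%k. 2 ^ k * (cmod (d k z))^2) ----> 0" by (rule summable_LIMSEQ_zero)
  hence "eventually (%k. 2 ^ k * (cmod (d k z))^2 < 1) sequentially"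
   by (rule order_tendstoD) simp
  hence ev: "eventually (%k. cmod (d k z) <= (1 / sqrt 2) ^ k) sequentially"
  proof eventually_elim
   case (elim k)
   have "((1 / sqrt 2) ^ k)^2 = ((1 / sqrt 2)^2) ^ k" by (simp only: power_mult[symmetric] mult.commute)
   hence "(cmod (d k z))^2 <= ((1 / sqrt 2) ^ k)^2"
    using elim by (simp add: power_divide field_simps)
   thus ?case by (rule power2_le_imp_le) simp
  qed
  show "summable (%k. d k z)"
   by (rule summable_comparison_test_ev[OF ev]) (auto simp: summable_geometric)
 qed
qed

text \<open>A rapidly Cauchy subsequence converges almost everywhere, and Fatou's lemma along that
  subsequence bounds the distance of every late \<open>f m\<close> to the pointwise limit.\<close>

theorem l2_complete:
 fixes f :: "nat => 'a => complex"
 assumes f: "!!n. f n : l2 M"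
  and C: "!!e. e > 0 ==> EX N. ALL m>=N. ALL n>=N. (LINT z|M. (cmod (f m z - f n z))^2) < e"
 obtains g where "g : l2 M" "(%n. LINT z|M. (cmod (f n z - g z))^2) ----> 0"
proof -
 have [measurable]: "f k : borel_measurable M" for k using f by measurable
 have "EX r. ALL k. (ALL m>=r k. ALL n>=r k. (LINT z|M. (cmod (f m z - f n z))^2) < (1/4) ^ k) & r k < r (Suc k)"
 proof (rule dependent_nat_choice)
  show "EX N. ALL m>=N. ALL n>=N. (LINT z|M. (cmod (f m z - f n z))^2) < (1/4) ^ 0" using C[of 1] by simp
  fix x k
  obtain N where "ALL m>=N. ALL n>=N. (LINT z|M. (cmod (f m z - f n z))^2) < (1/4) ^ Suc k"
   using C[of "(1/4) ^ Suc k"] by auto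
  thus "EX y. (ALL m>=y. ALL n>=y. (LINT z|M. (cmod (f m z - f n z))^2) < (1/4) ^ Suc k) & x < y"
   by (intro exI[of _ "max N (Suc x)"]) auto
 qed
 then obtain r where r: "!!k m n. m >= r k ==> n >= r k ==> (LINT z|M. (cmod (f m z - f n z))^2) < (1/4) ^ k"
  and r_mono: "strict_mono r" by (metis strict_mono_Suc_iff)
 have "AE z in M. summable (%k. f (r (Suc k)) z - f (r k) z)"
 proof (rule AE_le_4_pow)
  show "(%z. f (r (Suc k)) z - f (r k) z) : l2 M" for k using f l2_diff by blast
  show "(LINT z|M. (cmod (f (r (Suc k)) z - f (r k) z))^2) <= (1/4) ^ k" for k
   using r[of k "r (Suc k)" "r k"] r_mono by (simp add: less_imp_le strict_mono_less_eq)
 qed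
 hence conv: "AE z in M. convergent (%k. f (r k) z)"
 proof eventually_elim
  fix z assume "summable (%k. f (r (Suc k)) z - f (r k) z)"
  hence "convergent (%n. \<Sum>k<n. f (r (Suc k)) z - f (r k) z)" by (simp add: summable_iff_convergent)
  hence "convergent (%n. f (r n) z - f (r 0) z)" by (simp add: sum_lessThan_telescope[of "%k. f (r k) z"])
  hence "convergent (%n. (f (r n) z - f (r 0) z) + f (r 0) z)" using convergent_add convergent_const by blast
  thus "convergent (%k. f (r k) z)" by simp
 qed
 define g where "g z = lim (%k. f (r k) z)" for z
 have [measurable]: "g : borel_measurable M" unfolding g_def by measurable
 have lim: "AE z in M. (%k. f (r k) z) ----> g z"
  using conv by eventually_elim (simp add: g_def convergent_LIMSEQ_iff)
 have bound: "(\<integral>\<^sup>+z. ennreal ((cmod (f m z - g z))^2) \<partial>M) <= ennreal e"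
  if N: "ALL m>=N. ALL n>=N. (LINT z|M. (cmod (f m z - f n z))^2) < e" "m >= N" for N e m
 proof -
  have "(\<integral>\<^sup>+z. ennreal ((cmod (f m z - g z))^2) \<partial>M) = (\<integral>\<^sup>+z. liminf (%k. ennreal ((cmod (f m z - f (r k) z))^2)) \<partial>M)"
  proof (rule nn_integral_cong_AE)
   show "AE z in M. ennreal ((cmod (f m z - g z))^2) = liminf (%k. ennreal ((cmod (f m z - f (r k) z))^2))"
    using lim
   proof eventually_elim
    case (elim z)
    have "(%k. ennreal ((cmod (f m z - f (r k) z))^2)) ----> ennreal ((cmod (f m z - g z))^2)"
     by (intro tendsto_intros elim)
    thus ?case by (rule lim_imp_Liminf[OF sequentially_bot, symmetric])
   qed
  qed
  also have "... <= liminf (%k. \<integral>\<^sup>+z. ennreal ((cmod (f m z - f (r k) z))^2) \<partial>M)"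
   by (rule nn_integral_liminf) measurable
  also have "... <= limsup (%k. \<integral>\<^sup>+z. ennreal ((cmod (f m z - f (r k) z))^2) \<partial>M)"
   by (rule Liminf_le_Limsup) simp
  also have "... <= ennreal e"
  proof (rule Limsup_bounded)
   show "\<forall>\<^sub>F k in sequentially. (\<integral>\<^sup>+z. ennreal ((cmod (f m z - f (r k) z))^2) \<partial>M) <= ennreal e"
    unfolding eventually_sequentially
   proof (intro exI[of _ N] allI impI)
    fix k assume "N <= k"
    hence k: "N <= r k" using r_mono by (meson le_trans strict_mono_imp_increasing)
    have "(\<integral>\<^sup>+z. ennreal ((cmod (f m z - f (r k) z))^2) \<partial>M) = ennreal (LINT z|M. (cmod (f m z - f (r k) z))^2)"
     by (rule nn_integral_eq_integral) (use l2_integrable[OF l2_diff[OF f f]] in auto)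
    also have "... <= ennreal e" using N k by (intro ennreal_leI) (auto intro: less_imp_le)
    finally show "(\<integral>\<^sup>+z. ennreal ((cmod (f m z - f (r k) z))^2) \<partial>M) <= ennreal e" .
   qed
  qed
  finally show ?thesis .
 qed
 have fg: "(%z. f m z - g z) : l2 M" if "ALL m>=N. ALL n>=N. (LINT z|M. (cmod (f m z - f n z))^2) < e" "m >= N" for N m e
  using bound[OF that] by (intro l2I) (auto simp: integrable_iff_bounded le_less_trans)
 have g: "g : l2 M"
 proof -
  obtain N where N: "ALL m>=N. ALL n>=N. (LINT z|M. (cmod (f m z - f n z))^2) < 1" using C[of 1] by auto
  have "(%z. f N z - (f N z - g z)) : l2 M" using l2_diff[OF f fg[OF N order_refl]] by blast
  thus ?thesis by simp
 qed
 moreover have "(%n. LINT z|M. (cmod (f n z - g z))^2) ----> 0"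
 proof (rule LIMSEQ_I)
  fix e :: real assume e: "e > 0"
  obtain N where N: "ALL m>=N. ALL n>=N. (LINT z|M. (cmod (f m z - f n z))^2) < e/2" using C[of "e/2"] e by auto
  have "norm ((LINT z|M. (cmod (f n z - g z))^2) - 0) < e" if "n >= N" for n
  proof -
   have "ennreal (LINT z|M. (cmod (f n z - g z))^2) <= ennreal (e/2)"
    using bound[OF N that] by (subst nn_integral_eq_integral[symmetric]) (use l2_integrable[OF fg[OF N that]] in auto)
   hence "(LINT z|M. (cmod (f n z - g z))^2) <= e/2" using e by (simp add: ennreal_le_iff)
   thus ?thesis using e by simp
  qed
  thus "EX no. ALL n>=no. norm ((LINT z|M. (cmod (f n z - g z))^2) - 0) < e" by blast
 qed
 ultimately show thesis by (rule that)
qed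

section \<open>The Hilbert space of classes of square integrable functions\<close>

definition l2eq :: "(complex => complex) => (complex => complex) => bool" where
 "l2eq f g <-> f : L2 & g : L2 & f \<doteq> g"

lemma ae_eq_refl [simp]: "f \<doteq> f" by (simp add: ae_eq_def)
lemma ae_eq_sym: "f \<doteq> g ==> g \<doteq> f" by (auto simp: ae_eq_def)
lemma ae_eq_trans [trans]: "f \<doteq> g ==> g \<doteq> h ==> f \<doteq> h"
 unfolding ae_eq_def by (erule (1) eventually_elim2) simp

\<comment> \<open>The equivalence is partial: only members of \<open>L2\<close> are related to
  themselves, so every representative \<open>rp x\<close> is square integrable.\<close>
quotient_type hl2 = "complex => complex" / partial: l2eq
proof (rule part_equivpI)
 show "EX x. l2eq x x" using l2_zero[of circle] by (auto simp: l2eq_def L2_eq_l2)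
 show "symp l2eq" by (auto simp: symp_def l2eq_def ae_eq_sym)
 show "transp l2eq" by (auto simp: transp_def l2eq_def intro: ae_eq_trans)
qed

definition cls :: "(complex => complex) => hl2" where "cls = abs_hl2"
definition rp :: "hl2 => complex => complex" where "rp = rep_hl2"

lemma rp_L2 [simp]: "rp x : L2"
 using Quotient_rep_reflp[OF Quotient_hl2] by (auto simp: rp_def l2eq_def)

lemma rp_l2 [simp]: "rp x : l2 circle"
 using rp_L2 by (simp add: L2_eq_l2)

lemma rp_measurable [measurable]: "rp x : Bm"
 using rp_l2 l2_measurable by blast

lemma cls_rp [simp]: "cls (rp x) = x"
 by (simp add: cls_def rp_def Quotient_abs_rep[OF Quotient_hl2])

lemma cls_eq_iff: "f : L2 ==> g : L2 ==> cls f = cls g <-> f \<doteq> g"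
 using Quotient_rel[OF Quotient_hl2, of f g] by (auto simp: cls_def l2eq_def)

lemma rp_cls: "f : L2 ==> rp (cls f) \<doteq> f"
 by (metis cls_eq_iff cls_rp rp_L2)

lemma hl2_eqI: "rp x \<doteq> rp y ==> x = y"
 by (metis cls_eq_iff cls_rp rp_L2)

lemma hl2_eq_iff: "x = y <-> rp x \<doteq> rp y"
 by (auto intro: hl2_eqI)

instantiation hl2 :: real_inner
begin

definition "0 = cls (%z. 0)"
definition "x + y = cls (%z. rp x z + rp y z)"
definition "- x = cls (%z. - rp x z)"
definition "x - y = cls (%z. rp x z - rp y z)"
definition "r *\<^sub>R x = cls (%z. of_real r * rp x z)"
definition "inner x y = Re (ip (rp x) (rp y))"
definition "norm (x::hl2) = sqrt (inner x x)"
definition "dist x y = norm (x - y :: hl2)"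
definition "sgn x = inverse (norm x) *\<^sub>R (x :: hl2)"
definition "uniformity = (INF e\<in>{0<..}. principal {(x, y). dist (x::hl2) y < e})"
definition "open U = (ALL x:U. \<forall>\<^sub>F (x', y) in uniformity. (x'::hl2) = x --> y : U)"

lemma rp_zero: "rp 0 \<doteq> (%z. 0)"
 unfolding zero_hl2_def by (rule rp_cls) (simp add: L2_eq_l2 l2_zero)
lemma cls_plus: "f : L2 ==> g : L2 ==> cls f + cls g = cls (%z. f z + g z)"
 unfolding plus_hl2_def
 by (subst cls_eq_iff) (use rp_cls[of f] rp_cls[of g] in \<open>auto simp: L2_eq_l2 l2_add ae_eq_def elim!: eventually_elim2\<close>)
lemma cls_minus: "f : L2 ==> g : L2 ==> cls f - cls g = cls (%z. f z - g z)"
 unfolding minus_hl2_def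
 by (subst cls_eq_iff) (use rp_cls[of f] rp_cls[of g] in \<open>auto simp: L2_eq_l2 l2_diff ae_eq_def elim!: eventually_elim2\<close>)
lemma cls_uminus: "f : L2 ==> - cls f = cls (%z. - f z)"
 unfolding uminus_hl2_def
 by (subst cls_eq_iff) (use rp_cls[of f] in \<open>auto simp: L2_eq_l2 l2_uminus ae_eq_def elim!: eventually_mono\<close>)
lemma cls_scaleR: "f : L2 ==> r *\<^sub>R cls f = cls (%z. of_real r * f z)"
 unfolding scaleR_hl2_def
 by (subst cls_eq_iff) (use rp_cls[of f] in \<open>auto simp: L2_eq_l2 l2_cmult ae_eq_def elim!: eventually_mono\<close>)

lemma ip_cong: "f \<doteq> f' ==> g \<doteq> g' ==> f : L2 ==> g : L2 ==> f' : L2 ==> g' : L2 ==> ip f g = ip f' g'"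
 unfolding ip_def by (rule integral_cong_AE) (auto simp: ae_eq_def L2_eq_l2 l2_measurable elim!: eventually_elim2 intro!: borel_measurable_times measurable_compose[OF _ measurable_cnj])

lemma ip_self: "f : L2 ==> ip f f = of_real (LINT z|circle. (cmod (f z))^2)"
 unfolding ip_def by (simp add: complex_norm_square[symmetric] flip: of_real_power)

lemma inner_cls: "f : L2 ==> g : L2 ==> inner (cls f) (cls g) = Re (ip f g)"
 unfolding inner_hl2_def by (subst ip_cong) (auto simp: rp_cls)

instance
proof
 fix x y w :: hl2 and r s :: real
 obtain f g h where X: "x = cls f" "y = cls g" "w = cls h" and L: "f : l2 circle" "g : l2 circle" "h : l2 circle"
  using cls_rp rp_l2 by metis
 note S = X L L2_eq_l2 l2_zero l2_add l2_uminus l2_diff l2_cmult cls_plus cls_minus cls_uminus cls_scaleR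
 show "dist x y = norm (x - y)" by (rule dist_hl2_def)
 show "sgn x = inverse (norm x) *\<^sub>R x" by (rule sgn_hl2_def)
 show "(uniformity :: (hl2 \<times> hl2) filter) = (INF e\<in>{0<..}. principal {(x, y). dist (x::hl2) y < e})"
  by (rule uniformity_hl2_def)
 show "open U = (ALL x:U. \<forall>\<^sub>F (x', y) in uniformity. (x'::hl2) = x --> y : U)" for U :: "hl2 set"
  by (rule open_hl2_def)
 show "norm x = sqrt (inner x x)" by (rule norm_hl2_def)
 show "x + y + w = x + (y + w)" "x + y = y + x" "0 + x = x" "- x + x = 0" "x - y = x + - y"
  "r *\<^sub>R (x + y) = r *\<^sub>R x + r *\<^sub>R y" "(r + s) *\<^sub>R x = r *\<^sub>R x + s *\<^sub>R x"
  "r *\<^sub>R s *\<^sub>R x = (r * s) *\<^sub>R x" "1 *\<^sub>R x = x"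
  by (simp_all add: S zero_hl2_def algebra_simps)
 have "ip f g = cnj (ip g f)"
  unfolding ip_def by (simp add: mult.commute flip: LINT_cnj)
 thus "inner x y = inner y x" by (simp add: S inner_cls)
 have "ip (%z. f z + g z) h = ip f h + ip g h"
  unfolding ip_def by (simp add: distrib_right l2_inner_integrable L)
 thus "inner (x + y) w = inner x w + inner y w" by (simp add: S inner_cls)
 have "ip (%z. of_real r * f z) g = of_real r * ip f g" unfolding ip_def by (simp add: mult.assoc)
 thus "inner (r *\<^sub>R x) y = r * inner x y" by (simp add: S inner_cls)
 show "0 <= inner x x" by (simp add: inner_hl2_def ip_self)
 show "inner x x = 0 <-> x = 0"
 proof -
  have "inner x x = 0 <-> (LINT z|circle. (cmod (rp x z))^2) = 0" by (simp add: inner_hl2_def ip_self)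
  also have "... <-> (AE z in circle. (cmod (rp x z))\<^sup>2 = 0)"
   by (rule integral_nonneg_eq_0_iff_AE) (use l2_integrable[OF rp_l2] in auto)
  also have "... <-> x = 0"
   unfolding hl2_eq_iff ae_eq_def
  proof
   assume "AE z in circle. (cmod (rp x z))\<^sup>2 = 0"
   thus "AE z in circle. rp x z = rp 0 z" using rp_zero[unfolded ae_eq_def] by eventually_elim simp
  next
   assume "AE z in circle. rp x z = rp 0 z"
   thus "AE z in circle. (cmod (rp x z))\<^sup>2 = 0" using rp_zero[unfolded ae_eq_def] by eventually_elim simp
  qed
  finally show ?thesis .
 qed
qed

end

text \<open>The class instance carries the real Hilbert space structure, with \<open>inner\<close>
  the real part of \<open>cip\<close>; the complex structure is added on top of it by
  \<open>scaleC\<close> and \<open>cip\<close>.\<close>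

definition scaleC :: "complex => hl2 => hl2" (infixr "*C" 75) where
 "c *C x = cls (%z. c * rp x z)"

definition cip :: "hl2 => hl2 => complex" where
 "cip x y = ip (rp x) (rp y)"

lemmas cls_add = cls_plus[symmetric] and cls_diff = cls_minus[symmetric]

lemma cls_scaleC: "f : L2 ==> cls (%z. c * f z) = c *C cls f"
 unfolding scaleC_def
 by (subst cls_eq_iff) (use rp_cls[of f, THEN ae_eq_sym] in \<open>auto simp: L2_eq_l2 l2_cmult ae_eq_def elim!: eventually_mono\<close>)

lemma cip_cls: "f : L2 ==> g : L2 ==> cip (cls f) (cls g) = ip f g"
 unfolding cip_def by (rule ip_cong) (auto simp: rp_cls)

lemma scaleC_scaleC [simp]: "a *C b *C x = (a * b) *C x"
 using cls_scaleC[of "%z. b * rp x z" a]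
 by (simp add: scaleC_def L2_eq_l2 l2_cmult mult.assoc)

lemma scaleC_add_right: "a *C (x + y) = a *C x + a *C y"
proof -
 have "a *C (x + y) = cls (%z. a * (rp x z + rp y z))"
  unfolding plus_hl2_def by (rule cls_scaleC[symmetric]) (simp add: L2_eq_l2 l2_add)
 also have "... = cls (%z. a * rp x z + a * rp y z)" by (simp add: distrib_left)
 also have "... = a *C x + a *C y"
  unfolding scaleC_def by (rule cls_add) (simp_all add: L2_eq_l2 l2_cmult)
 finally show ?thesis .
qed

lemma scaleC_add_left: "(a + b) *C x = a *C x + b *C x"
 unfolding scaleC_def distrib_right by (rule cls_add) (simp_all add: L2_eq_l2 l2_cmult)

lemma scaleC_one [simp]: "1 *C x = x"
 by (simp add: scaleC_def)

lemma scaleC_of_real: "of_real r *C x = r *\<^sub>R x"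
 by (simp add: scaleC_def scaleR_hl2_def)

lemma scaleC_zero_left [simp]: "0 *C x = 0"
 using scaleC_of_real[of 0 x] by simp

lemma scaleC_zero_right [simp]: "a *C 0 = 0"
 using scaleC_scaleC[of a 0 0] by simp

lemma scaleC_minus_left: "(- a) *C x = - (a *C x)"
 using scaleC_add_left[of "-a" a x] by (simp add: eq_neg_iff_add_eq_0)

lemma scaleC_minus_right: "a *C (- x) = - (a *C x)"
 using scaleC_add_right[of a "-x" x] by (simp add: eq_neg_iff_add_eq_0)

lemma scaleC_diff_right: "a *C (x - y) = a *C x - a *C y"
 using scaleC_add_right[of a x "-y"] by (simp add: scaleC_minus_right)

lemma scaleC_diff_left: "(a - b) *C x = a *C x - b *C x"
 using scaleC_add_left[of a "-b" x] by (simp add: scaleC_minus_left)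

lemma scaleC_minus_one: "(-1) *C x = - x"
 by (simp add: scaleC_minus_left)

lemma cip_add_left: "cip (x + y) w = cip x w + cip y w"
proof -
 have "cip (x + y) w = ip (%z. rp x z + rp y z) (rp w)"
  using cip_cls[of "%z. rp x z + rp y z" "rp w"] by (simp add: plus_hl2_def L2_eq_l2 l2_add)
 also have "... = ip (rp x) (rp w) + ip (rp y) (rp w)"
   unfolding ip_def by (simp add: distrib_right l2_inner_integrable)
 finally show ?thesis by (simp add: cip_def)
qed

lemma cip_cl: "cip (a *C x) y = a * cip x y"
proof -
 have "cip (a *C x) y = ip (%z. a * rp x z) (rp y)"
  using cip_cls[of "%z. a * rp x z" "rp y"] by (simp add: scaleC_def L2_eq_l2 l2_cmult)
 also have "... = a * ip (rp x) (rp y)"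
   unfolding ip_def by (simp add: mult.assoc)
 finally show ?thesis by (simp add: cip_def)
qed

lemma cip_commute: "cip y x = cnj (cip x y)"
 unfolding cip_def ip_def by (simp add: mult.commute flip: LINT_cnj)

lemma cip_add_right: "cip w (x + y) = cip w x + cip w y"
 by (metis cip_add_left cip_commute complex_cnj_add)

lemma cip_cr: "cip x (a *C y) = cnj a * cip x y"
 by (metis cip_cl cip_commute complex_cnj_mult)

lemma cip_zero [simp]: "cip 0 x = 0" "cip x 0 = 0"
 using cip_cl[of 0 0 x] cip_cr[of x 0 0] by auto

lemma cip_minus_left: "cip (- x) w = - cip x w"
 using cip_cl[of "-1" x w] by (simp add: scaleC_minus_one)

lemma cip_minus_right: "cip w (- x) = - cip w x"
 using cip_cr[of w "-1" x] by (simp add: scaleC_minus_one)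

lemma cip_diff_left: "cip (x - y) w = cip x w - cip y w"
 using cip_add_left[of x "-y" w] by (simp add: cip_minus_left)

lemma cip_diff_right: "cip w (x - y) = cip w x - cip w y"
 using cip_add_right[of w x "-y"] by (simp add: cip_minus_right)

lemma inner_eq_cip: "inner x y = Re (cip x y)"
 by (simp add: inner_hl2_def cip_def)

lemma cip_self: "cip x x = of_real ((norm x)^2)"
 using ip_self[OF rp_L2, of x] by (simp add: cip_def power2_norm_eq_inner inner_hl2_def)

lemma cip_Im: "Im (cip x y) = inner x (\<i> *C y)"
 by (simp add: inner_eq_cip cip_cr)

lemma norm_scaleC: "norm (a *C x) = cmod a * norm x"
proof -
 have "cip (a *C x) (a *C x) = (a * cnj a) * cip x x"
  by (simp only: cip_cl cip_cr ac_simps)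
 hence "complex_of_real ((norm (a *C x))^2) = of_real ((cmod a * norm x)^2)"
  by (simp add: cip_self power_mult_distrib complex_norm_square[symmetric])
 hence "(norm (a *C x))^2 = (cmod a * norm x)^2" using of_real_eq_iff by blast
 thus ?thesis by (simp add: power2_eq_iff_nonneg)
qed

text \<open>Rotating \<open>x\<close> by a unimodular factor makes the product positive and reduces
  the claim to the real Cauchy-Schwarz inequality.\<close>

lemma cip_bound: "cmod (cip x y) <= norm x * norm y"
proof (cases "cip x y = 0")
 case False
 define c where "c = cnj (cip x y) / cmod (cip x y)"
 have c: "cmod c = 1" using False by (simp add: c_def norm_divide)
 have "c * cip x y = of_real (cmod (cip x y))"
  using False by (simp add: c_def complex_norm_square[symmetric] mult.commute power2_eq_square)
 hence "cmod (cip x y) = inner (c *C x) y" by (simp add: inner_eq_cip cip_cl)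
 also have "... <= norm (c *C x) * norm y" by (rule norm_cauchy_schwarz)
 finally show ?thesis by (simp add: norm_scaleC c)
qed simp

lemma norm_hl2_sq: "(norm x)^2 = (LINT z|circle. (cmod (rp x z))^2)"
 using ip_self[OF rp_L2, of x] by (simp add: power2_norm_eq_inner inner_hl2_def)

lemma norm_cls_sq: "f : L2 ==> (norm (cls f))^2 = (LINT z|circle. (cmod (f z))^2)"
 using cip_self[of "cls f"] cip_cls[of f f] ip_self[of f] of_real_eq_iff[where 'a=complex] by metis

lemma norm_cls: "f : L2 ==> norm (cls f) = L2norm f"
 using norm_cls_sq[of f] by (simp add: L2norm_def real_sqrt_unique)

lemma norm_diff_hl2_sq: "(norm (x - y))^2 = (LINT z|circle. (cmod (rp x z - rp y z))^2)"
 using norm_cls_sq[of "%z. rp x z - rp y z"] by (simp add: minus_hl2_def L2_eq_l2 l2_diff)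

instance hl2 :: complete_space
proof
 fix X :: "nat => hl2" assume "Cauchy X"
 have "EX N. ALL m>=N. ALL n>=N. (LINT z|circle. (cmod (rp (X m) z - rp (X n) z))^2) < e" if e: "e > 0" for e
 proof -
  obtain N where "ALL m>=N. ALL n>=N. norm (X m - X n) < sqrt e"
   using \<open>Cauchy X\<close> e unfolding Cauchy_iff by (meson real_sqrt_gt_zero)
  hence "ALL m>=N. ALL n>=N. (norm (X m - X n))\<^sup>2 < (sqrt e)^2"
   by (simp add: power_strict_mono)
  thus ?thesis using e by (auto simp: norm_diff_hl2_sq)
 qed
 then obtain g where g: "g : l2 circle" "(%n. LINT z|circle. (cmod (rp (X n) z - g z))^2) ----> 0"
  by (rule l2_complete[of "%n. rp (X n)" circle, OF rp_l2])
 have "(norm (X n - cls g))^2 = (LINT z|circle. (cmod (rp (X n) z - g z))^2)" for n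
  using norm_cls_sq[of "%z. rp (X n) z - g z"] cls_diff[of "rp (X n)" g] g(1)
  by (simp add: L2_eq_l2 l2_diff)
 hence "(%n. sqrt ((norm (X n - cls g))^2)) ----> sqrt 0"
  using g(2) by (intro tendsto_real_sqrt) simp
 hence "(%n. norm (X n - cls g)) ----> 0" by simp
 hence "X ----> cls g" by (metis LIM_zero_cancel tendsto_norm_zero_iff)
 thus "convergent X" by (auto simp: convergent_def)
qed

instance hl2 :: banach ..

section \<open>Orthogonal projections, Riesz representation and adjoints\<close>

text \<open>Stated for a coercive symmetric form rather than for the inner product because it is
  used twice: for closed subspaces of \<open>hl2\<close>, and for the modified form
  \<open>qq\<close> in the lifting argument.\<close>

lemma orthogonal_projection_exists:
 fixes q :: "'a::banach => 'a => real"
 assumes q: "bounded_bilinear q" and sym: "!!x y. q x y = q y x"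
  and c: "c > 0" "!!x. c * (norm x)^2 <= q x x"
  and W: "subspace W" "closed W"
 obtains w where "w : W" "!!v. v : W ==> q (x - w) v = 0"
proof -
 interpret bounded_bilinear q by fact
 define Q where "Q x = q x x" for x
 have Q0: "Q x >= 0" for x using c(2)[of x] c(1) unfolding Q_def
  by (meson mult_nonneg_nonneg order.trans less_imp_le zero_le_power2)
 define d where "d = (INF w\<in>W. Q (x - w))"
 have W0: "0 : W" using W(1) subspace_0 by blast
 have bdd: "bdd_below ((%w. Q (x - w)) ` W)" using Q0 by (auto intro!: bdd_belowI)
 have d_le: "d <= Q (x - w)" if "w : W" for w
  unfolding d_def using bdd that by (rule cINF_lower)
 have "EX w:W. Q (x - w) < d + 1 / real (Suc n)" for n
  using cINF_less_iff[OF _ bdd, of "d + 1 / real (Suc n)"] W0 unfolding d_def[symmetric] by auto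
 then obtain w where w: "!!n. w n : W" "!!n. Q (x - w n) < d + 1 / real (Suc n)" by metis
 \<comment> \<open>The parallelogram law: the midpoint of two near-minimizers is again a
   competitor.\<close>
 have par: "Q (w m - w n) < 2 / real (Suc m) + 2 / real (Suc n)" for m n
 proof -
  have "(1/2) *\<^sub>R (w m + w n) : W" using W(1) w(1) by (simp add: subspace_add subspace_scale)
  hence "d <= Q (x - (1/2) *\<^sub>R (w m + w n))" by (rule d_le)
  moreover have "Q (w m - w n) = 2 * Q (x - w m) + 2 * Q (x - w n) - 4 * Q (x - (1/2) *\<^sub>R (w m + w n))"
   unfolding Q_def by (simp add: diff_left diff_right add_left add_right scaleR_left scaleR_right algebra_simps sym[of "w n" "w m"] sym[of x "w m"] sym[of x "w n"])
  moreover have "2 / real (Suc m) = 2 * (1 / real (Suc m))" "2 / real (Suc n) = 2 * (1 / real (Suc n))" by simp_all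
  ultimately show ?thesis using w(2)[of m] w(2)[of n] by argo
 qed
 have "Cauchy w"
 proof (rule CauchyI)
  fix e :: real assume e: "e > 0"
  obtain N where N: "4 / (c * e\<^sup>2) < real N" using reals_Archimedean2 by blast
  have "norm (w m - w n) < e" if "m >= N" "n >= N" for m n
  proof -
   have "4 < real N * (c * e\<^sup>2)" using N c(1) e by (simp add: field_simps)
   moreover have N0: "real N > 0" using N c(1) e by (smt (verit) divide_pos_pos zero_less_power mult_pos_pos)
   ultimately have "4 / real N < c * e\<^sup>2" by (simp add: field_simps)
   moreover have "2 / real (Suc m) <= 2 / real N" "2 / real (Suc n) <= 2 / real N"
    using that N0 by (auto intro!: divide_left_mono)
   ultimately have "Q (w m - w n) < c * e\<^sup>2" using par[of m n] by simp
   hence "c * (norm (w m - w n))^2 < c * e\<^sup>2" using c(2)[of "w m - w n"] by (simp add: Q_def)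
   thus ?thesis using c(1) e by (simp add: power2_less_imp_less)
  qed
  thus "EX M. ALL m>=M. ALL n>=M. norm (w m - w n) < e" by blast
 qed
 then obtain l where l: "w ----> l" using Cauchy_convergent convergent_def by blast
 have lW: "l : W" using W(2) w(1) l closed_sequentially by blast
 have "(%n. Q (x - w n)) ----> Q (x - l)" unfolding Q_def by (intro tendsto tendsto_intros l)
 moreover have "(%n. d + 1 / real (Suc n)) ----> d + 0" using LIMSEQ_inverse_real_of_nat
  by (intro tendsto_intros) (simp add: inverse_eq_divide)
 ultimately have "Q (x - l) <= d + 0"
  by (rule LIMSEQ_le) (use w(2) in \<open>auto intro: less_imp_le\<close>)
 hence Ql: "Q (x - l) <= d" by simp
 have "q (x - l) v = 0" if v: "v : W" for v
 proof (cases "v = 0")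
  case True thus ?thesis by (simp add: zero_right)
 next
  case False
  hence Qv: "Q v > 0" using c(2)[of v] c(1) unfolding Q_def
   by (meson less_le_trans mult_pos_pos zero_less_norm_iff zero_less_power)
  \<comment> \<open>The minimizer of the quadratic polynomial that moving along \<open>v\<close>
    produces; minimality of \<open>l\<close> then forces its linear coefficient to vanish.\<close>
  define t where "t = q (x - l) v / Q v"
  have "l + t *\<^sub>R v : W" using lW v W(1) by (simp add: subspace_add subspace_scale)
  hence "Q (x - l) <= Q (x - (l + t *\<^sub>R v))" using d_le Ql by fastforce
  also have "Q (x - (l + t *\<^sub>R v)) = Q ((x - l) - t *\<^sub>R v)" by (simp add: algebra_simps)
  also have "... = Q (x - l) - 2 * t * q (x - l) v + t\<^sup>2 * Q v"
   unfolding Q_def power2_eq_square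
   by (simp only: diff_left[of _ "t *\<^sub>R v"] diff_right[of _ _ "t *\<^sub>R v"] scaleR_left scaleR_right sym[of v "x - l"])
    (simp add: algebra_simps)
  also have "... = Q (x - l) - (q (x - l) v)\<^sup>2 / Q v"
   using Qv by (simp add: t_def power2_eq_square field_simps)
  finally have "(q (x - l) v)^2 / Q v <= 0" by simp
  thus ?thesis using Qv by (simp add: divide_le_0_iff)
 qed
 thus thesis using that lW by blast
qed

definition csub :: "hl2 set => bool" where
 "csub M <-> 0 : M & (ALL x:M. ALL y:M. x + y : M) & (ALL c. ALL x:M. c *C x : M) & closed M"

lemma csubD:
 assumes "csub M"
 shows "0 : M" "x : M ==> y : M ==> x + y : M" "x : M ==> c *C x : M" "closed M"
  "x : M ==> - x : M" "x : M ==> y : M ==> x - y : M" "x : M ==> r *\<^sub>R x : M"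
proof -
 show 1: "0 : M" "x : M ==> y : M ==> x + y : M" "!!c x. x : M ==> c *C x : M" "closed M"
  using assms by (auto simp: csub_def)
 show 2: "x : M ==> - x : M" for x using 1(3)[of x "-1"] by (simp add: scaleC_minus_one)
 show "x - y : M" if "x : M" "y : M"
 proof -
  have "x + (- y) : M" using assms 2[OF that(2)] that(1) by (auto simp: csub_def)
  thus ?thesis by simp
 qed
 show "x : M ==> r *\<^sub>R x : M" using 1(3)[of x "of_real r"] by (simp add: scaleC_of_real)
qed

lemma csub_subspace: "csub M ==> subspace M"
 by (simp add: subspace_def csubD)

lemma csub_UNIV: "csub UNIV" by (simp add: csub_def)

lemma tendsto_cip [tendsto_intros]: "(f ---> a) F ==> (g ---> b) F ==> ((%x. cip (f x) (g x)) ---> cip a b) F"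
proof -
 assume fg: "(f ---> a) F" "(g ---> b) F"
 have *: "cip x y = complex_of_real (inner x y) + \<i> * complex_of_real (inner x (\<i> *C y))" for x y
  by (simp add: complex_eq_iff inner_eq_cip cip_Im[symmetric] cip_cr)
 have "((%x. \<i> *C g x) ---> \<i> *C b) F"
 proof (rule metric_tendsto_imp_tendsto[OF fg(2)])
  show "\<forall>\<^sub>F x in F. dist (\<i> *C g x) (\<i> *C b) <= dist (g x) b"
   by (simp add: dist_norm norm_scaleC flip: scaleC_diff_right)
 qed
 thus ?thesis unfolding * using fg by (intro tendsto_intros)
qed

lemma tendsto_scaleC [tendsto_intros]: "(g ---> b) F ==> ((%x. c *C g x) ---> c *C b) F"
proof -
 assume g: "(g ---> b) F"
 have "((%x. norm (c *C g x - c *C b)) ---> cmod c * norm (b - b)) F"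
  unfolding scaleC_diff_right[symmetric] norm_scaleC by (intro tendsto_intros g)
 thus ?thesis by (simp add: tendsto_norm_zero_iff LIM_zero_iff)
qed

lemma csub_orth: "csub {x. ALL y:S. cip x y = 0}"
 unfolding csub_def
proof (intro conjI)
 have "closed {x. cip x y = 0}" for y
 proof -
  have "continuous_on UNIV (%x. cip x y)" by (auto simp: continuous_on_def intro!: tendsto_intros)
  thus ?thesis by (simp add: closed_Collect_eq)
 qed
 hence "closed (\<Inter>y\<in>S. {x. cip x y = 0})" by blast
 moreover have "(\<Inter>y\<in>S. {x. cip x y = 0}) = {x. ALL y:S. cip x y = 0}" by auto
 ultimately show "closed {x. ALL y:S. cip x y = 0}" by simp
qed (auto simp: cip_add_left cip_cl)

lemma csub_Int: "csub A ==> csub B ==> csub (A \<inter> B)"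
 by (auto simp: csub_def)

definition PM :: "hl2 set => hl2 => hl2" where
 "PM M x = (SOME w. w : M & (ALL v:M. cip (x - w) v = 0))"

text \<open>Real orthogonality to both \<open>v\<close> and \<open>\<i> *C v\<close> amounts to
  complex orthogonality to \<open>v\<close>.\<close>

lemma PM_ex:
 assumes "csub M" shows "EX w. w : M & (ALL v:M. cip (x - w) v = 0)"
proof -
 obtain w where w: "w : M" "!!v. v : M ==> inner (x - w) v = 0"
  by (rule orthogonal_projection_exists[OF bounded_bilinear_inner inner_commute zero_less_one _
     csub_subspace[OF assms] csubD(4)[OF assms], of x]) (auto simp: power2_norm_eq_inner)
 have "cip (x - w) v = 0" if "v : M" for v
 proof (rule complex_eqI)
  show "Re (cip (x - w) v) = Re 0" using w(2)[OF that] by (simp add: inner_eq_cip)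
  show "Im (cip (x - w) v) = Im 0" using w(2)[of "\<i> *C v"] csubD(3)[OF assms that] by (simp add: cip_Im)
 qed
 thus ?thesis using w(1) by blast
qed

lemma PM_in: "csub M ==> PM M x : M"
 and PM_orth: "csub M ==> v : M ==> cip (x - PM M x) v = 0"
 using someI_ex[OF PM_ex, of M x] unfolding PM_def by blast+

lemma PM_cip: "csub M ==> v : M ==> cip (PM M x) v = cip x v"
 using PM_orth[of M v x] by (simp add: cip_diff_left)

lemma PM_cip_right: "csub M ==> v : M ==> cip v (PM M x) = cip v x"
 using PM_cip[of M v x] by (metis cip_commute)

lemma cip_self_eq_0: "cip x x = 0 <-> x = 0"
 by (simp add: cip_self)

lemma PM_unique:
 assumes M: "csub M" and w: "w : M" "!!v. v : M ==> cip w v = cip x v"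
 shows "PM M x = w"
proof -
 have d: "PM M x - w : M" using M w(1) PM_in csubD(6) by blast
 have "cip (PM M x - w) (PM M x - w) = 0"
  using PM_cip[OF M d, of x] w(2)[OF d] by (simp add: cip_diff_left)
 thus ?thesis by (simp add: cip_self_eq_0)
qed

lemma PM_id: "csub M ==> x : M ==> PM M x = x"
 by (rule PM_unique) auto

lemma csub_eqI:
 assumes "csub M" "x : M" "y : M" "!!v. v : M ==> cip x v = cip y v"
 shows "x = y"
 using PM_unique[OF assms(1,2), of y] PM_id[OF assms(1,3)] assms(4) by metis

lemma cip_eqI: "(!!v. cip x v = cip y v) ==> x = y"
 using csub_eqI[OF csub_UNIV] by blast

lemma cip_eqI': "(!!v. cip v x = cip v y) ==> x = y"
 by (rule cip_eqI) (metis cip_commute)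

lemma PM_add: "csub M ==> PM M (x + y) = PM M x + PM M y"
 by (rule PM_unique) (auto simp: PM_in csubD PM_cip cip_add_left)

lemma PM_scaleC: "csub M ==> PM M (c *C x) = c *C PM M x"
 by (rule PM_unique) (auto simp: PM_in csubD PM_cip cip_cl)

lemma PM_norm: "csub M ==> norm (PM M x) <= norm x"
proof -
 assume M: "csub M"
 have "complex_of_real ((norm (PM M x))^2) = cip x (PM M x)"
  using PM_cip[OF M PM_in[OF M], of x x] by (simp add: cip_self)
 hence "(norm (PM M x))^2 <= norm x * norm (PM M x)"
  using cip_bound[of x "PM M x"] by (metis abs_of_nonneg norm_of_real zero_le_power2)
 thus ?thesis by (cases "PM M x = 0") (auto simp: power2_eq_square)
qed

lemma PM_eq_0: "csub M ==> (!!v. v : M ==> cip x v = 0) ==> PM M x = 0"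
 by (rule PM_unique) (auto simp: csubD)

definition bcl :: "(hl2 => hl2) => bool" where
 "bcl A <-> (ALL x y. A (x + y) = A x + A y) & (ALL c x. A (c *C x) = c *C A x) & (EX C. ALL x. norm (A x) <= C * norm x)"

lemma bclI:
 "(!!x y. A (x + y) = A x + A y) ==> (!!c x. A (c *C x) = c *C A x) ==> (!!x. norm (A x) <= C * norm x) ==> bcl A"
 unfolding bcl_def by blast

lemma bcl_add: "bcl A ==> A (x + y) = A x + A y"
 and bcl_scaleC: "bcl A ==> A (c *C x) = c *C A x"
 by (auto simp: bcl_def)

lemma bcl_bound: assumes "bcl A" obtains C where "C > 0" "!!x. norm (A x) <= C * norm x"
proof -
 obtain C where C: "!!x. norm (A x) <= C * norm x" using assms by (auto simp: bcl_def)
 have "norm (A x) <= (\<bar>C\<bar> + 1) * norm x" for x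
  using C[of x] by (smt (verit) mult_right_mono norm_ge_zero)
 thus thesis using that[of "\<bar>C\<bar> + 1"] by auto
qed

lemma bcl_zero: "bcl A ==> A 0 = 0"
 using bcl_scaleC[of A 0 0] by simp

lemma bcl_minus: "bcl A ==> A (- x) = - A x"
 using bcl_scaleC[of A "-1" x] by (simp add: scaleC_minus_one)

lemma bcl_diff: "bcl A ==> A (x - y) = A x - A y"
 using bcl_add[of A x "-y"] by (simp add: bcl_minus)

lemma bcl_bounded_linear: assumes A: "bcl A" shows "bounded_linear A"
proof -
 obtain C where "C > 0" "!!x. norm (A x) <= C * norm x" using bcl_bound[OF A] by blast
 thus ?thesis using A
  by (intro bounded_linear_intro[of _ C]) (auto simp: bcl_add mult.commute simp flip: scaleC_of_real bcl_scaleC)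
qed

lemma tendsto_bcl: "bcl A ==> (f ---> a) F ==> ((%x. A (f x)) ---> A a) F"
 using bounded_linear.tendsto[OF bcl_bounded_linear] by blast

lemma bcl_PM: "csub M ==> bcl (PM M)"
 by (rule bclI[where C=1]) (auto simp: PM_add PM_scaleC PM_norm)

lemma bcl_id: "bcl (%x. x)" by (rule bclI[where C=1]) auto

lemma bcl_compose: assumes "bcl A" "bcl B" shows "bcl (%x. A (B x))"
proof -
 obtain C where C: "C > 0" "!!x. norm (A x) <= C * norm x" using bcl_bound[OF assms(1)] by blast
 obtain E where E: "E > 0" "!!x. norm (B x) <= E * norm x" using bcl_bound[OF assms(2)] by blast
 have "norm (A (B x)) <= (C * E) * norm x" for x
 proof -
  have "norm (A (B x)) <= C * norm (B x)" by (rule C)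
  also have "... <= C * (E * norm x)" using C(1) E(2) by (intro mult_left_mono) auto
  finally show ?thesis by (simp add: mult.assoc)
 qed
 thus ?thesis using assms by (intro bclI) (auto simp: bcl_add bcl_scaleC)
qed

lemma bcl_plus: assumes "bcl A" "bcl B" shows "bcl (%x. A x + B x)"
proof -
 obtain C where C: "C > 0" "!!x. norm (A x) <= C * norm x" using bcl_bound[OF assms(1)] by blast
 obtain E where E: "E > 0" "!!x. norm (B x) <= E * norm x" using bcl_bound[OF assms(2)] by blast
 have "norm (A x + B x) <= (C + E) * norm x" for x
  using norm_triangle_ineq[of "A x" "B x"] C(2)[of x] E(2)[of x] by (simp add: distrib_right)
 thus ?thesis using assms by (intro bclI) (auto simp: bcl_add bcl_scaleC scaleC_add_right)
qed

lemma bcl_scale: assumes "bcl A" shows "bcl (%x. c *C A x)"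
proof -
 obtain C where C: "C > 0" "!!x. norm (A x) <= C * norm x" using bcl_bound[OF assms(1)] by blast
 have "norm (c *C A x) <= (cmod c * C) * norm x" for x
  using C(2)[of x] by (simp add: norm_scaleC mult.assoc mult_left_mono)
 thus ?thesis using assms by (intro bclI[where C="cmod c * C"]) (auto simp: bcl_add bcl_scaleC scaleC_add_right mult.commute)
qed

lemma bcl_uminus: "bcl A ==> bcl (%x. - A x)"
 using bcl_scale[of A "-1"] by (simp add: scaleC_minus_one)

lemma bcl_minus2: "bcl A ==> bcl B ==> bcl (%x. A x - B x)"
 using bcl_plus[OF _ bcl_uminus, of A B] by simp

lemma bcl_rank1: "bcl (%x. cip x g *C f)"
proof (rule bclI[where C="norm g * norm f"])
 show "norm (cip x g *C f) <= norm g * norm f * norm x" for x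
  using cip_bound[of x g] by (simp add: norm_scaleC mult.assoc mult.commute mult.left_commute mult_left_mono)
qed (auto simp: cip_add_left scaleC_add_left cip_cl)

text \<open>For a nonzero functional, pick \<open>e\<close> orthogonal to the kernel:
  \<open>x - (\<phi> x / \<phi> e) *C e\<close> lies in the kernel, so \<phi> is a multiple of the
  product with \<open>e\<close>.\<close>

lemma riesz:
 fixes \<phi> :: "hl2 => complex"
 assumes add: "!!x y. \<phi> (x + y) = \<phi> x + \<phi> y" and sc: "!!c x. \<phi> (c *C x) = c * \<phi> x"
  and b: "!!x. cmod (\<phi> x) <= C * norm x"
 obtains h where "!!x. \<phi> x = cip x h"
proof -
 define M where "M = {x. \<phi> x = 0}"
 have diff: "\<phi> (x - y) = \<phi> x - \<phi> y" for x y
  using add[of x "(-1) *C y"] sc[of "-1" y] by (simp add: scaleC_minus_one)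
 have lim: "(\<phi> ---> \<phi> a) (at a)" for a
 proof -
  have "((%x. \<phi> (x - a)) ---> 0) (at a)"
  proof (rule Lim_null_comparison)
   show "\<forall>\<^sub>F x in at a. norm (\<phi> (x - a)) <= C * norm (x - a)" using b by simp
   have "((%x. C * norm (x - a)) ---> C * norm (a - a)) (at a)" by (intro tendsto_intros)
   thus "((%x. C * norm (x - a)) ---> 0) (at a)" by simp
  qed
  thus ?thesis by (simp add: diff LIM_zero_iff)
 qed
 have M: "csub M" unfolding csub_def
 proof (intro conjI)
  show "closed M" unfolding M_def by (rule closed_Collect_eq) (auto simp: continuous_on_def lim intro: tendsto_within_subset)
  show "0 : M" using sc[of 0 0] by (simp add: M_def)
 qed (auto simp: M_def add sc)
 show thesis
 proof (cases "EX x0. \<phi> x0 ~= 0")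
  case False thus thesis using that[of 0] by simp
 next
  case True
  then obtain x0 where x0: "\<phi> x0 ~= 0" by blast
  define e where "e = x0 - PM M x0"
  have pe: "\<phi> e ~= 0" using x0 PM_in[OF M, of x0] by (simp add: e_def diff M_def)
  hence e0: "cip e e ~= 0" using sc[of 0 0] by (auto simp: cip_self_eq_0)
  have "\<phi> x = cip x ((cnj (\<phi> e) / cnj (cip e e)) *C e)" for x
  proof -
   have "x - (\<phi> x / \<phi> e) *C e : M" using pe by (simp add: M_def diff sc)
   hence "cip e (x - (\<phi> x / \<phi> e) *C e) = 0" unfolding e_def by (rule PM_orth[OF M])
   hence "cip (x - (\<phi> x / \<phi> e) *C e) e = 0" by (metis cip_commute complex_cnj_zero)
   hence "cip x e = \<phi> x / \<phi> e * cip e e" by (simp add: cip_diff_left cip_cl)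
   thus ?thesis using pe e0 by (simp add: cip_cr)
  qed
  thus thesis by (rule that)
 qed
qed

definition adj :: "(hl2 => hl2) => hl2 => hl2" where
 "adj A y = (SOME h. ALL x. cip (A x) y = cip x h)"

lemma cip_adj: assumes "bcl A" shows "cip (A x) y = cip x (adj A y)"
proof -
 obtain C where C: "C > 0" "!!x. norm (A x) <= C * norm x" using bcl_bound[OF assms(1)] by blast
 have "cmod (cip (A x) y) <= (C * norm y) * norm x" for x
 proof -
  have "cmod (cip (A x) y) <= norm (A x) * norm y" by (rule cip_bound)
  also have "... <= (C * norm x) * norm y" by (rule mult_right_mono) (use C in auto)
  finally show ?thesis by (simp add: ac_simps)
 qed
 then obtain h where "!!x. cip (A x) y = cip x h"
  using riesz[of "%x. cip (A x) y"] assms by (metis (no_types, lifting) bcl_add bcl_scaleC cip_add_left cip_cl)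
 hence "EX h. ALL x. cip (A x) y = cip x h" by blast
 from someI_ex[OF this] show ?thesis unfolding adj_def by blast
qed

lemma cip_adj': "bcl A ==> cip (adj A x) y = cip x (A y)"
 using cip_adj[of A y x] by (metis cip_commute)

lemma adj_unique: "bcl A ==> (!!x. cip (A x) y = cip x h) ==> adj A y = h"
 by (rule cip_eqI') (simp add: cip_adj[symmetric])

lemma bcl_adj: assumes A: "bcl A" shows "bcl (adj A)"
proof -
 obtain C where C: "C > 0" "!!x. norm (A x) <= C * norm x" using bcl_bound[OF A] by blast
 show ?thesis
 proof (rule bclI[where C=C])
  show "adj A (x + y) = adj A x + adj A y" for x y
   by (rule adj_unique[OF A]) (simp add: cip_add_right cip_adj[OF A])
  show "adj A (c *C x) = c *C adj A x" for x c
   by (rule adj_unique[OF A]) (simp add: cip_cr cip_adj[OF A])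
  show "norm (adj A x) <= C * norm x" for x
  proof -
   have "(norm (adj A x))^2 = cmod (cip (adj A x) (adj A x))"
    by (simp add: cip_self norm_power)
   also have "... = cmod (cip (A (adj A x)) x)" by (simp add: cip_adj[OF A])
   also have "... <= norm (A (adj A x)) * norm x" by (rule cip_bound)
   also have "... <= (C * norm (adj A x)) * norm x" by (rule mult_right_mono) (use C in auto)
   finally have "norm (adj A x) * norm (adj A x) <= (C * norm x) * norm (adj A x)"
    by (simp add: power2_eq_square ac_simps)
   thus ?thesis using C(1) by (cases "adj A x = 0") (auto simp: mult_le_cancel_right)
  qed
 qed
qed

section \<open>Bounded functions and multiplication operators\<close>

abbreviation Li :: "(complex => complex) set" where "Li \<equiv> Linfty circle"

lemma Li_measurable [measurable_dest]: "\<phi> : Li ==> \<phi> : Bm"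
 by (simp add: Linfty_def)

lemma Li_bound: assumes "\<phi> : Li" obtains C where "C > 0" "AE z in circle. cmod (\<phi> z) <= C"
proof -
 obtain C where "AE z in circle. cmod (\<phi> z) <= C" using assms by (auto simp: Linfty_def)
 hence "AE z in circle. cmod (\<phi> z) <= max C 1" by eventually_elim simp
 thus thesis using that[of "max C 1"] by simp
qed

lemma LiI: "\<phi> : Bm ==> AE z in circle. cmod (\<phi> z) <= C ==> \<phi> : Li"
 by (auto simp: Linfty_def)

lemma AE_circleI: "(!!z. z : sph ==> P z) ==> AE z in circle. P z"
 by (rule AE_I2) (simp add: space_circle)

lemma Li_const: "(%z. c) : Li"
 by (rule LiI[where C="cmod c"]) auto

lemma Li_continuous: "continuous_on UNIV f ==> f : Li"
proof -
 assume f: "continuous_on UNIV f"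
 have "compact (f ` sph)" using f
  by (intro compact_continuous_image) (auto intro: continuous_on_subset)
 then obtain B where "!!z. z : sph ==> norm (f z) <= B"
  using compact_imp_bounded bounded_iff by (metis imageI)
 thus ?thesis using continuous_measurable_circle[OF f refl] by (intro LiI[of _ B] AE_circleI) auto
qed

lemma Li_pow: "(%z. z ^ n) : Li" "(%z. cnj z ^ n) : Li" "(%z. z) : Li" "cnj : Li"
 by (rule Li_continuous, intro continuous_intros)+

lemma Li_mult: assumes "\<phi> : Li" "\<psi> : Li" shows "(%z. \<phi> z * \<psi> z) : Li"
proof -
 obtain C where C: "C > 0" "AE z in circle. cmod (\<phi> z) <= C" using Li_bound[OF assms(1)] .
 obtain D where D: "D > 0" "AE z in circle. cmod (\<psi> z) <= D" using Li_bound[OF assms(2)] .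
 show ?thesis
 proof (rule LiI[where C="C * D"])
  show "AE z in circle. cmod (\<phi> z * \<psi> z) <= C * D"
   using C(2) D(2) by eventually_elim (use C(1) in \<open>auto simp: norm_mult intro!: mult_mono\<close>)
 qed (use assms in measurable)
qed

lemma Li_add: assumes "\<phi> : Li" "\<psi> : Li" shows "(%z. \<phi> z + \<psi> z) : Li"
proof -
 obtain C where C: "C > 0" "AE z in circle. cmod (\<phi> z) <= C" using Li_bound[OF assms(1)] .
 obtain D where D: "D > 0" "AE z in circle. cmod (\<psi> z) <= D" using Li_bound[OF assms(2)] .
 show ?thesis
 proof (rule LiI[where C="C + D"])
  show "AE z in circle. cmod (\<phi> z + \<psi> z) <= C + D"
   using C(2) D(2) by eventually_elim (meson add_mono norm_triangle_ineq order_trans)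
 qed (use assms in measurable)
qed

lemma Li_uminus: "\<phi> : Li ==> (%z. - \<phi> z) : Li"
 using Li_mult[OF Li_const[of "-1"]] by simp

lemma Li_diff: "\<phi> : Li ==> \<psi> : Li ==> (%z. \<phi> z - \<psi> z) : Li"
 using Li_add[OF _ Li_uminus, of \<phi> \<psi>] by simp

lemma Li_cnj: "\<phi> : Li ==> (%z. cnj (\<phi> z)) : Li"
 by (auto simp: Linfty_def intro: measurable_compose[OF _ measurable_cnj])

lemma Li_reflect: "\<phi> : Li ==> (%z. \<phi> (cnj z)) : Li"
proof -
 assume p: "\<phi> : Li"
 then obtain C where C: "AE z in circle. cmod (\<phi> z) <= C" by (auto simp: Linfty_def)
 show ?thesis
  by (rule LiI[OF _ AE_circle_cnj[OF C]])
    (rule measurable_compose[OF measurable_cnj_circle Li_measurable[OF p]])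
qed

lemma Li_L2: "\<phi> : Li ==> \<phi> : L2"
proof -
 assume p: "\<phi> : Li"
 have "(%z. 1) : l2 circle" by (simp add: l2_def)
 hence "(%z. \<phi> z * 1) : l2 circle" using p l2_bounded_mult[of "%z. 1" circle \<phi>] by (auto simp: Linfty_def)
 thus ?thesis by (simp add: L2_eq_l2)
qed

lemma Li_mult_L2: "\<phi> : Li ==> f : L2 ==> (%z. \<phi> z * f z) : L2"
 unfolding L2_eq_l2 using l2_bounded_mult[of f circle \<phi>] by (auto simp: Linfty_def)

lemma L2_diff: "f : L2 ==> g : L2 ==> (%z. f z - g z) : L2"
 by (simp add: L2_eq_l2 l2_diff)

lemma L2_add: "f : L2 ==> g : L2 ==> (%z. f z + g z) : L2"
 by (simp add: L2_eq_l2 l2_add)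

lemma L2_cnj: "f : L2 ==> (%z. cnj (f z)) : L2"
 by (simp add: L2_eq_l2 l2_cnj)

lemma cls_cong: "f \<doteq> g ==> f : L2 ==> g : L2 ==> cls f = cls g"
 by (simp add: cls_eq_iff)

lemma ae_eq_mult: "f \<doteq> g ==> (%z. h z * f z) \<doteq> (%z. h z * g z)"
 unfolding ae_eq_def by (auto elim: eventually_mono)

definition mul :: "(complex => complex) => hl2 => hl2" where
 "mul \<phi> x = cls (%z. \<phi> z * rp x z)"

lemma mul_cls: "\<phi> : Li ==> f : L2 ==> mul \<phi> (cls f) = cls (%z. \<phi> z * f z)"
 unfolding mul_def by (rule cls_cong) (auto simp: Li_mult_L2 ae_eq_mult rp_cls)

lemma mul_mul: "\<phi> : Li ==> \<psi> : Li ==> mul \<phi> (mul \<psi> x) = mul (%z. \<phi> z * \<psi> z) x"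
 using mul_cls[of \<phi> "%z. \<psi> z * rp x z"] by (simp add: mul_def Li_mult_L2 mult.assoc)

lemma mul_cong: "\<phi> : Li ==> \<psi> : Li ==> \<phi> \<doteq> \<psi> ==> mul \<phi> x = mul \<psi> x"
 unfolding mul_def by (rule cls_cong) (auto simp: Li_mult_L2 ae_eq_def elim: eventually_mono)

lemma mul_add: "\<phi> : Li ==> mul \<phi> (x + y) = mul \<phi> x + mul \<phi> y"
 using mul_cls[of \<phi> "%z. rp x z + rp y z"] cls_add[of "%z. \<phi> z * rp x z" "%z. \<phi> z * rp y z"]
 by (simp add: mul_def plus_hl2_def[symmetric] L2_add Li_mult_L2 distrib_left)

lemma mul_scaleC: "\<phi> : Li ==> mul \<phi> (c *C x) = c *C mul \<phi> x"
 using mul_cls[of \<phi> "%z. c * rp x z"] cls_scaleC[of "%z. \<phi> z * rp x z" c]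
 by (simp add: mul_def scaleC_def[symmetric] L2_eq_l2[symmetric] Li_mult_L2 Li_const mult.left_commute)

lemma mul_minus: "\<phi> : Li ==> \<psi> : Li ==> mul (%z. \<phi> z - \<psi> z) x = mul \<phi> x - mul \<psi> x"
 using cls_diff[of "%z. \<phi> z * rp x z" "%z. \<psi> z * rp x z"]
 by (simp add: mul_def Li_mult_L2 left_diff_distrib)

lemma mul_const: "mul (%z. c) x = c *C x"
 by (simp add: mul_def scaleC_def)

lemma mul_one: "mul (%z. 1) x = x"
 by (simp add: mul_const)

lemma mul_norm:
 assumes "\<phi> : Li" "AE z in circle. cmod (\<phi> z) <= C" "C >= 0"
 shows "norm (mul \<phi> x) <= C * norm x"
proof -
 have "(norm (mul \<phi> x))^2 = (LINT z|circle. (cmod (\<phi> z * rp x z))^2)"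
  unfolding mul_def by (rule norm_cls_sq) (simp add: Li_mult_L2 assms)
 also have "... <= (LINT z|circle. C\<^sup>2 * (cmod (rp x z))^2)"
 proof (rule integral_mono_AE)
  show "integrable circle (%z. (cmod (\<phi> z * rp x z))^2)"
   using Li_mult_L2[OF assms(1) rp_L2] by (simp add: L2_def)
  show "AE z in circle. (cmod (\<phi> z * rp x z))\<^sup>2 <= C\<^sup>2 * (cmod (rp x z))^2"
   using assms(2) by eventually_elim (auto simp: norm_mult power_mult_distrib intro!: mult_right_mono power_mono)
 qed (simp add: l2_integrable)
 also have "... = (C * norm x)^2" by (simp add: norm_hl2_sq power_mult_distrib)
 finally show ?thesis by (rule power2_le_imp_le) (simp add: assms)
qed

lemma bcl_mul: assumes "\<phi> : Li" shows "bcl (mul \<phi>)"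
proof -
 obtain C where "C > 0" "AE z in circle. cmod (\<phi> z) <= C" using Li_bound[OF assms] .
 thus ?thesis by (intro bclI[where C=C]) (auto simp: assms mul_add mul_scaleC mul_norm)
qed

lemma cip_mul: "\<phi> : Li ==> cip (mul \<phi> x) y = cip x (mul (%z. cnj (\<phi> z)) y)"
proof -
 assume p: "\<phi> : Li"
 have "cip (mul \<phi> x) y = ip (%z. \<phi> z * rp x z) (rp y)"
  using cip_cls[of "%z. \<phi> z * rp x z" "rp y"] by (simp add: mul_def Li_mult_L2 p)
 also have "... = ip (rp x) (%z. cnj (\<phi> z) * rp y z)"
  by (simp add: ip_def mult.assoc mult.left_commute)
 also have "... = cip x (mul (%z. cnj (\<phi> z)) y)"
  using cip_cls[of "rp x" "%z. cnj (\<phi> z) * rp y z"] by (simp add: mul_def Li_mult_L2 Li_cnj p)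
 finally show ?thesis .
qed

lemma mul_isometry:
 assumes p: "\<phi> : Li" "AE z in circle. cmod (\<phi> z) = 1" shows "cip (mul \<phi> x) (mul \<phi> y) = cip x y"
proof -
 have "(%z. cnj (\<phi> z) * \<phi> z) \<doteq> (%z. 1)"
  unfolding ae_eq_def using p(2) by eventually_elim (simp add: complex_norm_square[symmetric] mult.commute)
 thus ?thesis
  using mul_cong[of "%z. cnj (\<phi> z) * \<phi> z" "%z. 1" y]
  by (simp add: cip_mul p mul_mul Li_cnj Li_mult Li_const mul_one)
qed

abbreviation zmul :: "hl2 => hl2" where "zmul \<equiv> mul (%z. z)"
abbreviation zbmul :: "hl2 => hl2" where "zbmul \<equiv> mul cnj"

lemma AE_norm1: "AE z in circle. cmod z = 1" by (rule AE_circleI) simp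

lemma zmul_zbmul [simp]: "zmul (zbmul x) = x" "zbmul (zmul x) = x"
proof -
 have *: "(%z. z * cnj z) \<doteq> (%z. 1)" "(%z. cnj z * z) \<doteq> (%z. 1)" unfolding ae_eq_def
  by (rule AE_circleI, simp add: complex_norm_square[symmetric] mult.commute)+
 show "zmul (zbmul x) = x" "zbmul (zmul x) = x"
  using mul_cong[OF _ _ *(1), of x] mul_cong[OF _ _ *(2), of x]
  by (simp_all add: mul_mul Li_pow Li_mult Li_const mul_one)
qed

lemma cip_zmul: "cip (zmul x) y = cip x (zbmul y)" "cip (zbmul x) y = cip x (zmul y)"
 by (simp_all add: cip_mul Li_pow)

section \<open>Fourier coefficients, the Hardy space and the backward shift\<close>

definition e :: "nat => hl2" where "e n = cls (%z. z ^ n)"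
definition em :: "nat => hl2" where "em n = cls (%z. cnj z ^ n)"
definition HH :: "hl2 set" where "HH = {x. ALL y:range (%n. em (Suc n)). cip x y = 0}"
abbreviation coef :: "hl2 => nat => complex" where "coef x n \<equiv> cip x (e n)"

lemma csub_HH: "csub HH" unfolding HH_def by (rule csub_orth)

lemma HH_iff: "x : HH <-> (ALL n. cip x (em (Suc n)) = 0)"
 by (auto simp: HH_def)

lemma cip_em: "f : L2 ==> cip (cls f) (em n) = (LINT z|circle. f z * z ^ n)"
 unfolding em_def by (subst cip_cls) (auto simp: Li_L2 Li_pow ip_def)

lemma cip_e: "f : L2 ==> cip (cls f) (e n) = (LINT z|circle. f z * cnj z ^ n)"
 unfolding e_def by (subst cip_cls) (auto simp: Li_L2 Li_pow ip_def)

lemma H2_iff: "f : H2 <-> f : L2 & cls f : HH"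
 unfolding H2_def HH_iff by (auto simp: cip_em)

lemma zmul_e: "zmul (e n) = e (Suc n)"
 unfolding e_def by (subst mul_cls) (auto simp: Li_pow Li_L2)

lemma zbmul_em: "zbmul (em n) = em (Suc n)"
 unfolding em_def by (subst mul_cls) (auto simp: Li_pow Li_L2)

lemma e_0: "e 0 = em 0" by (simp add: e_def em_def)

lemma cip_e_em: "cip (e m) (em n) = (if m + n = 0 then 1 else 0)"
 unfolding e_def em_def by (subst cip_cls) (auto simp: Li_pow Li_L2 ip_def circle_moment simp flip: power_add)

lemma cip_e_e: "cip (e m) (e n) = (if m = n then 1 else 0)"
proof (induction n arbitrary: m)
 case 0 thus ?case using cip_e_em[of m 0] by (simp add: e_0)
next
 case (Suc n)
 show ?case
 proof (cases m)
  case 0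
  have "cip (e 0) (e (Suc n)) = cnj (cip (e (Suc n)) (em 0))" by (metis cip_commute e_0)
  thus ?thesis using 0 by (simp add: cip_e_em)
 next
  case (Suc k)
  have "cip (e m) (e (Suc n)) = cip (zmul (e k)) (zmul (e n))" by (simp add: zmul_e Suc)
  also have "... = cip (e k) (e n)" by (simp add: cip_zmul)
  finally show ?thesis using Suc.IH[of k] Suc by simp
 qed
qed

lemma e_HH: "e n : HH" by (simp add: HH_iff cip_e_em)

text \<open>Membership in \<open>HH\<close> kills the moments against positive powers of
  \<open>z\<close>, the hypothesis kills those against powers of \<open>cnj z\<close>; a function
  with all moments zero vanishes.\<close>

lemma HH_coef_eq_0:
 assumes "x : HH" "!!n. coef x n = 0" shows "x = 0"
proof -
 have "AE z in circle. rp x z = 0"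
 proof (rule AE_zero_moments[OF refl])
  show "finite_measure circle" by unfold_locales
  show "integrable circle (rp x)" using l2_mult_integrable[OF rp_l2 Li_L2[OF Li_const[of 1], unfolded L2_eq_l2], of x] by simp
  show "(LINT z|circle. rp x z * z ^ n) = 0" for n
   using assms(1) assms(2)[of 0] cip_em[OF rp_L2, of x n] by (cases n) (auto simp: HH_iff e_0)
  show "(LINT z|circle. rp x z * cnj z ^ n) = 0" for n
   using assms(2)[of n] cip_e[OF rp_L2, of x n] by simp
 qed
 hence "rp x \<doteq> rp 0" unfolding ae_eq_def using rp_zero[unfolded ae_eq_def] by eventually_elim simp
 thus ?thesis by (rule hl2_eqI)
qed

lemma HH_eqI: "x : HH ==> y : HH ==> (!!n. coef x n = coef y n) ==> x = y"
 using HH_coef_eq_0[of "x - y"] csubD(6)[OF csub_HH] by (simp add: cip_diff_left)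

definition fsum :: "(nat => complex) => nat => hl2" where
 "fsum a N = (\<Sum>k<N. a k *C e k)"

lemma cip_sum_left: "cip (\<Sum>k\<in>A. f k) y = (\<Sum>k\<in>A. cip (f k) y)"
 by (induction A rule: infinite_finite_induct) (auto simp: cip_add_left)

lemma cip_sum_right: "cip y (\<Sum>k\<in>A. f k) = (\<Sum>k\<in>A. cip y (f k))"
 by (induction A rule: infinite_finite_induct) (auto simp: cip_add_right)

lemma fsum_HH: "fsum a N : HH"
 unfolding fsum_def by (rule subspace_sum[OF csub_subspace[OF csub_HH]]) (simp add: csubD(3)[OF csub_HH] e_HH)

lemma coef_fsum: "coef (fsum a N) n = (if n < N then a n else 0)"
 unfolding fsum_def cip_sum_left cip_cl cip_e_e by (simp add: if_distrib cong: if_cong)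

lemma norm_sum_e: "finite A ==> (norm (\<Sum>k\<in>A. a k *C e k))^2 = (\<Sum>k\<in>A. (cmod (a k))\<^sup>2)"
proof -
 assume A: "finite A"
 have "complex_of_real ((norm (\<Sum>k\<in>A. a k *C e k))^2) = (\<Sum>k\<in>A. a k * cnj (a k))"
  unfolding cip_self[symmetric] cip_sum_left cip_sum_right cip_cl cip_cr cip_e_e
  using A by (simp add: if_distrib mult.commute cong: if_cong)
 also have "... = of_real (\<Sum>k\<in>A. (cmod (a k))\<^sup>2)" by (simp only: complex_norm_square of_real_sum)
 finally show ?thesis using of_real_eq_iff by blast
qed

lemma bessel: "(\<Sum>k<N. (cmod (coef x k))\<^sup>2) <= (norm x)^2"
proof -
 let ?s = "fsum (coef x) N"
 have 1: "cip x ?s = of_real (\<Sum>k<N. (cmod (coef x k))\<^sup>2)"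
  unfolding fsum_def cip_sum_right cip_cr of_real_sum complex_norm_square
  by (simp add: mult.commute)
 have 2: "cip ?s ?s = of_real (\<Sum>k<N. (cmod (coef x k))\<^sup>2)"
  unfolding cip_self fsum_def by (subst norm_sum_e) auto
 have 3: "cip ?s x = of_real (\<Sum>k<N. (cmod (coef x k))\<^sup>2)"
  using 1 by (metis cip_commute complex_cnj_complex_of_real)
 have "complex_of_real ((norm (x - ?s))^2) = of_real ((norm x)^2 - (\<Sum>k<N. (cmod (coef x k))\<^sup>2))"
  using 1 2 3 unfolding cip_self[symmetric] cip_diff_left cip_diff_right of_real_diff by simp
 hence "(norm (x - ?s))^2 = (norm x)^2 - (\<Sum>k<N. (cmod (coef x k))\<^sup>2)" using of_real_eq_iff by blast
 thus ?thesis using zero_le_power2[of "norm (x - ?s)"] by linarith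
qed

lemma summable_coef: "summable (%k. (cmod (coef x k))^2)"
 by (rule summableI_nonneg_bounded[OF _ bessel]) simp

lemma riesz_fischer:
 assumes "summable (%k. (cmod (a k))^2)"
 obtains y where "y : HH" "fsum a ----> y" "!!n. coef y n = a n"
proof -
 have "Cauchy (fsum a)"
 proof (rule CauchyI')
  fix r :: real assume r: "r > 0"
  have "Cauchy (%n. \<Sum>k<n. (cmod (a k))\<^sup>2)" using assms by (simp add: summable_iff_convergent Cauchy_convergent_iff)
  then obtain M where M: "!!m n. m >= M ==> n >= M ==> norm ((\<Sum>k<m. (cmod (a k))\<^sup>2) - (\<Sum>k<n. (cmod (a k))\<^sup>2)) < r\<^sup>2"
   using r unfolding Cauchy_iff by (meson zero_less_power)
  have "dist (fsum a m) (fsum a n) < r" if mn: "m >= M" "n > m" for m n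
  proof -
   have "{..<n} = {..<m} \<union> {m..<n}" using mn by auto
   hence d: "sum f {..<n} - sum f {..<m} = sum f {m..<n}" for f :: "nat => 'b::ab_group_add"
    by (simp add: sum.union_disjoint ivl_disj_int)
   have "(norm (fsum a n - fsum a m))^2 = (\<Sum>k<n. (cmod (a k))\<^sup>2) - (\<Sum>k<m. (cmod (a k))\<^sup>2)"
    unfolding fsum_def d by (rule norm_sum_e) simp
   also have "... < r\<^sup>2" using M[of n m] mn by simp
   finally have "norm (fsum a n - fsum a m) < r" using r by (simp add: power2_less_imp_less)
   thus ?thesis by (simp add: dist_norm norm_minus_commute)
  qed
  thus "EX M. ALL m>=M. ALL n>m. dist (fsum a m) (fsum a n) < r" by blast
 qed
 then obtain y where y: "fsum a ----> y" using Cauchy_convergent convergent_def by blast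
 have "y : HH" using csubD(4)[OF csub_HH] fsum_HH y closed_sequentially by blast
 moreover have "coef y n = a n" for n
 proof -
  have "(%N. coef (fsum a N) n) ----> coef y n" by (intro tendsto_intros y)
  moreover have "(%N. coef (fsum a N) n) ----> a n"
   by (rule tendsto_eventually) (auto simp: coef_fsum eventually_sequentially intro!: exI[of _ "Suc n"])
  ultimately show ?thesis using LIMSEQ_unique by blast
 qed
 ultimately show thesis using that y by blast
qed

lemma fsum_tendsto: assumes "x : HH" shows "fsum (coef x) ----> x"
proof -
 obtain y where y: "y : HH" "fsum (coef x) ----> y" "!!n. coef y n = coef x n"
  using riesz_fischer[OF summable_coef] by blast
 have "y = x" using y assms HH_eqI by blast
 thus ?thesis using y by simp
qed

lemma HH_cip_sums: assumes "x : HH" shows "(%k. coef x k * cnj (coef y k)) sums cip x y"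
proof -
 have "(%N. cip (fsum (coef x) N) y) ----> cip x y" by (intro tendsto_intros fsum_tendsto assms)
 moreover have "cip (fsum (coef x) N) y = (\<Sum>k<N. coef x k * cnj (coef y k))" for N
  unfolding fsum_def cip_sum_left cip_cl by (simp only: cip_commute[of "e i" y for i])
 ultimately show ?thesis by (simp add: sums_def)
qed

lemma parseval: assumes "x : HH" shows "(%k. (cmod (coef x k))^2) sums (norm x)\<^sup>2"
proof -
 have "(%k. complex_of_real ((cmod (coef x k))^2)) sums of_real ((norm x)^2)"
  using HH_cip_sums[OF assms, of x] by (simp only: cip_self complex_norm_square)
 thus ?thesis by (simp only: sums_of_real_iff)
qed

definition L :: "hl2 => hl2" where "L x = zbmul (x - coef x 0 *C e 0)"

lemma bcl_L: "bcl L"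
 unfolding L_def by (intro bcl_compose[OF bcl_mul] bcl_minus2 bcl_id bcl_rank1 Li_pow)

lemma L_HH: "x : HH ==> L x : HH"
proof -
 assume x: "x : HH"
 have "cip (L x) (em (Suc n)) = 0" for n
 proof -
  have "cip (L x) (em (Suc n)) = cip (x - coef x 0 *C e 0) (zmul (zbmul (em n)))"
   unfolding L_def zbmul_em[symmetric] by (simp add: cip_zmul)
  also have "... = 0"
   using x by (cases n) (auto simp: cip_diff_left cip_cl cip_e_em cip_e_e HH_iff e_0[symmetric])
  finally show ?thesis .
 qed
 thus ?thesis by (simp add: HH_iff)
qed

lemma coef_L: "coef (L x) n = coef x (Suc n)"
 by (simp add: L_def cip_zmul zmul_e cip_diff_left cip_cl cip_e_e)

lemma L_pow_HH: "x : HH ==> (L ^^ n) x : HH"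
 by (induction n) (auto simp: L_HH)

lemma coef_L_pow: "coef ((L ^^ n) x) k = coef x (n + k)"
 by (induction n arbitrary: k) (auto simp: coef_L)

lemma zmul_L: "zmul (L x) = x - coef x 0 *C e 0"
 by (simp add: L_def)

lemma norm_L: "(norm (L x))^2 = (norm x)^2 - (cmod (coef x 0))^2"
proof -
 have "cip (L x) (L x) = cip x x - coef x 0 * cnj (coef x 0)"
  using cip_commute[of x "e 0"] by (simp add: L_def cip_zmul cip_diff_left cip_diff_right cip_cl cip_cr cip_e_e)
 hence "complex_of_real ((norm (L x))^2) = of_real ((norm x)^2 - (cmod (coef x 0))^2)"
  by (simp only: cip_self complex_norm_square of_real_diff)
 thus ?thesis using of_real_eq_iff by blast
qed

lemma norm_L_pow: "(norm ((L ^^ N) x))^2 = (norm x)^2 - (\<Sum>k<N. (cmod (coef x k))\<^sup>2)"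
 by (induction N) (auto simp: norm_L coef_L_pow)

text \<open>The squared norm of the N-th iterate is a tail of the Parseval series. This strong
  convergence is what makes telescoping arguments along \<open>L\<close> converge.\<close>

lemma L_pow_tendsto: assumes "x : HH" shows "(%N. (L ^^ N) x) ----> 0"
proof -
 have "(%N. (norm x)\<^sup>2 - (\<Sum>k<N. (cmod (coef x k))\<^sup>2)) ----> (norm x)^2 - (norm x)^2"
  using parseval[OF assms] by (intro tendsto_intros) (simp add: sums_def)
 hence "(%N. sqrt ((norm ((L ^^ N) x))^2)) ----> sqrt 0"
  unfolding norm_L_pow by (intro tendsto_real_sqrt) simp
 thus ?thesis by (simp add: tendsto_norm_zero_iff)
qed

lemma zmul_HH: "x : HH ==> zmul x : HH"
 using zbmul_em by (simp add: HH_iff cip_zmul)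

lemma coef_zmul_0: "x : HH ==> coef (zmul x) 0 = 0"
 using zbmul_em[of 0] by (simp add: HH_iff cip_zmul e_0)

lemma L_zmul: "x : HH ==> L (zmul x) = x"
 by (simp add: L_def coef_zmul_0)

text \<open>Multiplication by \<phi> sends \<open>e n\<close> to the n-th forward shift of \<phi>,
  and the Hardy space is closed under sums and limits.\<close>

lemma mul_HH:
 assumes p: "\<phi> : Li" "cls \<phi> : HH" and x: "x : HH" shows "mul \<phi> x : HH"
proof -
 have "mul \<phi> (e n) : HH" for n
 proof (induction n)
  case 0 show ?case using p by (simp add: e_def mul_cls Li_L2 Li_const)
 next
  case (Suc n)
  have "mul \<phi> (zmul (e n)) = zmul (mul \<phi> (e n))"
   by (simp add: mul_mul p Li_pow mult.commute)
  hence "mul \<phi> (e (Suc n)) = zmul (mul \<phi> (e n))" by (simp add: zmul_e)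
  thus ?case using Suc zmul_HH by simp
 qed
 hence *: "coef x k *C mul \<phi> (e k) : HH" for k by (rule csubD(3)[OF csub_HH])
 have "mul \<phi> (fsum (coef x) N) = (\<Sum>k<N. coef x k *C mul \<phi> (e k))" for N
  unfolding fsum_def linear_sum[OF bounded_linear.linear[OF bcl_bounded_linear[OF bcl_mul[OF p(1)]]]]
  by (simp add: mul_scaleC p)
 hence "mul \<phi> (fsum (coef x) N) : HH" for N
  by (simp only:) (rule subspace_sum[OF csub_subspace[OF csub_HH] *])
 moreover have "(%N. mul \<phi> (fsum (coef x) N)) ----> mul \<phi> x"
  by (rule tendsto_bcl[OF bcl_mul[OF p(1)] fsum_tendsto[OF x]])
 ultimately show ?thesis by (rule closed_sequentially[OF csubD(4)[OF csub_HH]])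
qed

section \<open>Radial limits\<close>

lemma measurable_sphere_continuous:
 fixes f :: "complex => 'b::topological_space"
 assumes "continuous_on (sph) f" shows "f : Bm"
 using borel_measurable_continuous_on_restrict[OF assms] measurable_cong_sets[OF sets_circle refl] by blast

text \<open>On the circle dz = \<i> z dt, so Cauchy's kernel reads \<open>z / (z - w)\<close> with
  respect to normalized arc length.\<close>

lemma cauchy_circle:
 assumes "continuous_on (cball 0 1) g" "g holomorphic_on ball 0 1" "cmod w < 1"
 shows "(LINT z|circle. g z * (z / (z - w))) = g w"
proof -
 let ?f = "%z. g z * (z / (z - w))"
 have ne: "z - w ~= 0" if "z : sph" for z using that assms(3) by auto
 have c: "continuous_on (sph) ?f"
  using ne by (intro continuous_intros continuous_on_subset[OF assms(1)]) auto
 have m: "?f : Bm"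
  by (rule measurable_sphere_continuous[OF c])
 have "((%u. g u / (u - w)) has_contour_integral (2 * of_real pi * \<i> * g w)) (circlepath 0 1)"
  by (rule Cauchy_integral_circlepath[OF assms(1,2)]) (use assms(3) in simp)
 hence "((%t. g (0 + 1 * cis t) / (0 + 1 * cis t - w) * 1 * \<i> * cis t) has_integral 2 * of_real pi * \<i> * g w) {0..2*pi}"
  unfolding circlepath_def by (subst (asm) has_contour_integral_part_circlepath_iff) auto
 hence "((%t. \<i> * ?f (cis t)) has_integral \<i> * (2 * of_real pi * g w)) {0..2*pi}"
  by (simp add: algebra_simps)
 hence "((%t. (1 / \<i>) * (\<i> * ?f (cis t))) has_integral (1 / \<i>) * (\<i> * (2 * of_real pi * g w))) {0..2*pi}"
  by (rule has_integral_mult_right)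
 hence "((%t. ?f (cis t)) has_integral 2 * of_real pi * g w) {0..2*pi}" by simp
 moreover have "continuous_on {0..2*pi} (%t. ?f (cis t))"
  by (rule continuous_on_compose2[OF c]) (auto intro!: continuous_intros)
 hence "set_integrable lborel {0..2*pi} (%t. ?f (cis t))"
  unfolding set_integrable_def by (intro borel_integrable_compact) auto
 ultimately have "(LINT t:{0..2*pi}|lborel. ?f (cis t)) = 2 * of_real pi * g w"
  using set_borel_integral_eq_integral(2) integral_unique by metis
 thus ?thesis by (subst integral_circle[OF m]) (simp add: scaleR_conv_of_real)
qed

definition poisson :: "complex => complex => real" where
 "poisson w z = (1 - (cmod w)^2) / (cmod (z - w))^2"

lemma poisson_nonneg: "cmod w < 1 ==> poisson w z >= 0"
 by (simp add: poisson_def abs_square_le_1)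

lemma continuous_poisson: "cmod w < 1 ==> continuous_on (sph) (poisson w)"
 unfolding poisson_def by (intro continuous_intros) auto

lemma poisson_eq:
 assumes "z : sph" "cmod w < 1"
 shows "of_real (poisson w z) = (1 - (cmod w)^2) / (1 - cnj w * z) * (z / (z - w))"
proof -
 have z: "z * cnj z = 1" using assms(1) by (simp add: complex_norm_square[symmetric])
 have 1: "z - w ~= 0" using assms by auto
 have "cnj (z - w) = cnj z * (1 - cnj w * z)" using z by (simp add: algebra_simps)
 hence "of_real ((cmod (z - w))^2) = (z - w) * (cnj z * (1 - cnj w * z))"
  unfolding complex_norm_square by simp
 moreover have "z ~= 0" "cnj z = 1 / z" using z by (auto simp: eq_divide_eq mult.commute)
 ultimately show ?thesis unfolding poisson_def of_real_divide
  by (simp add: divide_inverse ac_simps)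
qed

text \<open>The Poisson kernel is Cauchy's kernel times a factor analytic in \<open>z\<close>.
  Absorbing that factor into \<open>h\<close> leaves Cauchy's formula, and at \<open>z = w\<close>
  the factor equals 1.\<close>

lemma poisson_integral:
 assumes h: "continuous_on (cball 0 1) h" "h holomorphic_on ball 0 1" "cmod w < 1"
 shows "(LINT z|circle. h z * of_real (poisson w z)) = h w"
proof -
 have ne: "1 - cnj w * z ~= 0" if "z : cball 0 1" for z
 proof
  assume "1 - cnj w * z = 0"
  hence "cmod w * cmod z = 1" by (metis complex_mod_cnj eq_iff_diff_eq_0 norm_mult norm_one)
  moreover have "cmod w * cmod z <= cmod w * 1" using that by (intro mult_left_mono) auto
  ultimately show False using assms(3) by simp
 qed
 define g where "g z = h z * ((1 - (cmod w)^2) / (1 - cnj w * z))" for z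
 have "(LINT z|circle. h z * of_real (poisson w z)) = (LINT z|circle. g z * (z / (z - w)))"
  by (rule integral_eqI) (auto simp: space_circle poisson_eq assms g_def)
 also have "... = g w"
 proof (rule cauchy_circle[OF _ _ assms(3)])
  show "continuous_on (cball 0 1) g" unfolding g_def by (intro continuous_intros h) (use ne in auto)
  show "g holomorphic_on ball 0 1" unfolding g_def by (intro holomorphic_intros h) (use ne in auto)
 qed
 also have "g w = h w"
 proof -
  have "of_real (1 - (cmod w)^2) = 1 - cnj w * w"
   by (simp only: of_real_diff of_real_1 complex_norm_square mult.commute)
  thus ?thesis using ne[of w] assms(3) unfolding g_def by (simp add: mult.commute)
 qed
 finally show ?thesis .
qed

lemma poisson_integral_one: "cmod w < 1 ==> (LINT z|circle. poisson w z) = 1"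
proof -
 assume w: "cmod w < 1"
 have "complex_of_real (LINT z|circle. poisson w z) = 1"
  using poisson_integral[of "%z. 1" w] w by simp
 thus ?thesis by simp
qed

lemma measurable_poisson: "cmod w < 1 ==> poisson w : Bm"
 by (rule measurable_sphere_continuous[OF continuous_poisson])

lemma sphere_continuous_bounded:
 fixes f :: "complex => 'b::real_normed_vector"
 assumes "continuous_on (sph) f" obtains B where "!!z. z : sph ==> norm (f z) <= B"
 using compact_imp_bounded[OF compact_continuous_image[OF assms compact_sphere]] unfolding bounded_iff by blast

lemma integrable_sphere_continuous:
 fixes f :: "complex => 'b::{banach, second_countable_topology}"
 assumes "continuous_on (sph) f" shows "integrable circle f"
proof -
 obtain B where "!!z. z : sph ==> norm (f z) <= B" using sphere_continuous_bounded[OF assms] by blast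
 thus ?thesis
  by (intro integrable_bounded_circle[OF _ refl measurable_sphere_continuous[OF assms]]) unfold_locales
qed

lemma circle_norm: assumes "cmod z = 1" shows "(Re z)^2 + (Im z)^2 = 1"
 using assms by (simp flip: cmod_power2)

lemma poisson_swap: assumes "cmod z = 1" "cmod v = 1"
 shows "poisson (of_real s * z) v = poisson (of_real s * v) z"
proof -
 have "(cmod (v - of_real s * z))^2 = (cmod (z - of_real s * v))^2"
  using circle_norm[OF assms(1)] circle_norm[OF assms(2)] by (simp add: cmod_power2) algebra
 thus ?thesis using assms by (simp add: poisson_def norm_mult)
qed

lemma poisson_Re: "poisson w v = Re ((v + w) / (v - w))" if "cmod v = 1"
proof -
 have "Re ((v + w) * cnj (v - w)) = 1 - (cmod w)^2"
  using circle_norm[OF that] unfolding cmod_power2 by (simp add: power2_eq_square algebra_simps)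
 thus ?thesis unfolding poisson_def complex_div_cnj[of "v + w"]
  by (simp only: Re_divide_of_real flip: of_real_power)
qed

text \<open>As a function of \<open>y\<close> the second kernel is the real part of
  \<open>h\<close>, which is analytic up to the circle; integrating against the first kernel
  evaluates \<open>h\<close> at its pole \<open>?w\<close>.\<close>

lemma poisson_semigroup: assumes "cmod z = 1" "cmod v = 1" and r: "0 <= r" "r < 1" and s: "0 <= s" "s < 1"
 shows "(LINT y|circle. poisson (of_real r * z) y * poisson (of_real s * v) y) = poisson (of_real (r * s) * z) v"
proof -
 define h where "h y = (v + of_real s * y) / (v - of_real s * y)" for y
 let ?w = "of_real r * z"
 have w: "cmod ?w < 1" using assms by (simp add: norm_mult)
 have ne: "v - of_real s * y ~= 0" if "y : cball 0 1" for y
  using that s assms(2) mult_left_le[of "cmod y" s] by (auto simp: norm_mult)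
 have c: "continuous_on (cball 0 1) h" unfolding h_def by (intro continuous_intros ballI ne)
 have hol: "h holomorphic_on ball 0 1" unfolding h_def by (intro holomorphic_intros ne) auto
 have int: "integrable circle (%y. h y * of_real (poisson ?w y))"
  by (intro integrable_sphere_continuous continuous_intros continuous_poisson w continuous_on_subset[OF c]) auto
 have p: "poisson (of_real s * v) y = Re (h y)" if "cmod y = 1" for y
  using poisson_swap[of v y s] poisson_Re[of v "of_real s * y"] that assms by (simp add: h_def)
 have "(LINT y|circle. poisson ?w y * poisson (of_real s * v) y) = (LINT y|circle. Re (h y * of_real (poisson ?w y)))"
  by (rule integral_eqI) (auto simp: space_circle p)
 also have "... = Re (h ?w)" by (simp only: integral_Re[OF int] poisson_integral[OF c hol w])
 finally show ?thesis using assms by (simp add: poisson_Re h_def ac_simps)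
qed

text \<open>Let \<open>r <= s\<close>. The points \<open>r * z\<close> and \<open>r * s * z\<close>
  are at distance \<open>r - r * s\<close>, at most the distance of the latter to \<open>v\<close>,
  so replacing one by the other at most doubles the distance to \<open>v\<close>. Moreover
  \<open>1 - (r * s)^2 <= 2 * (1 - r\<^sup>2)\<close>. The constant is 8 = 2 * 4.\<close>

lemma poisson_prod_le: assumes "cmod z = 1" "cmod v = 1" and r: "0 <= r" "r < 1" and s: "0 <= s" "s < 1"
 shows "poisson (of_real (r * s) * z) v <= 8 * (poisson (of_real r * z) v + poisson (of_real s * v) z)"
proof -
 have *: "poisson (of_real (r * s) * z) v <= 8 * poisson (of_real r * z) v"
  if "r <= s" "0 <= r" "s < 1" "cmod z = 1" "cmod v = 1" for r s z v
 proof -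
  have rs: "r * r <= r * s" "r * s <= r" "0 <= r * s" "r <= 1" using that by (auto simp: mult_left_mono mult_left_le)
  let ?a = "cmod (v - of_real (r * s) * z)" and ?b = "cmod (v - of_real r * z)"
  have "?b <= ?a + cmod (of_real (r * s - r) * z)"
   using norm_triangle_ineq[of "v - of_real (r * s) * z" "of_real (r * s - r) * z"] by (simp add: algebra_simps)
  also have "cmod (of_real (r * s - r) * z) = r - r * s" using rs that by (simp only: norm_mult norm_of_real) simp
  also have "r - r * s <= ?a"
   using norm_triangle_ineq2[of v "of_real (r * s) * z"] rs that by (simp add: norm_mult)
  finally have "?b\<^sup>2 <= (2 * ?a)^2" by (intro power_mono) auto
  moreover have "(r * r) * (r * r) <= (r * s) * (r * s)" "0 <= (1 - r * r) * (1 - r * r)"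
   using rs that by (auto intro!: mult_mono mult_nonneg_nonneg mult_left_le)
  hence "1 - (r * s)^2 <= 2 * (1 - r\<^sup>2)" by (simp add: power2_eq_square algebra_simps)
  ultimately have "(1 - (r * s)^2) * ?b\<^sup>2 <= (2 * (1 - r\<^sup>2)) * (2 * ?a)^2"
   using rs that by (intro mult_mono) (auto simp: abs_square_le_1)
  moreover have "0 < ?b" "0 < ?a"
   using rs that norm_triangle_ineq2[of v "of_real r * z"] by (auto simp: norm_mult)
  ultimately show ?thesis using that rs by (simp add: poisson_def norm_mult field_simps abs_mult)
 qed
 show ?thesis
  using *[of r s z v] *[of s r v z] assms poisson_nonneg[of "of_real r * z" v] poisson_nonneg[of "of_real s * v" z]
   poisson_swap[of z v "r * s"] by (cases "r <= s") (auto simp: norm_mult mult.commute)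
qed

lemma ennreal_two_mult_le: "2 * (x * y) <= x * x + y * (y::ennreal)"
proof (cases x y rule: ennreal2_cases)
 case (real_real a b)
 have "2 * (a * b) <= a * a + b * b" using zero_le_square[of "a - b"] by (simp add: algebra_simps)
 thus ?thesis using real_real by (simp flip: ennreal_mult ennreal_plus ennreal_numeral add: ennreal_leI)
qed (auto simp: ennreal_top_mult)

text \<open>By 2ab <= a^2 + b^2 the right-hand side contains one copy of the integral of
  \<open>f * f\<close>, which is moved to the left. The bound \<open>B\<close> makes that copy
  finite, as subtraction of extended reals demands.\<close>

lemma nn_integral_square_absorb:
 fixes f h :: "complex => ennreal"
 assumes [measurable]: "f : Bm" "h : Bm"
  and fin: "!!y. cmod y = 1 ==> f y <= ennreal B"
  and le: "(\<integral>\<^sup>+y. f y * f y \<partial>circle) <= c * (\<integral>\<^sup>+y. h y * f y \<partial>circle)"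
 shows "(\<integral>\<^sup>+y. f y * f y \<partial>circle) <= c * c * (\<integral>\<^sup>+y. h y * h y \<partial>circle)"
proof -
 let ?I = "%f. \<integral>\<^sup>+y. f y \<partial>circle"
 have "2 * ?I (%y. f y * f y) <= 2 * (c * ?I (%y. h y * f y))" by (intro mult_left_mono le) simp
 also have "... = ?I (%y. 2 * (c * h y * f y))" by (simp add: nn_integral_cmult mult.assoc)
 also have "... <= ?I (%y. (c * h y) * (c * h y) + f y * f y)" by (intro nn_integral_mono ennreal_two_mult_le)
 also have "... = ?I (%y. c * c * (h y * h y)) + ?I (%y. f y * f y)" by (simp add: nn_integral_add ac_simps)
 finally have "?I (%y. f y * f y) + ?I (%y. f y * f y) <= ?I (%y. f y * f y) + c * c * ?I (%y. h y * h y)"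
  by (simp add: mult_2 nn_integral_cmult add.commute)
 moreover have "?I (%y. f y * f y) <= ?I (%y. ennreal B * ennreal B)"
  by (intro nn_integral_mono mult_mono fin) (auto simp: space_circle)
 hence "?I (%y. f y * f y) ~= \<infinity>" by (auto simp: space_circle emeasure_circle ennreal_mult_eq_top_iff top_unique)
 ultimately show ?thesis by (simp add: ennreal_add_left_cancel_le)
qed

text \<open>\<open>TT\<^sup>*\<close>: the adjoint \<open>f\<close> of the linearized maximal operator satisfies \<open>\<parallel>f\<parallel>\<^sup>2 <= 16 \<langle>h, f\<rangle>\<close>, because the
 product of two Poisson kernels integrates to a third one, which is dominated by the sum of the two.\<close>

lemma linearized_maximal:
 assumes R [measurable]: "R : Bm" and R01: "!!z. 0 <= R z" "!!z. R z <= \<rho>" "\<rho> < 1"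
  and g: "g holomorphic_on UNIV"
 shows "(\<integral>\<^sup>+z. ennreal ((cmod (g (of_real (R z) * z)))^2) \<partial>circle) <= 65537 * (\<integral>\<^sup>+z. ennreal ((cmod (g z))^2) \<partial>circle)"
proof -
 let ?p = "%z. poisson (of_real (R z) * z)" and ?I = "%f. \<integral>\<^sup>+y. f y \<partial>circle"
 let ?k = "%z y. ennreal (?p z y)" and ?g = "%y. ennreal (cmod (g y))"
 have c: "continuous_on A g" for A using g holomorphic_on_imp_continuous_on continuous_on_subset by blast
 have [measurable]: "g : borel_measurable borel" by (rule borel_measurable_continuous_onI[OF c])
 have id [measurable]: "(%z. z) : Bm" by (rule measurable_sphere_continuous) (rule continuous_on_id)
 have [measurable]: "g : Bm" by (rule measurable_sphere_continuous[OF c])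
 have km [measurable]: "(%x. ?k (f x) (g x)) : borel_measurable M" if [measurable]: "f : M \<rightarrow>\<^sub>M circle" "g : borel_measurable M" for f g M
  unfolding poisson_def using measurable_compose[OF _ id, of f] by measurable
 have [measurable]: "(%x. ?k (f x) (g x)) : borel_measurable M" if "f : M \<rightarrow>\<^sub>M circle" "g : M \<rightarrow>\<^sub>M circle" for f g M
  using that measurable_compose[OF _ id, of g] by (intro km) auto
 have [measurable]: "(%z. ?k z y) : Bm" for y by measurable
 interpret P: pair_sigma_finite circle circle by unfold_locales
 have "bounded (g ` cball 0 1)" by (intro compact_imp_bounded compact_continuous_image c compact_cball)
 then obtain B where B: "ALL w:cball 0 1. cmod (g w) <= B" unfolding bounded_iff by auto
 define h where "h z = ?g (of_real (R z) * z)" for z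
 have [measurable]: "h : Bm" unfolding h_def by measurable
 define f where "f y = ?I (%z. h z * ?k z y)" for y
 have [measurable]: "f : Bm" unfolding f_def by measurable
 have w: "cmod (of_real (R z) * z) <= \<rho>" "cmod (of_real (R z) * z) < 1" if "cmod z = 1" for z
  using that R01(1,2)[of z] R01(3) by (auto simp: norm_mult)
 have hB: "h z <= ennreal B" if "cmod z = 1" for z
  using B w[OF that] by (simp add: h_def ennreal_leI)
 have "f y * f y = ?I (%z. ?I (%v. (h z * h v) * (?k z y * ?k v y)))" for y
  unfolding f_def by (subst nn_integral_multc[symmetric], measurable) (subst nn_integral_cmult[symmetric], measurable, simp add: ac_simps)
 hence "?I (%y. f y * f y) = ?I (%y. ?I (%z. ?I (%v. (h z * h v) * (?k z y * ?k v y))))" by simp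
 also have "... = ?I (%z. ?I (%y. ?I (%v. (h z * h v) * (?k z y * ?k v y))))"
  by (rule P.Fubini') measurable
 also have "... = ?I (%z. ?I (%v. ?I (%y. (h z * h v) * (?k z y * ?k v y))))"
  by (intro nn_integral_cong P.Fubini') measurable
 also have "... <= ?I (%z. ?I (%v. 8 * h z * (h v * ?k v z) + 8 * h v * (h z * ?k z v)))"
 proof (intro nn_integral_mono)
  fix z v assume "z : space circle" "v : space circle"
  hence z: "cmod z = 1" and v: "cmod v = 1" by (auto simp: space_circle)
  note wz = w(2)[OF z] w(2)[OF v]
  have [measurable]: "?k z : Bm" "?k v : Bm"
   by (auto intro!: measurable_compose[OF _ measurable_ennreal] measurable_poisson wz)
  have "?I (%y. ?k z y * ?k v y) = ennreal (LINT y|circle. ?p z y * ?p v y)"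
   using wz by (subst nn_integral_eq_integral[symmetric])
    (auto simp: ennreal_mult poisson_nonneg intro!: integrable_sphere_continuous continuous_intros continuous_poisson)
  also have "... <= ennreal (8 * (?p z v + ?p v z))"
   using R01(1,2)[of z] R01(1,2)[of v] R01(3) poisson_prod_le[OF z v, of "R z" "R v"]
   by (intro ennreal_leI) (simp add: poisson_semigroup z v)
  finally have "?I (%y. (h z * h v) * (?k z y * ?k v y)) <= (h z * h v) * ennreal (8 * (?p z v + ?p v z))"
   by (subst nn_integral_cmult) (auto intro: mult_left_mono)
  thus "?I (%y. (h z * h v) * (?k z y * ?k v y)) <= 8 * h z * (h v * ?k v z) + 8 * h v * (h z * ?k z v)"
   using wz by (simp add: poisson_nonneg ennreal_mult algebra_simps)
 qed
 also have "... = ?I (%z. ?I (%v. 8 * h z * (h v * ?k v z))) + ?I (%z. ?I (%v. 8 * h v * (h z * ?k z v)))"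
  by (subst nn_integral_add[symmetric], measurable) (intro nn_integral_cong nn_integral_add; measurable)
 also have "?I (%z. ?I (%v. 8 * h v * (h z * ?k z v))) = ?I (%v. ?I (%z. 8 * h v * (h z * ?k z v)))"
  by (rule P.Fubini'[symmetric]) measurable
 also have "?I (%z. ?I (%v. 8 * h z * (h v * ?k v z))) = 8 * ?I (%y. h y * f y)"
  by (simp add: f_def nn_integral_cmult mult.assoc)
 finally have ff: "?I (%y. f y * f y) <= 16 * ?I (%y. h y * f y)" by (simp flip: distrib_right)
 \<comment> \<open>A crude bound, whose purpose is finiteness of the integrals that get absorbed; it
   rests on the radii staying below \<rho> < 1.\<close>
 have fB: "f y <= ennreal (B / (1 - \<rho>)^2)" if y: "cmod y = 1" for y
 proof -
  have "f y <= ?I (%z. ennreal B * ennreal (1 / (1 - \<rho>)^2))" unfolding f_def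
  proof (intro nn_integral_mono mult_mono hB ennreal_leI)
   fix z assume "z : space circle"
   hence z: "cmod z = 1" by (simp add: space_circle)
   have "(1 - \<rho>)^2 <= (cmod (y - of_real (R z) * z))^2"
    using norm_triangle_ineq2[of y "of_real (R z) * z"] y R01(3) w[OF z] by (intro power_mono) auto
   thus "?p z y <= 1 / (1 - \<rho>)^2"
    unfolding poisson_def using R01(3) w[OF z] by (intro frac_le) (auto simp: abs_square_le_1)
  qed (auto simp: space_circle)
  moreover have "0 <= B" using order_trans[OF norm_ge_zero B[rule_format, of 0]] by simp
  ultimately show ?thesis by (simp add: space_circle emeasure_circle flip: ennreal_mult)
 qed
 have "h z <= ?I (%y. ?g y * ?k z y)" if z: "cmod z = 1" for z
 proof -
  have "cmod (g (of_real (R z) * z)) = cmod (LINT y|circle. g y * of_real (?p z y))"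
   by (simp only: poisson_integral[OF c holomorphic_on_subset[OF g subset_UNIV] w(2)[OF z]])
  also have "... <= (LINT y|circle. cmod (g y) * ?p z y)"
   using integral_norm_bound[of circle "%y. g y * of_real (?p z y)"] poisson_nonneg[OF w(2)[OF z]] by (simp add: norm_mult)
  finally have "h z <= ennreal (LINT y|circle. cmod (g y) * ?p z y)" by (simp add: h_def ennreal_leI)
  also have "... = ?I (%y. ennreal (cmod (g y) * ?p z y))"
   using w(2)[OF z] by (intro nn_integral_eq_integral[symmetric] integrable_sphere_continuous continuous_intros continuous_poisson c)
    (auto simp: poisson_nonneg)
  finally show ?thesis using poisson_nonneg[OF w(2)[OF z]] by (simp add: ennreal_mult)
 qed
 hence "?I (%z. h z * h z) <= ?I (%z. h z * ?I (%y. ?g y * ?k z y))"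
  by (intro nn_integral_mono mult_left_mono) (auto simp: space_circle)
 also have "... = ?I (%z. ?I (%y. ?g y * (h z * ?k z y)))"
  by (intro nn_integral_cong) (subst nn_integral_cmult[symmetric], measurable, simp add: ac_simps)
 also have "... = ?I (%y. ?I (%z. ?g y * (h z * ?k z y)))"
  by (rule P.Fubini'[symmetric]) measurable
 also have "... = ?I (%y. ?g y * f y)" by (simp add: f_def nn_integral_cmult)
 finally have hg: "?I (%z. h z * h z) <= ?I (%y. ?g y * f y)" .
 \<comment> \<open>With \<open>hg\<close> this bounds the square of \<open>f\<close> by 256 times
   the pairing of \<bar>g\<bar> with \<open>f\<close>, and a second absorption yields 65536 = 256 *
   256 times the square of \<open>g\<close>. The final 65537 adds the 1 from 2ab <= a^2 +
   b^2.\<close>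
 have "?I (%y. f y * f y) <= 16 * 16 * ?I (%y. h y * h y)" by (rule nn_integral_square_absorb[OF _ _ fB ff]) measurable
 also have "... <= 256 * ?I (%y. ?g y * f y)" using mult_left_mono[OF hg, of 256] by simp
 finally have "?I (%y. f y * f y) <= 256 * 256 * ?I (%y. ?g y * ?g y)"
  by (intro nn_integral_square_absorb[OF _ _ fB]) measurable
 hence "?I (%y. ?g y * ?g y) + ?I (%y. f y * f y) <= (1 + 65536) * ?I (%y. ?g y * ?g y)"
  unfolding distrib_right by (simp add: add_left_mono)
 moreover have "?I (%y. ?g y * f y) <= ?I (%y. 2 * (?g y * f y))" by (intro nn_integral_mono) (simp add: mult_2)
 moreover have "... <= ?I (%y. ?g y * ?g y) + ?I (%y. f y * f y)"
  by (subst nn_integral_add[symmetric]) (auto intro!: nn_integral_mono ennreal_two_mult_le)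
 ultimately have "?I (%z. h z * h z) <= 65537 * ?I (%y. ?g y * ?g y)" using hg by simp
 thus ?thesis by (simp add: h_def power2_eq_square ennreal_mult)
qed

section \<open>Taylor coefficients, dilations and boundary values of bounded analytic
  functions\<close>

definition tay :: "(complex => complex) => nat => complex" where
 "tay \<Psi> n = (deriv ^^ n) \<Psi> 0 / fact n"

definition dil :: "(complex => complex) => real => complex => complex" where
 "dil \<Psi> \<rho> z = \<Psi> (of_real \<rho> * z)"

lemma Hinfty_holo: "\<Psi> : Hinfty ==> \<Psi> holomorphic_on ball 0 1"
 by (simp add: Hinfty_def)

lemma Hinfty_cont: "\<Psi> : Hinfty ==> continuous_on (ball 0 1) \<Psi>"
 by (simp add: Hinfty_holo holomorphic_on_imp_continuous_on)

lemma Hinfty_bound: assumes "\<Psi> : Hinfty" obtains C where "C > 0" "!!w. cmod w < 1 ==> cmod (\<Psi> w) <= C"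
proof -
 obtain C where C: "C > 0" "ALL x:\<Psi> ` ball 0 1. norm x <= C"
  using assms unfolding Hinfty_def by (auto simp: bounded_pos)
 thus thesis using that[of C] by auto
qed

lemma tay_sums: "\<Psi> holomorphic_on ball 0 1 ==> cmod w < 1 ==> (%n. tay \<Psi> n * w ^ n) sums \<Psi> w"
 using holomorphic_power_series[of \<Psi> 0 1 w] by (simp add: tay_def)

lemma dil_ball: "0 <= \<rho> ==> \<rho> < 1 ==> cmod z <= 1 ==> cmod (of_real \<rho> * z) < 1"
 using mult_left_mono[of "cmod z" 1 \<rho>] by (simp add: norm_mult)

lemma dil_cont: "\<Psi> holomorphic_on ball 0 1 ==> 0 <= \<rho> ==> \<rho> < 1 ==> continuous_on (cball 0 1) (dil \<Psi> \<rho>)"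
 unfolding dil_def
 by (rule continuous_on_compose2[OF holomorphic_on_imp_continuous_on]) (auto intro!: continuous_intros dil_ball)

lemma dil_holo: "\<Psi> holomorphic_on ball 0 1 ==> 0 <= \<rho> ==> \<rho> < 1 ==> dil \<Psi> \<rho> holomorphic_on ball 0 1"
 unfolding dil_def
 by (rule holomorphic_on_compose_gen[of "%z. of_real \<rho> * z" _ \<Psi>, unfolded o_def])
   (auto intro!: holomorphic_intros dil_ball)

lemma dil_Li: "\<Psi> holomorphic_on ball 0 1 ==> 0 <= \<rho> ==> \<rho> < 1 ==> dil \<Psi> \<rho> : Li"
proof -
 assume "\<Psi> holomorphic_on ball 0 1" "0 <= \<rho>" "\<rho> < 1"
 hence c: "continuous_on (sph) (dil \<Psi> \<rho>)" by (rule continuous_on_subset[OF dil_cont]) auto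
 obtain B where "!!z. z : sph ==> norm (dil \<Psi> \<rho> z) <= B" using sphere_continuous_bounded[OF c] by blast
 thus ?thesis by (intro LiI[OF measurable_sphere_continuous[OF c]] AE_circleI)
qed

lemma dil_moment:
 assumes h: "\<Psi> holomorphic_on ball 0 1" and r: "0 <= \<rho>" "\<rho> < 1"
 shows "(LINT z|circle. dil \<Psi> \<rho> z * z ^ Suc n) = 0"
proof -
 have "(LINT z|circle. dil \<Psi> \<rho> z * z ^ Suc n) = (LINT z|circle. (dil \<Psi> \<rho> z * z ^ Suc n) * (z / (z - 0)))"
  by (rule integral_eqI) (auto simp: space_circle)
 also have "... = dil \<Psi> \<rho> 0 * 0 ^ Suc n"
  by (rule cauchy_circle) (auto intro!: continuous_intros holomorphic_intros dil_cont dil_holo h r)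
 finally show ?thesis by simp
qed

lemma integral_power_series:
 fixes g :: "complex => complex"
 assumes sets: "sets M = sets circle" and g: "integrable M g" and a: "summable (%k. cmod (a k))"
 shows "(%k. a k * (LINT z|M. z ^ k * g z)) sums (LINT z|M. (\<Sum>k. a k * z ^ k) * g z)"
proof -
 have sp: "space M = sph" using sets_eq_imp_space_eq[OF sets] by (simp add: space_circle)
 have m: "(%z. z ^ k * g z) : borel_measurable M" for k
  by (intro borel_measurable_times borel_measurable_integrable[OF g] continuous_measurable_circle[OF _ sets] continuous_intros)
 have i: "integrable M (%z. z ^ k * g z)" for k
  by (rule integrable_le[OF g m]) (auto simp: sp norm_mult norm_power)
 have "(%k. LINT z|M. a k * (z ^ k * g z)) sums (LINT z|M. (\<Sum>k. a k * (z ^ k * g z)))"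
 proof (rule sums_integral)
  show "integrable M (%z. a k * (z ^ k * g z))" for k by (intro integrable_mult_right i)
  show "AE z in M. summable (%k. norm (a k * (z ^ k * g z)))"
   by (rule AE_I2) (simp add: sp norm_mult norm_power summable_mult2 a)
  have "(LINT z|M. norm (a k * (z ^ k * g z))) = (LINT z|M. cmod (a k) * cmod (g z))" for k
   by (rule integral_eqI) (auto simp: sp norm_mult norm_power)
  thus "summable (%k. LINT z|M. norm (a k * (z ^ k * g z)))" by (simp add: summable_mult2 a)
 qed
 moreover have "(LINT z|M. (\<Sum>k. a k * (z ^ k * g z))) = (LINT z|M. (\<Sum>k. a k * z ^ k) * g z)"
 proof (rule integral_eqI)
  fix z assume "z : space M"
  hence "summable (%k. a k * z ^ k)" by (rule_tac summable_norm_cancel) (simp add: sp norm_mult norm_power a)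
  from suminf_mult2[OF this, of "g z"] show "(\<Sum>k. a k * (z ^ k * g z)) = (\<Sum>k. a k * z ^ k) * g z" by (simp only: mult.assoc)
 qed simp
 ultimately show ?thesis by simp
qed

lemma dil_coef:
 assumes h: "\<Psi> holomorphic_on ball 0 1" and r: "0 <= \<rho>" "\<rho> < 1"
 shows "(LINT z|circle. dil \<Psi> \<rho> z * cnj z ^ n) = tay \<Psi> n * of_real \<rho> ^ n"
proof -
 let ?a = "%k. tay \<Psi> k * of_real \<rho> ^ k"
 \<comment> \<open>Absolute convergence at radius \<rho> follows from convergence at the larger
   radius \<open>(1 + \<rho>) / 2\<close>, still inside the disc.\<close>
 have sm: "summable (%k. cmod (?a k))"
 proof (rule powser_insidea)
  show "summable (%k. tay \<Psi> k * of_real ((1 + \<rho>) / 2) ^ k)"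
   by (rule sums_summable[OF tay_sums[OF h]]) (use r in \<open>simp add: norm_divide del: of_real_add of_real_divide\<close>)
  show "norm (complex_of_real \<rho>) < norm (complex_of_real ((1 + \<rho>) / 2))"
   using r by (simp del: of_real_add of_real_divide)
 qed
 have "(%k. ?a k * (LINT z|circle. z ^ k * cnj z ^ n)) sums (LINT z|circle. (\<Sum>k. ?a k * z ^ k) * cnj z ^ n)"
  by (rule integral_power_series[OF refl _ sm]) (intro integrable_sphere_continuous continuous_intros)
 moreover have "(LINT z|circle. z ^ k * cnj z ^ n) = (if k = n then 1 else 0)" for k
  using cip_e[OF Li_L2[OF Li_pow(1)], of k n] by (simp add: e_def[symmetric] cip_e_e)
 moreover have "(LINT z|circle. (\<Sum>k. ?a k * z ^ k) * cnj z ^ n) = (LINT z|circle. dil \<Psi> \<rho> z * cnj z ^ n)"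
 proof (rule integral_eqI)
  fix z assume "z : space circle"
  thus "(\<Sum>k. ?a k * z ^ k) * cnj z ^ n = dil \<Psi> \<rho> z * cnj z ^ n"
   using tay_sums[OF h dil_ball[OF r], of z] by (simp add: space_circle dil_def sums_iff power_mult_distrib mult.assoc)
 qed simp
 ultimately have "(%k. if k = n then ?a k else 0) sums (LINT z|circle. dil \<Psi> \<rho> z * cnj z ^ n)"
  by (simp add: if_distrib cong: if_cong)
 thus ?thesis using sums_unique2[OF sums_single[of n ?a]] by simp
qed

lemma dil_HH:
 assumes h: "\<Psi> holomorphic_on ball 0 1" and r: "0 <= \<rho>" "\<rho> < 1"
 shows "cls (dil \<Psi> \<rho>) : HH" "coef (cls (dil \<Psi> \<rho>)) n = tay \<Psi> n * of_real \<rho> ^ n"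
 using dil_moment[OF assms] dil_coef[OF assms] Li_L2[OF dil_Li[OF assms]]
 by (auto simp: HH_iff cip_em cip_e)

lemma norm_e: "norm (e n) = 1"
proof -
 have "complex_of_real ((norm (e n))^2) = of_real (1\<^sup>2)" unfolding cip_self[symmetric] by (simp add: cip_e_e)
 hence "(norm (e n))^2 = 1\<^sup>2" using of_real_eq_iff by blast
 thus ?thesis by (rule power2_eq_imp_eq) simp_all
qed

lemma Li_norm_cls:
 assumes "f : Bm" "AE z in circle. cmod (f z) <= C" "C >= 0"
 shows "norm (cls f) <= C"
proof -
 have f: "f : Li" by (rule LiI[OF assms(1,2)])
 have "norm (mul f (e 0)) <= C * norm (e 0)" by (rule mul_norm[OF f assms(2,3)])
 moreover have "mul f (e 0) = cls f" unfolding e_def by (subst mul_cls[OF f]) (auto simp: Li_L2 Li_const)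
 ultimately show ?thesis by (simp add: norm_e)
qed

definition rad :: "nat => real" where "rad n = 1 - 1 / real (n + 2)"

lemma rad: "0 <= rad n" "rad n < 1" "rad ----> 1" "m <= n ==> rad m <= rad n"
proof -
 have "(%n. 1 / real (n + 2)) ----> 0"
  using LIMSEQ_ignore_initial_segment[OF lim_1_over_n[where 'a=real], of 2] by simp
 thus "rad ----> 1" unfolding rad_def using tendsto_diff[OF tendsto_const[of 1]] by fastforce
qed (auto simp: rad_def field_simps)

text \<open>Bessel's inequality for the dilations has the bound \<open>C\<close> of \<Psi> on its
  right, uniformly in the radius; in each partial sum the radius may then tend to 1.\<close>

lemma summable_tay: assumes P: "\<Psi> : Hinfty" shows "summable (%n. (cmod (tay \<Psi> n))^2)"
proof -
 have h: "\<Psi> holomorphic_on ball 0 1" using P Hinfty_holo by blast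
 obtain C where C: "C > 0" "!!w. cmod w < 1 ==> cmod (\<Psi> w) <= C" using Hinfty_bound[OF P] by blast
 have n: "norm (cls (dil \<Psi> (rad j))) <= C" for j
  by (rule Li_norm_cls[OF Li_measurable[OF dil_Li[OF h]]])
   (use C in \<open>auto intro!: AE_circleI simp: rad dil_def norm_mult\<close>)
 have "(\<Sum>n<N. (cmod (tay \<Psi> n * of_real (rad j) ^ n))\<^sup>2) <= C\<^sup>2" for N j
  using order_trans[OF bessel power_mono[OF n norm_ge_zero]] by (simp add: dil_HH(2)[OF h rad(1,2)])
 moreover have "(%j. \<Sum>n<N. (cmod (tay \<Psi> n * of_real (rad j) ^ n))\<^sup>2) ----> (\<Sum>n<N. (cmod (tay \<Psi> n * of_real 1 ^ n))\<^sup>2)" for N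
  by (intro tendsto_intros rad)
 ultimately have "(\<Sum>n<N. (cmod (tay \<Psi> n))\<^sup>2) <= C\<^sup>2" for N
  using LIMSEQ_le_const2[of "%j. \<Sum>n<N. (cmod (tay \<Psi> n * of_real (rad j) ^ n))\<^sup>2"] by fastforce
 thus ?thesis by (intro summableI_nonneg_bounded) auto
qed

lemma nn_integral_poly:
 assumes "finite A" shows "(\<integral>\<^sup>+z. ennreal ((cmod (\<Sum>n\<in>A. a n * z ^ n))^2) \<partial>circle) = ennreal (\<Sum>n\<in>A. (cmod (a n))\<^sup>2)"
proof -
 let ?g = "%z. \<Sum>n\<in>A. a n * z ^ n"
 have g: "?g : L2" by (intro Li_L2 Li_continuous continuous_intros)
 have "cls ?g = (\<Sum>n\<in>A. a n *C e n)" using assms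
 proof induction
  case (insert x F)
  thus ?case using cls_add[of "%z. a x * z ^ x" "%z. \<Sum>n\<in>F. a n * z ^ n"] cls_scaleC[of "%z. z ^ x" "a x"]
   by (simp add: e_def Li_L2 Li_continuous continuous_intros L2_eq_l2[symmetric])
 qed (simp add: zero_hl2_def)
 hence "(\<Sum>n\<in>A. (cmod (a n))\<^sup>2) = (L2norm ?g)^2" using norm_sum_e[OF assms, of a] norm_cls[OF g] by simp
 thus ?thesis using g
  by (simp add: L2norm_def L2_def integral_nonneg_AE nn_integral_eq_integral)
qed

text \<open>For finitely many radii the supremum is dominated by the value at a measurably chosen
  radius \<open>R z\<close>, to which the linearized estimate applies with a constant independent of
  their number. Monotone convergence then passes to all radii.\<close>

lemma radial_maximal:
 fixes q :: "nat => real"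
 assumes g: "g holomorphic_on UNIV" and q: "!!i. 0 <= q i & q i < 1"
 shows "(\<integral>\<^sup>+z. (SUP i. ennreal ((cmod (g (of_real (q i) * z)))^2)) \<partial>circle) <= 65537 * (\<integral>\<^sup>+z. ennreal ((cmod (g z))^2) \<partial>circle)"
proof -
 let ?G = "%r z. ennreal ((cmod (g (of_real r * z)))^2)"
 have c: "continuous_on A g" for A using g holomorphic_on_imp_continuous_on continuous_on_subset by blast
 have [measurable]: "g : borel_measurable borel" by (rule borel_measurable_continuous_onI[OF c])
 have [measurable]: "(%z. z) : Bm" by (rule measurable_sphere_continuous) (rule continuous_on_id)
 have ex: "EX R \<rho>. R : Bm & (ALL z. 0 <= R z & R z <= \<rho>) & \<rho> < 1 & (ALL i<=n. ALL z. ?G (q i) z <= ?G (R z) z)" for n :: nat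
 proof (induction n)
  case 0 thus ?case using q[of 0] by (intro exI[of _ "%_. q 0"] exI[of _ "q 0"]) auto
 next
  case (Suc n)
  then obtain R \<rho> where R [measurable]: "R : Bm" and r: "ALL z. 0 <= R z & R z <= \<rho>" "\<rho> < 1" "ALL i<=n. ALL z. ?G (q i) z <= ?G (R z) z"
   by blast
  let ?R = "%z. if ?G (q (Suc n)) z <= ?G (R z) z then R z else q (Suc n)"
  have "?R : Bm" by measurable
  thus ?case using r q[of "Suc n"]
   by (intro exI[of _ ?R] exI[of _ "max \<rho> (q (Suc n))"]) (auto simp: le_Suc_eq le_max_iff_disj, metis nle_le order_trans)
 qed
 have fin: "(\<integral>\<^sup>+z. (SUP i\<in>{..n}. ?G (q i) z) \<partial>circle) <= 65537 * (\<integral>\<^sup>+z. ?G 1 z \<partial>circle)" for n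
 proof -
  from ex[of n] obtain R \<rho> where R: "R : Bm" "!!z. 0 <= R z" "!!z. R z <= \<rho>" "\<rho> < 1"
   "!!i z. i <= n ==> ?G (q i) z <= ?G (R z) z" by blast
  have "(\<integral>\<^sup>+z. (SUP i\<in>{..n}. ?G (q i) z) \<partial>circle) <= (\<integral>\<^sup>+z. ?G (R z) z \<partial>circle)"
   by (intro nn_integral_mono SUP_least R) simp
  thus ?thesis using linearized_maximal[OF R(1-4) g] by simp
 qed
 have "(\<integral>\<^sup>+z. (SUP i. ?G (q i) z) \<partial>circle) = (\<integral>\<^sup>+z. (SUP n. SUP i\<in>{..n}. ?G (q i) z) \<partial>circle)"
  by (intro nn_integral_cong antisym SUP_least) (auto intro: SUP_upper SUP_upper2)
 also have "... = (SUP n. \<integral>\<^sup>+z. (SUP i\<in>{..n}. ?G (q i) z) \<partial>circle)"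
  by (rule nn_integral_monotone_convergence_SUP) (auto intro!: incseq_SucI le_funI SUP_subset_mono)
 also have "... <= 65537 * (\<integral>\<^sup>+z. ?G 1 z \<partial>circle)" by (intro SUP_least fin)
 finally show ?thesis by simp
qed

text \<open>The Taylor series is cut into blocks \<open>g j\<close> with rapidly decaying norms. The
  maximal estimate makes the blocks decay geometrically along almost every radius, uniformly in the
  radius; the series of blocks then converges uniformly on the closed segment, and its continuous
  sum supplies the limit at 1.\<close>

lemma AE_radial_limit:
 assumes P: "\<Psi> : Hinfty"
 shows "AE z in circle. EX l. ((%r. \<Psi> (of_real r * z)) ---> l) (at_left 1)"
proof -
 let ?b = "%n. (cmod (tay \<Psi> n))^2"
 \<comment> \<open>Ratio 1/16: after weighting with \<open>4 ^ j\<close> the maximal estimates still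
   sum with ratio 1/4, while the weight itself yields the decay \<open>(1/2) ^ j\<close> of the
   moduli.\<close>
 have "EX N. ALL m>=N. ALL n. norm (sum ?b {m..<n}) < (1/16) ^ j" for j :: nat
  using summable_tay[OF P] unfolding summable_Cauchy by simp
 then obtain f where f: "!!j m n. f j <= m ==> norm (sum ?b {m..<n}) < (1/16) ^ j" by metis
 define N where "N j = (\<Sum>i\<le>j. f i) + j" for j
 have sm: "strict_mono N" by (simp add: strict_mono_Suc_iff N_def)
 have fN: "f j <= N j" for j using member_le_sum[of j "{..j}" f] by (simp add: N_def)
 define g where "g j z = (\<Sum>n\<in>{N j..<N (Suc j)}. tay \<Psi> n * z ^ n)" for j z
 have gs: "(\<Sum>j<J. g j z) = (\<Sum>n<N J. tay \<Psi> n * z ^ n) - (\<Sum>n<N 0. tay \<Psi> n * z ^ n)" for J z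
 proof (induction J)
  case (Suc J)
  have "(\<Sum>n<N (Suc J). tay \<Psi> n * z ^ n) = (\<Sum>n<N J. tay \<Psi> n * z ^ n) + g J z"
   unfolding g_def using sm by (subst sum.atLeastLessThan_concat[of 0 "N J" "N (Suc J)", symmetric, unfolded atLeast0LessThan])
    (auto simp: strict_mono_less_eq)
  thus ?case using Suc by simp
 qed simp
 \<comment> \<open>Countably many radii keep the supremum measurable; density and continuity extend
   the bound to all radii, including 1.\<close>
 obtain q :: "nat => real" where q: "!!i. 0 <= q i & q i < 1" "{0..1} \<subseteq> closure (range q)"
 proof -
  obtain T where T: "countable T" "T \<subseteq> {0..<1::real}" "{0..<1} \<subseteq> closure T" using separable by blast
  have "T ~= {}" using T(3) by auto
  hence "range (from_nat_into T) = T" "from_nat_into T i : T" for i using T(1) by (simp_all add: from_nat_into)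
  moreover have "{0..1} \<subseteq> closure T" using closure_minimal[OF T(3)] by simp
  ultimately show thesis using T(2) by (intro that[of "from_nat_into T"]) (auto simp: subset_iff)
 qed
 define M where "M j z = (SUP i. ennreal ((cmod (g j (of_real (q i) * z)))^2))" for j z
 have gc: "continuous_on A (g j)" for j A unfolding g_def by (intro continuous_intros)
 have Mm [measurable]: "M j : Bm" for j
  unfolding M_def by (intro borel_measurable_SUP measurable_compose[OF _ measurable_ennreal] measurable_sphere_continuous continuous_intros
   continuous_on_compose2[OF gc[of UNIV]]) auto
 have "(\<integral>\<^sup>+z. M j z \<partial>circle) <= 65537 * ennreal ((1/16) ^ j)" for j
 proof -
  have "(\<integral>\<^sup>+z. M j z \<partial>circle) <= 65537 * ennreal (sum ?b {N j..<N (Suc j)})"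
   using radial_maximal[OF _ q(1), of "g j"] unfolding M_def g_def by (simp add: nn_integral_poly holomorphic_intros)
  also have "... <= 65537 * ennreal ((1/16) ^ j)"
   using f[OF fN, of j "N (Suc j)"] by (intro mult_left_mono ennreal_leI) auto
  finally show ?thesis .
 qed
 hence "(\<integral>\<^sup>+z. (\<Sum>j. ennreal (4 ^ j) * M j z) \<partial>circle) <= (\<Sum>j. ennreal (4 ^ j) * (65537 * ennreal ((1/16) ^ j)))"
  by (simp add: nn_integral_suminf nn_integral_cmult suminf_le mult_left_mono)
 also have "... = (\<Sum>j. ennreal (65537 * (1/4) ^ j))"
 proof (rule suminf_cong)
  fix j
  have "(1/4) ^ j = 4 ^ j * (1/16 :: real) ^ j" by (simp flip: power_mult_distrib)
  thus "ennreal (4 ^ j) * (65537 * ennreal ((1/16) ^ j)) = ennreal (65537 * (1/4) ^ j)"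
   by (simp add: ennreal_mult mult.left_commute)
 qed
 also have "... < \<infinity>" by (simp add: less_top[symmetric] ennreal_suminf_neq_top)
 finally have "(\<integral>\<^sup>+z. (\<Sum>j. ennreal (4 ^ j) * M j z) \<partial>circle) ~= \<infinity>" by simp
 hence "AE z in circle. (\<Sum>j. ennreal (4 ^ j) * M j z) ~= \<infinity>" by (intro nn_integral_noteq_infinite) measurable
 thus ?thesis using AE_space
 proof eventually_elim
  case (elim z)
  obtain K where K: "(\<Sum>j. ennreal (4 ^ j) * M j z) = ennreal K" "K >= 0" using elim(1) by (cases "(\<Sum>j. ennreal (4 ^ j) * M j z)") auto
  have bq: "cmod (g j (of_real (q i) * z)) <= sqrt K * (1/2) ^ j" for i j
  proof -
   let ?x = "cmod (g j (of_real (q i) * z))"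
   have "(2 ^ j * ?x)^2 = 4 ^ j * ?x\<^sup>2"
    unfolding power2_eq_square by (simp add: mult.left_commute flip: power_mult_distrib mult.assoc)
   hence "ennreal ((2 ^ j * ?x)^2) <= ennreal (4 ^ j) * M j z"
    unfolding M_def by (simp add: ennreal_mult) (intro mult_left_mono SUP_upper UNIV_I zero_le)
   also have "... <= ennreal K" unfolding K(1)[symmetric] using sum_le_suminf[of "%j. ennreal (4 ^ j) * M j z" "{j}"] by simp
   finally have "2 ^ j * ?x <= sqrt K" using K(2) by (intro real_le_rsqrt) (simp add: ennreal_le_iff)
   thus ?thesis by (simp add: field_simps)
  qed
  have b: "norm (g j (of_real r * z)) <= sqrt K * (1/2) ^ j" if r: "r : {0..1}" for j r
   by (rule continuous_le_on_closure[where S="range q" and f="%r. cmod (g j (of_real r * z))"])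
    (use q(2) r bq in \<open>auto intro!: continuous_intros continuous_on_compose2[OF gc[of UNIV]]\<close>)
  have "uniform_limit {0..1} (%J r. \<Sum>j<J. g j (of_real r * z)) (%r. \<Sum>j. g j (of_real r * z)) sequentially"
   by (rule Weierstrass_m_test[OF b]) (auto intro!: summable_mult summable_geometric)
  hence cont: "continuous_on {0..1} (%r. (\<Sum>j. g j (of_real r * z)))"
   by (rule uniform_limit_theorem[rotated]) (auto intro!: always_eventually continuous_intros continuous_on_compose2[OF gc[of UNIV]])
  let ?F = "%r. (\<Sum>j. g j (of_real r * z)) + (\<Sum>n<N 0. tay \<Psi> n * (of_real r * z) ^ n)"
  have eq: "?F r = \<Psi> (of_real r * z)" if "0 <= r" "r < 1" for r
  proof -
   have "(%J. \<Sum>n<N J. tay \<Psi> n * (of_real r * z) ^ n) ----> \<Psi> (of_real r * z)"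
    using tay_sums[OF Hinfty_holo[OF P], of "of_real r * z"] LIMSEQ_subseq_LIMSEQ[OF _ sm] that elim(2)
    by (simp add: sums_def o_def space_circle norm_mult)
   hence "(%j. g j (of_real r * z)) sums (\<Psi> (of_real r * z) - (\<Sum>n<N 0. tay \<Psi> n * (of_real r * z) ^ n))"
    unfolding sums_def gs by (intro tendsto_intros)
   thus ?thesis by (simp add: sums_iff)
  qed
  have "continuous_on {0..1} ?F" by (intro continuous_intros cont)
  hence "(?F ---> ?F 1) (at 1 within {0..1})" unfolding continuous_on_def by (rule bspec) simp
  hence "(?F ---> ?F 1) (at_left 1)" by (simp add: at_within_Icc_at_left)
  hence "((%r. \<Psi> (of_real r * z)) ---> ?F 1) (at_left 1)"
   by (rule Lim_transform_eventually) (use eventually_at_left_real[OF zero_less_one] eq in \<open>auto elim: eventually_mono\<close>)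
  thus ?case by (rule exI)
 qed
qed

text \<open>Cauchy's criterion with thresholds taken from the sequence \<open>rad\<close> and
  tolerances \<open>1 / (m + 1)\<close>: existence of the limit becomes a countable combination of
  closed conditions, as measurability of \<open>bv\<close> requires.\<close>

lemma radial_limit_criterion:
 fixes G :: "real => complex"
 shows "(EX l. (G ---> l) (at_left 1)) <->
  (ALL m::nat. EX k. ALL r:{rad k<..<1}. ALL s:{rad k<..<1}. dist (G r) (G s) <= 1 / real (m + 1))" (is "?A <-> ?B")
proof
 assume ?A
 then obtain l where l: "(G ---> l) (at_left 1)" ..
 show ?B
 proof
  fix m :: nat
  have "eventually (%r. dist (G r) l < 1 / real (m + 1) / 2) (at_left 1)"
   by (rule tendstoD[OF l]) simp
  then obtain b where b: "b < 1" "!!r. b < r ==> r < 1 ==> dist (G r) l < 1 / real (m + 1) / 2"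
   unfolding eventually_at_left[OF zero_less_one] by auto
  obtain k where k: "b < rad k"
   using order_tendstoD(1)[OF rad(3) b(1)] unfolding eventually_sequentially by blast
  have "dist (G r) (G s) <= 1 / real (m + 1)" if "r : {rad k<..<1}" "s : {rad k<..<1}" for r s
   using dist_triangle_half_l[of "G r" l "1 / real (m + 1)" "G s"] b(2)[of r] b(2)[of s] that k by auto
  thus "EX k. ALL r:{rad k<..<1}. ALL s:{rad k<..<1}. dist (G r) (G s) <= 1 / real (m + 1)" by blast
 qed
next
 assume B: ?B
 have "cauchy_filter (filtermap G (at_left 1))"
  unfolding cauchy_filter_metric_filtermap
 proof (intro allI impI)
  fix e :: real assume "e > 0"
  then obtain m :: nat where m: "1 / real (m + 1) < e" using nat_approx_posE by (metis Suc_eq_plus1)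
  obtain k where "ALL r:{rad k<..<1}. ALL s:{rad k<..<1}. dist (G r) (G s) <= 1 / real (m + 1)" using B by blast
  thus "EX P. eventually P (at_left 1) & (ALL x y. P x & P y --> dist (G x) (G y) < e)"
   using m eventually_at_left_real[OF rad(2), of k] by (intro exI[of _ "%r. r : {rad k<..<1}"]) force
 qed
 moreover have "filtermap G (at_left 1) ~= bot" "filtermap G (at_left 1) <= principal UNIV" by (simp_all add: filtermap_bot_iff)
 ultimately show ?A
  using complete_UNIV[where 'a=complex] unfolding complete_uniform filterlim_def by blast
qed

lemma bv_tendsto:
 assumes "\<Psi> : Hinfty"
 shows "AE z in circle. ((%r. \<Psi> (of_real r * z)) ---> bv \<Psi> z) (at_left 1)"
 using AE_radial_limit[OF assms]
 by eventually_elim (erule exE, frule tendsto_Lim[OF trivial_limit_at_left_real], simp add: bv_def)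

lemma tendsto_rad: "(f ---> l) (at_left 1) ==> (%j. f (rad j)) ----> l"
 by (rule filterlim_compose) (auto simp: filterlim_at rad(2,3) less_imp_neq)

text \<open>The set of points with a radial limit is a countable intersection of countable unions of
  closed sets. On it \<open>bv\<close> is a limit of dilations, off it \<open>bv\<close> is
  constant.\<close>

lemma measurable_bv: assumes P: "\<Psi> : Hinfty" shows "bv \<Psi> : Bm"
proof -
 let ?G = "%z r. \<Psi> (of_real r * z)"
 let ?E = "%m k::nat. {z : sph. ALL r:{rad k<..<1}. ALL s:{rad k<..<1}. dist (?G z r) (?G z s) <= 1 / real (m + 1)}"
 define Q where "Q z <-> (EX l. (?G z ---> l) (at_left 1))" for z
 have [measurable]: "(%z. ?G z r) : Bm" if "0 <= r" "r < 1" for r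
  using Li_measurable[OF dil_Li[OF Hinfty_holo[OF P] that]] by (simp add: dil_def[abs_def])
 have "closed (?E m k)" for m k
 proof -
  have "?E m k = sph \<inter> (\<Inter>r\<in>{rad k<..<1}. \<Inter>s\<in>{rad k<..<1}. {z : sph. dist (?G z r) (?G z s) <= 1 / real (m + 1)})"
   by auto
  moreover have "closed {z : sph. dist (?G z r) (?G z s) <= 1 / real (m + 1)}"
   if "r : {rad k<..<1}" "s : {rad k<..<1}" for r s
  proof -
   have c: "continuous_on (sph) (%z. ?G z r)" if "r : {rad k<..<1}" for r
    using dil_cont[OF Hinfty_holo[OF P], of r] that rad(1)[of k] continuous_on_subset[of "cball 0 1" _ "sph"]
    by (auto simp: dil_def[abs_def])
   show ?thesis using that by (intro continuous_on_closed_Collect_le continuous_intros c) auto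
  qed
  ultimately show ?thesis by (auto intro!: closed_INT closed_Int)
 qed
 hence E: "?E m k : sets circle" for m k by (auto simp: sets_circle_iff)
 have "(\<Inter>m. \<Union>k. ?E m k) : sets circle" by (intro sets.countable_INT sets.countable_nat_UN image_subsetI E UNIV_not_empty)
 moreover have "(\<Inter>m. \<Union>k. ?E m k) = {z : space circle. Q z}"
  unfolding Q_def radial_limit_criterion by (auto simp: space_circle)
 ultimately have [measurable]: "Measurable.pred circle Q" by (simp add: pred_def)
 \<comment> \<open>Where no radial limit exists, \<open>Lim\<close> unfolds to the description of an
   unsatisfiable predicate, which is one fixed value.\<close>
 have "bv \<Psi> z = (if Q z then lim (%j. dil \<Psi> (rad j) z) else (THE l. False))" for z
 proof (cases "Q z")
  case True
  then obtain l where l: "(?G z ---> l) (at_left 1)" unfolding Q_def ..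
  hence "bv \<Psi> z = l" unfolding bv_def by (intro tendsto_Lim) simp_all
  moreover have "lim (%j. dil \<Psi> (rad j) z) = l"
   using tendsto_rad[OF l] unfolding dil_def by (rule limI)
  ultimately show ?thesis using True by simp
 qed (simp add: Q_def bv_def t2_space_class.Lim_def)
 moreover have [measurable]: "dil \<Psi> (rad j) : Bm" for j using dil_Li[OF Hinfty_holo[OF P] rad(1,2)] by (rule Li_measurable)
 have "(%z. if Q z then lim (%j. dil \<Psi> (rad j) z) else (THE l. False)) : Bm"
  by measurable
 ultimately show ?thesis by presburger
qed

lemma AE_bv_le:
 assumes P: "\<Psi> : Hinfty" and C: "!!w. cmod w < 1 ==> cmod (\<Psi> w) <= C"
 shows "AE z in circle. cmod (bv \<Psi> z) <= C"
 using bv_tendsto[OF P] AE_space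
proof eventually_elim
 case (elim z)
 have "(%j. cmod (\<Psi> (of_real (rad j) * z))) ----> cmod (bv \<Psi> z)"
  by (intro tendsto_intros tendsto_rad elim(1))
 thus ?case
  by (rule LIMSEQ_le_const2) (use elim(2) C in \<open>auto simp: space_circle norm_mult rad intro!: exI[of _ 0]\<close>)
qed

lemma bv_Li: assumes P: "\<Psi> : Hinfty" shows "bv \<Psi> : Li"
proof -
 obtain C where "C > 0" "!!w. cmod w < 1 ==> cmod (\<Psi> w) <= C" using Hinfty_bound[OF P] by blast
 thus ?thesis by (intro LiI[OF measurable_bv[OF P] AE_bv_le[OF P]])
qed

lemma bv_integral:
 assumes P: "\<Psi> : Hinfty" and f: "f : Li"
 shows "(%j. LINT z|circle. dil \<Psi> (rad j) z * f z) ----> (LINT z|circle. bv \<Psi> z * f z)"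
proof -
 have h: "\<Psi> holomorphic_on ball 0 1" using P Hinfty_holo by blast
 obtain C where C: "C > 0" "!!w. cmod w < 1 ==> cmod (\<Psi> w) <= C" using Hinfty_bound[OF P] by blast
 obtain D where D: "D > 0" "AE z in circle. cmod (f z) <= D" using Li_bound[OF f] .
 show ?thesis
 proof (rule integral_dominated_convergence[where w="%_. C * D"])
  show "(%z. bv \<Psi> z * f z) : Bm"
   using Li_measurable[OF Li_mult[OF bv_Li[OF P] f]] .
  show "(%z. dil \<Psi> (rad j) z * f z) : Bm" for j
   using Li_measurable[OF Li_mult[OF dil_Li[OF h] f]] rad by blast
  show "AE z in circle. (%j. dil \<Psi> (rad j) z * f z) ----> bv \<Psi> z * f z"
   using bv_tendsto[OF P]
  proof eventually_elim
   case (elim z)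
   thus ?case unfolding dil_def by (intro tendsto_intros tendsto_rad[where f="%r. \<Psi> (of_real r * z)"])
  qed
  show "AE z in circle. norm (dil \<Psi> (rad j) z * f z) <= C * D" for j
   using D(2) AE_space
  proof eventually_elim
   case (elim z)
   hence "cmod (dil \<Psi> (rad j) z) <= C" unfolding dil_def
    by (intro C(2)) (simp add: space_circle norm_mult rad)
   thus ?case using elim(1) C(1) unfolding norm_mult by (intro mult_mono) auto
  qed
 qed simp
qed

lemma bv_HH: assumes P: "\<Psi> : Hinfty" shows "cls (bv \<Psi>) : HH" "coef (cls (bv \<Psi>)) n = tay \<Psi> n"
proof -
 have h: "\<Psi> holomorphic_on ball 0 1" using P Hinfty_holo by blast
 have 1: "(LINT z|circle. bv \<Psi> z * z ^ Suc n) = 0" for n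
  using bv_integral[OF P Li_pow(1)[of "Suc n"]] dil_moment[OF h rad(1,2), of _ n]
  by (simp add: LIMSEQ_const_iff)
 thus "cls (bv \<Psi>) : HH" by (simp add: HH_iff cip_em Li_L2 bv_Li P del: power_Suc)
 have "(%j. LINT z|circle. dil \<Psi> (rad j) z * cnj z ^ n) ----> (LINT z|circle. bv \<Psi> z * cnj z ^ n)"
  by (rule bv_integral[OF P Li_pow(2)])
 hence "(%j. tay \<Psi> n * of_real (rad j) ^ n) ----> (LINT z|circle. bv \<Psi> z * cnj z ^ n)"
  by (simp add: dil_coef[OF h rad(1,2)])
 moreover have "(%j. tay \<Psi> n * of_real (rad j) ^ n) ----> tay \<Psi> n * of_real 1 ^ n"
  by (intro tendsto_intros rad)
 ultimately have "(LINT z|circle. bv \<Psi> z * cnj z ^ n) = tay \<Psi> n" using LIMSEQ_unique by fastforce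
 thus "coef (cls (bv \<Psi>)) n = tay \<Psi> n" by (simp add: cip_e Li_L2 bv_Li P)
qed

section \<open>Lifting the commutant\<close>

lemma bcl_sum: "bcl A ==> A (\<Sum>k\<in>S. f k) = (\<Sum>k\<in>S. A (f k))"
 using linear_sum[OF bounded_linear.linear[OF bcl_bounded_linear]] by blast

lemma cip_L: "x : HH ==> g : HH ==> cip (L x) g = cip x (zmul g)"
proof -
 assume x: "x : HH" and g: "g : HH"
 have "cip x (zmul g) = cip (zmul (L x) + coef x 0 *C e 0) (zmul g)" by (simp add: zmul_L)
 also have "... = cip (L x) g + coef x 0 * cip (e 0) (zmul g)"
  by (simp add: cip_add_left cip_cl cip_zmul)
 also have "cip (e 0) (zmul g) = 0" using coef_zmul_0[OF g] by (metis cip_commute complex_cnj_zero)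
 finally show ?thesis by simp
qed

lemma cip_L_pow: "x : HH ==> g : HH ==> cip ((L ^^ n) x) g = cip x ((zmul ^^ n) g)"
proof (induction n arbitrary: g)
 case (Suc n)
 have "cip ((L ^^ Suc n) x) g = cip ((L ^^ n) x) (zmul g)"
  using Suc.prems by (simp add: cip_L L_pow_HH)
 also have "... = cip x ((zmul ^^ n) (zmul g))" by (rule Suc.IH) (simp_all add: Suc.prems zmul_HH)
 finally show ?case by (simp add: funpow_swap1)
qed simp

lemma mul_e: "\<phi> : Li ==> mul \<phi> (e n) = (zmul ^^ n) (cls \<phi>)"
proof (induction n)
 case 0
 thus ?case by (simp add: e_def mul_cls Li_const Li_L2)
next
 case (Suc n)
 have "mul \<phi> (zmul (e n)) = zmul (mul \<phi> (e n))"
  using Suc.prems by (simp add: mul_mul Li_pow mult.commute)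
 thus ?case using Suc by (simp add: zmul_e)
qed

lemma powser_eq_0:
 fixes a :: "nat => complex"
 assumes "!!w. cmod w < 1 ==> (%n. a n * w ^ n) sums 0"
 shows "a m = 0"
proof (cases "m = 0")
 case True
 have "(%n. a n * 0 ^ n) sums 0" using assms[of 0] by simp
 moreover have "(%n. a n * 0 ^ n) sums a 0" by (rule powser_sums_zero)
 ultimately show ?thesis using True sums_unique2 by blast
next
 case False
 show ?thesis
 proof (rule ccontr)
  assume "a m ~= 0"
  then obtain s :: real where s: "0 < s" "!!z::complex. z : cball 0 s - {0} ==> (0::complex) ~= 0"
   by (rule powser_0_nonzero[of 1 0 a "%_. 0" m, rotated 3]) (use assms False in auto)
  thus False using s(2)[of "of_real s"] by simp
 qed
qed

lemma norm_fst_le': "norm (fst p) <= norm p"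
 using norm_fst_le[of "fst p" "snd p"] by simp

text \<open>Aim: an operator commuting with \<open>L\<close> on an invariant subspace of the Hardy
  space is multiplication by the conjugate of a bounded analytic \<Psi>, followed by projection
  (\<open>lifting\<close>). The commutation makes the map from \<open>(L f, coef f 0)\<close> to
  \<open>(f, coef (B f) 0)\<close> isometric for suitable forms. Extended to all pairs it becomes a
  contractive linear system, and the transfer function of that system gives \<Psi>.\<close>

locale lurking =
 fixes K :: "hl2 set" and B :: "hl2 => hl2"
 assumes K: "csub K" "K \<subseteq> HH" and LK: "!!f. f : K ==> L f : K"
  and B: "bcl B" "!!f. f : K ==> B f : K" and BL: "!!f. f : K ==> B (L f) = L (B f)"
begin

definition c0 where "c0 = (SOME C. C > 0 & (ALL x. norm (B x) <= C * norm x))"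

lemma c0: "c0 > 0" "norm (B x) <= c0 * norm x"
proof -
 obtain C where "C > 0 & (ALL x. norm (B x) <= C * norm x)" using bcl_bound[OF B(1)] by metis
 hence "c0 > 0 & (ALL x. norm (B x) <= c0 * norm x)" unfolding c0_def by (rule someI)
 thus "c0 > 0" "norm (B x) <= c0 * norm x" by auto
qed

text \<open>The extra 1 above the squared bound of \<open>B\<close> makes \<open>qq\<close> coercive
  with constant 1, so that projections with respect to \<open>qq\<close> exist.\<close>

definition c2 where "c2 = c0\<^sup>2 + 1"

definition qq :: "hl2 \<times> complex => hl2 \<times> complex => real" where
 "qq x y = c2 * inner x y - inner (B (fst x)) (B (fst y))"

lemma c2: "c2 > 0" unfolding c2_def by (simp add: add_nonneg_pos)

lemma B_sq: "(norm (B x))^2 <= c0\<^sup>2 * (norm x)^2"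
 using power_mono[OF c0(2)[of x] norm_ge_zero, of 2] by (simp add: power_mult_distrib)

lemma bounded_bilinear_qq: "bounded_bilinear qq"
proof
 interpret B: bounded_linear B by (rule bcl_bounded_linear[OF B(1)])
 show "qq (a + a') b = qq a b + qq a' b" "qq a (b + b') = qq a b + qq a b'"
  "qq (r *\<^sub>R a) b = r *\<^sub>R qq a b" "qq a (r *\<^sub>R b) = r *\<^sub>R qq a b" for a a' b b' r
  by (simp_all add: qq_def inner_add_left inner_add_right B.add B.scaleR algebra_simps)
 have "norm (qq a b) <= norm a * norm b * (c2 + c0\<^sup>2)" for a b
 proof -
  have "\<bar>inner (B (fst a)) (B (fst b))\<bar> <= norm (B (fst a)) * norm (B (fst b))" by (rule Cauchy_Schwarz_ineq2)
  also have "... <= (c0 * norm (fst a)) * (c0 * norm (fst b))" using c0 by (intro mult_mono) auto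
  also have "... <= (c0 * norm a) * (c0 * norm b)" using c0(1) by (intro mult_mono mult_left_mono norm_fst_le') auto
  finally have 1: "\<bar>inner (B (fst a)) (B (fst b))\<bar> <= norm a * norm b * c0\<^sup>2" by (simp add: power2_eq_square ac_simps)
  have "\<bar>c2 * inner a b\<bar> <= norm a * norm b * c2"
   using Cauchy_Schwarz_ineq2[of a b] c2 by (simp add: abs_mult mult.commute mult_left_mono)
  thus ?thesis using 1 by (simp add: qq_def distrib_left)
 qed
 thus "EX K. ALL a b. norm (qq a b) <= norm a * norm b * K" by blast
qed

lemma qq_coercive: "1 * (norm x)^2 <= qq x x"
proof -
 have "(norm (B (fst x)))^2 <= c0\<^sup>2 * (norm x)^2"
  using B_sq[of "fst x"] power_mono[OF norm_fst_le'[of x] norm_ge_zero, of 2]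
  by (meson mult_left_mono order_trans zero_le_power2)
 thus ?thesis by (simp add: qq_def c2_def power2_norm_eq_inner[symmetric] algebra_simps)
qed

text \<open>The pair of \<open>g\<close> and \<open>t\<close> encodes the function z g + t; on Hardy
  functions the inverse takes \<open>f\<close> to \<open>(L f, coef f 0)\<close>.\<close>

definition emb :: "hl2 \<times> complex => hl2" where "emb p = zmul (fst p) + snd p *C e 0"

definition W :: "(hl2 \<times> complex) set" where "W = {p. fst p : HH & emb p : K}"

lemma L_emb: "fst p : HH ==> L (emb p) = fst p"
 and coef_emb: "fst p : HH ==> coef (emb p) 0 = snd p"
proof -
 assume p: "fst p : HH"
 show c: "coef (emb p) 0 = snd p" using coef_zmul_0[OF p] by (simp add: emb_def cip_add_left cip_cl cip_e_e)
 show "L (emb p) = fst p" unfolding L_def c by (simp add: emb_def)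
qed

lemma emb_split: "f : K ==> (L f, coef f 0) : W" "emb (L f, coef f 0) = f"
proof -
 show "emb (L f, coef f 0) = f" by (simp add: emb_def zmul_L)
 thus "f : K ==> (L f, coef f 0) : W" using LK K(2) by (auto simp: W_def)
qed

lemma emb_add: "emb (p + p') = emb p + emb p'"
 by (simp add: emb_def mul_add Li_pow scaleC_add_left)

lemma emb_scaleC: "emb (c *C fst p, c * snd p) = c *C emb p"
 by (simp add: emb_def mul_scaleC Li_pow scaleC_add_right)

lemma emb_scaleR: "emb (r *\<^sub>R p) = r *\<^sub>R emb p"
 using emb_scaleC[of "of_real r" p] by (simp add: scaleC_of_real scaleR_prod_def scaleR_conv_of_real)

lemma subspace_W: "subspace W"
 using csubD[OF K(1)] csubD[OF csub_HH] unfolding subspace_def W_def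
 by (auto simp: emb_add emb_scaleR) (auto simp: emb_def bcl_zero bcl_mul Li_pow)

lemma continuous_emb: "continuous_on UNIV emb"
proof -
 have "((%p. emb p) ---> emb a) (at a)" for a
 proof -
  have "((%p. snd p *C e 0 - snd a *C e 0) ---> 0) (at a)"
  proof (rule Lim_null_comparison)
   show "\<forall>\<^sub>F p in at a. norm (snd p *C e 0 - snd a *C e 0) <= cmod (snd p - snd a)"
    by (simp add: norm_scaleC norm_e flip: scaleC_diff_left)
   have "((%p. cmod (snd p - snd a)) ---> cmod (snd a - snd a)) (at a)" by (intro tendsto_intros)
   thus "((%p. cmod (snd p - snd a)) ---> 0) (at a)" by simp
  qed
  hence "((%p. snd p *C e 0) ---> snd a *C e 0) (at a)" by (simp add: LIM_zero_iff)
  moreover have "((%p. zmul (fst p)) ---> zmul (fst a)) (at a)"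
   by (intro tendsto_bcl[OF bcl_mul[OF Li_pow(3)]] tendsto_intros)
  ultimately show ?thesis unfolding emb_def by (intro tendsto_add)
 qed
 thus ?thesis by (auto simp: continuous_on_def intro: tendsto_within_subset)
qed

lemma closed_W: "closed W"
proof -
 have "W = fst -` HH \<inter> emb -` K" by (auto simp: W_def)
 moreover have "closed (fst -` HH :: (hl2 \<times> complex) set)"
  by (rule closed_vimage[OF csubD(4)[OF csub_HH]]) (intro continuous_intros)
 moreover have "closed (emb -` K)"
  by (rule closed_vimage[OF csubD(4)[OF K(1)] continuous_emb])
 ultimately show ?thesis by (simp add: closed_Int)
qed

definition pr :: "hl2 \<times> complex => hl2 \<times> complex" where
 "pr p = (SOME w. w : W & (ALL v:W. qq (p - w) v = 0))"

lemma qq_sym: "qq x y = qq y x"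
 by (simp add: qq_def inner_commute)

lemma pr: "pr p : W" "v : W ==> qq (p - pr p) v = 0"
proof -
 have "EX w. w : W & (ALL v:W. qq (p - w) v = 0)"
  by (rule orthogonal_projection_exists[OF bounded_bilinear_qq qq_sym zero_less_one qq_coercive subspace_W closed_W, of p]) blast
 from someI_ex[OF this] show "pr p : W" "v : W ==> qq (p - pr p) v = 0" unfolding pr_def by auto
qed

interpretation qq: bounded_bilinear qq by (rule bounded_bilinear_qq)

lemma pr_unique: assumes w: "w : W" "!!v. v : W ==> qq (p - w) v = 0" shows "pr p = w"
proof -
 have d: "pr p - w : W" using subspace_diff[OF subspace_W pr(1) w(1)] .
 have "qq (pr p - w) (pr p - w) = qq (p - w) (pr p - w) - qq (p - pr p) (pr p - w)"
  by (simp add: qq.diff_left)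
 also have "... = 0" using w(2)[OF d] pr(2)[OF d] by simp
 finally have "(norm (pr p - w))^2 <= 0" using qq_coercive[of "pr p - w"] by simp
 thus ?thesis by simp
qed

lemma pr_add: "pr (p + p') = pr p + pr p'"
proof (rule pr_unique)
 show "pr p + pr p' : W" by (rule subspace_add[OF subspace_W pr(1) pr(1)])
 fix v assume "v : W"
 hence "qq (p - pr p) v = 0" "qq (p' - pr p') v = 0" using pr(2) by auto
 thus "qq (p + p' - (pr p + pr p')) v = 0" by (simp add: qq.diff_left qq.add_left)
qed

definition cs :: "complex => hl2 \<times> complex => hl2 \<times> complex" where
 "cs c p = (c *C fst p, c * snd p)"

lemma cs_W: "p : W ==> cs c p : W"
 using csubD(3)[OF csub_HH] csubD(3)[OF K(1)] emb_scaleC[of c p] by (auto simp: W_def cs_def)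

lemma qq_cs: "qq (cs c p) v = qq p (cs (cnj c) v)"
proof -
 have 1: "inner (c *C x) y = inner x (cnj c *C y)" for x y
  by (simp add: inner_eq_cip cip_cl cip_cr)
 have 2: "inner (c * x) y = inner x (cnj c * y)" for x y :: complex
  by (simp add: inner_complex_def algebra_simps)
 show ?thesis unfolding qq_def cs_def inner_prod_def fst_conv snd_conv bcl_scaleC[OF B(1)] 1 2 ..
qed

lemma pr_cs: "pr (cs c p) = cs c (pr p)"
proof (rule pr_unique[OF cs_W[OF pr(1)]])
 fix v assume "v : W"
 hence "qq (p - pr p) (cs (cnj c) v) = 0" using pr(2) cs_W by blast
 moreover have "cs c p - cs c (pr p) = cs c (p - pr p)"
  by (simp add: cs_def scaleC_diff_right right_diff_distrib)
 ultimately show "qq (cs c p - cs c (pr p)) v = 0" by (simp add: qq_cs)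
qed

lemma qq_pr_le: "qq (pr p) (pr p) <= qq p p"
proof -
 have "qq (p - pr p) (pr p) = 0" by (rule pr(2)[OF pr(1)])
 hence "qq p p - qq (pr p) (pr p) = qq (p - pr p) (p - pr p)"
  by (simp add: qq.diff_left qq.diff_right qq_sym[of p "pr p"])
 thus ?thesis using qq_coercive[of "p - pr p"] zero_le_power2[of "norm (p - pr p)"] by linarith
qed

definition q :: "hl2 => real" where "q x = c2 * (norm x)^2 - (norm (B x))^2"

lemma q_nonneg: "q x >= 0" and q_le: "q x <= c2 * (norm x)^2"
proof -
 have "(norm (B x))^2 <= c2 * (norm x)^2"
  using B_sq[of x] zero_le_power2[of "norm x"] unfolding c2_def distrib_right by linarith
 thus "q x >= 0" "q x <= c2 * (norm x)^2" by (auto simp: q_def)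
qed

lemma qq_pair: "qq (x, a) (x, a) = q x + c2 * (cmod a)^2"
 by (simp add: qq_def q_def power2_norm_eq_inner algebra_simps)

text \<open>The lurking isometry on pairs that encode elements of \<open>K\<close>; any other pair
  is first projected to these along \<open>qq\<close>.\<close>

definition V :: "hl2 \<times> complex => hl2 \<times> complex" where
 "V p = (emb (pr p), coef (B (emb (pr p))) 0)"

lemma V_add: "V (p + p') = V p + V p'"
 by (simp add: V_def pr_add emb_add bcl_add[OF B(1)] cip_add_left)

lemma V_cs: "V (cs c p) = cs c (V p)"
 unfolding V_def pr_cs emb_scaleC[of c "pr p", folded cs_def]
 by (simp add: cs_def bcl_scaleC[OF B(1)] cip_cl)

text \<open>On pairs coming from \<open>K\<close> equality holds: \<open>norm_L\<close> is applied
  to \<open>f\<close> and to \<open>B f\<close>, and \<open>BL\<close> identifies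
  \<open>L (B f)\<close> with \<open>B (L f)\<close>. The projection can only decrease
  \<open>qq\<close>.\<close>

lemma V_contraction: "q (fst (V p)) + (cmod (snd (V p)))^2 <= q (fst p) + c2 * (cmod (snd p))^2"
proof -
 define f where "f = emb (pr p)"
 have f: "f : K" "L f = fst (pr p)" "coef f 0 = snd (pr p)"
  using pr(1)[of p] by (auto simp: f_def W_def L_emb coef_emb)
 have "q f + (cmod (coef (B f) 0))^2 = c2 * (norm f)^2 - (norm (L (B f)))^2"
  by (simp add: q_def norm_L)
 also have "... = q (L f) + c2 * (cmod (coef f 0))^2"
  using BL[OF f(1)] by (simp add: q_def norm_L algebra_simps)
 also have "... = qq (pr p) (pr p)" using qq_pair[of "fst (pr p)" "snd (pr p)"] by (simp add: f)
 also have "... <= qq p p" by (rule qq_pr_le)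
 also have "qq p p = q (fst p) + c2 * (cmod (snd p))^2" using qq_pair[of "fst p" "snd p"] by simp
 finally show ?thesis by (simp add: V_def f_def)
qed

lemma V_K: "f : K ==> V (L f, coef f 0) = (f, coef (B f) 0)"
proof -
 assume f: "f : K"
 have "pr (L f, coef f 0) = (L f, coef f 0)"
  by (rule pr_unique) (simp_all add: emb_split f qq.zero_left flip: zero_prod_def)
 thus ?thesis by (simp add: V_def emb_split)
qed

text \<open>The states of the linear system \<open>V\<close> started at 0 and driven by the scalar
  input \<open>c\<close>; \<open>out\<close> is its output.\<close>

primrec st :: "(nat => complex) => nat => hl2" where
 "st c 0 = 0"
| "st c (Suc n) = fst (V (st c n, c n))"

definition out :: "(nat => complex) => nat => complex" where
 "out c n = snd (V (st c n, c n))"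

lemma energy: "q (st c N) + (\<Sum>n<N. (cmod (out c n))\<^sup>2) <= c2 * (\<Sum>n<N. (cmod (c n))\<^sup>2)"
proof (induction N)
 case 0
 show ?case by (simp add: q_def bcl_zero[OF B(1)])
next
 case (Suc N)
 thus ?case using V_contraction[of "(st c N, c N)"] by (simp add: out_def algebra_simps)
qed

definition a :: "hl2 => hl2" where "a x = fst (V (x, 0))"
definition b :: "hl2" where "b = fst (V (0, 1))"
definition \<gamma> :: "hl2 => complex" where "\<gamma> x = snd (V (x, 0))"
definition d :: "complex" where "d = snd (V (0, 1))"

lemma V_eq: "V (x, t) = (a x + t *C b, \<gamma> x + t * d)"
proof -
 have "(x, t) = (x, 0) + cs t (0, 1)" by (simp add: cs_def)
 hence "V (x, t) = V (x, 0) + cs t (V (0, 1))" by (simp only: V_add V_cs)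
 thus ?thesis by (simp add: a_def b_def \<gamma>_def d_def cs_def prod_eq_iff)
qed

lemma a_add: "a (x + y) = a x + a y" and \<gamma>_add: "\<gamma> (x + y) = \<gamma> x + \<gamma> y"
 using V_add[of "(x, 0)" "(y, 0)"] by (simp_all add: a_def \<gamma>_def)

lemma a_scaleC: "a (c *C x) = c *C a x" and \<gamma>_scaleC: "\<gamma> (c *C x) = c * \<gamma> x"
 using V_cs[of c "(x, 0)"] by (simp_all add: a_def \<gamma>_def cs_def)

lemma a_pow_add: "(a ^^ n) (x + y) = (a ^^ n) x + (a ^^ n) y"
 by (induction n) (simp_all add: a_add)

lemma a_pow_scaleC: "(a ^^ n) (c *C x) = c *C (a ^^ n) x"
 by (induction n) (simp_all add: a_scaleC)

lemma a_zero: "a 0 = 0" and \<gamma>_zero: "\<gamma> 0 = 0"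
 using a_scaleC[of 0 0] \<gamma>_scaleC[of 0 0] by simp_all

text \<open>The impulse response of the system, that is, the coefficients of its transfer
  function.\<close>

definition \<psi> :: "nat => complex" where
 "\<psi> k = (case k of 0 => d | Suc j => \<gamma> ((a ^^ j) b))"

lemma st_eq: "st c n = (\<Sum>j<n. c j *C (a ^^ (n - 1 - j)) b)"
proof (induction n)
 case (Suc n)
 have a_sum: "a (\<Sum>j\<in>S. f j) = (\<Sum>j\<in>S. a (f j))" if "finite S" for S :: "nat set" and f
  using that by (induction S rule: finite_induct) (simp_all add: a_add a_zero)
 have "st c (Suc n) = a (st c n) + c n *C b" by (simp add: V_eq)
 also have "a (st c n) = (\<Sum>j<n. c j *C a ((a ^^ (n - 1 - j)) b))" by (simp add: Suc a_sum a_scaleC)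
 also have "... = (\<Sum>j<n. c j *C (a ^^ (Suc n - 1 - j)) b)"
 proof (rule sum.cong[OF refl])
  fix j assume "j : {..<n}"
  hence "Suc n - 1 - j = Suc (n - 1 - j)" by auto
  thus "c j *C a ((a ^^ (n - 1 - j)) b) = c j *C (a ^^ (Suc n - 1 - j)) b" by simp
 qed
 finally show ?case by simp
qed simp

lemma out_eq: "out c n = (\<Sum>j\<le>n. \<psi> j * c (n - j))"
proof -
 have g_sum: "\<gamma> (\<Sum>j\<in>S. f j) = (\<Sum>j\<in>S. \<gamma> (f j))" if "finite S" for S :: "nat set" and f
  using that by (induction S rule: finite_induct) (simp_all add: \<gamma>_add \<gamma>_zero)
 have "out c n = \<gamma> (st c n) + c n * d" by (simp add: out_def V_eq)
 also have "\<gamma> (st c n) = (\<Sum>j<n. c j * \<psi> (n - j))"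
  unfolding st_eq g_sum[OF finite_lessThan] \<gamma>_scaleC
 proof (rule sum.cong[OF refl])
  fix j assume "j : {..<n}"
  hence "n - j = Suc (n - 1 - j)" by auto
  thus "c j * \<gamma> ((a ^^ (n - 1 - j)) b) = c j * \<psi> (n - j)" by (simp add: \<psi>_def)
 qed
 also have "(\<Sum>j<n. c j * \<psi> (n - j)) + c n * d = (\<Sum>j\<le>n. c j * \<psi> (n - j))"
  by (simp add: lessThan_Suc_atMost[symmetric] \<psi>_def)
 also have "... = (\<Sum>j\<le>n. c (n - j) * \<psi> (n - (n - j)))"
  by (rule sum.nat_diff_reindex[symmetric, of _ "Suc n", unfolded lessThan_Suc_atMost, simplified])
 also have "... = (\<Sum>j\<le>n. \<psi> j * c (n - j))" by (rule sum.cong) (auto simp: mult.commute)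
 finally show ?thesis .
qed

text \<open>A unit impulse as input has energy 1 and produces \<psi> as output.\<close>

lemma \<psi>_bound: "(cmod (\<psi> k))^2 <= c2"
proof -
 define \<delta> :: "nat => complex" where "\<delta> n = (if n = 0 then 1 else 0)" for n
 have "out \<delta> k = \<psi> k" unfolding out_eq \<delta>_def
  by (subst sum.remove[of _ k]) (auto intro!: sum.neutral)
 moreover have "(cmod (out \<delta> k))^2 <= (\<Sum>n<Suc k. (cmod (out \<delta> n))\<^sup>2)"
  by (rule member_le_sum) auto
 moreover have "(\<Sum>n<Suc k. (cmod (out \<delta> n))\<^sup>2) <= c2 * (\<Sum>n<Suc k. (cmod (\<delta> n))\<^sup>2)"
  using energy[of \<delta> "Suc k"] q_nonneg[of "st \<delta> (Suc k)"] by linarith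
 moreover have "(\<Sum>n<Suc k. (cmod (\<delta> n))\<^sup>2) = 1"
  unfolding \<delta>_def by (subst sum.remove[of _ 0]) (auto intro!: sum.neutral)
 ultimately show ?thesis by simp
qed

text \<open>\<open>V_K\<close> says that \<open>f\<close> is the state reached from
  \<open>L f\<close> with input \<open>coef f 0\<close>, the output being
  \<open>coef (B f) 0\<close>. Unrolling this m more times expresses the output by the coefficients
  of \<open>f\<close> and a remainder.\<close>

lemma coef_B: "f : K ==> coef (B f) 0 = (\<Sum>k\<le>m. \<psi> k * coef f k) + \<gamma> ((a ^^ m) ((L ^^ Suc m) f))"
proof (induction m)
 case 0
 thus ?case using V_K[OF 0] by (simp add: V_eq \<psi>_def) (metis add.commute mult.commute)
next
 case (Suc m)
 let ?g = "(L ^^ Suc m) f"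
 have gK: "(L ^^ j) f : K" for j using Suc.prems by (induction j) (auto simp: LK)
 have "?g = a (L ?g) + coef ?g 0 *C b" using V_K[OF gK[of "Suc m"]] by (simp add: V_eq)
 hence "\<gamma> ((a ^^ m) ?g) = \<gamma> ((a ^^ m) (a (L ?g))) + coef ?g 0 * \<gamma> ((a ^^ m) b)"
  by (metis a_pow_add a_pow_scaleC \<gamma>_add \<gamma>_scaleC)
 moreover have "coef ?g 0 = coef f (Suc m)" using coef_L_pow[of "Suc m" f 0] by simp
 moreover have "(a ^^ m) (a (L ?g)) = (a ^^ Suc m) ((L ^^ Suc (Suc m)) f)" by (simp add: funpow_swap1)
 moreover have "\<gamma> ((a ^^ m) b) = \<psi> (Suc m)" by (simp add: \<psi>_def)
 ultimately show ?case using Suc.IH[OF Suc.prems] by (simp add: mult.commute)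
qed

lemma q_a: "q (a y) <= q y"
proof -
 have "q (a y) + (cmod (snd (V (y, 0))))^2 <= q y"
  using V_contraction[of "(y, 0)"] by (simp add: a_def)
 thus ?thesis using zero_le_power2[of "cmod (snd (V (y, 0)))"] by linarith
qed

lemma q_a_pow: "q ((a ^^ m) x) <= q x"
 by (induction m) (auto intro: order_trans[OF q_a])

lemma \<gamma>_sq: "(cmod (\<gamma> x))^2 <= q x"
 using V_contraction[of "(x, 0)"] q_nonneg[of "fst (V (x, 0))"] by (simp add: \<gamma>_def)

text \<open>The remainder is controlled by \<open>q\<close>, which \<open>a\<close> does not
  increase; it is thus at most a multiple of the norm of an iterate of \<open>L\<close>, and these
  tend to 0.\<close>

lemma coef_B_sums: assumes f: "f : K" shows "(%k. \<psi> k * coef f k) sums coef (B f) 0"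
proof -
 have "(%m. \<gamma> ((a ^^ m) ((L ^^ Suc m) f))) ----> 0"
 proof (rule Lim_null_comparison)
  show "\<forall>\<^sub>F m in sequentially. cmod (\<gamma> ((a ^^ m) ((L ^^ Suc m) f))) <= sqrt c2 * norm ((L ^^ Suc m) f)"
  proof (rule always_eventually[OF allI])
   fix m
   let ?x = "(L ^^ Suc m) f"
   have "(cmod (\<gamma> ((a ^^ m) ?x)))^2 <= c2 * (norm ?x)^2"
    using \<gamma>_sq[of "(a ^^ m) ?x"] q_a_pow[of m ?x] q_le[of ?x] by linarith
   also have "... = (sqrt c2 * norm ?x)^2" using c2 by (simp add: power_mult_distrib)
   finally show "cmod (\<gamma> ((a ^^ m) ?x)) <= sqrt c2 * norm ?x"
    by (rule power2_le_imp_le) (use c2 in simp)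
  qed
  have "f : HH" using f K(2) by blast
  from LIMSEQ_Suc[OF L_pow_tendsto[OF this]]
  have "(%m. sqrt c2 * norm ((L ^^ Suc m) f)) ----> sqrt c2 * norm (0 :: hl2)"
   by (intro tendsto_intros)
  thus "(%m. sqrt c2 * norm ((L ^^ Suc m) f)) ----> 0" by simp
 qed
 hence "(%m. coef (B f) 0 - \<gamma> ((a ^^ m) ((L ^^ Suc m) f))) ----> coef (B f) 0 - 0"
  by (intro tendsto_intros)
 moreover have "coef (B f) 0 - \<gamma> ((a ^^ m) ((L ^^ Suc m) f)) = (\<Sum>k\<le>m. \<psi> k * coef f k)" for m
  using coef_B[OF f, of m] by simp
 ultimately show ?thesis by (simp add: sums_def_le)
qed

lemma symbol_summable: assumes w: "cmod w < 1" shows "summable (%k. cmod (\<psi> k * w ^ k))"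
proof -
 have 1: "summable (%k. sqrt c2 * cmod w ^ k)" using w by (intro summable_mult summable_geometric) simp
 have "cmod (\<psi> k) <= sqrt c2" for k by (rule real_le_rsqrt[OF \<psi>_bound])
 hence 2: "norm (cmod (\<psi> k * w ^ k)) <= sqrt c2 * cmod w ^ k" for k
  by (simp add: norm_mult norm_power mult_right_mono)
 show ?thesis by (rule summable_comparison_test'[OF 1, of 0]) (rule 2)
qed

text \<open>The input \<open>cnj w ^ n\<close>, the coefficients of the reproducing kernel at
  \<open>w\<close>, produces an output whose generating function at \<open>w\<close> is the symbol
  divided by 1 - \<bar>w\<bar>^2. The energy inequality and Cauchy-Schwarz bound this by
  \<open>sqrt c2\<close> over the same denominator.\<close>

lemma symbol_bound: assumes w: "cmod w < 1" shows "cmod (\<Sum>k. \<psi> k * w ^ k) <= sqrt c2"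
proof -
 let ?r = "(cmod w)^2"
 have r: "0 <= ?r" "?r < 1" using w by (auto simp: abs_square_less_1)
 define c where "c n = cnj w ^ n" for n
 have cw: "c n * w ^ n = of_real ?r ^ n" for n
  unfolding c_def power_mult_distrib[symmetric] by (simp only: complex_norm_square mult.commute[of "cnj w"])
 have g: "(%n. ?r ^ n) sums (1 / (1 - ?r))" using geometric_sums[of ?r] r by simp
 have gc: "(%n. complex_of_real ?r ^ n) sums (1 / (1 - of_real ?r))"
  using geometric_sums[of "complex_of_real ?r"] r by (simp add: norm_power)
 have "(%n. \<Sum>j\<le>n. (\<psi> j * w ^ j) * (c (n - j) * w ^ (n - j))) sums ((\<Sum>k. \<psi> k * w ^ k) * (\<Sum>n. c n * w ^ n))"
 proof (rule Cauchy_product_sums)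
  show "summable (%k. norm (\<psi> k * w ^ k))" using symbol_summable[OF w] .
  show "summable (%k. norm (c k * w ^ k))" unfolding cw using g r by (simp add: norm_power sums_iff)
 qed
 moreover have "(\<Sum>j\<le>n. (\<psi> j * w ^ j) * (c (n - j) * w ^ (n - j))) = out c n * w ^ n" for n
 proof -
  have "(\<psi> j * w ^ j) * (c (n - j) * w ^ (n - j)) = \<psi> j * c (n - j) * w ^ n" if "j <= n" for j
   using that by (simp add: power_add[symmetric] ac_simps)
  thus ?thesis unfolding out_eq sum_distrib_right by (intro sum.cong) auto
 qed
 ultimately have s: "(%n. out c n * w ^ n) sums ((\<Sum>k. \<psi> k * w ^ k) * (1 / (1 - of_real ?r)))"
  using gc by (simp add: cw sums_iff)
 have "cmod (\<Sum>n<N. out c n * w ^ n) <= sqrt c2 * (1 / (1 - ?r))" for N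
 proof -
  have gN: "(\<Sum>n<N. ?r ^ n) <= 1 / (1 - ?r)"
   using sum_le_suminf[of "%n. ?r ^ n" "{..<N}"] g r by (simp add: sums_iff)
  have g0: "0 <= (\<Sum>n<N. ?r ^ n)" using r by (intro sum_nonneg) auto
  have "cmod (\<Sum>n<N. out c n * w ^ n) <= (\<Sum>n<N. cmod (out c n) * cmod w ^ n)"
   by (rule order_trans[OF norm_sum]) (simp add: norm_mult norm_power)
  hence "(cmod (\<Sum>n<N. out c n * w ^ n))^2 <= (\<Sum>n<N. cmod (out c n) * cmod w ^ n)^2"
   by (rule power_mono) simp
  also have "... <= (\<Sum>n<N. (cmod (out c n))\<^sup>2) * (\<Sum>n<N. (cmod w ^ n)\<^sup>2)" by (rule Cauchy_Schwarz_ineq_sum)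
  also have "... <= (c2 * (\<Sum>n<N. (cmod (c n))\<^sup>2)) * (\<Sum>n<N. (cmod w ^ n)\<^sup>2)"
   using energy[of c N] q_nonneg[of "st c N"] by (intro mult_right_mono sum_nonneg) auto
  also have "(\<Sum>n<N. (cmod (c n))\<^sup>2) = (\<Sum>n<N. ?r ^ n)"
   by (simp add: c_def norm_power power_mult[symmetric] mult.commute)
  also have "(\<Sum>n<N. (cmod w ^ n)\<^sup>2) = (\<Sum>n<N. ?r ^ n)"
   by (simp add: power_mult[symmetric] mult.commute)
  also have "c2 * (\<Sum>n<N. ?r ^ n) * (\<Sum>n<N. ?r ^ n) <= c2 * (1 / (1 - ?r)) * (1 / (1 - ?r))"
   using c2 gN g0 order_trans[OF g0 gN] by (intro mult_mono mult_left_mono mult_nonneg_nonneg) auto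
  also have "... = (sqrt c2 * (1 / (1 - ?r)))^2" using c2 by (simp add: power2_eq_square)
  finally show ?thesis by (rule power2_le_imp_le) (use c2 r in simp)
 qed
 hence "cmod ((\<Sum>k. \<psi> k * w ^ k) * (1 / (1 - of_real ?r))) <= sqrt c2 * (1 / (1 - ?r))"
  by (intro LIMSEQ_le_const2[OF tendsto_norm[OF s[unfolded sums_def]]] exI allI impI)
 moreover have "1 / (1 - complex_of_real ?r) = of_real (1 / (1 - ?r))" by simp
 hence "cmod (1 / (1 - complex_of_real ?r)) = 1 / (1 - ?r)"
  using r by (simp only: norm_of_real) simp
 ultimately have "cmod (\<Sum>k. \<psi> k * w ^ k) * (1 / (1 - ?r)) <= sqrt c2 * (1 / (1 - ?r))"
  by (simp only: norm_mult)
 thus ?thesis by (rule mult_right_le_imp_le) (use r in simp)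
qed

lemma L_pow_K: "f : K ==> (L ^^ j) f : K"
 by (induction j) (simp_all add: LK)

lemma B_L_pow: assumes "f : K" shows "B ((L ^^ j) f) = (L ^^ j) (B f)"
proof (induction j)
 case (Suc j)
 have "B (L ((L ^^ j) f)) = L (B ((L ^^ j) f))" by (rule BL[OF L_pow_K[OF assms]])
 thus ?case by (simp add: Suc)
qed simp

text \<open>Conjugated coefficients, because \<open>B\<close> acts by the conjugate of
  \<Psi>.\<close>

definition \<Psi> where "\<Psi> w = (\<Sum>k. cnj (\<psi> k) * w ^ k)"

lemma \<Psi>_sums: assumes "cmod w < 1" shows "(%k. cnj (\<psi> k) * w ^ k) sums \<Psi> w"
proof -
 have "summable (%k. cmod (cnj (\<psi> k) * w ^ k))"
  using symbol_summable[OF assms] by (simp add: norm_mult)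
 thus ?thesis unfolding \<Psi>_def by (rule summable_sums[OF summable_norm_cancel])
qed

lemma \<Psi>_holo: "\<Psi> holomorphic_on ball 0 1"
proof (rule power_series_holomorphic[of 0 1 "%k. cnj (\<psi> k)" \<Psi>])
 fix w :: complex assume "w : ball 0 1"
 thus "(%k. cnj (\<psi> k) * (w - 0) ^ k) sums \<Psi> w" using \<Psi>_sums[of w] by simp
qed

lemma \<Psi>_bound: assumes w: "cmod w < 1" shows "cmod (\<Psi> w) <= sqrt c2"
proof -
 have w': "cmod (cnj w) < 1" using w by simp
 have "(%k. cnj (\<psi> k * cnj w ^ k)) sums cnj (\<Sum>k. \<psi> k * cnj w ^ k)"
  unfolding sums_cnj by (rule summable_sums[OF summable_norm_cancel[OF symbol_summable[OF w']]])
 hence "(%k. cnj (\<psi> k) * w ^ k) sums cnj (\<Sum>k. \<psi> k * cnj w ^ k)"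
  by (simp only: complex_cnj_mult complex_cnj_power complex_cnj_cnj)
 hence "\<Psi> w = cnj (\<Sum>k. \<psi> k * cnj w ^ k)" by (rule sums_unique2[OF \<Psi>_sums[OF w]])
 thus ?thesis using symbol_bound[OF w'] by simp
qed

lemma \<Psi>_Hinfty: "\<Psi> : Hinfty"
proof -
 have "ALL x:\<Psi> ` ball 0 1. norm x <= sqrt c2" using \<Psi>_bound by simp
 thus ?thesis using \<Psi>_holo unfolding Hinfty_def bounded_iff by blast
qed

lemma tay_\<Psi>: "tay \<Psi> k = cnj (\<psi> k)"
proof -
 have "tay \<Psi> k - cnj (\<psi> k) = 0"
 proof (rule powser_eq_0)
  fix w :: complex assume w: "cmod w < 1"
  show "(%n. (tay \<Psi> n - cnj (\<psi> n)) * w ^ n) sums 0"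
   using sums_diff[OF tay_sums[OF \<Psi>_holo w] \<Psi>_sums[OF w]] by (simp add: left_diff_distrib)
 qed
 thus ?thesis by simp
qed

text \<open>The n-th coefficient of \<open>B f\<close> is the 0-th coefficient of \<open>B\<close>
  at the n-th iterate of \<open>L\<close>, so the series for the 0-th coefficient determines all of
  them.\<close>

theorem lifting:
 assumes f: "f : K"
 shows "B f = PM HH (mul (%z. cnj (bv \<Psi> z)) f)"
proof (rule HH_eqI)
 note P = \<Psi>_Hinfty
 have Lp: "bv \<Psi> : Li" by (rule bv_Li[OF P])
 show "B f : HH" using B(2)[OF f] K(2) by blast
 show "PM HH (mul (%z. cnj (bv \<Psi> z)) f) : HH" by (rule PM_in[OF csub_HH])
 fix n
 have Lf: "(L ^^ n) f : HH" using L_pow_K[OF f] K(2) by blast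
 have fH: "f : HH" using f K(2) by blast
 have 1: "coef (B f) n = coef (B ((L ^^ n) f)) 0" by (simp add: B_L_pow f coef_L_pow)
 have 2: "(%k. \<psi> k * coef ((L ^^ n) f) k) sums coef (B ((L ^^ n) f)) 0" by (rule coef_B_sums[OF L_pow_K[OF f]])
 have "(%k. coef ((L ^^ n) f) k * cnj (coef (cls (bv \<Psi>)) k)) sums cip ((L ^^ n) f) (cls (bv \<Psi>))"
  by (rule HH_cip_sums[OF Lf])
 hence 3: "(%k. \<psi> k * coef ((L ^^ n) f) k) sums cip ((L ^^ n) f) (cls (bv \<Psi>))"
  by (simp only: bv_HH(2)[OF P] tay_\<Psi> complex_cnj_cnj mult.commute[of _ "\<psi> k" for k])
 have 4: "cip ((L ^^ n) f) (cls (bv \<Psi>)) = cip f ((zmul ^^ n) (cls (bv \<Psi>)))"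
  by (rule cip_L_pow[OF fH bv_HH(1)[OF P]])
 have 5: "cip f ((zmul ^^ n) (cls (bv \<Psi>))) = cip f (mul (bv \<Psi>) (e n))" by (simp add: mul_e[OF Lp])
 have 6: "cip f (mul (bv \<Psi>) (e n)) = cip (mul (%z. cnj (bv \<Psi> z)) f) (e n)" by (simp add: cip_mul Li_cnj Lp)
 have 7: "coef (PM HH (mul (%z. cnj (bv \<Psi> z)) f)) n = cip (mul (%z. cnj (bv \<Psi> z)) f) (e n)"
  by (rule PM_cip[OF csub_HH e_HH])
 show "coef (B f) n = coef (PM HH (mul (%z. cnj (bv \<Psi> z)) f)) n"
  by (simp only: 1 sums_unique2[OF 2 3] 4 5 6 7)
qed

lemma cip_lifting:
 assumes "f : K" "g : HH" shows "cip (B f) g = cip f (mul (bv \<Psi>) g)"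
 unfolding lifting[OF assms(1)] PM_cip[OF csub_HH assms(2)]
 by (simp add: cip_mul Li_cnj bv_Li \<Psi>_Hinfty)

end

section \<open>The model space\<close>

definition cj :: "hl2 => hl2" where "cj x = cls (%z. cnj (rp x z))"

lemma cj_cls: "f : L2 ==> cj (cls f) = cls (%z. cnj (f z))"
 unfolding cj_def
proof (rule cls_cong)
 assume f: "f : L2"
 show "(%z. cnj (rp (cls f) z)) \<doteq> (%z. cnj (f z))"
  using rp_cls[OF f] unfolding ae_eq_def by eventually_elim simp
qed (auto simp: L2_cnj)

lemma cj_cj [simp]: "cj (cj x) = x"
 using cj_cls[of "%z. cnj (rp x z)"] by (simp add: cj_def L2_cnj)

lemma cip_cj: "cip (cj x) (cj y) = cip y x"
 unfolding cj_def by (subst cip_cls) (auto simp: L2_cnj ip_def cip_def mult.commute)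

lemma cj_add: "cj (x + y) = cj x + cj y"
 using cj_cls[of "%z. rp x z + rp y z"] cls_add[of "%z. cnj (rp x z)" "%z. cnj (rp y z)"]
 by (simp add: plus_hl2_def[of x y] L2_add L2_cnj cj_def[of x] cj_def[of y])

lemma cj_scaleC: "cj (c *C x) = cnj c *C cj x"
 using cj_cls[of "%z. c * rp x z"] cls_scaleC[of "%z. cnj (rp x z)" "cnj c"]
 by (simp add: scaleC_def[of c x] Li_mult_L2[OF Li_const] L2_cnj cj_def[of x])

lemma cj_minus: "cj (- x) = - cj x"
 using cj_scaleC[of "-1" x] by (simp add: scaleC_minus_one)

lemma cj_diff: "cj (x - y) = cj x - cj y"
 using cj_add[of x "- y"] by (simp add: cj_minus)

lemma norm_cj: "norm (cj x) = norm x"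
proof -
 have "complex_of_real ((norm (cj x))^2) = of_real ((norm x)^2)" unfolding cip_self[symmetric] by (rule cip_cj)
 hence "(norm (cj x))^2 = (norm x)^2" using of_real_eq_iff by blast
 thus ?thesis by (rule power2_eq_imp_eq) simp_all
qed

lemma cj_mul: "\<phi> : Li ==> cj (mul \<phi> x) = mul (%z. cnj (\<phi> z)) (cj x)"
proof -
 assume p: "\<phi> : Li"
 have "cj (mul \<phi> x) = cls (%z. cnj (\<phi> z * rp x z))" unfolding mul_def by (rule cj_cls) (simp add: Li_mult_L2 p)
 also have "... = cls (%z. cnj (\<phi> z) * cnj (rp x z))" by simp
 also have "... = mul (%z. cnj (\<phi> z)) (cj x)" unfolding cj_def by (rule mul_cls[symmetric]) (simp_all add: Li_cnj p L2_cnj)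
 finally show ?thesis .
qed

lemma cj_e: "cj (e n) = em n"
 unfolding e_def em_def by (subst cj_cls) (simp_all add: Li_pow Li_L2)

lemma tendsto_cj: "(f ---> a) F ==> ((%x. cj (f x)) ---> cj a) F"
proof -
 assume f: "(f ---> a) F"
 have "((%x. norm (f x - a)) ---> norm (a - a)) F" by (intro tendsto_intros f)
 hence "((%x. norm (cj (f x) - cj a)) ---> 0) F" by (simp add: cj_diff[symmetric] norm_cj)
 thus ?thesis by (simp add: tendsto_norm_zero_iff LIM_zero_iff)
qed

text \<open>Conjugation and the extra factor \<open>cnj z\<close> turn Hardy functions into series
  with strictly negative frequencies.\<close>

lemma cip_zbmul_cj: assumes x: "x : HH" and y: "y : HH" shows "cip y (zbmul (cj x)) = 0"
proof -
 have "cip y (zbmul (em n)) = 0" for n using y by (simp add: zbmul_em HH_iff)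
 hence s: "cip y (zbmul (cj (fsum (coef x) N))) = 0" for N
 proof (induction N)
  case 0
  have "cj 0 = 0" using cj_scaleC[of 0 0] by simp
  thus ?case by (simp add: fsum_def bcl_zero[OF bcl_mul[OF Li_pow(4)]])
 next
  case (Suc N)
  thus ?case
   by (simp add: fsum_def cj_add cj_scaleC cj_e mul_add mul_scaleC Li_pow cip_add_right cip_cr)
 qed
 have "(%N. cip y (zbmul (cj (fsum (coef x) N)))) ----> cip y (zbmul (cj x))"
  by (intro tendsto_cip tendsto_const tendsto_bcl[OF bcl_mul[OF Li_pow(4)]] tendsto_cj fsum_tendsto x)
 thus ?thesis unfolding s by (simp add: LIMSEQ_const_iff)
qed

lemma zbmul_split: "zbmul x = L x + coef x 0 *C em 1"
proof -
 have "em 1 = zbmul (e 0)" using zbmul_em[of 0] by (simp add: e_0)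
 thus ?thesis unfolding L_def by (simp add: bcl_diff[OF bcl_mul[OF Li_pow(4)]] mul_scaleC Li_pow)
qed

lemma cip_zmul_HH: "x : HH ==> cip (zmul x) y = cip x (L y)"
 by (simp add: cip_zmul zbmul_split[of y] cip_add_right cip_cr HH_iff)

lemma tay_0: "tay \<Psi> 0 = \<Psi> 0" by (simp add: tay_def)

locale inner_fn =
 fixes u :: "complex => complex"
 assumes inner: "inner_function u" and nc: "\<not> u constant_on ball 0 1"
begin

abbreviation "U \<equiv> bv u"
abbreviation "Mu \<equiv> mul U"
abbreviation "Mub \<equiv> mul (%z. cnj (U z))"

lemma uH: "u : Hinfty" using inner by (simp add: inner_function_def)
lemma U_unim: "AE z in circle. cmod (U z) = 1" using inner by (simp add: inner_function_def)
lemma U_Li: "U : Li" by (rule bv_Li[OF uH])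
lemma Ub_Li: "(%z. cnj (U z)) : Li" by (rule Li_cnj[OF U_Li])
lemma bcl_Mu: "bcl Mu" by (rule bcl_mul[OF U_Li])

lemma cip_Mu_Mu: "cip (Mu x) (Mu y) = cip x y" by (rule mul_isometry[OF U_Li U_unim])

lemma cip_Mu: "cip (Mu x) y = cip x (Mub y)" and cip_Mub: "cip (Mub x) y = cip x (Mu y)"
 by (simp_all add: cip_mul U_Li Ub_Li)

lemma Mub_Mu [simp]: "Mub (Mu x) = x" and Mu_Mub [simp]: "Mu (Mub x) = x"
proof -
 have *: "(%z. cnj (U z) * U z) \<doteq> (%z. 1)" "(%z. U z * cnj (U z)) \<doteq> (%z. 1)"
  unfolding ae_eq_def using U_unim
  by (eventually_elim, simp add: complex_norm_square[symmetric] mult.commute)+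
 show "Mub (Mu x) = x" "Mu (Mub x) = x"
  using mul_cong[OF _ _ *(1), of x] mul_cong[OF _ _ *(2), of x]
  by (simp_all add: mul_mul U_Li Ub_Li Li_mult Li_const mul_one)
qed

lemma Mu_HH: "x : HH ==> Mu x : HH" by (rule mul_HH[OF U_Li bv_HH(1)[OF uH]])

lemma zmul_Mu: "zmul (Mu x) = Mu (zmul x)" "zbmul (Mu x) = Mu (zbmul x)"
 by (simp_all add: mul_mul U_Li Li_pow mult.commute)

lemma zmul_Mub: "zbmul (Mub x) = Mub (zbmul x)" "zmul (Mub x) = Mub (zmul x)"
 by (simp_all add: mul_mul Ub_Li Li_pow mult.commute)

text \<open>The Poisson formula for dilations passes to the limit, so \<open>u\<close> is the
  Poisson integral of its unimodular boundary values.\<close>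

lemma u_le: assumes w: "cmod w < 1" shows "cmod (u w) <= 1"
proof -
 have h: "u holomorphic_on ball 0 1" by (rule Hinfty_holo[OF uH])
 have P: "(%z. complex_of_real (poisson w z)) : Li"
 proof -
  have c: "continuous_on (sph) (%z. complex_of_real (poisson w z))"
   by (intro continuous_intros continuous_poisson w)
  obtain B where "!!z. z : sph ==> norm (complex_of_real (poisson w z)) <= B"
   using sphere_continuous_bounded[OF c] by blast
  thus ?thesis by (intro LiI[OF measurable_sphere_continuous[OF c]] AE_circleI)
 qed
 have "(%j. LINT z|circle. dil u (rad j) z * of_real (poisson w z)) ----> (LINT z|circle. U z * of_real (poisson w z))"
  by (rule bv_integral[OF uH P])
 moreover have "(LINT z|circle. dil u (rad j) z * of_real (poisson w z)) = u (of_real (rad j) * w)" for j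
  using poisson_integral[OF dil_cont[OF h rad(1,2)] dil_holo[OF h rad(1,2)] w] by (simp add: dil_def)
 moreover have "(%j. u (of_real (rad j) * w)) ----> u w"
 proof -
  have "isCont u w" using continuous_on_interior[OF Hinfty_cont[OF uH]] w by (simp add: interior_open)
  moreover have "(%j. of_real (rad j) * w) ----> of_real 1 * w" by (intro tendsto_intros rad)
  ultimately show ?thesis using isCont_tendsto_compose by fastforce
 qed
 ultimately have eq: "u w = (LINT z|circle. U z * of_real (poisson w z))" using LIMSEQ_unique by fastforce
 have pi: "integrable circle (poisson w)" by (rule integrable_sphere_continuous[OF continuous_poisson[OF w]])
 have "cmod (u w) <= (LINT z|circle. cmod (U z * of_real (poisson w z)))" unfolding eq by (rule integral_norm_bound)
 also have "... = (LINT z|circle. poisson w z)"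
 proof (rule integral_cong_AE)
  show "AE z in circle. cmod (U z * of_real (poisson w z)) = poisson w z"
   using U_unim by eventually_elim (simp add: norm_mult poisson_nonneg[OF w])
  show "(%z. cmod (U z * of_real (poisson w z))) : Bm"
   using Li_measurable[OF Li_mult[OF U_Li P]] by measurable
  show "poisson w : Bm" by (rule measurable_poisson[OF w])
 qed
 also have "... = 1" by (rule poisson_integral_one[OF w])
 finally show ?thesis .
qed

lemma u_lt: assumes w: "cmod w < 1" shows "cmod (u w) < 1"
proof (rule ccontr)
 assume "\<not> cmod (u w) < 1"
 hence 1: "cmod (u w) = 1" using u_le[OF w] by simp
 have "u constant_on ball 0 1"
 proof (rule maximum_modulus_principle[of u "ball 0 1" "ball 0 1" w])
  show "!!z. z : ball 0 1 ==> cmod (u z) <= cmod (u w)" unfolding 1 by (rule u_le) simp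
 qed (use w Hinfty_holo[OF uH] in auto)
 thus False using nc by blast
qed

definition K :: "hl2 set" where "K = HH \<inter> {x. ALL y:Mu ` HH. cip x y = 0}"

lemma csub_K: "csub K" unfolding K_def by (rule csub_Int[OF csub_HH csub_orth])

lemma K_iff: "x : K <-> x : HH & (ALL y:HH. cip x (Mu y) = 0)" by (auto simp: K_def)

lemma K_HH: "x : K ==> x : HH" by (simp add: K_iff)
lemma K_Mu: "x : K ==> y : HH ==> cip x (Mu y) = 0" by (simp add: K_iff)
lemma Mu_K: "x : K ==> y : HH ==> cip (Mu y) x = 0" using K_Mu by (metis cip_commute complex_cnj_zero)

lemmas K_sub = csubD[OF csub_K]

lemma HH_split: "y = zmul (L y) + coef y 0 *C e 0" by (simp add: zmul_L)

lemma coef_Mu_0: assumes y: "y : HH" shows "coef (Mu y) 0 = u 0 * coef y 0"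
proof -
 have "coef (Mu (e 0)) 0 = u 0"
  using bv_HH(2)[OF uH, of 0] by (simp add: mul_e U_Li tay_0)
 moreover have "coef (Mu (zmul (L y))) 0 = 0"
  using coef_zmul_0[OF Mu_HH[OF L_HH[OF y]]] by (simp add: zmul_Mu)
 moreover have "Mu y = Mu (zmul (L y)) + coef y 0 *C Mu (e 0)"
  by (metis HH_split bcl_Mu bcl_add bcl_scaleC)
 ultimately show ?thesis by (simp add: cip_add_left cip_cl)
qed

text \<open>The reproducing kernel of \<open>K\<close> at 0 (\<open>coef_k0\<close>);
  \<open>kt\<close> is its image under the conjugation (\<open>Cc_k0\<close>).\<close>

definition k0 :: hl2 where "k0 = e 0 - cnj (u 0) *C Mu (e 0)"
definition kt :: hl2 where "kt = L (Mu (e 0))"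
text \<open>The value of \<open>k0\<close> at 0, which is also its squared norm; it is positive
  because \<open>u\<close> is nonconstant.\<close>

definition n0 :: complex where "n0 = 1 - u 0 * cnj (u 0)"

lemma n0_real: "n0 = of_real (1 - (cmod (u 0))^2)" by (simp only: n0_def of_real_diff of_real_1 complex_norm_square)

lemma n0_pos: "1 - (cmod (u 0))^2 > 0" using u_lt[of 0] by (simp add: abs_square_less_1)

lemma n0_ne: "n0 ~= 0" "cnj n0 = n0" using n0_pos unfolding n0_real by (auto simp del: of_real_diff)

lemma e0_Mu: "y : HH ==> cip (e 0) (Mu y) = cnj (u 0) * cip (e 0) y"
 using coef_Mu_0[of y] by (metis cip_commute complex_cnj_mult)

lemma k0_K: "k0 : K"
 unfolding K_iff k0_def
 by (auto simp: e_HH Mu_HH csubD[OF csub_HH] cip_diff_left cip_cl cip_Mu_Mu e0_Mu)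

lemma coef_k0: "f : K ==> cip f k0 = coef f 0"
 by (simp add: k0_def cip_diff_right cip_cr K_Mu e_HH)

lemma k0_coef: "f : K ==> cip k0 f = cnj (coef f 0)"
 using coef_k0 by (metis cip_commute)

lemma coef_k0_0: "coef k0 0 = n0"
 by (simp add: k0_def cip_diff_left cip_cl cip_e_e coef_Mu_0 e_HH n0_def mult.commute)

lemma L_K: assumes f: "f : K" shows "L f : K"
 unfolding K_iff
proof (intro conjI ballI)
 show "L f : HH" by (rule L_HH[OF K_HH[OF f]])
 fix y assume y: "y : HH"
 show "cip (L f) (Mu y) = 0"
  by (simp add: cip_L K_HH f Mu_HH y zmul_Mu K_Mu zmul_HH)
qed

lemma kt_K: "kt : K"
 unfolding K_iff kt_def
proof (intro conjI ballI)
 show "L (Mu (e 0)) : HH" by (simp add: L_HH Mu_HH e_HH)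
 fix y assume y: "y : HH"
 have "cip (e 0) (zmul y) = 0" using coef_zmul_0[OF y] by (metis cip_commute complex_cnj_zero)
 thus "cip (L (Mu (e 0))) (Mu y) = 0"
  by (simp add: cip_L Mu_HH e_HH y zmul_Mu cip_Mu_Mu)
qed

lemma L_e0: "L (e 0) = 0" by (simp add: L_def cip_e_e bcl_zero bcl_mul Li_pow)

lemma L_k0: "L k0 = - (cnj (u 0) *C kt)"
 by (simp add: k0_def kt_def bcl_diff[OF bcl_L] bcl_scaleC[OF bcl_L] L_e0)

definition S :: "hl2 => hl2" where "S x = PM K (zmul x)"

lemma bcl_S: "bcl S" unfolding S_def by (intro bcl_compose[OF bcl_PM[OF csub_K] bcl_mul] Li_pow)

lemma S_K: "S x : K" unfolding S_def by (rule PM_in[OF csub_K])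

lemma cip_S: "f : K ==> g : K ==> cip (S f) g = cip f (L g)"
 by (simp add: S_def PM_cip csub_K cip_zmul_HH K_HH)

lemma cip_S_right: "f : K ==> g : K ==> cip g (S f) = cip (L g) f"
 using cip_S by (metis cip_commute)

text \<open>For \<open>h\<close> in \<open>K\<close>, the function \<open>zmul h\<close> leaves
  \<open>K\<close> only along \<open>Mu (e 0)\<close>, and its component there is
  \<open>cip h kt\<close>.\<close>

lemma S_eq: assumes h: "h : K" shows "S h = zmul h - cip h kt *C Mu (e 0)"
 unfolding S_def
proof (rule PM_unique[OF csub_K])
 have hH: "h : HH" by (rule K_HH[OF h])
 have 1: "cip (zmul h) (Mu (e 0)) = cip h kt" unfolding kt_def by (rule cip_zmul_HH[OF hH])
 show "zmul h - cip h kt *C Mu (e 0) : K"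
  unfolding K_iff
 proof (intro conjI ballI)
  show "zmul h - cip h kt *C Mu (e 0) : HH"
   by (simp add: csubD[OF csub_HH] zmul_HH hH Mu_HH e_HH)
  fix y assume y: "y : HH"
  have "Mu y = zmul (Mu (L y)) + coef y 0 *C Mu (e 0)"
   by (metis HH_split bcl_Mu bcl_add bcl_scaleC zmul_Mu(1))
  hence "cip (zmul h) (Mu y) = cip (zmul h) (zmul (Mu (L y))) + cnj (coef y 0) * cip h kt"
   by (simp only: cip_add_right cip_cr 1)
  also have "cip (zmul h) (zmul (Mu (L y))) = cip h (Mu (L y))" by (simp add: cip_zmul(1))
  also have "cip h (Mu (L y)) = 0" by (rule K_Mu[OF h L_HH[OF y]])
  finally show "cip (zmul h - cip h kt *C Mu (e 0)) (Mu y) = 0"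
   using cip_commute[of "e 0" y] by (simp add: cip_diff_left cip_cl cip_Mu_Mu)
 qed
 show "cip (zmul h - cip h kt *C Mu (e 0)) v = cip (zmul h) v" if "v : K" for v
  by (simp add: cip_diff_left cip_cl Mu_K that e_HH)
qed

lemma L_S: "h : K ==> L (S h) = h - cip h kt *C kt"
 by (simp add: S_eq bcl_diff[OF bcl_L] bcl_scaleC[OF bcl_L] L_zmul K_HH kt_def)

lemma coef_S_0: "h : K ==> coef (S h) 0 = - (u 0 * cip h kt)"
 by (simp add: S_eq cip_diff_left cip_cl coef_zmul_0 K_HH coef_Mu_0 e_HH cip_e_e)

definition Cc :: "hl2 => hl2" where "Cc x = Mu (zbmul (cj x))"

lemma Cc_add: "Cc (x + y) = Cc x + Cc y"
 by (simp add: Cc_def cj_add mul_add U_Li Li_pow)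

lemma Cc_scaleC: "Cc (c *C x) = cnj c *C Cc x"
 by (simp add: Cc_def cj_scaleC mul_scaleC U_Li Li_pow)

lemma Cc_minus: "Cc (- x) = - Cc x"
 using Cc_scaleC[of "-1" x] by (simp add: scaleC_minus_one)

lemma Cc_Cc [simp]: "Cc (Cc x) = x"
proof -
 have "cj (Mu (zbmul (cj x))) = Mub (zmul x)" by (simp add: cj_mul U_Li Li_pow)
 hence "Cc (Cc x) = Mu (zbmul (Mub (zmul x)))" by (simp add: Cc_def)
 also have "zbmul (Mub (zmul x)) = Mub (zbmul (zmul x))" by (rule zmul_Mub)
 finally show ?thesis by simp
qed

lemma cip_Cc: "cip (Cc x) (Cc y) = cip y x"
 by (simp add: Cc_def cip_Mu_Mu cip_zmul cip_cj)

lemma cip_Cc_swap: "cip (Cc x) y = cip (Cc y) x"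
 using cip_Cc[of x "Cc y"] by simp

lemma cip_Cc_swap': "cip x (Cc y) = cip y (Cc x)"
 using cip_Cc[of "Cc x" y] by simp

lemma Cc_K: assumes x: "x : K" shows "Cc x : K"
 unfolding K_iff
proof (intro conjI ballI)
 show "Cc x : HH"
  unfolding HH_iff
 proof
  fix n
  have "cip (Cc x) (em (Suc n)) = cip (cj x) (zmul (Mub (zbmul (em n))))"
   by (simp add: Cc_def cip_Mu cip_zmul zbmul_em)
  also have "zmul (Mub (zbmul (em n))) = Mub (zmul (zbmul (em n)))"
   by (simp add: mul_mul Ub_Li Li_pow Li_mult ac_simps del: zmul_zbmul)
  also have "... = cj (Mu (e n))" by (simp add: cj_mul U_Li cj_e)
  also have "cip (cj x) (cj (Mu (e n))) = cip (Mu (e n)) x" by (rule cip_cj)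
  also have "... = 0" by (rule Mu_K[OF x e_HH])
  finally show "cip (Cc x) (em (Suc n)) = 0" .
 qed
 fix y assume y: "y : HH"
 have "cip (Cc x) (Mu y) = cip (zbmul (cj x)) y" by (simp add: Cc_def cip_Mu_Mu)
 also have "... = 0" using cip_zbmul_cj[OF K_HH[OF x] y] by (metis cip_commute complex_cnj_zero)
 finally show "cip (Cc x) (Mu y) = 0" .
qed

lemma Cc_k0: "Cc k0 = kt"
proof -
 have 1: "coef (Mu (e 0)) 0 = u 0" by (simp add: coef_Mu_0 e_HH cip_e_e)
 have "Cc k0 = Mu (zbmul (e 0)) - u 0 *C Mu (zbmul (Mub (e 0)))"
  unfolding Cc_def k0_def
  unfolding cj_diff
  by (simp add: cj_scaleC cj_mul U_Li cj_e e_0[symmetric]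
    bcl_diff[OF bcl_mul] mul_scaleC Li_pow Ub_Li)
 also have "Mu (zbmul (Mub (e 0))) = zbmul (e 0)"
  by (simp add: zmul_Mu(2)[symmetric])
 also have "Mu (zbmul (e 0)) - u 0 *C zbmul (e 0) = L (Mu (e 0))"
  unfolding L_def 1 by (simp add: bcl_diff[OF bcl_mul] mul_scaleC Li_pow zmul_Mu(2))
 finally show ?thesis by (simp add: kt_def)
qed

lemma Cc_kt: "Cc kt = k0" using Cc_Cc[of k0] by (simp add: Cc_k0)

text \<open>Under the conjugation, subtracting the value at 0 becomes subtracting a multiple of
  \<open>Mu (e 0)\<close>, which the projection to \<open>K\<close> removes.\<close>

lemma S_Cc: assumes f: "f : K" shows "S (Cc f) = Cc (L f)"
 unfolding S_def
proof (rule PM_unique[OF csub_K])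
 show "Cc (L f) : K" by (rule Cc_K[OF L_K[OF f]])
 fix v assume v: "v : K"
 have "Cc (L f) = Mu (zbmul (cj (zbmul (f - coef f 0 *C e 0))))" by (simp add: Cc_def L_def)
 also have "... = Mu (cj (f - coef f 0 *C e 0))" by (simp add: cj_mul Li_pow)
 also have "cj (f - coef f 0 *C e 0) = cj f - cnj (coef f 0) *C e 0"
  by (simp add: cj_diff cj_scaleC cj_e e_0[symmetric])
 finally have "Cc (L f) = Mu (cj f) - cnj (coef f 0) *C Mu (e 0)"
  by (simp add: bcl_diff[OF bcl_Mu] bcl_scaleC[OF bcl_Mu])
 hence "cip (Cc (L f)) v = cip (Mu (cj f)) v" by (simp add: cip_diff_left cip_cl Mu_K v e_HH)
 also have "Mu (cj f) = zmul (Cc f)" by (simp add: Cc_def zmul_Mu)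
 finally show "cip (Cc (L f)) v = cip (zmul (Cc f)) v" .
qed

end

section \<open>Truncated Toeplitz operators through their forms\<close>

context inner_fn
begin

text \<open>Operators are bounded on all of \<open>hl2\<close>, where adjoints exist; what counts is
  the restriction to \<open>K\<close>.\<close>

definition opK :: "(hl2 => hl2) => bool" where
 "opK A <-> bcl A & (ALL f:K. A f : K)"

lemma opK_bcl: "opK A ==> bcl A" and opK_K: "opK A ==> f : K ==> A f : K"
 by (auto simp: opK_def)

lemma opK_compose: "opK A ==> opK B ==> opK (%x. A (B x))"
 by (auto simp: opK_def bcl_compose)

definition dA :: "(hl2 => hl2) => hl2 => hl2 => complex" where
 "dA A f g = cip (A f) g - cip (A (L f)) (L g)"

definition tform :: "(hl2 => hl2) => hl2 => hl2 => bool" where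
 "tform A \<phi> \<eta> <-> \<phi> : K & \<eta> : K \<and>
   (ALL f:K. ALL g:K. dA A f g = coef f 0 * cip \<phi> g + cnj (coef g 0) * cip f \<eta>)"

definition Csym :: "(hl2 => hl2) => bool" where
 "Csym A <-> (ALL f:K. ALL g:K. cip (A (Cc f)) (Cc g) = cip (A g) f)"

lemma tform_D: "tform A \<phi> \<eta> ==> f : K ==> g : K ==>
  cip (A f) g - cip (A (L f)) (L g) = coef f 0 * cip \<phi> g + cnj (coef g 0) * cip f \<eta>"
 by (auto simp: tform_def dA_def)

lemma L_pow_K: "f : K ==> (L ^^ n) f : K" by (induction n) (auto simp: L_K)

text \<open>A vanishing form allows replacing \<open>f\<close> and \<open>g\<close> by
  \<open>L f\<close> and \<open>L g\<close>; the iterates of both tend to 0.\<close>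

lemma dA_zero_imp:
 assumes A: "opK A" and d: "!!f g. f : K ==> g : K ==> dA A f g = 0" and f: "f : K"
 shows "A f = 0"
proof -
 obtain C where C: "C > 0" "!!x. norm (A x) <= C * norm x" using bcl_bound[OF opK_bcl[OF A]] by blast
 have "cip (A f) g = 0" if g: "g : K" for g
 proof -
  have eq: "cip (A f) g = cip (A ((L ^^ n) f)) ((L ^^ n) g)" for n
  proof (induction n)
   case (Suc n)
   thus ?case using d[OF L_pow_K[OF f, of n] L_pow_K[OF g, of n]] by (simp add: dA_def)
  qed simp
  have "(%n. cip (A ((L ^^ n) f)) ((L ^^ n) g)) ----> cip (A 0) 0"
   by (intro tendsto_cip tendsto_bcl[OF opK_bcl[OF A]] L_pow_tendsto K_HH f g)
  thus ?thesis unfolding eq[symmetric] by (simp add: LIMSEQ_const_iff)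
 qed
 thus ?thesis using csub_eqI[OF csub_K opK_K[OF A f] K_sub(1)] by simp
qed

lemma proj_k0:
 assumes f: "f : K"
 shows "f - (coef f 0 / n0) *C k0 : K" "coef (f - (coef f 0 / n0) *C k0) 0 = 0"
 using n0_ne by (auto simp: K_sub f k0_K cip_diff_left cip_cl coef_k0_0)

lemma mod_k0_zero:
 assumes x: "x : K" and 0: "!!g. g : K ==> coef g 0 = 0 ==> cip x g = 0"
 shows "x = (coef x 0 / n0) *C k0"
proof -
 let ?y = "x - (coef x 0 / n0) *C k0"
 have "cip ?y ?y = cip x ?y - (coef x 0 / n0) * cip k0 ?y" by (simp only: cip_diff_left cip_cl)
 also have "... = 0" using 0[OF proj_k0[OF x]] k0_coef[OF proj_k0(1)[OF x]] proj_k0(2)[OF x] by simp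
 finally show ?thesis by (simp add: cip_self_eq_0)
qed

text \<open>Every element of \<open>K\<close> is a multiple of \<open>k0\<close> plus a function
  vanishing at 0. By hypothesis the form is then determined by its values with \<open>k0\<close> in
  one of the slots, and these values are represented by \<phi> and \<eta>.\<close>

lemma tform_of_vanishing:
 assumes A: "opK A" and d: "!!f g. f : K ==> g : K ==> coef f 0 = 0 ==> coef g 0 = 0 ==> dA A f g = 0"
 shows "EX \<phi> \<eta>. tform A \<phi> \<eta>"
proof -
 have B: "bcl A" by (rule opK_bcl[OF A])
 have d_add: "dA A (f + f') g = dA A f g + dA A f' g" for f f' g
  by (simp add: dA_def bcl_add[OF B] bcl_add[OF bcl_L] cip_add_left)
 have d_sc: "dA A (c *C f) g = c * dA A f g" for c f g
  by (simp add: dA_def bcl_scaleC[OF B] bcl_scaleC[OF bcl_L] cip_cl right_diff_distrib)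
 have d_add': "dA A f (g + g') = dA A f g + dA A f g'" for f g g'
  by (simp add: dA_def bcl_add[OF bcl_L] cip_add_right)
 have d_sc': "dA A f (c *C g) = cnj c * dA A f g" for c f g
  by (simp add: dA_def bcl_scaleC[OF bcl_L] cip_cr right_diff_distrib)
 define \<phi>0 where "\<phi>0 = A k0 - S (A (L k0))"
 define \<eta>0 where "\<eta>0 = PM K (adj A k0) - S (PM K (adj A (L k0)))"
 have p0: "dA A k0 g = cip \<phi>0 g" if "g : K" for g
  by (simp add: dA_def \<phi>0_def cip_diff_left cip_S L_K k0_K opK_K[OF A] that)
 have x0: "dA A f k0 = cip f \<eta>0" if "f : K" for f
  by (simp add: dA_def \<eta>0_def cip_diff_right cip_S_right L_K k0_K PM_in csub_K PM_cip_right that cip_adj[OF B])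
 \<comment> \<open>Both vectors would account for the value of the form at (\<open>k0\<close>,
   \<open>k0\<close>); \<kappa> removes it from \<eta>.\<close>
 define \<kappa> where "\<kappa> = dA A k0 k0 / (n0 * n0)"
 define \<phi> where "\<phi> = (1 / n0) *C \<phi>0"
 define \<eta> where "\<eta> = (1 / n0) *C \<eta>0 - cnj \<kappa> *C k0"
 have "tform A \<phi> \<eta>"
  unfolding tform_def
 proof (intro conjI ballI)
  show "\<phi> : K" by (simp add: \<phi>_def \<phi>0_def K_sub opK_K[OF A] k0_K S_K)
  show "\<eta> : K" by (simp add: \<eta>_def \<eta>0_def K_sub PM_in csub_K k0_K S_K)
  fix f g assume f: "f : K" and g: "g : K"
  define a where "a = coef f 0 / n0"
  define b where "b = coef g 0 / n0"
  define f' where "f' = f - a *C k0"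
  define g' where "g' = g - b *C k0"
  have fg: "f = f' + a *C k0" "g = g' + b *C k0" by (simp_all add: f'_def g'_def)
  have f': "f' : K" "coef f' 0 = 0" using proj_k0[OF f] by (auto simp: f'_def a_def)
  have g': "g' : K" "coef g' 0 = 0" using proj_k0[OF g] by (auto simp: g'_def b_def)
  have "dA A f g = dA A f' g + a * dA A k0 g" by (subst fg(1)) (simp only: d_add d_sc)
  also have "dA A f' g = dA A f' g' + cnj b * dA A f' k0" by (subst fg(2)) (simp only: d_add' d_sc')
  also have "dA A f' g' = 0" by (rule d[OF f'(1) g'(1) f'(2) g'(2)])
  also have "dA A f' k0 = dA A f k0 - a * dA A k0 k0"
   using arg_cong[OF fg(1), of "%f. dA A f k0"] by (simp only: d_add d_sc add_diff_cancel_right')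
  finally have "dA A f g = cnj b * (dA A f k0 - a * dA A k0 k0) + a * dA A k0 g" by simp
  also have "... = coef f 0 * cip \<phi> g + cnj (coef g 0) * cip f \<eta>"
   using n0_ne by (simp add: p0 x0 f g \<phi>_def \<eta>_def cip_diff_right cip_cl cip_cr coef_k0 a_def b_def \<kappa>_def field_simps)
  finally show "dA A f g = coef f 0 * cip \<phi> g + cnj (coef g 0) * cip f \<eta>" .
 qed
 thus ?thesis by blast
qed

lemma tform_vanish: "tform A \<phi> \<eta> ==> f : K ==> g : K ==> coef f 0 = 0 ==> coef g 0 = 0 ==> dA A f g = 0"
 by (simp add: tform_def)

lemma cip_Cc_kt: "g : K ==> cip (Cc g) kt = cnj (coef g 0)"
 using cip_Cc[of g k0] by (simp add: Cc_k0 k0_coef)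

lemma coef_SC_0: "g : K ==> coef g 0 = 0 ==> coef (S (Cc g)) 0 = 0"
 by (simp add: coef_S_0 Cc_K cip_Cc_kt)

lemma cip_SC_swap:
 assumes x: "x : K" and f: "f : K" shows "cip f (S (Cc x)) = cip x (S (Cc f))"
proof -
 have "cip f (S (Cc x)) = cip (L f) (Cc x)" by (rule cip_S_right[OF Cc_K[OF x] f])
 also have "... = cip x (Cc (L f))" by (rule cip_Cc_swap')
 finally show ?thesis by (simp only: S_Cc[OF f])
qed

lemma cip_L_L: "x : HH ==> g : HH ==> cip (L x) (L g) = cip x g - coef x 0 * cnj (coef g 0)"
 by (simp add: cip_L L_HH zmul_L cip_diff_right cip_cr)

text \<open>\<open>S\<close> after \<open>Cc\<close> is an antilinear map whose square is
  \<open>S\<close> after \<open>L\<close> on \<open>K\<close>, and against functions vanishing at 0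
  that square acts as the identity.\<close>

lemma SC_dual:
 assumes x: "x : K" and g: "g : K" "coef g 0 = 0"
 shows "cip (S (Cc x)) (S (Cc g)) = cip g x"
proof -
 have "cip (S (Cc x)) (S (Cc g)) = cip g (S (Cc (S (Cc x))))" by (rule cip_SC_swap[OF S_K g(1), symmetric])
 also have "S (Cc (S (Cc x))) = S (L x)" by (simp add: S_Cc x)
 also have "cip g ... = cip (L g) (L x)" by (rule cip_S_right[OF L_K[OF x] g(1)])
 finally show ?thesis by (simp add: cip_L_L K_HH x g)
qed

lemma SC_mod_zero:
 assumes x: "x : K" and 0: "!!g. g : K ==> coef g 0 = 0 ==> cip (S (Cc x)) g = 0"
  and g: "g : K" "coef g 0 = 0"
 shows "cip x g = 0"
 using SC_dual[OF x g] 0[OF S_K coef_SC_0[OF g]] by (metis cip_commute complex_cnj_zero)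

text \<open>The values of a symmetric operator at \<open>k0\<close> and \<open>kt\<close> solve a linear system with determinant \<open>n0\<close>.\<close>

lemma tform_right_values:
 assumes A: "opK A" and T: "tform A \<phi> \<eta>" and C: "Csym A" and g: "g : K" "coef g 0 = 0"
 shows "cip (A k0) g = cip \<phi> g - cnj (u 0) * cip (S (Cc \<eta>)) g"
  "cip (A kt) (L g) = cip (S (Cc \<eta>)) g - u 0 * cip \<phi> g"
proof -
 have K: "\<phi> : K" "\<eta> : K" using T by (auto simp: tform_def)
 have B: "bcl A" by (rule opK_bcl[OF A])
 define q p s y where "q = cip (A k0) g" "p = cip (A kt) (L g)" "s = cip (S (Cc \<eta>)) g" "y = cip \<phi> g"
 have 1: "q + cnj (u 0) * p = n0 * y"
  using tform_D[OF T k0_K g(1)] g(2) unfolding q_p_s_y_def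
  by (simp add: L_k0 bcl_minus[OF B] bcl_scaleC[OF B] cip_minus_left cip_cl coef_k0_0)
 \<comment> \<open>The second equation of the system is the form at (\<open>?h\<close>,
   \<open>k0\<close>): \<open>L\<close> takes \<open>?h\<close> to \<open>Cc g\<close>, and the
   symmetry of \<open>A\<close> turns all terms into \<open>q\<close>, \<open>p\<close> and
   \<open>s\<close>.\<close>
 let ?h = "S (Cc g)"
 have hK: "?h : K" by (rule S_K)
 have h0: "coef ?h 0 = 0" by (rule coef_SC_0[OF g])
 have Lh: "L ?h = Cc g" by (simp add: L_S Cc_K g cip_Cc_kt)
 have "cip (A ?h) k0 - cip (A (Cc g)) (L k0) = n0 * cip ?h \<eta>"
  using tform_D[OF T hK k0_K] h0 n0_ne by (simp add: Lh coef_k0_0)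
 moreover have "cip (A ?h) k0 = p"
 proof -
  have "cip (A (Cc (L g))) (Cc kt) = cip (A kt) (L g)"
   using C L_K[OF g(1)] kt_K unfolding Csym_def by blast
  thus ?thesis by (simp add: S_Cc g Cc_kt q_p_s_y_def)
 qed
 moreover have "cip (A (Cc g)) (L k0) = - (u 0 * q)"
 proof -
  have "cip (A (Cc g)) (Cc k0) = cip (A k0) g" using C g(1) k0_K unfolding Csym_def by blast
  thus ?thesis by (simp add: L_k0 cip_minus_right cip_cr Cc_k0 q_p_s_y_def)
 qed
 moreover have "cip ?h \<eta> = s"
 proof -
  have "cip ?h \<eta> = cip (Cc \<eta>) (L g)" by (simp add: S_Cc g cip_Cc_swap[of "L g"])
  also have "... = s" unfolding q_p_s_y_def by (rule cip_S[symmetric]) (simp_all add: Cc_K K g)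
  finally show ?thesis .
 qed
 ultimately have 2: "p + u 0 * q = n0 * s" by simp
 have "n0 * q = n0 * (y - cnj (u 0) * s)"
 proof -
  have "n0 * q = (q + cnj (u 0) * p) - cnj (u 0) * (p + u 0 * q)" by (simp add: n0_def algebra_simps)
  thus ?thesis unfolding 1 2 by (simp add: algebra_simps)
 qed
 hence q: "q = y - cnj (u 0) * s" using n0_ne by simp
 have "n0 * p = n0 * (s - u 0 * y)"
 proof -
  have "n0 * p = (p + u 0 * q) - u 0 * (q + cnj (u 0) * p)" by (simp add: n0_def algebra_simps)
  thus ?thesis unfolding 1 2 by (simp add: algebra_simps)
 qed
 hence "p = s - u 0 * y" using n0_ne by simp
 with q show "cip (A k0) g = cip \<phi> g - cnj (u 0) * cip (S (Cc \<eta>)) g"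
  "cip (A kt) (L g) = cip (S (Cc \<eta>)) g - u 0 * cip \<phi> g" by (simp_all add: q_p_s_y_def)
qed

text \<open>Symmetry of \<open>A\<close> turns left values at \<open>f\<close> into right values at
  \<open>S (Cc f)\<close>, which again vanishes at 0 and which \<open>L\<close> takes to
  \<open>Cc f\<close>.\<close>

lemma tform_left_values:
 assumes A: "opK A" and T: "tform A \<phi> \<eta>" and C: "Csym A" and f: "f : K" "coef f 0 = 0"
 shows "cip (A f) k0 = cip f \<eta> - u 0 * cip f (S (Cc \<phi>))"
  "cip (A (L f)) kt = cip f (S (Cc \<phi>)) - cnj (u 0) * cip f \<eta>"
proof -
 have K: "\<phi> : K" "\<eta> : K" using T by (auto simp: tform_def)
 have C: "cip (A y) x = cip (A (Cc x)) (Cc y)" if "x : K" "y : K" for x y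
  using C that unfolding Csym_def by metis
 have Lh: "L (S (Cc f)) = Cc f" by (simp add: L_S Cc_K f cip_Cc_kt)
 note v = tform_right_values[OF A T assms(3) S_K coef_SC_0[OF f]]
 show "cip (A f) k0 = cip f \<eta> - u 0 * cip f (S (Cc \<phi>))"
  using v(2) C[OF k0_K f(1)] by (simp only: Lh Cc_k0 SC_dual[OF K(2) f] cip_SC_swap[OF K(1) f(1)])
 show "cip (A (L f)) kt = cip f (S (Cc \<phi>)) - cnj (u 0) * cip f \<eta>"
  using v(1) C[OF kt_K L_K[OF f(1)]] by (simp only: S_Cc[OF f(1), symmetric] Cc_kt SC_dual[OF K(2) f] cip_SC_swap[OF K(1) f(1)])
qed

text \<open>When \<open>f\<close> vanishes at 0, \<open>A2\<close> commutes with \<open>L\<close> up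
  to a multiple of \<open>kt\<close>. The form of the product is therefore the form of
  \<open>A1\<close> at \<open>A2 f\<close> plus a term in \<open>A1 kt\<close>, and both are known.
  In the result the contributions of \<open>u 0\<close> cancel.\<close>

lemma product_form:
 assumes A1: "opK A1" "tform A1 \<phi>1 \<eta>1" "Csym A1" and A2: "opK A2" "tform A2 \<phi>2 \<eta>2" "Csym A2"
  and f: "f : K" "coef f 0 = 0" and g: "g : K" "coef g 0 = 0"
 shows "dA (%x. A1 (A2 x)) f g = cip f \<eta>2 * cip \<phi>1 g - cip f (S (Cc \<phi>2)) * cip (S (Cc \<eta>1)) g"
proof -
 have B1: "bcl A1" by (rule opK_bcl[OF A1(1)])
 define w where "w = L (A2 f) - A2 (L f)"
 define x t where "x = cip f \<eta>2" "t = cip f (S (Cc \<phi>2))"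
 have wK: "w : K" by (simp add: w_def K_sub L_K opK_K[OF A2(1)] f)
 have w: "w = - (t *C kt)"
 proof (rule csub_eqI[OF csub_K wK])
  show "- (t *C kt) : K" by (simp add: K_sub kt_K)
  fix h assume h: "h : K"
  \<comment> \<open>The form of \<open>A2\<close> at (\<open>f\<close>, \<open>S h\<close>):
    \<open>S\<close> is adjoint to \<open>L\<close>, and \<open>L (S h)\<close> differs from
    \<open>h\<close> by a multiple of \<open>kt\<close>, so this tests \<open>w\<close> against
    \<open>h\<close>.\<close>
  have "cip (A2 f) (S h) - cip (A2 (L f)) (L (S h)) = cnj (coef (S h) 0) * x"
   using tform_D[OF A2(2) f(1) S_K[of h]] f(2) by (simp add: x_t_def)
  hence "cip (L (A2 f)) h - (cip (A2 (L f)) h - cnj (cip h kt) * cip (A2 (L f)) kt) = - (cnj (u 0) * cnj (cip h kt) * x)"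
   by (simp add: cip_S_right h opK_K[OF A2(1)] f L_S cip_diff_right cip_cr coef_S_0)
  hence "cip w h = - (cnj (cip h kt) * (cip (A2 (L f)) kt + cnj (u 0) * x))"
   by (simp add: w_def cip_diff_left algebra_simps)
  also have "cip (A2 (L f)) kt + cnj (u 0) * x = t"
   using tform_left_values(2)[OF A2 f] by (simp add: x_t_def)
  also have "cnj (cip h kt) = cip kt h" by (metis cip_commute)
  finally show "cip w h = cip (- (t *C kt)) h" by (simp add: cip_minus_left cip_cl)
 qed
 have "dA (%x. A1 (A2 x)) f g = (cip (A1 (A2 f)) g - cip (A1 (L (A2 f))) (L g)) + cip (A1 w) (L g)"
  by (simp add: dA_def w_def bcl_diff[OF B1] cip_diff_left)
 also have "cip (A1 (A2 f)) g - cip (A1 (L (A2 f))) (L g) = coef (A2 f) 0 * cip \<phi>1 g"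
  using tform_D[OF A1(2) opK_K[OF A2(1) f(1)] g(1)] g(2) by simp
 also have "coef (A2 f) 0 = x - u 0 * t"
  using tform_left_values(1)[OF A2 f] coef_k0[OF opK_K[OF A2(1) f(1)]] by (simp add: x_t_def)
 also have "cip (A1 w) (L g) = - (t * (cip (S (Cc \<eta>1)) g - u 0 * cip \<phi>1 g))"
  using tform_right_values(2)[OF A1 g]
  by (simp add: w bcl_minus[OF B1] bcl_scaleC[OF B1] cip_minus_left cip_cl)
 finally show ?thesis by (simp add: x_t_def algebra_simps)
qed

text \<open>Proportionality modulo \<open>k0\<close>, since \<phi> and \<eta> are determined only up
  to the exchange of a multiple of \<open>k0\<close>. That this is the Sedlock class of \<alpha> is
  \<open>sedA_iff_symb\<close>.\<close>

definition sedA :: "complex => (hl2 => hl2) => bool" where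
 "sedA \<alpha> A <-> (EX \<phi> \<eta>. tform A \<phi> \<eta> & (ALL g:K. coef g 0 = 0 --> cip (S (Cc \<eta>)) g = \<alpha> * cip \<phi> g))"

definition sedInf :: "(hl2 => hl2) => bool" where
 "sedInf A <-> (EX \<phi> \<eta>. tform A \<phi> \<eta> & (ALL g:K. coef g 0 = 0 --> cip \<phi> g = 0))"

text \<open>Both vectors are multiples of \<open>k0\<close>, so the form is a multiple of f(0) times
  the conjugate of g(0), which is the form of the identity.\<close>

lemma scalar_of_tform:
 assumes A: "opK A" and T: "tform A \<phi> \<eta>"
  and p: "!!g. g : K ==> coef g 0 = 0 ==> cip \<phi> g = 0"
  and x: "!!g. g : K ==> coef g 0 = 0 ==> cip \<eta> g = 0"
 shows "EX c. ALL f:K. A f = c *C f"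
proof -
 have B: "bcl A" by (rule opK_bcl[OF A])
 have K: "\<phi> : K" "\<eta> : K" using T by (auto simp: tform_def)
 define c where "c = coef \<phi> 0 / n0 + cnj (coef \<eta> 0 / n0)"
 have pe: "\<phi> = (coef \<phi> 0 / n0) *C k0" by (rule mod_k0_zero[OF K(1) p])
 have xe: "\<eta> = (coef \<eta> 0 / n0) *C k0" by (rule mod_k0_zero[OF K(2) x])
 let ?A = "%f. A f - c *C f"
 have A': "opK ?A" using A by (auto simp: opK_def K_sub intro!: bcl_minus2 bcl_scale bcl_id)
 have "?A f = 0" if "f : K" for f
 proof (rule dA_zero_imp[OF A' _ that])
  fix f g assume f: "f : K" and g: "g : K"
  have id: "cip f g - cip (L f) (L g) = coef f 0 * cnj (coef g 0)"
   by (simp add: cip_L_L K_HH f g)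
  have "dA ?A f g = dA A f g - c * (cip f g - cip (L f) (L g))"
   by (simp add: dA_def cip_diff_left cip_cl algebra_simps)
  also have "dA A f g = coef f 0 * cip \<phi> g + cnj (coef g 0) * cip f \<eta>" using T f g by (simp add: tform_def)
  also have "cip \<phi> g = coef \<phi> 0 / n0 * cnj (coef g 0)"
   by (subst pe) (simp add: cip_cl k0_coef g)
  also have "cip f \<eta> = cnj (coef \<eta> 0 / n0) * coef f 0"
   by (subst xe) (simp only: cip_cr coef_k0[OF f])
  finally show "dA ?A f g = 0" unfolding id c_def by (simp add: algebra_simps)
 qed
 thus ?thesis by (intro exI[of _ c]) auto
qed

text \<open>By \<open>product_form\<close> two rank-one forms agree on functions vanishing at 0. If
  they are nonzero, their factors are proportional with a common ratio. If they vanish, the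
  operators being nonscalar decides which factors are trivial: a trivial \<phi> of \<open>A1\<close>
  leads to the class of \<infinity>, a trivial \<eta> of \<open>A2\<close> to the class of
  0.\<close>

theorem sedlock_product:
 assumes A1: "opK A1" "tform A1 \<phi>1 \<eta>1" "Csym A1" and A2: "opK A2" "tform A2 \<phi>2 \<eta>2" "Csym A2"
  and n1: "\<not> (EX c. ALL f:K. A1 f = c *C f)" and n2: "\<not> (EX c. ALL f:K. A2 f = c *C f)"
  and T: "tform (%x. A1 (A2 x)) \<phi> \<eta>"
 shows "(EX \<alpha>. sedA \<alpha> A1 & sedA \<alpha> A2) \<or> (sedInf A1 & sedInf A2)"
proof -
 have K: "\<phi>1 : K" "\<eta>1 : K" "\<phi>2 : K" "\<eta>2 : K" using A1(2) A2(2) by (auto simp: tform_def)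
 have key: "cip f \<eta>2 * cip \<phi>1 g = cip f (S (Cc \<phi>2)) * cip (S (Cc \<eta>1)) g"
  if "f : K" "coef f 0 = 0" "g : K" "coef g 0 = 0" for f g
  using product_form[OF A1 A2 that] tform_vanish[OF T that(1,3,2,4)] by simp
 define Z where "Z x <-> (ALL g:K. coef g 0 = 0 --> cip x g = 0)" for x
 have Zr: "Z x <-> (ALL g:K. coef g 0 = 0 --> cip g x = 0)" for x
  unfolding Z_def by (metis cip_commute complex_cnj_zero_iff)
 have ZS: "Z x" if "x : K" "Z (S (Cc x))" for x
  using SC_mod_zero[OF that(1)] that(2) unfolding Z_def by blast
 have n1': "\<not> (Z \<phi>1 & Z \<eta>1)" using scalar_of_tform[OF A1(1,2)] n1 unfolding Z_def by blast
 have n2': "\<not> (Z \<phi>2 & Z \<eta>2)" using scalar_of_tform[OF A2(1,2)] n2 unfolding Z_def by blast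
 have rank0: "Z (S (Cc \<phi>2)) \<or> Z (S (Cc \<eta>1))" if "Z \<phi>1 \<or> Z \<eta>2"
 proof (rule ccontr)
  assume "\<not> (Z (S (Cc \<phi>2)) \<or> Z (S (Cc \<eta>1)))"
  then obtain f g where fg: "f : K" "coef f 0 = 0" "cip f (S (Cc \<phi>2)) ~= 0" "g : K" "coef g 0 = 0" "cip (S (Cc \<eta>1)) g ~= 0"
   unfolding Zr[of "S (Cc \<phi>2)"] unfolding Z_def by blast
  have "cip f \<eta>2 * cip \<phi>1 g = 0" using that fg unfolding Zr[of \<eta>2] unfolding Z_def by auto
  thus False using key[OF fg(1,2,4,5)] fg(3,6) by simp
 qed
 show ?thesis
 proof (cases "Z \<phi>1")
  case True
  hence "\<not> Z (S (Cc \<eta>1))" using n1' ZS[OF K(2)] by blast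
  hence "Z \<phi>2" using rank0 True ZS[OF K(3)] by blast
  hence "sedInf A1 & sedInf A2" using True A1(2) A2(2) unfolding sedInf_def Z_def by blast
  thus ?thesis ..
 next
  case p1: False
  show ?thesis
  proof (cases "Z \<eta>2")
   case True
   hence "\<not> Z (S (Cc \<phi>2))" using n2' ZS[OF K(3)] by blast
   hence z1: "Z (S (Cc \<eta>1))" using rank0 True by blast
   have z2: "Z (S (Cc \<eta>2))" unfolding Z_def
   proof (intro ballI impI)
    fix g assume g: "g : K" "coef g 0 = 0"
    have e2: "\<eta>2 = (coef \<eta>2 0 / n0) *C k0" by (rule mod_k0_zero[OF K(4)]) (use True in \<open>auto simp: Z_def\<close>)
    have "S (Cc k0) = - (u 0 *C k0)"
     by (simp add: S_Cc k0_K L_k0 Cc_minus Cc_scaleC Cc_kt)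
    hence "S (Cc \<eta>2) = cnj (coef \<eta>2 0 / n0) *C (- (u 0 *C k0))"
     by (subst e2) (simp only: Cc_scaleC bcl_scaleC[OF bcl_S])
    thus "cip (S (Cc \<eta>2)) g = 0" using k0_coef[OF g(1)] g(2)
     by (simp add: cip_cl cip_minus_left)
   qed
   have "sedA 0 A1 & sedA 0 A2"
    using z1 z2 A1(2) A2(2) unfolding sedA_def Z_def by auto
   thus ?thesis by blast
  next
   case x2: False
   obtain f0 where f0: "f0 : K" "coef f0 0 = 0" "cip f0 \<eta>2 ~= 0" using x2 unfolding Zr by blast
   obtain g0 where g0: "g0 : K" "coef g0 0 = 0" "cip \<phi>1 g0 ~= 0" using p1 unfolding Z_def by blast
   have "cip f0 (S (Cc \<phi>2)) ~= 0" using key[OF f0(1,2) g0(1,2)] f0(3) g0(3) by auto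
   \<comment> \<open>The ratio of the two left factors at one point where the first is nonzero;
     \<open>key\<close> at (\<open>f0\<close>, \<open>g0\<close>) shows that the denominator does
     not vanish.\<close>
   define \<alpha> where "\<alpha> = cip f0 \<eta>2 / cip f0 (S (Cc \<phi>2))"
   have a0: "\<alpha> ~= 0" using f0(3) \<open>cip f0 (S (Cc \<phi>2)) ~= 0\<close> by (simp add: \<alpha>_def)
   have s1: "cip (S (Cc \<eta>1)) g = \<alpha> * cip \<phi>1 g" if "g : K" "coef g 0 = 0" for g
    using key[OF f0(1,2) that] \<open>cip f0 (S (Cc \<phi>2)) ~= 0\<close> by (simp add: \<alpha>_def field_simps)
   have x2e: "cip f \<eta>2 = \<alpha> * cip f (S (Cc \<phi>2))" if "f : K" "coef f 0 = 0" for f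
    using key[OF that g0(1,2)] s1[OF g0(1,2)] g0(3) by simp
   have s2: "cip (S (Cc \<eta>2)) g = \<alpha> * cip \<phi>2 g" if g: "g : K" "coef g 0 = 0" for g
   proof -
    have "cip (S (Cc g)) \<eta>2 = \<alpha> * cip (S (Cc g)) (S (Cc \<phi>2))" by (rule x2e[OF S_K coef_SC_0[OF g]])
    moreover have "cip (S (Cc g)) \<eta>2 = cip (S (Cc \<eta>2)) g"
     using cip_SC_swap[OF g(1) K(4)] by (metis cip_commute)
    moreover have "cip (S (Cc g)) (S (Cc \<phi>2)) = cip \<phi>2 g" using SC_dual[OF K(3) g] by (metis cip_commute)
    ultimately show ?thesis by simp
   qed
   have "sedA \<alpha> A1 & sedA \<alpha> A2" using s1 s2 A1(2) A2(2) unfolding sedA_def by blast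
   thus ?thesis by blast
  qed
 qed
qed

text \<open>With a common ratio the two terms of \<open>product_form\<close> cancel; for the class
  of \<infinity> each of them is zero.\<close>

theorem sedlock_product_converse:
 assumes A1: "opK A1" "Csym A1" and A2: "opK A2" "Csym A2"
  and s: "(sedA \<alpha> A1 & sedA \<alpha> A2) \<or> (sedInf A1 & sedInf A2)"
 shows "EX \<phi> \<eta>. tform (%x. A1 (A2 x)) \<phi> \<eta>"
 using s
proof
 assume "sedA \<alpha> A1 & sedA \<alpha> A2"
 then obtain \<phi>1 \<eta>1 \<phi>2 \<eta>2 where 1: "tform A1 \<phi>1 \<eta>1" "!!g. g : K ==> coef g 0 = 0 ==> cip (S (Cc \<eta>1)) g = \<alpha> * cip \<phi>1 g"
  and 2: "tform A2 \<phi>2 \<eta>2" "!!g. g : K ==> coef g 0 = 0 ==> cip (S (Cc \<eta>2)) g = \<alpha> * cip \<phi>2 g"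
  unfolding sedA_def by blast
 have K: "\<phi>2 : K" "\<eta>2 : K" using 2 by (auto simp: tform_def)
 show ?thesis
 proof (rule tform_of_vanishing[OF opK_compose[OF A1(1) A2(1)]])
  fix f g assume f: "f : K" "coef f 0 = 0" and g: "g : K" "coef g 0 = 0"
  have "cip f \<eta>2 = \<alpha> * cip f (S (Cc \<phi>2))"
   using 2(2)[OF S_K coef_SC_0[OF f]] by (simp only: SC_dual[OF K(2) f] cip_SC_swap[OF K(1) f(1)])
  thus "dA (%x. A1 (A2 x)) f g = 0"
   using product_form[OF A1(1) 1(1) A1(2) A2(1) 2(1) A2(2) f g] 1(2)[OF g] by simp
 qed
next
 assume "sedInf A1 & sedInf A2"
 then obtain \<phi>1 \<eta>1 \<phi>2 \<eta>2 where 1: "tform A1 \<phi>1 \<eta>1" "!!g. g : K ==> coef g 0 = 0 ==> cip \<phi>1 g = 0"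
  and 2: "tform A2 \<phi>2 \<eta>2" "!!g. g : K ==> coef g 0 = 0 ==> cip \<phi>2 g = 0"
  unfolding sedInf_def by blast
 have K: "\<phi>2 : K" "\<eta>2 : K" using 2 by (auto simp: tform_def)
 show ?thesis
 proof (rule tform_of_vanishing[OF opK_compose[OF A1(1) A2(1)]])
  fix f g assume f: "f : K" "coef f 0 = 0" and g: "g : K" "coef g 0 = 0"
  have "cip \<phi>2 (S (Cc f)) = 0" by (rule 2(2)[OF S_K coef_SC_0[OF f]])
  hence "cip f (S (Cc \<phi>2)) = 0" using cip_SC_swap[OF K(1) f(1)] by simp
  thus "dA (%x. A1 (A2 x)) f g = 0"
   using product_form[OF A1(1) 1(1) A1(2) A2(1) 2(1) A2(2) f g] 1(2)[OF g] by simp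
 qed
qed

end

section \<open>The Sedlock classes\<close>

context inner_fn
begin

definition mS :: "complex => hl2 => hl2" where
 "mS a f = S f + (a / (1 - a * cnj (u 0)) * cip f kt) *C k0"

text \<open>The adjoint of \<open>mS a\<close> on \<open>K\<close> (\<open>cip_mS\<close>), a
  rank-one perturbation of the backward shift.\<close>

definition mL :: "complex => hl2 => hl2" where
 "mL a g = L g + (cnj a / (1 - cnj a * u 0) * coef g 0) *C kt"

lemma den_ne: assumes "cmod a <= 1" shows "1 - a * cnj (u 0) ~= 0" "1 - cnj a * u 0 ~= 0"
proof -
 have "cmod (a * cnj (u 0)) < 1"
 proof -
  have "cmod a * cmod (u 0) <= 1 * cmod (u 0)" by (rule mult_right_mono[OF assms]) simp
  also have "... < 1" using u_lt[of 0] by simp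
  finally show ?thesis by (simp add: norm_mult)
 qed
 hence *: "a * cnj (u 0) ~= 1" by auto
 thus "1 - a * cnj (u 0) ~= 0" by simp
 have "cnj (a * cnj (u 0)) ~= cnj 1" using * by (simp only: complex_cnj_cancel_iff not_False_eq_True)
 thus "1 - cnj a * u 0 ~= 0" by simp
qed

lemma bcl_mS: "bcl (mS a)"
proof -
 have "bcl (%f. S f + (a / (1 - a * cnj (u 0))) *C (cip f kt *C k0))"
  by (intro bcl_plus bcl_S bcl_scale bcl_rank1)
 thus ?thesis unfolding mS_def[abs_def] scaleC_scaleC .
qed

lemma bcl_mL: "bcl (mL a)"
proof -
 have "bcl (%f. L f + (cnj a / (1 - cnj a * u 0)) *C (cip f (e 0) *C kt))"
  by (intro bcl_plus bcl_L bcl_scale bcl_rank1)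
 thus ?thesis unfolding mL_def[abs_def] scaleC_scaleC .
qed

lemma mS_K: "f : K ==> mS a f : K" by (simp add: mS_def K_sub S_K k0_K)
lemma mL_K: "f : K ==> mL a f : K" by (simp add: mL_def K_sub L_K kt_K)

lemma opK_mS: "opK (mS a)" and opK_mL: "opK (mL a)"
 by (simp_all add: opK_def bcl_mS bcl_mL mS_K mL_K)

lemma cip_mS: "f : K ==> g : K ==> cip (mS a f) g = cip f (mL a g)"
 by (simp add: mS_def mL_def cip_add_left cip_add_right cip_cl cip_cr cip_S k0_coef)

lemma cip_mS_right: "f : K ==> g : K ==> cip g (mS a f) = cip (mL a g) f"
 using cip_mS by (metis cip_commute)

lemma mS_Cc: "g : K ==> mS a (Cc g) = Cc (mL a g)"
 by (simp add: mS_def mL_def S_Cc Cc_add Cc_scaleC Cc_kt cip_Cc_kt)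

lemma mL_Cc: "g : K ==> mL a (Cc g) = Cc (mS a g)"
 using mS_Cc[OF Cc_K, of g a] by (metis Cc_Cc)

text \<open>The commutator form \<open>E\<close> vanishes for \<open>g\<close> orthogonal to \<open>k0\<close>, and it is antisymmetric under the
 conjugation because \<open>A\<close> is symmetric; together this leaves no room for a multiple of \<open>kt \<otimes> k0\<close>.\<close>

lemma sedA_commute_form:
 assumes A: "opK A" "Csym A" and s: "sedA a A" and a: "cmod a <= 1" and f: "f : K" and g: "g : K"
 shows "cip (A (mS a f)) g = cip (A f) (mL a g)"
proof -
 have B: "bcl A" by (rule opK_bcl[OF A(1)])
 obtain \<phi> \<eta> where T: "tform A \<phi> \<eta>" and s: "!!g. g : K ==> coef g 0 = 0 ==> cip (S (Cc \<eta>)) g = a * cip \<phi> g"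
  using s unfolding sedA_def by blast
 define E where "E f g = cip (A (mS a f)) g - cip (A f) (mL a g)" for f g
 have E0: "E f g = 0" if f: "f : K" and g: "g : K" "coef g 0 = 0" for f g
 proof -
  have 1: "cip (A (S f)) g - cip (A f) (L g) = - cip f kt * (cip (A kt) (L g) + u 0 * cip \<phi> g)"
   using tform_D[OF T S_K[of f] g(1)] g(2)
   by (simp add: L_S f coef_S_0 bcl_diff[OF B] bcl_scaleC[OF B] cip_diff_left cip_cl algebra_simps)
  have "E f g = (cip (A (S f)) g - cip (A f) (L g)) + a / (1 - a * cnj (u 0)) * cip f kt * cip (A k0) g"
   unfolding E_def mS_def mL_def by (simp add: g(2) bcl_add[OF B] bcl_scaleC[OF B] cip_add_left cip_cl)
  also have "... = - cip f kt * (a * cip \<phi> g) + a / (1 - a * cnj (u 0)) * cip f kt * (cip \<phi> g - cnj (u 0) * (a * cip \<phi> g))"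
   unfolding 1 using tform_right_values[OF A(1) T A(2) g] s[OF g] by simp
  also have "cip \<phi> g - cnj (u 0) * (a * cip \<phi> g) = (1 - a * cnj (u 0)) * cip \<phi> g" by (simp add: algebra_simps)
  also have "- cip f kt * (a * cip \<phi> g) + a / (1 - a * cnj (u 0)) * cip f kt * ((1 - a * cnj (u 0)) * cip \<phi> g) = 0"
   using den_ne(1)[OF a] by simp
  finally show ?thesis .
 qed
 have anti: "E (Cc g) (Cc f) = - E f g" if f: "f : K" and g: "g : K" for f g
 proof -
  have C: "cip (A (Cc x)) (Cc y) = cip (A y) x" if "x : K" "y : K" for x y
   using A(2) that unfolding Csym_def by blast
  show ?thesis unfolding E_def by (simp add: mS_Cc mL_Cc f g C mS_K mL_K)
 qed
 have E_sub: "E f (g + b *C h) = E f g + cnj b * E f h" for f g h b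
  by (simp add: E_def bcl_add[OF bcl_mL] bcl_scaleC[OF bcl_mL] cip_add_right cip_cr algebra_simps)
 have dec: "E f g = cnj (coef g 0 / n0) * E f k0" if f: "f : K" and g: "g : K" for f g
  using E_sub[of f "g - (coef g 0 / n0) *C k0" "coef g 0 / n0" k0] E0[OF f proj_k0[OF g]] by simp
 have 0: "E kt k0 = 0" using anti[OF kt_K k0_K] by (simp add: Cc_k0 Cc_kt)
 have "E f k0 = 0"
 proof -
  have "E (Cc k0) (Cc f) = 0" using dec[OF kt_K Cc_K[OF f]] 0 by (simp add: Cc_k0)
  thus ?thesis using anti[OF f k0_K] by simp
 qed
 hence "E f g = 0" using dec[OF f g] by simp
 thus ?thesis by (simp add: E_def)
qed

lemma sedA_commute:
 assumes A: "opK A" "Csym A" and s: "sedA a A" and a: "cmod a <= 1" and f: "f : K"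
 shows "A (mS a f) = mS a (A f)"
 using sedA_commute_form[OF A s a f]
 by (intro csub_eqI[OF csub_K]) (simp_all add: opK_K[OF A(1)] mS_K f cip_mS)

text \<open>Boundary values of the inverse of 1 - conj(a) u. Multiplication by this function carries
  \<open>mL a\<close> to the unperturbed \<open>L\<close> (\<open>L_X\<close>), the situation in
  which lifting applies.\<close>

definition rsv :: "complex => complex => complex" where "rsv a z = 1 / (1 - cnj a * U z)"

abbreviation X :: "complex => hl2 => hl2" where "X a \<equiv> mul (rsv a)"
definition Y :: "complex => hl2 => hl2" where "Y a h = h - cnj a *C Mu h"

lemma rsv_AE: assumes "cmod a < 1" shows "AE z in circle. 1 - cnj a * U z ~= 0 & cmod (rsv a z) <= 1 / (1 - cmod a)"
 using U_unim
proof eventually_elim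
 case (elim z)
 have "1 - cmod a <= cmod (1 - cnj a * U z)"
  using norm_triangle_ineq2[of 1 "cnj a * U z"] elim by (simp add: norm_mult)
 thus ?case using assms by (auto simp: rsv_def norm_divide intro!: divide_left_mono mult_pos_pos)
qed

lemma rsv_Li: "cmod a < 1 ==> rsv a : Li"
proof (rule LiI)
 show "rsv a : Bm" using Li_measurable[OF U_Li] unfolding rsv_def[abs_def] by measurable
 show "cmod a < 1 ==> AE z in circle. cmod (rsv a z) <= 1 / (1 - cmod a)"
  using rsv_AE[of a] by (auto elim: eventually_mono)
qed

lemma rsvb_Li: "cmod a < 1 ==> (%z. cnj (rsv a z)) : Li" by (rule Li_cnj[OF rsv_Li])

lemma bcl_Y: "bcl (Y a)" unfolding Y_def by (intro bcl_minus2 bcl_id bcl_scale bcl_Mu)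

lemma Y_X: assumes a: "cmod a < 1" shows "Y a (X a g) = g" "X a (Y a g) = g"
proof -
 have Y: "Y a h = mul (%z. 1 - cnj a * U z) h" for h
  unfolding Y_def by (simp add: mul_minus Li_const Li_mult U_Li mul_one mul_mul[of "%z. cnj a", symmetric] mul_const)
 have l: "(%z. 1 - cnj a * U z) : Li" by (intro Li_diff Li_const Li_mult U_Li)
 have *: "(%z. (1 - cnj a * U z) * rsv a z) \<doteq> (%z. 1)" "(%z. rsv a z * (1 - cnj a * U z)) \<doteq> (%z. 1)"
  unfolding ae_eq_def using rsv_AE[OF a] by (eventually_elim, simp add: rsv_def)+
 show "Y a (X a g) = g" "X a (Y a g) = g"
  unfolding Y using mul_cong[OF _ _ *(1), of g] mul_cong[OF _ _ *(2), of g]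
  by (simp_all add: mul_mul l rsv_Li[OF a] Li_mult Li_const mul_one)
qed

text \<open>The multiplier is the boundary function of the bounded analytic \<open>v\<close>,
  because \<open>u\<close> is bounded by 1 in the disc.\<close>

lemma X_HH: assumes a: "cmod a < 1" and g: "g : HH" shows "X a g : HH"
proof -
 define v where "v w = 1 / (1 - cnj a * u w)" for w
 have d: "1 - cmod a <= cmod (1 - cnj a * u w)" if "cmod w < 1" for w
 proof -
  have "cmod a * cmod (u w) <= cmod a * 1" by (rule mult_left_mono[OF u_le[OF that]]) simp
  thus ?thesis using norm_triangle_ineq2[of 1 "cnj a * u w"] by (simp add: norm_mult)
 qed
 have nz: "1 - cnj a * u w ~= 0" if "cmod w < 1" for w using d[OF that] a by auto
 have vH: "v : Hinfty"
  unfolding Hinfty_def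
 proof (intro CollectI conjI)
  show "v holomorphic_on ball 0 1"
   unfolding v_def by (intro holomorphic_intros Hinfty_holo[OF uH]) (use nz in auto)
  show "bounded (v ` ball 0 1)"
   by (rule boundedI[where B="1 / (1 - cmod a)"])
    (use d nz a in \<open>auto simp: v_def norm_divide intro!: divide_left_mono mult_pos_pos\<close>)
 qed
 have "bv v \<doteq> rsv a"
  unfolding ae_eq_def using bv_tendsto[OF vH] bv_tendsto[OF uH] rsv_AE[OF a]
 proof eventually_elim
  case (elim z)
  have "((%r. v (of_real r * z)) ---> rsv a z) (at_left 1)"
   unfolding v_def rsv_def by (intro tendsto_intros elim(2)) (use elim(3) in simp)
  thus ?case using elim(1) by (intro tendsto_unique[OF _ elim(1)]) simp_all
 qed
 hence "mul (bv v) g = X a g" by (rule mul_cong[OF bv_Li[OF vH] rsv_Li[OF a]])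
 moreover have "mul (bv v) g : HH" by (rule mul_HH[OF bv_Li[OF vH] bv_HH(1)[OF vH] g])
 ultimately show ?thesis by simp
qed

lemma L_Mu: assumes h: "h : HH" shows "L (Mu h) = Mu (L h) + coef h 0 *C kt"
proof -
 have "Mu h = zmul (Mu (L h)) + coef h 0 *C Mu (e 0)"
  by (metis HH_split bcl_Mu bcl_add bcl_scaleC zmul_Mu(1))
 hence "L (Mu h) = L (zmul (Mu (L h)) + coef h 0 *C Mu (e 0))" by simp
 also have "... = L (zmul (Mu (L h))) + coef h 0 *C L (Mu (e 0))"
  by (simp only: bcl_add[OF bcl_L] bcl_scaleC[OF bcl_L])
 finally show ?thesis by (simp add: L_zmul Mu_HH L_HH h kt_def)
qed

lemma Y_L: assumes a: "cmod a < 1" and h: "h : HH" shows "Y a (L h) = mL a (Y a h)"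
proof -
 have 0: "coef (Y a h) 0 = (1 - cnj a * u 0) * coef h 0"
  by (simp add: Y_def cip_diff_left cip_cl coef_Mu_0 h algebra_simps)
 have "L (Y a h) = L h - cnj a *C (Mu (L h) + coef h 0 *C kt)"
  unfolding Y_def by (simp only: bcl_diff[OF bcl_L] bcl_scaleC[OF bcl_L] L_Mu[OF h])
 thus ?thesis
  using den_ne(2)[of a] a unfolding mL_def 0
  by (simp add: Y_def scaleC_add_right)
qed

lemma L_X: assumes a: "cmod a < 1" and g: "g : HH" shows "L (X a g) = X a (mL a g)"
 using Y_L[OF a X_HH[OF a g]] Y_X[OF a] by metis

text \<open>The adjoint of \<open>A\<close> commutes with \<open>mL a\<close>. Transported by
  \<open>X a\<close> it commutes with \<open>L\<close> on the transported model space
  \<open>K'\<close>, where \<open>lifting\<close> supplies the symbol.\<close>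

theorem sedA_symbol:
 assumes A: "opK A" "Csym A" and s: "sedA a A" and a: "cmod a < 1"
 obtains \<Psi> where "\<Psi> : Hinfty" "!!f g. f : K ==> g : K ==> cip (A f) g = cip (mul (bv \<Psi>) f) (X a g)"
proof -
 define B where "B g = PM K (adj A g)" for g
 have bA: "bcl A" by (rule opK_bcl[OF A(1)])
 have bB: "bcl B" unfolding B_def by (rule bcl_compose[OF bcl_PM[OF csub_K] bcl_adj[OF bA]])
 have B_K: "B g : K" for g by (simp add: B_def PM_in csub_K)
 have AB: "cip (A f) g = cip f (B g)" if "f : K" for f g
  by (simp add: B_def PM_cip_right csub_K that cip_adj[OF bA])
 have BL: "B (mL a g) = mL a (B g)" if g: "g : K" for g
 proof (rule csub_eqI[OF csub_K B_K mL_K[OF B_K]])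
  fix v assume v: "v : K"
  have "cip v (B (mL a g)) = cip v (mL a (B g))"
   using sedA_commute_form[OF A s _ v g] a
   by (simp add: AB[symmetric] v cip_mS[symmetric] B_K mS_K)
  thus "cip (B (mL a g)) v = cip (mL a (B g)) v" by (metis cip_commute)
 qed
 \<comment> \<open>The image of \<open>K\<close> under \<open>X a\<close>, described through the
   inverse \<open>Y a\<close> so that closedness is a preimage.\<close>
 define K' where "K' = HH \<inter> {h. Y a h : K}"
 define B' where "B' h = X a (B (Y a h))" for h
 have K': "csub K'"
  unfolding K'_def
 proof (rule csub_Int[OF csub_HH])
  have "closed (Y a -` K)"
   by (intro closed_vimage K_sub linear_continuous_on bcl_bounded_linear bcl_Y)
  thus "csub {h. Y a h : K}"
   by (auto simp: csub_def bcl_zero[OF bcl_Y] bcl_add[OF bcl_Y] bcl_scaleC[OF bcl_Y] K_sub vimage_def)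
 qed
 have bB': "bcl B'" unfolding B'_def by (rule bcl_compose[OF bcl_mul[OF rsv_Li[OF a]] bcl_compose[OF bB bcl_Y]])
 interpret lurking K' B'
 proof
  show "csub K'" by (rule K')
  show "K' \<subseteq> HH" by (auto simp: K'_def)
  show "bcl B'" by (rule bB')
  fix h assume h: "h : K'"
  hence hH: "h : HH" and hK: "Y a h : K" by (auto simp: K'_def)
  show "L h : K'" by (simp add: K'_def L_HH hH Y_L a mL_K hK)
  show "B' h : K'" by (simp add: K'_def B'_def X_HH a K_HH B_K Y_X)
  show "B' (L h) = L (B' h)" by (simp add: B'_def Y_L a hH BL hK L_X K_HH B_K)
 qed
 show ?thesis
 proof
  show "\<Psi> : Hinfty" by (rule \<Psi>_Hinfty)
  fix f g assume f: "f : K" and g: "g : K"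
  have Xg: "X a g : K'" by (simp add: K'_def X_HH a K_HH g Y_X)
  have B'H: "B' (X a g) : HH" by (simp add: B'_def X_HH a K_HH B_K)
  have "B g = Y a (B' (X a g))" by (simp add: B'_def Y_X a)
  hence "cip (A f) g = cip f (Y a (B' (X a g)))" by (simp add: AB f)
  \<comment> \<open>\<open>Y a\<close> differs from the identity by a multiple of \<open>u\<close>
    times a Hardy function, to which \<open>f\<close> is orthogonal.\<close>
  also have "... = cip f (B' (X a g))" unfolding Y_def by (simp add: cip_diff_right cip_cr K_Mu f B'H)
  also have "... = cnj (cip (B' (X a g)) f)" by (rule cip_commute)
  also have "cip (B' (X a g)) f = cip (X a g) (mul (bv \<Psi>) f)" by (rule cip_lifting[OF Xg K_HH[OF f]])
  also have "cnj ... = cip (mul (bv \<Psi>) f) (X a g)" by (metis cip_commute)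
  finally show "cip (A f) g = cip (mul (bv \<Psi>) f) (X a g)" .
 qed
qed

text \<open>Write \<open>A2 f\<close> explicitly as \<open>h + a *C k - Mu k\<close> with a Hardy
  function \<open>k\<close>. Multiplying \<open>h\<close> by the first symbol gives the product
  symbol; the rest contributes nothing, because (u - a) times a Hardy function, tested against
  \<open>X a g\<close>, is u times that function tested against \<open>g\<close> in
  \<open>K\<close>.\<close>

theorem sedA_symbol_mult:
 assumes a: "cmod a < 1" and H: "\<Psi>1 : Hinfty" "\<Psi>2 : Hinfty"
  and A2: "!!f. f : K ==> A2 f : K"
  and 1: "!!f g. f : K ==> g : K ==> cip (A1 f) g = cip (mul (bv \<Psi>1) f) (X a g)"
  and 2: "!!f g. f : K ==> g : K ==> cip (A2 f) g = cip (mul (bv \<Psi>2) f) (X a g)"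
  and f: "f : K" and g: "g : K"
 shows "cip (A1 (A2 f)) g = cip (mul (%z. bv \<Psi>1 z * bv \<Psi>2 z) f) (X a g)"
proof -
 have l1: "bv \<Psi>1 : Li" by (rule bv_Li[OF H(1)])
 define h where "h = mul (bv \<Psi>2) f"
 define p where "p = mul (%z. cnj (rsv a z)) h"
 define k where "k = PM HH (Mub p)"
 have hH: "h : HH" unfolding h_def by (rule mul_HH[OF bv_Li bv_HH(1) K_HH]) (simp_all add: H f)
 have kH: "k : HH" by (simp add: k_def PM_in csub_HH)
 have p: "h = p - a *C Mub p"
 proof -
  have l: "(%z. cnj (1 - cnj a * U z)) : Li" by (intro Li_cnj Li_diff Li_const Li_mult U_Li)
  have "p - a *C Mub p = mul (%z. cnj (1 - cnj a * U z)) p"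
   by (simp add: mul_minus Li_const Li_mult Ub_Li mul_one mul_mul[of "%z. a", symmetric] mul_const)
  also have "... = mul (%z. cnj (1 - cnj a * U z) * cnj (rsv a z)) h" unfolding p_def by (rule mul_mul[OF l rsvb_Li[OF a]])
  also have "... = mul (%z. 1) h"
   by (rule mul_cong[OF Li_mult[OF l rsvb_Li[OF a]] Li_const], unfold ae_eq_def)
     (use rsv_AE[OF a] in \<open>eventually_elim, simp add: rsv_def complex_cnj_mult[symmetric] complex_cnj_diff[symmetric] del: complex_cnj_mult complex_cnj_diff\<close>)
  finally show ?thesis by (simp add: mul_one)
 qed
 have A2f: "A2 f = h + a *C k - Mu k"
 proof (rule csub_eqI[OF csub_K A2[OF f]])
  have pk: "cip (h + a *C k) y = cip p y" if "y : HH" for y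
   using that unfolding k_def
   by (simp add: cip_add_left cip_cl PM_cip csub_HH) (subst p, simp add: cip_diff_left cip_cl)
  show "h + a *C k - Mu k : K"
   unfolding K_iff
  proof (intro conjI ballI)
   show "h + a *C k - Mu k : HH" by (simp add: csubD[OF csub_HH] hH kH Mu_HH)
   fix y assume y: "y : HH"
   have "cip (h + a *C k - Mu k) (Mu y) = cip p (Mu y) - cip k y"
    by (simp only: cip_diff_left pk Mu_HH y cip_Mu_Mu)
   also have "cip k y = cip (Mub p) y" unfolding k_def by (rule PM_cip[OF csub_HH y])
   finally show "cip (h + a *C k - Mu k) (Mu y) = 0" by (simp add: cip_Mub)
  qed
  fix v assume v: "v : K"
  have "cip (A2 f) v = cip h (X a v)" unfolding h_def by (rule 2[OF f v])
  also have "... = cip p v" unfolding p_def by (simp add: cip_mul rsvb_Li a)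
  also have "... = cip (h + a *C k - Mu k) v"
   using pk[OF K_HH[OF v]] by (simp add: cip_diff_left Mu_K v kH)
  finally show "cip (A2 f) v = cip (h + a *C k - Mu k) v" .
 qed
 have "cip (A1 (A2 f)) g = cip (mul (bv \<Psi>1) (A2 f)) (X a g)" by (rule 1[OF A2[OF f] g])
 also have "... = cip (mul (bv \<Psi>1) h) (X a g) - cip (mul (bv \<Psi>1) (Mu k - a *C k)) (X a g)"
  unfolding A2f cip_diff_left[symmetric] bcl_diff[OF bcl_mul[OF l1], symmetric] by (simp add: algebra_simps)
 also have "cip (mul (bv \<Psi>1) (Mu k - a *C k)) (X a g) = 0"
 proof -
  let ?q = "mul (bv \<Psi>1) k"
  have qH: "?q : HH" by (rule mul_HH[OF l1 bv_HH(1)[OF H(1)] kH])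
  have "mul (bv \<Psi>1) (Mu k - a *C k) = Mu ?q - a *C ?q"
   by (simp add: bcl_diff[OF bcl_mul] mul_scaleC l1 mul_mul U_Li mult.commute)
  hence "cip (mul (bv \<Psi>1) (Mu k - a *C k)) (X a g) = cip ?q (Mub (X a g) - cnj a *C X a g)"
   by (simp add: cip_diff_left cip_diff_right cip_cl cip_cr cip_Mu)
  also have "Mub (X a g) - cnj a *C X a g = Mub (Y a (X a g))"
   by (simp add: Y_def bcl_diff[OF bcl_mul] mul_scaleC Ub_Li)
  also have "cip ?q (Mub (Y a (X a g))) = cip (Mu ?q) g" by (simp only: Y_X[OF a] cip_Mu)
  also have "... = 0" by (rule Mu_K[OF g qH])
  finally show ?thesis .
 qed
 also have "mul (bv \<Psi>1) h = mul (%z. bv \<Psi>1 z * bv \<Psi>2 z) f"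
  unfolding h_def by (rule mul_mul[OF l1 bv_Li[OF H(2)]])
 finally show ?thesis by simp
qed

definition adK :: "(hl2 => hl2) => hl2 => hl2" where "adK A g = PM K (adj A g)"

lemma opK_adK: "opK A ==> opK (adK A)"
 unfolding opK_def adK_def[abs_def]
 using bcl_compose[OF bcl_PM[OF csub_K] bcl_adj] PM_in[OF csub_K] by blast

lemma cip_adK: "opK A ==> g : K ==> cip (adK A f) g = cip f (A g)"
 by (simp add: adK_def PM_cip csub_K cip_adj' opK_bcl)

lemma cip_adK': "opK A ==> g : K ==> cip g (adK A f) = cip (A g) f"
 using cip_adK by (metis cip_commute)

lemma tform_adK:
 assumes A: "opK A" and T: "tform A \<phi> \<eta>" shows "tform (adK A) \<eta> \<phi>"
 unfolding tform_def
proof (intro conjI ballI)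
 show "\<eta> : K" "\<phi> : K" using T by (auto simp: tform_def)
 fix f g assume f: "f : K" and g: "g : K"
 have "dA (adK A) f g = cnj (cip (A g) f - cip (A (L g)) (L f))"
  using cip_commute[of "A g" f] cip_commute[of "A (L g)" "L f"] by (simp add: dA_def cip_adK A g L_K)
 also have "... = cnj (coef g 0) * cnj (cip \<phi> f) + coef f 0 * cnj (cip g \<eta>)"
  by (simp add: tform_D[OF T g f])
 also have "... = coef f 0 * cip \<eta> g + cnj (coef g 0) * cip f \<phi>"
  using cip_commute[of \<phi> f] cip_commute[of g \<eta>] by simp
 finally show "dA (adK A) f g = coef f 0 * cip \<eta> g + cnj (coef g 0) * cip f \<phi>" .
qed

lemma Csym_adK: assumes A: "opK A" "Csym A" shows "Csym (adK A)"
 unfolding Csym_def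
proof (intro ballI)
 fix f g assume f: "f : K" and g: "g : K"
 have "cip (adK A (Cc f)) (Cc g) = cnj (cip (A (Cc g)) (Cc f))"
  using cip_commute[of "A (Cc g)" "Cc f"] by (simp add: cip_adK A Cc_K g)
 also have "cip (A (Cc g)) (Cc f) = cip (A f) g" using A(2) f g unfolding Csym_def by blast
 also have "cnj (cip (A f) g) = cip (adK A g) f"
  using cip_commute[of "A f" g] by (simp add: cip_adK A f)
 finally show "cip (adK A (Cc f)) (Cc g) = cip (adK A g) f" .
qed

text \<open>Adjoints exchange \<phi> and \<eta>, which inverts and conjugates the ratio. Classes
  outside the closed disc are thereby reduced to classes inside.\<close>

lemma sedA_adK:
 assumes A: "opK A" and s: "sedA a A" and a: "a ~= 0" shows "sedA (1 / cnj a) (adK A)"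
proof -
 obtain \<phi> \<eta> where T: "tform A \<phi> \<eta>" and s: "!!g. g : K ==> coef g 0 = 0 ==> cip (S (Cc \<eta>)) g = a * cip \<phi> g"
  using s unfolding sedA_def by blast
 have K: "\<phi> : K" "\<eta> : K" using T by (auto simp: tform_def)
 have "cip (S (Cc \<phi>)) g = 1 / cnj a * cip \<eta> g" if g: "g : K" "coef g 0 = 0" for g
 proof -
  have "cnj (cip \<eta> g) = a * cip \<phi> (S (Cc g))"
   using s[OF S_K coef_SC_0[OF g]] SC_dual[OF K(2) g] cip_commute[of g \<eta>] by simp
  also have "cip \<phi> (S (Cc g)) = cip g (S (Cc \<phi>))" by (rule cip_SC_swap[OF K(1) g(1), symmetric])
  also have "... = cnj (cip (S (Cc \<phi>)) g)" by (rule cip_commute)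
  finally have "cnj (cnj (cip \<eta> g)) = cnj (a * cnj (cip (S (Cc \<phi>)) g))" by (rule arg_cong)
  thus ?thesis using a by simp
 qed
 thus ?thesis using tform_adK[OF A T] unfolding sedA_def by blast
qed

lemma sedInf_adK:
 assumes A: "opK A" and s: "sedInf A" shows "sedA 0 (adK A)"
proof -
 obtain \<phi> \<eta> where T: "tform A \<phi> \<eta>" and s: "!!g. g : K ==> coef g 0 = 0 ==> cip \<phi> g = 0"
  using s unfolding sedInf_def by blast
 have K: "\<phi> : K" "\<eta> : K" using T by (auto simp: tform_def)
 have "cip (S (Cc \<phi>)) g = 0 * cip \<eta> g" if g: "g : K" "coef g 0 = 0" for g
 proof -
  have "cip g (S (Cc \<phi>)) = 0"
   using cip_SC_swap[OF K(1) g(1)] s[OF S_K coef_SC_0[OF g]] by simp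
  thus ?thesis using cip_commute[of g "S (Cc \<phi>)"] by simp
 qed
 thus ?thesis using tform_adK[OF A T] unfolding sedA_def by blast
qed

end

section \<open>Moments, Poisson integrals and Herglotz's theorem\<close>

lemma integrable_Li: "f : Li ==> integrable circle f"
 using Li_bound[of f "integrable circle f"] circle.integrable_const_bound[of f] Li_measurable[of f] by blast

lemma re_moment:
 assumes h: "h holomorphic_on ball 0 1" and r: "0 <= \<rho>" "\<rho> < 1"
 shows "(LINT z|circle. of_real (2 * Re (dil h \<rho> z)) * z ^ n) = cnj (tay h n) * of_real \<rho> ^ n + (if n = 0 then h 0 else 0)"
proof -
 have l: "dil h \<rho> : Li" by (rule dil_Li[OF h r])
 have i1: "integrable circle (%z. dil h \<rho> z * z ^ n)" by (intro integrable_Li Li_mult l Li_pow)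
 have i2: "integrable circle (%z. cnj (dil h \<rho> z * cnj z ^ n))" by (intro integrable_Li Li_cnj Li_mult l Li_pow)
 have "(LINT z|circle. of_real (2 * Re (dil h \<rho> z)) * z ^ n)
  = (LINT z|circle. dil h \<rho> z * z ^ n + cnj (dil h \<rho> z * cnj z ^ n))"
  unfolding complex_add_cnj[symmetric] by (simp add: distrib_right)
 also have "... = (LINT z|circle. dil h \<rho> z * z ^ n) + cnj (LINT z|circle. dil h \<rho> z * cnj z ^ n)"
  by (simp only: Bochner_Integration.integral_add[OF i1 i2] LINT_cnj)
 also have "(LINT z|circle. dil h \<rho> z * cnj z ^ n) = tay h n * of_real \<rho> ^ n" by (rule dil_coef[OF h r])
 also have "(LINT z|circle. dil h \<rho> z * z ^ n) = (if n = 0 then h 0 else 0)"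
 proof (cases n)
  case 0
  thus ?thesis using dil_coef[OF h r, of 0] by (simp add: tay_0)
 next
  case (Suc k)
  thus ?thesis using dil_moment[OF h r, of k] by simp
 qed
 finally show ?thesis by simp
qed

lemma powser_tay:
 assumes s: "!!w. cmod w < 1 ==> (%n. a n * w ^ n) sums f w"
 shows "f holomorphic_on ball 0 1" "tay f n = a n"
proof -
 show h: "f holomorphic_on ball 0 1"
  by (rule power_series_holomorphic[of 0 1 a]) (use s in auto)
 have "(%n. (tay f n - a n) * w ^ n) sums 0" if "cmod w < 1" for w
  using sums_diff[OF tay_sums[OF h that] s[OF that]] by (simp add: left_diff_distrib)
 from powser_eq_0[OF this] show "tay f n = a n" by simp
qed

text \<open>For n > 0 the conjugate coefficient is, up to a power of 1/2, the n-th moment of twice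
  the real part on the circle of radius 1/2, and moments of constants vanish.\<close>

lemma tay_const_Re:
 assumes h: "D holomorphic_on ball 0 1" and c: "!!w. cmod w < 1 ==> Re (D w) = c" and n: "n > 0"
 shows "tay D n = 0"
proof -
 have "(LINT z|circle. of_real (2 * Re (dil D (1/2) z)) * z ^ n) = (LINT z|circle. of_real (2 * c) * z ^ n)"
  by (rule integral_eqI) (auto simp: dil_def space_circle norm_mult c)
 also have "... = 0" using n by (simp add: circle_moment)
 finally show ?thesis using re_moment[OF h, of "1/2" n] n by simp
qed

context
 fixes \<mu> :: "complex measure"
 assumes sets: "sets \<mu> = sets circle" and fin: "finite_measure \<mu>"
begin

lemma space_sphere: "space \<mu> = sph"
 using sets_eq_imp_space_eq[OF sets] by (simp add: space_circle)

lemma measurable_power: "(%z. z ^ n) : borel_measurable \<mu>" "(%z. cnj z ^ n) : borel_measurable \<mu>"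
 by (intro continuous_measurable_circle[OF _ sets] continuous_intros)+

lemma integrable_power: "integrable \<mu> (%z. z ^ n)"
 by (rule integrable_bounded_circle[OF fin sets, where B=1]) (auto simp: measurable_power norm_power)

lemma moment_series:
 assumes w: "cmod w < 1"
 shows "(%n. (LINT z|\<mu>. z ^ n) * w ^ n) sums (LINT z|\<mu>. 1 / (1 - w * z))"
proof -
 have "(%n. w ^ n * (LINT z|\<mu>. z ^ n * 1)) sums (LINT z|\<mu>. (\<Sum>n. w ^ n * z ^ n) * 1)"
  by (rule integral_power_series[OF sets]) (use w integrable_power[of 0] in \<open>simp_all add: norm_power summable_geometric\<close>)
 moreover have "(LINT z|\<mu>. (\<Sum>n. w ^ n * z ^ n) * 1) = (LINT z|\<mu>. 1 / (1 - w * z))"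
  by (rule integral_eqI)
   (use w in \<open>auto simp: space_sphere suminf_geometric norm_mult simp flip: power_mult_distrib\<close>)
 ultimately show ?thesis by (simp add: mult.commute)
qed

lemma poisson_eq_Re:
 assumes z: "z : sph" and w: "cmod w < 1"
 shows "poisson w z = 2 * Re (1 / (1 - cnj w * z)) - 1"
proof -
 have s: "cmod (cnj w * z) = cmod w" using z by (simp add: norm_mult)
 hence ne: "1 - cnj w * z ~= 0" using w by auto
 have "1 - cnj w * z = z * cnj (z - w)" using z by (simp add: algebra_simps complex_norm_square[symmetric])
 hence "cmod (1 - cnj w * z) = cmod (z - w)" using z by (simp add: norm_mult del: complex_cnj_diff)
 hence "poisson w z = poisson (cnj w * z) 1" by (simp only: poisson_def s)
 also have "... = Re (1 / (1 - cnj w * z) + 1 / (1 - cnj w * z) - 1)"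
  unfolding poisson_Re[OF norm_one] using ne by (intro arg_cong[where f=Re]) (simp add: field_simps)
 finally show ?thesis by (simp only: plus_complex.simps minus_complex.simps one_complex.simps mult_2)
qed

lemma poisson_moments:
 assumes w: "cmod w < 1"
 shows "(LINT z|\<mu>. poisson w z) = 2 * Re (LINT z|\<mu>. 1 / (1 - cnj w * z)) - measure \<mu> (sph)"
proof -
 interpret finite_measure \<mu> by (rule fin)
 have i: "integrable \<mu> (%z. 1 / (1 - cnj w * z))"
 proof (rule integrable_bounded_circle[OF fin sets])
  show "(%z. 1 / (1 - cnj w * z)) : borel_measurable \<mu>"
   by (rule borel_measurable_circle[OF _ sets]) measurable
  show "norm (1 / (1 - cnj w * z)) <= 1 / (1 - cmod w)" if "z : sph" for z
  proof -
   have "1 - cmod w <= cmod (1 - cnj w * z)" using norm_triangle_ineq2[of 1 "cnj w * z"] that by (simp add: norm_mult)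
   thus ?thesis using w by (auto simp: norm_divide intro!: divide_left_mono mult_pos_pos)
  qed
 qed
 have "(LINT z|\<mu>. poisson w z) = (LINT z|\<mu>. 2 * Re (1 / (1 - cnj w * z)) - 1)"
  by (rule integral_eqI) (use w in \<open>auto simp: space_sphere poisson_eq_Re\<close>)
 also have "... = (LINT z|\<mu>. 2 * Re (1 / (1 - cnj w * z))) - (LINT z|\<mu>. 1)"
  by (rule Bochner_Integration.integral_diff) (simp_all add: i)
 also have "(LINT z|\<mu>. 2 * Re (1 / (1 - cnj w * z))) = 2 * Re (LINT z|\<mu>. 1 / (1 - cnj w * z))"
  using i by simp
 finally show ?thesis by (simp add: space_sphere)
qed

end

text \<open>A Poisson integral is, up to the total mass, twice the real part of an analytic function
  whose Taylor coefficients are the moments. The difference of the two analytic functions has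
  constant real part; the total masses agree by taking w = 0.\<close>

lemma poisson_moments_eq:
 assumes m: "sets \<mu> = sets circle" "finite_measure \<mu>" and n: "sets \<nu> = sets circle" "finite_measure \<nu>"
  and eq: "!!w. cmod w < 1 ==> (LINT z|\<mu>. poisson w z) = (LINT z|\<nu>. poisson w z)"
 shows "\<mu> = \<nu>"
proof (rule measure_eq_moments[OF m(1) n(1) m(2) n(2)])
 fix k
 define D where "D w = (LINT z|\<mu>. 1 / (1 - w * z)) - (LINT z|\<nu>. 1 / (1 - w * z))" for w
 have s: "(%n. ((LINT z|\<mu>. z ^ n) - (LINT z|\<nu>. z ^ n)) * w ^ n) sums D w" if "cmod w < 1" for w
  using sums_diff[OF moment_series[OF m that] moment_series[OF n that]] by (simp add: D_def left_diff_distrib)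
 note D = powser_tay[OF s]
 have tot: "measure \<mu> (sph) = measure \<nu> (sph)"
  using eq[of 0] poisson_moments[OF m, of 0] poisson_moments[OF n, of 0]
  by (simp add: space_sphere[OF m] space_sphere[OF n])
 have "Re (D w) = 0" if "cmod w < 1" for w
  using poisson_moments[OF m, of "cnj w"] poisson_moments[OF n, of "cnj w"] eq[of "cnj w"] that tot by (simp add: D_def)
 from tay_const_Re[OF D(1) this] D(2) show "(LINT z|\<mu>. z ^ k) = (LINT z|\<nu>. z ^ k)"
  using tot space_sphere[OF m] space_sphere[OF n] by (cases "k = 0") auto
qed

text \<open>Transported to the line by \<open>cis\<close>, the densities give probability measures
  living on a fixed bounded interval. These are tight, so a subsequence converges weakly, and its
  limit is pushed back to the circle.\<close>

lemma moment_limit_measure: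
 fixes p :: "nat => complex => real"
 assumes p: "!!j. p j : Bm" "!!j z. z : sph ==> 0 <= p j z"
  "!!j. integrable circle (p j)" "!!j. (LINT z|circle. p j z) = 1"
  and lim: "!!n. (%j. LINT z|circle. of_real (p j z) * z ^ n) ----> m n"
 obtains \<mu> where "sets \<mu> = sets circle" "finite_measure \<mu>" "!!n. (LINT z|\<mu>. z ^ n) = m n"
proof -
 define N where "N = uniform_measure lborel {0..2*pi}"
 have circ: "circle = distr N (restrict_space borel (sph)) cis" by (simp add: circle_def N_def)
 have cm: "cis : N \<rightarrow>\<^sub>M restrict_space borel (sph)" using cis_measurable by (simp add: N_def)
 have sN: "sets N = sets borel" by (simp add: N_def)
 have pm: "p j : borel_measurable (restrict_space borel (sph))" for j
  using p(1) by (metis measurable_cong_sets sets_circle)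
 have pc: "(%t. p j (cis t)) : borel_measurable N" for j by (rule measurable_compose[OF cm pm])
 define \<nu> where "\<nu> j = density N (%t. ennreal (p j (cis t)))" for j
 have tot: "emeasure (\<nu> j) UNIV = 1" for j
 proof -
  have "emeasure (\<nu> j) UNIV = (\<integral>\<^sup>+t. ennreal (p j (cis t)) \<partial>N)"
   unfolding \<nu>_def by (subst emeasure_density) (use pc sN in \<open>auto simp: N_def\<close>)
  also have "... = (\<integral>\<^sup>+z. ennreal (p j z) \<partial>circle)"
   unfolding circ by (rule nn_integral_distr[symmetric, OF cm]) (use pm in measurable)
  also have "... = ennreal (LINT z|circle. p j z)"
   by (rule nn_integral_eq_integral[OF p(3)]) (auto intro!: AE_I2 simp: space_circle p(2))
  finally show ?thesis by (simp add: p(4))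
 qed
 have rd: "real_distribution (\<nu> j)" for j
 proof -
  have "prob_space (\<nu> j)" using tot[of j] by (intro prob_spaceI) (simp add: \<nu>_def N_def)
  thus ?thesis by (auto simp: real_distribution_def real_distribution_axioms_def \<nu>_def sN)
 qed
 have tight: "tight \<nu>"
  unfolding tight_def
 proof (intro conjI allI impI rd)
  fix \<epsilon> :: real assume e: "\<epsilon> > 0"
  \<comment> \<open>A half-open interval containing [0, 2 pi], in the shape that tightness
    prescribes.\<close>
  have "measure (\<nu> j) {-1<..7} = 1" for j
  proof -
   interpret real_distribution "\<nu> j" by (rule rd)
   have "AE t in N. t : {0..2*pi}" unfolding N_def by (rule AE_uniform_measureI) auto
   hence "AE t in \<nu> j. t : {0..2*pi}" unfolding \<nu>_def by (subst AE_density) (use pc in auto)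
   hence "AE t in \<nu> j. t : {-1<..7}" by eventually_elim (use pi_less_4 pi_approx in auto)
   thus ?thesis by (subst prob_eq_1) auto
  qed
  thus "EX a b::real. a < b & (ALL n. measure (\<nu> n) {a<..b} > 1 - \<epsilon>)"
   using e by (intro exI[of _ "-1"] exI[of _ 7]) auto
 qed
 obtain r M where r: "strict_mono r" and M: "real_distribution M" and w: "weak_conv_m (\<nu> o id o r) M"
  using tight_imp_convergent_subsubsequence[OF tight strict_mono_id] by blast
 interpret M: real_distribution M by (rule M)
 define \<mu> where "\<mu> = distr M (restrict_space borel (sph)) cis"
 have cmM: "cis : M \<rightarrow>\<^sub>M restrict_space borel (sph)"
  using cis_measurable by (simp add: measurable_cong_sets[OF M.events_eq_borel refl] measurable_cong_sets[OF sN[unfolded N_def] refl])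
 have zm: "(%z. z ^ n) : borel_measurable (restrict_space borel (sph))" for n
  by (intro measurable_restrict_space1) measurable
 show ?thesis
 proof
  show "sets \<mu> = sets circle" by (simp add: \<mu>_def sets_circle)
  interpret prob_space \<mu> unfolding \<mu>_def by (rule M.prob_space_distr[OF cmM])
  show "finite_measure \<mu>" by unfold_locales
  fix n
  have "(%k. LINT t|(\<nu> o id o r) k. cis t ^ n) ----> (LINT t|M. cis t ^ n)"
  proof (rule weak_conv_imp_integral_bdd_continuous_conv[OF _ M w])
   show "real_distribution ((\<nu> o id o r) k)" for k by (simp add: rd)
   have "continuous_on UNIV (%t. cis t ^ n)" by (intro continuous_intros)
   thus "isCont (%t. cis t ^ n) x" for x by (simp add: continuous_on_eq_continuous_at)
   show "norm (cis x ^ n) <= 1" for x by (simp add: norm_power)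
  qed
  moreover have "(LINT t|\<nu> j. cis t ^ n) = (LINT z|circle. of_real (p j z) * z ^ n)" for j
  proof -
   have "(LINT t|\<nu> j. cis t ^ n) = (LINT t|N. p j (cis t) *\<^sub>R cis t ^ n)"
    unfolding \<nu>_def by (rule integral_density) (use pc p(2) measurable_compose[OF cm zm] in \<open>auto\<close>)
   also have "... = (LINT z|circle. p j z *\<^sub>R z ^ n)"
    unfolding circ by (rule integral_distr[symmetric, OF cm]) (use pm zm in measurable)
   finally show ?thesis by (simp add: scaleR_conv_of_real)
  qed
  moreover have "(%k. LINT z|circle. of_real (p (r k) z) * z ^ n) ----> m n"
   using LIMSEQ_subseq_LIMSEQ[OF lim r] by (simp add: comp_def)
  ultimately have "(LINT t|M. cis t ^ n) = m n" using LIMSEQ_unique by (auto simp: comp_def)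
  moreover have "(LINT z|\<mu>. z ^ n) = (LINT t|M. cis t ^ n)" unfolding \<mu>_def by (rule integral_distr[OF cmM zm])
  ultimately show "(LINT z|\<mu>. z ^ n) = m n" by simp
 qed
qed

text \<open>On each smaller circle 2 Re h - c is nonnegative with mean c, so after division by c it
  is a probability density. Its moments tend to the conjugate Taylor coefficients over c, and
  scaling the limit measure by c gives the result.\<close>

theorem herglotz:
 assumes h: "h holomorphic_on ball 0 1" and pos: "!!w. cmod w < 1 ==> 2 * Re (h w) >= c"
  and h0: "h 0 = of_real c" and c: "c > 0"
 obtains \<mu> where "sets \<mu> = sets circle" "finite_measure \<mu>" "!!n. (LINT z|\<mu>. z ^ n) = cnj (tay h n)"
proof -
 define p where "p j z = (2 * Re (dil h (rad j) z) - c) / c" for j z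
 have l: "dil h (rad j) : Li" for j by (rule dil_Li[OF h rad(1,2)])
 have p1: "p j : Bm" for j
  unfolding p_def[abs_def] using Li_measurable[OF l] by measurable
 have p2: "0 <= p j z" if "z : sph" for j z
  using pos[of "of_real (rad j) * z"] that rad(1,2)[of j] c by (simp add: p_def dil_def norm_mult)
 have p3: "integrable circle (p j)" for j
  unfolding p_def[abs_def] using integrable_Li[OF l] by (intro integrable_divide Bochner_Integration.integrable_diff) auto
 have mom: "(LINT z|circle. of_real (p j z) * z ^ n) = (cnj (tay h n) * of_real (rad j) ^ n) / of_real c" for j n
 proof -
  have i: "integrable circle (%z. complex_of_real (2 * Re (dil h (rad j) z)) * z ^ n)"
  proof -
   have "(%z. (dil h (rad j) z + cnj (dil h (rad j) z)) * z ^ n) : Li" by (intro Li_mult Li_add Li_cnj l Li_pow)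
   thus ?thesis using integrable_Li by (simp only: complex_add_cnj)
  qed
  have i': "integrable circle (%z. complex_of_real c * z ^ n)" by (intro integrable_Li Li_mult Li_const Li_pow)
  have "(LINT z|circle. of_real (p j z) * z ^ n)
   = (LINT z|circle. (of_real (2 * Re (dil h (rad j) z)) * z ^ n - of_real c * z ^ n) / of_real c)"
   by (rule integral_eqI) (simp_all add: p_def left_diff_distrib)
  also have "... = ((LINT z|circle. of_real (2 * Re (dil h (rad j) z)) * z ^ n) - (LINT z|circle. of_real c * z ^ n)) / of_real c"
   by (simp only: integral_divide_zero Bochner_Integration.integral_diff[OF i i'])
  also have "(LINT z|circle. of_real c * z ^ n) = (if n = 0 then of_real c else 0)"
   by (simp add: circle_moment)
  also have "(LINT z|circle. of_real (2 * Re (dil h (rad j) z)) * z ^ n) = cnj (tay h n) * of_real (rad j) ^ n + (if n = 0 then h 0 else 0)"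
   by (rule re_moment[OF h rad(1,2)])
  finally show ?thesis by (simp add: h0)
 qed
 have p4: "(LINT z|circle. p j z) = 1" for j
 proof -
  have "complex_of_real (LINT z|circle. p j z) = 1" using mom[of j 0] c by (simp add: tay_0 h0)
  thus ?thesis by simp
 qed
 have lim: "(%j. LINT z|circle. of_real (p j z) * z ^ n) ----> cnj (tay h n) / of_real c" for n
 proof -
  have "(%j. (cnj (tay h n) * of_real (rad j) ^ n) / of_real c) ----> (cnj (tay h n) * of_real 1 ^ n) / complex_of_real c"
   using c by (intro tendsto_intros rad(3)) simp
  thus ?thesis by (simp add: mom)
 qed
 obtain \<nu> where n: "sets \<nu> = sets circle" "finite_measure \<nu>" "!!n. (LINT z|\<nu>. z ^ n) = cnj (tay h n) / of_real c"
  using moment_limit_measure[OF p1 p2 p3 p4 lim] by blast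
 interpret \<nu>: finite_measure \<nu> by (rule n(2))
 show ?thesis
 proof
  show "sets (density \<nu> (%_. ennreal c)) = sets circle" by (simp add: n)
  show "finite_measure (density \<nu> (%_. ennreal c))"
   by (intro finite_measureI) (simp add: emeasure_density nn_integral_cmult_indicator ennreal_mult_eq_top_iff)
  show "(LINT z|density \<nu> (%_. ennreal c). z ^ k) = cnj (tay h k)" for k
  proof -
   have "(LINT z|density \<nu> (%_. ennreal c). z ^ k) = (LINT z|\<nu>. c *\<^sub>R z ^ k)"
    using c by (intro integral_density measurable_power n) auto
   thus ?thesis using c by (simp add: n(3) scaleR_conv_of_real)
  qed
 qed
qed

section \<open>The Clark measure\<close>

definition lip :: "'a measure => ('a => complex) => ('a => complex) => complex" where
 "lip M f g = (LINT z|M. f z * cnj (g z))"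

definition lsq :: "'a measure => ('a => complex) => real" where
 "lsq M f = (LINT z|M. (cmod (f z))^2)"

lemma lsq_nonneg: "lsq M f >= 0" by (simp add: lsq_def)

lemma lip_self: "f : l2 M ==> lip M f f = of_real (lsq M f)"
 unfolding lip_def lsq_def complex_norm_square[symmetric] by (rule integral_complex_of_real)

lemma lip_commute: "lip M g f = cnj (lip M f g)"
 by (simp add: lip_def LINT_cnj[symmetric] mult.commute)

lemma lip_add_left: "f : l2 M ==> g : l2 M ==> h : l2 M ==> lip M (%z. f z + g z) h = lip M f h + lip M g h"
 by (simp add: lip_def distrib_right l2_inner_integrable)

lemma lip_diff_left: "f : l2 M ==> g : l2 M ==> h : l2 M ==> lip M (%z. f z - g z) h = lip M f h - lip M g h"
 by (simp add: lip_def left_diff_distrib l2_inner_integrable)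

lemma lip_diff_right: "f : l2 M ==> g : l2 M ==> h : l2 M ==> lip M h (%z. f z - g z) = lip M h f - lip M h g"
 by (simp add: lip_def right_diff_distrib l2_inner_integrable)

lemma lip_scale_left: "lip M (%z. c * f z) g = c * lip M f g"
 by (simp add: lip_def mult.assoc)

lemma lip_cong:
 assumes "f : l2 M" "f' : l2 M" "g : l2 M" "g' : l2 M"
  and "AE z in M. f z = f' z" "AE z in M. g z = g' z"
 shows "lip M f g = lip M f' g'"
 unfolding lip_def
proof (rule integral_cong_AE)
 show "AE z in M. f z * cnj (g z) = f' z * cnj (g' z)" using assms(5,6) by eventually_elim simp
qed (use assms(1-4)[THEN l2_measurable] in measurable)

lemma lsq_0_AE: "f : l2 M ==> lsq M f = 0 ==> AE z in M. f z = 0"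
 unfolding lsq_def using integral_nonneg_eq_0_iff_AE[OF l2_integrable, of f M] by simp

lemma l2_abs_mult: "f : l2 M ==> g : l2 M ==> integrable M (%z. cmod (f z) * cmod (g z))"
 using integrable_norm[OF l2_mult_integrable, of f M g] by (simp add: norm_mult)

lemma l2_CS: assumes f: "f : l2 M" and g: "g : l2 M" shows "(cmod (lip M f g))^2 <= lsq M f * lsq M g"
proof -
 define y where "y = (LINT z|M. cmod (f z) * cmod (g z))"
 note i = l2_integrable[OF f] l2_integrable[OF g] l2_abs_mult[OF f g]
 have x: "cmod (lip M f g) <= y"
  unfolding lip_def y_def
  using integral_norm_bound[of M "%z. f z * cnj (g z)"] by (simp add: norm_mult)
 have q: "0 <= t\<^sup>2 * lsq M f - 2 * t * y + lsq M g" for t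
 proof -
  have "0 <= (LINT z|M. (t * cmod (f z) - cmod (g z))^2)" by simp
  also have "... = (LINT z|M. t\<^sup>2 * (cmod (f z))^2 - 2 * t * (cmod (f z) * cmod (g z)) + (cmod (g z))^2)"
   by (simp add: power2_diff power_mult_distrib algebra_simps)
  also have "... = t\<^sup>2 * lsq M f - 2 * t * y + lsq M g"
   unfolding lsq_def y_def using i by simp
  finally show ?thesis .
 qed
 have "y\<^sup>2 <= lsq M f * lsq M g"
 proof (cases "lsq M f = 0")
  case True
  have "y = 0"
  proof (rule ccontr)
   assume "y ~= 0"
   \<comment> \<open>With \<open>lsq M f = 0\<close> the inequality \<open>q\<close> is affine in
     \<open>t\<close>; this \<open>t\<close> would make it negative.\<close>
   hence "0 <= - (lsq M g + 1) + lsq M g" using q[of "(lsq M g + 1) / (2 * y)"] True by simp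
   thus False by simp
  qed
  thus ?thesis by (simp add: True)
 next
  case False
  hence A: "lsq M f > 0" using lsq_nonneg[of M f] by simp
  have "0 <= lsq M g - y\<^sup>2 / lsq M f"
   using q[of "y / lsq M f"] A by (simp add: power_divide power2_eq_square field_simps)
  thus ?thesis using A by (simp add: field_simps)
 qed
 moreover have "(cmod (lip M f g))^2 <= y\<^sup>2" by (rule power_mono[OF x]) simp
 ultimately show ?thesis by simp
qed

lemma lip_tendsto_left:
 assumes f: "!!k. f k : l2 M" "F : l2 M" and g: "g : l2 M" and lim: "(%k. lsq M (%z. f k z - F z)) ----> 0"
 shows "(%k. lip M (f k) g) ----> lip M F g"
proof -
 have "(%k. sqrt (lsq M (%z. f k z - F z) * lsq M g)) ----> sqrt (0 * lsq M g)" by (intro tendsto_intros lim)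
 hence s: "(%k. sqrt (lsq M (%z. f k z - F z) * lsq M g)) ----> 0" by simp
 have "(%k. lip M (f k) g - lip M F g) ----> 0"
 proof (rule Lim_null_comparison[OF _ s])
  have "cmod (lip M (f k) g - lip M F g) <= sqrt (lsq M (%z. f k z - F z) * lsq M g)" for k
   using l2_CS[OF l2_diff[OF f(1) f(2)] g, of k]
   by (intro real_le_rsqrt) (simp add: lip_diff_left f g)
  thus "\<forall>\<^sub>F k in sequentially. norm (lip M (f k) g - lip M F g) <= sqrt (lsq M (%z. f k z - F z) * lsq M g)" by simp
 qed
 thus ?thesis by (rule LIM_zero_cancel)
qed

lemma lip_tendsto_right:
 assumes f: "!!k. f k : l2 M" "F : l2 M" and g: "g : l2 M" and lim: "(%k. lsq M (%z. f k z - F z)) ----> 0"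
 shows "(%k. lip M g (f k)) ----> lip M g F"
proof -
 have "(%k. cnj (lip M (f k) g)) ----> cnj (lip M F g)" by (intro tendsto_cnj lip_tendsto_left assms)
 thus ?thesis by (simp only: lip_commute[symmetric])
qed

lemma lsq_add_le: "f : l2 M ==> g : l2 M ==> lsq M (%z. f z + g z) <= 2 * lsq M f + 2 * lsq M g"
proof -
 assume f: "f : l2 M" and g: "g : l2 M"
 have "lsq M (%z. f z + g z) <= (LINT z|M. 2 * (cmod (f z))^2 + 2 * (cmod (g z))^2)"
  unfolding lsq_def by (intro integral_mono l2_integrable l2_add f g) (auto simp: l2_integrable f g cmod_add_sq_le)
 thus ?thesis by (simp add: lsq_def l2_integrable f g)
qed

text \<open>The value at a point of the disc of the analytic function with the Fourier coefficients
  of \<open>g\<close>.\<close>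

definition ev :: "hl2 => complex => complex" where "ev g w = (\<Sum>n. coef g n * w ^ n)"

lemma coef_bound: "cmod (coef g n) <= norm g" using cip_bound[of g "e n"] by (simp add: norm_e)

lemma ev_term: "cmod (coef g n * w ^ n) <= norm g * cmod w ^ n"
 by (simp add: norm_mult norm_power mult_right_mono coef_bound)

lemma geo_bound: "cmod w < 1 ==> (%n. norm g * cmod w ^ n) sums (norm g / (1 - cmod w))" for g :: hl2
 using sums_mult[OF geometric_sums[of "cmod w"], of "norm g"] by simp

lemma ev_sums: assumes "cmod w < 1" shows "(%n. coef g n * w ^ n) sums ev g w"
 unfolding ev_def
 by (rule summable_sums, rule summable_comparison_test'[OF sums_summable[OF geo_bound[OF assms]]], rule ev_term)

lemma ev_bound: assumes w: "cmod w < 1" shows "cmod (ev g w) <= norm g / (1 - cmod w)"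
proof -
 have "summable (%n. cmod (coef g n * w ^ n))"
  by (rule summable_comparison_test'[OF sums_summable[OF geo_bound[OF w]]]) (simp only: real_norm_def abs_norm_cancel, rule ev_term)
 hence "cmod (ev g w) <= (\<Sum>n. cmod (coef g n * w ^ n))" unfolding ev_def by (rule summable_norm)
 also have "... <= (\<Sum>n. norm g * cmod w ^ n)"
  by (rule suminf_le[OF ev_term \<open>summable (%n. cmod (coef g n * w ^ n))\<close> sums_summable[OF geo_bound[OF w]]])
 also have "... = norm g / (1 - cmod w)" using sums_unique[OF geo_bound[OF w]] by simp
 finally show ?thesis .
qed

lemma ev_add: "cmod w < 1 ==> ev (x + y) w = ev x w + ev y w"
 using sums_unique2[OF ev_sums[of w "x + y"] sums_add[OF ev_sums[of w x] ev_sums[of w y], simplified distrib_right[symmetric] cip_add_left[symmetric]]] by simp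

lemma ev_scaleC: "cmod w < 1 ==> ev (c *C x) w = c * ev x w"
proof -
 assume w: "cmod w < 1"
 have "(%n. coef (c *C x) n * w ^ n) sums (c * ev x w)"
  using sums_mult[OF ev_sums[OF w, of x], of c] by (simp add: cip_cl mult.assoc)
 thus ?thesis using ev_sums[OF w] sums_unique2 by blast
qed

lemma ev_L: assumes w: "cmod w < 1" shows "ev x w = coef x 0 + w * ev (L x) w"
proof -
 have "(%n. coef x (Suc n) * w ^ Suc n) sums (w * ev (L x) w)"
  using sums_mult[OF ev_sums[OF w, of "L x"], of w] by (simp add: coef_L ac_simps)
 hence "(%n. coef x n * w ^ n) sums (w * ev (L x) w + coef x 0)" by (subst (asm) sums_Suc_iff) simp
 thus ?thesis using ev_sums[OF w, of x] sums_unique2 by (metis add.commute)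
qed

section \<open>The unitary modification of the compressed shift and its Clark measure\<close>

locale clark = inner_fn +
 fixes a :: complex
 assumes a: "cmod a = 1"
begin

abbreviation T :: "hl2 => hl2" where "T \<equiv> mS a"
abbreviation T' :: "hl2 => hl2" where "T' \<equiv> mL a"

lemma a_cnj: "a * cnj a = 1" using a by (simp add: complex_norm_square[symmetric])

lemma den: "1 - a * cnj (u 0) ~= 0" "1 - cnj a * u 0 ~= 0" using den_ne[of a] a by simp_all

lemma T'_T: assumes f: "f : K" shows "T' (T f) = f"
proof -
 define d where "d = 1 - a * cnj (u 0)"
 define d' where "d' = 1 - cnj a * u 0"
 have ne: "d ~= 0" "d' ~= 0" using den by (simp_all add: d_def d'_def)
 define s where "s = cip f kt"
 have c0: "coef (T f) 0 = - (u 0 * s) + a / d * s * n0"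
  by (simp add: mS_def cip_add_left cip_cl coef_S_0 f coef_k0_0 s_def d_def)
 have "T' (T f) = f + (- s + a / d * s * - cnj (u 0) + cnj a / d' * (- (u 0 * s) + a / d * s * n0)) *C kt"
  unfolding mL_def c0[unfolded s_def d_def]
  by (simp add: mS_def bcl_add[OF bcl_L] bcl_scaleC[OF bcl_L] L_S f L_k0 s_def d_def d'_def
    scaleC_add_left scaleC_diff_left scaleC_minus_left scaleC_minus_right algebra_simps)
 \<comment> \<open>After clearing denominators the coefficient of \<open>kt\<close> is a multiple of
   \<open>a * cnj a - 1\<close>; this is where unimodularity makes \<open>T\<close>
   isometric.\<close>
 also have "- s + a / d * s * - cnj (u 0) + cnj a / d' * (- (u 0 * s) + a / d * s * n0) = 0"
 proof -
  have "d * d' * (- s + a / d * s * - cnj (u 0) + cnj a / d' * (- (u 0 * s) + a / d * s * n0))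
   = s * (- (d * d') - a * cnj (u 0) * d' - cnj a * u 0 * d + a * cnj a * n0)"
   using ne by (simp add: field_simps)
  also have "- (d * d') - a * cnj (u 0) * d' - cnj a * u 0 * d + a * cnj a * n0 = - 1 + (a * cnj a) * (u 0 * cnj (u 0)) + a * cnj a * n0"
   unfolding d_def d'_def by (simp add: algebra_simps)
  also have "... = 0" unfolding a_cnj n0_def by simp
  finally show ?thesis using ne by simp
 qed
 finally show ?thesis by simp
qed

text \<open>The conjugation exchanges \<open>T\<close> and \<open>T'\<close>, which turns the claim
  into \<open>T'_T\<close>.\<close>

lemma T_T': assumes f: "f : K" shows "T (T' f) = f"
proof -
 have "T (T' (Cc h)) = Cc h" if "h : K" for h
  using that by (simp add: mL_Cc mS_Cc mS_K T'_T)
 from this[OF Cc_K[OF f]] show ?thesis by simp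
qed

lemma cip_T_T: "f : K ==> g : K ==> cip (T f) (T g) = cip f g"
 by (simp add: cip_mS mS_K T'_T)

lemma cip_T'_T': "f : K ==> g : K ==> cip (T' f) (T' g) = cip f g"
 by (simp add: cip_mS[symmetric] mL_K T_T')

lemma T_pow_K: "f : K ==> (T ^^ n) f : K" and T'_pow_K: "f : K ==> (T' ^^ n) f : K"
 by (induction n) (simp_all add: mS_K mL_K)

definition tk :: "nat => hl2" where "tk n = (T ^^ n) k0"

lemma tk_K: "tk n : K" by (simp add: tk_def T_pow_K k0_K)

lemma cip_T_pow: assumes f: "f : K" and g: "g : K" shows "cip g ((T ^^ n) f) = cip ((T' ^^ n) g) f"
 using g
proof (induction n arbitrary: g)
 case (Suc n)
 have "cip g ((T ^^ Suc n) f) = cip (T' g) ((T ^^ n) f)" by (simp add: cip_mS_right T_pow_K f Suc.prems)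
 also have "... = cip ((T' ^^ n) (T' g)) f" by (rule Suc.IH[OF mL_K[OF Suc.prems]])
 also have "(T' ^^ n) (T' g) = (T' ^^ Suc n) g" by (simp add: funpow_swap1)
 finally show ?case .
qed simp

lemma cip_tk: "g : K ==> cip g (tk n) = coef ((T' ^^ n) g) 0"
 by (simp add: tk_def cip_T_pow k0_K coef_k0 T'_pow_K)

text \<open>Orthogonality to all \<open>tk n\<close> says that every iterate of \<open>T'\<close> at
  \<open>g\<close> vanishes at 0. There \<open>T'\<close> coincides with \<open>L\<close>, so all
  Fourier coefficients of \<open>g\<close> are zero.\<close>

lemma cyclic: assumes g: "g : K" and 0: "!!n. cip g (tk n) = 0" shows "g = 0"
proof -
 have z: "coef ((T' ^^ n) g) 0 = 0" for n using 0[of n] by (simp add: cip_tk g)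
 have "(T' ^^ n) g = (L ^^ n) g" for n
 proof (induction n)
  case (Suc n)
  have "(T' ^^ Suc n) g = L ((T' ^^ n) g)" using z[of n] by (simp add: mL_def[of a "(T' ^^ n) g"])
  thus ?case by (simp add: Suc)
 qed simp
 hence "coef g n = 0" for n using z[of n] coef_L_pow[of n g 0] by simp
 thus ?thesis by (rule HH_coef_eq_0[OF K_HH[OF g]])
qed

definition c1 :: complex where "c1 = cnj a / (1 - cnj a * u 0)"

lemma ev_Mu_e: "cmod w < 1 ==> ev (Mu (e 0)) w = u w"
 using tay_sums[OF Hinfty_holo[OF uH], of w] bv_HH(2)[OF uH]
 by (simp add: ev_def mul_e U_Li sums_iff)

lemma ev_e0: "cmod w < 1 ==> ev (e 0) w = 1"
 using ev_L[of w "e 0"] ev_scaleC[of w 0 0] by (simp add: L_e0 cip_e_e)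

lemma ev_k0: "cmod w < 1 ==> ev k0 w = 1 - cnj (u 0) * u w"
proof -
 assume w: "cmod w < 1"
 have "k0 = e 0 + (- cnj (u 0)) *C Mu (e 0)" by (simp add: k0_def scaleC_minus_left)
 hence "ev k0 w = ev (e 0 + (- cnj (u 0)) *C Mu (e 0)) w" by simp
 also have "... = 1 - cnj (u 0) * u w" by (simp only: ev_add[OF w] ev_scaleC[OF w] ev_Mu_e[OF w] ev_e0[OF w]) simp
 finally show ?thesis .
qed

lemma ev_kt: "cmod w < 1 ==> w * ev kt w = u w - u 0"
 using ev_L[of w "Mu (e 0)"] by (simp add: kt_def[symmetric] ev_Mu_e coef_Mu_0 e_HH cip_e_e)

lemma ev_step: assumes w: "cmod w < 1" shows "ev g w = coef g 0 * (1 - c1 * (u w - u 0)) + w * ev (T' g) w"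
proof -
 have "w * ev (T' g) w = w * ev (L g) w + c1 * coef g 0 * (w * ev kt w)"
  by (simp add: mL_def ev_add w ev_scaleC c1_def algebra_simps)
 thus ?thesis using ev_L[OF w, of g] by (simp add: ev_kt w algebra_simps)
qed

lemma norm_T'_pow: "g : K ==> norm ((T' ^^ n) g) = norm g"
proof (induction n)
 case (Suc n)
 have "complex_of_real ((norm (T' ((T' ^^ n) g)))^2) = of_real ((norm ((T' ^^ n) g))^2)"
  unfolding cip_self[symmetric] by (intro cip_T'_T' T'_pow_K Suc)
 hence "(norm (T' ((T' ^^ n) g)))^2 = (norm ((T' ^^ n) g))^2" by (simp only: of_real_eq_iff)
 hence "norm (T' ((T' ^^ n) g)) = norm ((T' ^^ n) g)" by (rule power2_eq_imp_eq) simp_all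
 thus ?case using Suc by simp
qed simp

lemma clark_den: assumes "cmod w < 1" shows "1 - cnj a * u w ~= 0"
proof -
 have "cmod (cnj a * u w) < 1" using u_lt[OF assms] a by (simp add: norm_mult)
 thus ?thesis by auto
qed

lemma c1_eq: "1 - c1 * (u w - u 0) = (1 - cnj a * u w) / (1 - cnj a * u 0)"
 using den by (simp add: c1_def field_simps)

text \<open>Iterating \<open>ev_step\<close> gives a finite expansion whose remainder carries the
  factor \<open>w ^ N\<close>; its other factor stays bounded because \<open>T'\<close> is
  isometric.\<close>

lemma generating: assumes g: "g : K" and w: "cmod w < 1"
 shows "(%n. cip g (tk n) * w ^ n) sums (ev g w / (1 - c1 * (u w - u 0)))"
proof -
 define d where "d = 1 - c1 * (u w - u 0)"
 have d: "d ~= 0" unfolding d_def c1_eq using clark_den[OF w] den by simp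
 have eq: "ev g w = (\<Sum>n<N. cip g (tk n) * w ^ n) * d + w ^ N * ev ((T' ^^ N) g) w" for N
 proof (induction N)
  case (Suc N)
  have "w ^ N * ev ((T' ^^ N) g) w = w ^ N * (cip g (tk N) * d) + w ^ Suc N * ev ((T' ^^ Suc N) g) w"
   using ev_step[OF w, of "(T' ^^ N) g"] by (simp add: d_def[symmetric] cip_tk g distrib_left mult.assoc)
  thus ?case using Suc by (simp add: algebra_simps)
 qed simp
 have "(%N. w ^ N * ev ((T' ^^ N) g) w) ----> 0"
 proof (rule Lim_null_comparison)
  have "norm (w ^ N * ev ((T' ^^ N) g) w) <= cmod w ^ N * (norm g / (1 - cmod w))" for N
   unfolding norm_mult norm_power using ev_bound[OF w, of "(T' ^^ N) g"] norm_T'_pow[OF g, of N]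
   by (intro mult_left_mono) simp_all
  thus "\<forall>\<^sub>F N in sequentially. norm (w ^ N * ev ((T' ^^ N) g) w) <= cmod w ^ N * (norm g / (1 - cmod w))" by simp
  have "(%N. cmod w ^ N * (norm g / (1 - cmod w))) ----> 0 * (norm g / (1 - cmod w))"
   using w by (intro tendsto_intros LIMSEQ_realpow_zero) auto
  thus "(%N. cmod w ^ N * (norm g / (1 - cmod w))) ----> 0" by simp
 qed
 hence "(%N. (ev g w - w ^ N * ev ((T' ^^ N) g) w) / d) ----> (ev g w - 0) / d"
  by (intro tendsto_intros d)
 moreover have "(ev g w - w ^ N * ev ((T' ^^ N) g) w) / d = (\<Sum>n<N. cip g (tk n) * w ^ n)" for N
  using eq[of N] d by simp
 ultimately show ?thesis by (simp add: sums_def d_def)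
qed

text \<open>The generating function of \<open>cip k0 (tk n)\<close> in closed form. Up to constants,
  twice its real part is the Poisson integral prescribed for the Clark measure
  (\<open>Q_Re\<close>).\<close>

definition Q :: "complex => complex" where
 "Q w = (1 - cnj a * u 0) * (1 - cnj (u 0) * u w) / (1 - cnj a * u w)"

lemma Q_sums: "cmod w < 1 ==> (%n. cip k0 (tk n) * w ^ n) sums Q w"
 using generating[OF k0_K, of w] by (simp add: ev_k0 c1_eq Q_def mult.commute)

lemmas Q_tay = powser_tay[OF Q_sums]

lemma Q_0: "Q 0 = of_real (1 - (cmod (u 0))^2)"
 unfolding n0_real[symmetric] using den by (simp add: Q_def n0_def mult.commute)

lemma Q_Re: assumes w: "cmod w < 1"
 shows "2 * Re (Q w) - (1 - (cmod (u 0))^2) = (cmod (1 - cnj a * u 0))^2 * ((1 - (cmod (u w))^2) / (cmod (a - u w))^2)"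
proof -
 \<comment> \<open>With \<open>p\<close> and its conjugate \<open>q\<close> treated as independent,
   the claim becomes an identity of rational functions; \<bar>a\<bar> = 1 enters through
   \<open>aa\<close>.\<close>
 define s s' p q where "s = cnj a * u 0" "s' = a * cnj (u 0)" "p = 1 - cnj a * u w" "q = 1 - a * cnj (u w)"
 have "q = cnj p" by (simp add: s_s'_p_q_def)
 moreover have "p ~= 0" using clark_den[OF w] by (simp add: s_s'_p_q_def)
 ultimately have pq: "p ~= 0" "q ~= 0" "q = cnj p" by simp_all
 have aa: "a * (cnj a * x) = x" for x using a_cnj by (simp add: mult.assoc[symmetric])
 have t: "cnj (u 0) * u w = s' * (1 - p)" "u 0 * cnj (u w) = s * (1 - q)" "u 0 * cnj (u 0) = s * s'" "u w * cnj (u w) = (1 - p) * (1 - q)"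
  using aa by (simp_all add: s_s'_p_q_def ac_simps)
 have Q: "Q w = (1 - s) * (1 - s' * (1 - p)) / p" unfolding Q_def t(1) by (simp add: s_s'_p_q_def)
 have Q': "cnj (Q w) = (1 - s') * (1 - s * (1 - q)) / q"
  unfolding Q_def t(2)[symmetric] by (simp add: s_s'_p_q_def mult.commute)
 have na: "cmod (a - u w) = cmod p"
 proof -
  have "a - u w = a * p" using aa[of "u w"] by (simp add: s_s'_p_q_def right_diff_distrib)
  thus ?thesis by (simp add: norm_mult a)
 qed
 have "complex_of_real (2 * Re (Q w) - (1 - (cmod (u 0))^2)) = Q w + cnj (Q w) - (1 - u 0 * cnj (u 0))"
  by (simp only: of_real_diff of_real_1 complex_add_cnj complex_norm_square)
 also have "... = (1 - s) * (1 - s') * ((1 - (1 - p) * (1 - q)) / (p * q))"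
 proof -
  have "x + y - (1 - r) = (1 - s) * (1 - s') * ((1 - (1 - p) * (1 - q)) / (p * q))"
   if "x = (1 - s) * (1 - s' * (1 - p)) / p" "y = (1 - s') * (1 - s * (1 - q)) / q" "r = s * s'" for x y r
   unfolding that using pq(1,2) by (simp add: field_simps)
  from this[OF Q Q' t(3)] show ?thesis .
 qed
 also have "... = of_real ((cmod (1 - s))^2 * ((1 - (cmod (u w))^2) / (cmod p)^2))"
  unfolding of_real_mult of_real_divide of_real_diff complex_norm_square t(4) pq(3)[symmetric]
  by (simp add: s_s'_p_q_def)
 finally show ?thesis unfolding of_real_eq_iff na by (simp add: s_s'_p_q_def)
qed

lemma mu_ex: "EX \<mu>. sets \<mu> = sets circle & finite_measure \<mu> & (ALL n. (LINT z|\<mu>. z ^ n) = cip (tk n) k0)"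
proof -
 have pos: "2 * Re (Q w) >= 1 - (cmod (u 0))^2" if "cmod w < 1" for w
 proof -
  have "0 <= (1 - (cmod (u w))^2) / (cmod (a - u w))^2" using u_le[OF that] by (simp add: power_le_one)
  hence "0 <= 2 * Re (Q w) - (1 - (cmod (u 0))^2)" unfolding Q_Re[OF that] by (intro mult_nonneg_nonneg) auto
  thus ?thesis by simp
 qed
 obtain \<mu> where "sets \<mu> = sets circle" "finite_measure \<mu>" "!!n. (LINT z|\<mu>. z ^ n) = cnj (tay Q n)"
  using herglotz[OF Q_tay(1) pos Q_0 n0_pos] by blast
 thus ?thesis using cip_commute[of k0 "tk _"] by (intro exI[of _ \<mu>]) (auto simp: Q_tay(2))
qed

text \<open>The scalar spectral measure of \<open>T\<close> at \<open>k0\<close>. It is the Clark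
  measure multiplied by the constant \<bar>1 - conj(a) u(0)\<bar>^2
  (\<open>mu_poisson\<close>).\<close>

definition mu :: "complex measure" where
 "mu = (SOME \<mu>. sets \<mu> = sets circle & finite_measure \<mu> & (ALL n. (LINT z|\<mu>. z ^ n) = cip (tk n) k0))"

lemma mu: "sets mu = sets circle" "finite_measure mu" "(LINT z|mu. z ^ n) = cip (tk n) k0"
 using someI_ex[OF mu_ex] unfolding mu_def[symmetric] by blast+

sublocale mu: finite_measure mu by (rule mu(2))

lemma space_mu: "space mu = sph" by (rule space_sphere[OF mu(1,2)])

lemma mu_poisson: assumes w: "cmod w < 1"
 shows "(LINT z|mu. poisson w z) = (cmod (1 - cnj a * u 0))^2 * ((1 - (cmod (u w))^2) / (cmod (a - u w))^2)"
proof -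
 have w': "cmod (cnj w) < 1" using w by simp
 have "(%n. (LINT z|mu. z ^ n) * cnj w ^ n) sums cnj (Q w)"
  using Q_sums[OF w] sums_cnj[of "%n. cip k0 (tk n) * w ^ n" "Q w"] cip_commute[of k0 "tk _"]
  by (simp add: mu(3))
 hence "(LINT z|mu. 1 / (1 - cnj w * z)) = cnj (Q w)"
  using moment_series[OF mu(1,2) w'] sums_unique2 by blast
 moreover have "measure mu (sph) = 1 - (cmod (u 0))^2"
 proof -
  have "complex_of_real (measure mu (sph)) = (LINT z|mu. z ^ 0)" by (simp add: space_mu scaleR_conv_of_real)
  also have "... = n0" unfolding mu(3) by (simp add: tk_def coef_k0 k0_K coef_k0_0)
  finally show ?thesis unfolding n0_real by (simp only: of_real_eq_iff)
 qed
 ultimately show ?thesis using poisson_moments[OF mu(1,2) w] Q_Re[OF w] by simp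
qed

text \<open>The definite description in \<open>clark_measure\<close> denotes something only once
  existence and uniqueness are known: a multiple of \<open>mu\<close> exists, and a measure is
  determined by its Poisson integral. The functions constructed later are bounded at every point of
  the circle, so their membership in \<open>Linfty\<close> follows from the sigma-algebra.\<close>

lemma sets_clark: "sets (clark_measure u a) = sets circle"
proof -
 let ?P = "%\<mu>. sets \<mu> = sets circle & finite_measure \<mu> \<and>
   (ALL w:ball 0 1. (LINT z|\<mu>. (1 - (cmod w)^2) / (cmod (z - w))^2)
    = (1 - (cmod (u w))^2) / (cmod (a - u w))^2)"
 define r where "r = 1 / (cmod (1 - cnj a * u 0))^2"
 have r: "r > 0" using den by (simp add: r_def)
 define \<nu> where "\<nu> = density mu (%_. ennreal r)"
 have "EX! \<mu>. ?P \<mu>"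
 proof (rule ex1I[of _ \<nu>])
  show "?P \<nu>"
  proof (intro conjI ballI)
   show "sets \<nu> = sets circle" by (simp add: \<nu>_def mu)
   show "finite_measure \<nu>" unfolding \<nu>_def
    by (intro finite_measureI) (simp add: emeasure_density nn_integral_cmult_indicator ennreal_mult_eq_top_iff)
   fix w :: complex assume "w : ball 0 1"
   hence w: "cmod w < 1" by simp
   have "(LINT z|\<nu>. poisson w z) = (LINT z|mu. r *\<^sub>R poisson w z)"
    unfolding \<nu>_def using r
    by (intro integral_density) (use measurable_poisson[OF w] mu(1) in \<open>auto simp: measurable_cong_sets[OF mu(1) refl]\<close>)
   also have "... = r * (LINT z|mu. poisson w z)" by simp
   also have "... = (1 - (cmod (u w))^2) / (cmod (a - u w))^2"
    unfolding mu_poisson[OF w] using den by (simp add: r_def)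
   finally show "(LINT z|\<nu>. (1 - (cmod w)^2) / (cmod (z - w))^2) = (1 - (cmod (u w))^2) / (cmod (a - u w))^2"
    by (simp add: poisson_def)
  qed
  thus "\<mu> = \<nu>" if "?P \<mu>" for \<mu>
   using that by (intro poisson_moments_eq) (auto simp: poisson_def)
 qed
 from theI'[OF this] show ?thesis unfolding clark_measure_def by blast
qed

end

section \<open>The spectral representation: \<open>T\<close> as multiplication by z\<close>

context clark
begin

text \<open>Pairs of a polynomial \<open>f\<close> and the vector f(T) \<open>k0\<close>. A relation
  and not a map, since different polynomials can give the same vector when \<open>K\<close> has
  finite dimension.\<close>

inductive trigp :: "hl2 => (complex => complex) => bool" where
 zero: "trigp 0 (%z. 0)"
| step: "trigp x f ==> trigp (x + c *C tk n) (%z. f z + c * z ^ n)"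

lemma trigp_K: "trigp x f ==> x : K"
 by (induction rule: trigp.induct) (simp_all add: K_sub tk_K)

lemma trigp_cont: "trigp x f ==> continuous_on UNIV f"
 by (induction rule: trigp.induct) (intro continuous_intros | assumption)+

lemma l2_mu_bounded:
 assumes "f : borel_measurable mu" "!!z. z : sph ==> cmod (f z) <= C" shows "f : l2 mu"
proof (rule l2I[OF assms(1)], rule integrable_bounded_circle[OF mu(2,1), where B="C\<^sup>2"])
 show "norm ((cmod (f z))^2) <= C\<^sup>2" if "z : sph" for z using power_mono[OF assms(2)[OF that], of 2] by simp
qed (use assms(1) in measurable)

lemma l2_mu_cont: assumes "continuous_on UNIV f" shows "f : l2 mu"
proof -
 obtain C where "!!z. z : sph ==> norm (f z) <= C"
  using sphere_continuous_bounded[OF continuous_on_subset[OF assms subset_UNIV]] by blast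
 thus ?thesis by (rule l2_mu_bounded[OF continuous_measurable_circle[OF assms mu(1)]])
qed

lemma trigp_l2: "trigp x f ==> f : l2 mu" by (rule l2_mu_cont[OF trigp_cont])

lemma l2_pow: "(%z. z ^ n) : l2 mu" "(%z. cnj z ^ n) : l2 mu" "(%z. c) : l2 mu"
 by (intro l2_mu_cont continuous_intros)+

lemma l2_mult_z: assumes "f : l2 mu" shows "(%z. z * f z) : l2 mu"
proof (rule l2_bounded_mult[OF assms, where C=1])
 show "(%z. z) : borel_measurable mu" by (rule continuous_measurable_circle[OF _ mu(1)]) simp
 show "AE z in mu. cmod z <= 1" by (rule AE_I2) (simp add: space_mu)
qed

lemma trigp_add: "trigp y g ==> trigp x f ==> trigp (x + c *C y) (%z. f z + c * g z)"
proof (induction rule: trigp.induct)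
 case (step y g d n)
 have "trigp (x + c *C y + (c * d) *C tk n) (%z. f z + c * g z + c * d * z ^ n)"
  by (rule trigp.step[OF step.IH[OF step.prems]])
 thus ?case by (simp add: scaleC_add_right add.assoc distrib_left mult.assoc)
qed simp

lemma trigp_pow: "trigp (tk n) (%z. z ^ n)" using trigp.step[OF trigp.zero, of 1 n] by simp

lemma trigp_T: "trigp x f ==> trigp (T x) (%z. z * f z)"
proof (induction rule: trigp.induct)
 case zero thus ?case using trigp.zero by (simp add: bcl_zero[OF bcl_mS])
next
 case (step x f c n)
 have "trigp (T x + c *C tk (Suc n)) (%z. z * f z + c * z ^ Suc n)" by (rule trigp.step[OF step.IH])
 thus ?case
  by (simp add: bcl_add[OF bcl_mS] bcl_scaleC[OF bcl_mS] tk_def distrib_left mult.left_commute)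
qed

text \<open>As \<open>T\<close> is isometric, the product depends only on the difference of the
  exponents, as do the moments on the circle.\<close>

lemma cip_tk_tk: "cip (tk m) (tk n) = lip mu (%z. z ^ m) (%z. z ^ n)"
proof -
 have *: "cip (tk (n + k)) (tk n) = lip mu (%z. z ^ (n + k)) (%z. z ^ n)" for n k
 proof -
  have "cip (tk (n + k)) (tk n) = cip (tk k) k0"
  proof (induction n)
   case (Suc n)
   have "cip (T (tk (n + k))) (T (tk n)) = cip (tk (n + k)) (tk n)" by (rule cip_T_T[OF tk_K tk_K])
   thus ?case using Suc by (simp add: tk_def)
  qed (simp add: tk_def)
  also have "... = (LINT z|mu. z ^ (n + k) * cnj (z ^ n))"
   unfolding mu(3)[symmetric]
  proof (rule integral_eqI)
   fix z assume "z : space mu"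
   hence "z ^ n * cnj z ^ n = 1"
    by (simp add: space_mu power_mult_distrib[symmetric] complex_norm_square[symmetric])
   thus "z ^ k = z ^ (n + k) * cnj (z ^ n)" by (simp add: power_add ac_simps)
  qed simp
  finally show ?thesis by (simp add: lip_def)
 qed
 show ?thesis
 proof (cases "n <= m")
  case True thus ?thesis using *[of n "m - n"] by simp
 next
  case False
  have "cip (tk m) (tk n) = cnj (cip (tk n) (tk m))" by (rule cip_commute)
  also have "cip (tk n) (tk m) = lip mu (%z. z ^ n) (%z. z ^ m)" using *[of m "n - m"] False by simp
  also have "cnj ... = lip mu (%z. z ^ m) (%z. z ^ n)" by (rule lip_commute[symmetric])
  finally show ?thesis .
 qed
qed

lemma cip_trigp_tk: "trigp x f ==> cip x (tk n) = lip mu f (%z. z ^ n)"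
proof (induction rule: trigp.induct)
 case zero thus ?case by (simp add: lip_def)
next
 case (step x f c m)
 have "lip mu (%z. f z + c * z ^ m) (%z. z ^ n) = lip mu f (%z. z ^ n) + lip mu (%z. c * z ^ m) (%z. z ^ n)"
  by (rule lip_add_left[OF trigp_l2[OF step(1)] l2_cmult[OF l2_pow(1)] l2_pow(1)])
 thus ?case by (simp add: step cip_add_left cip_cl cip_tk_tk lip_scale_left)
qed

lemma cip_trigp: "trigp y g ==> trigp x f ==> cip x y = lip mu f g"
proof (induction rule: trigp.induct)
 case zero thus ?case by (simp add: lip_def)
next
 case (step y g c m)
 have "cip x (y + c *C tk m) = cip x y + cnj c * cip x (tk m)" by (simp add: cip_add_right cip_cr)
 also have "... = cnj (lip mu g f + c * lip mu (%z. z ^ m) f)"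
  unfolding step.IH[OF step.prems] cip_trigp_tk[OF step.prems] lip_commute[of mu f g] lip_commute[of mu f "%z. z ^ m"] by simp
 also have "lip mu g f + c * lip mu (%z. z ^ m) f = lip mu (%z. g z + c * z ^ m) f"
  unfolding lip_scale_left[symmetric]
  by (rule lip_add_left[OF trigp_l2[OF step(1)] l2_cmult[OF l2_pow(1)] trigp_l2[OF step.prems], symmetric])
 also have "cnj ... = lip mu f (%z. g z + c * z ^ m)" by (rule lip_commute[symmetric])
 finally show ?case .
qed

text \<open>The component of \<open>x\<close> orthogonal to the closure of these vectors is
  orthogonal to all \<open>tk n\<close>, hence zero by cyclicity.\<close>

lemma trigp_dense:
 assumes x: "x : K" obtains X G where "!!k. trigp (X k) (G k)" "X ----> x"
proof -
 define D where "D = {x. EX f. trigp x f}"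
 have D_add: "x + c *C y : D" if "x : D" "y : D" for x y c using that trigp_add unfolding D_def by blast
 have seq: "v : closure D <-> (EX X. (ALL n. X n : D) & X ----> v)" for v by (rule closure_sequential)
 have cl_add: "v + c *C w : closure D" if v: "v : closure D" and w: "w : closure D" for v w c
 proof -
  obtain X Y where "!!n. X n : D" "X ----> v" "!!n. Y n : D" "Y ----> w" using v w seq by metis
  hence "(%n. X n + c *C Y n) ----> v + c *C w" "!!n. X n + c *C Y n : D" by (auto intro!: tendsto_add tendsto_scaleC D_add)
  thus ?thesis unfolding seq by (intro exI[of _ "%n. X n + c *C Y n"]) simp
 qed
 have 0: "0 : closure D" using trigp.zero closure_subset[of D] by (auto simp: D_def)
 have cs: "csub (closure D)"
  unfolding csub_def
 proof (intro conjI ballI allI)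
  show "v + w : closure D" if "v : closure D" "w : closure D" for v w using cl_add[OF that, of 1] by simp
  show "c *C w : closure D" if "w : closure D" for c w using cl_add[OF 0 that, of c] by simp
 qed (simp_all add: 0)
 have DK: "closure D \<subseteq> K" by (rule closure_minimal) (auto simp: D_def trigp_K K_sub(4))
 define y where "y = x - PM (closure D) x"
 have yK: "y : K" using PM_in[OF cs, of x] DK by (auto simp: y_def intro!: K_sub x)
 have "cip y (tk n) = 0" for n
 proof -
  have "tk n : closure D" using trigp_pow[of n] closure_subset[of D] by (auto simp: D_def)
  thus ?thesis unfolding y_def by (rule PM_orth[OF cs])
 qed
 hence "y = 0" by (rule cyclic[OF yK])
 hence "x : closure D" using PM_in[OF cs, of x] by (simp add: y_def)
 then obtain X where X: "!!n. X n : D" "X ----> x" using seq by metis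
 have "EX G. ALL k. trigp (X k) (G k)" using X(1) unfolding D_def by (intro choice) blast
 thus ?thesis using X(2) that by metis
qed

text \<open>The closure of the relation \<open>trigp\<close> in both norms. Since
  \<open>trigp\<close> preserves products, the closure is the graph of an isometry modulo null
  sets.\<close>

definition isrep :: "hl2 => (complex => complex) => bool" where
 "isrep x F <-> F : l2 mu & (EX X G. (ALL k. trigp (X k) (G k)) & X ----> x & (%k. lsq mu (%z. G k z - F z)) ----> 0)"

lemma isrep_l2: "isrep x F ==> F : l2 mu" by (simp add: isrep_def)

lemma isrep_trigp: "trigp x f ==> isrep x f"
 unfolding isrep_def by (intro conjI trigp_l2 exI[of _ "%k. x"] exI[of _ "%k. f"]) (simp_all add: lsq_def)

lemma isrep_ex: assumes x: "x : K" shows "EX F. isrep x F"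
proof -
 obtain X G where XG: "!!k. trigp (X k) (G k)" "X ----> x" using trigp_dense[OF x] by blast
 have d: "lsq mu (%z. G m z - G n z) = (norm (X m - X n))^2" for m n
 proof -
  have t: "trigp (X m - X n) (%z. G m z - G n z)"
   using trigp_add[OF XG(1)[of n] XG(1)[of m], of "-1"] by (simp add: scaleC_minus_one)
  have "complex_of_real (lsq mu (%z. G m z - G n z)) = of_real ((norm (X m - X n))^2)"
   unfolding lip_self[OF trigp_l2[OF t], symmetric] cip_self[symmetric] by (rule cip_trigp[OF t t, symmetric])
  thus ?thesis by (simp only: of_real_eq_iff)
 qed
 have C: "EX N. ALL m>=N. ALL n>=N. (LINT z|mu. (cmod (G m z - G n z))^2) < e" if e: "e > 0" for e
 proof -
  have "Cauchy X" by (rule LIMSEQ_imp_Cauchy[OF XG(2)])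
  then obtain N where N: "!!m n. m >= N ==> n >= N ==> norm (X m - X n) < sqrt e"
   using e unfolding Cauchy_iff by (meson real_sqrt_gt_zero)
  have "(norm (X m - X n))^2 < e" if "m >= N" "n >= N" for m n
   using power_strict_mono[OF N[OF that], of 2] e by simp
  thus ?thesis using d by (intro exI[of _ N]) (simp add: lsq_def)
 qed
 obtain F where F: "F : l2 mu" "(%n. LINT z|mu. (cmod (G n z - F z))^2) ----> 0"
  using l2_complete[OF trigp_l2[OF XG(1)] C] by blast
 have "isrep x F"
  unfolding isrep_def
  by (intro conjI F(1) exI[of _ X] exI[of _ G] allI XG) (use F(2) in \<open>simp add: lsq_def\<close>)
 thus ?thesis by blast
qed

lemma isrep_cip_trigp: assumes F: "isrep x F" and t: "trigp y g" shows "cip x y = lip mu F g"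
proof -
 obtain X G where XG: "!!k. trigp (X k) (G k)" "X ----> x" "(%k. lsq mu (%z. G k z - F z)) ----> 0"
  using F unfolding isrep_def by blast
 have "(%k. cip (X k) y) ----> cip x y" by (intro tendsto_cip XG(2) tendsto_const)
 moreover have "(%k. lip mu (G k) g) ----> lip mu F g"
  by (rule lip_tendsto_left[OF trigp_l2[OF XG(1)] isrep_l2[OF F] trigp_l2[OF t] XG(3)])
 moreover have "cip (X k) y = lip mu (G k) g" for k by (rule cip_trigp[OF t XG(1)])
 ultimately show ?thesis using LIMSEQ_unique by simp
qed

lemma isrep_cip: assumes F: "isrep x F" and H: "isrep y H" shows "cip x y = lip mu F H"
proof -
 obtain X G where XG: "!!k. trigp (X k) (G k)" "X ----> y" "(%k. lsq mu (%z. G k z - H z)) ----> 0"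
  using H unfolding isrep_def by blast
 have "(%k. cip x (X k)) ----> cip x y" by (intro tendsto_cip XG(2) tendsto_const)
 moreover have "(%k. lip mu F (G k)) ----> lip mu F H"
  by (rule lip_tendsto_right[OF trigp_l2[OF XG(1)] isrep_l2[OF H] isrep_l2[OF F] XG(3)])
 moreover have "cip x (X k) = lip mu F (G k)" for k by (rule isrep_cip_trigp[OF F XG(1)])
 ultimately show ?thesis using LIMSEQ_unique by simp
qed

lemma isrep_unique: assumes F: "isrep x F" and H: "isrep x H" shows "AE z in mu. F z = H z"
proof -
 have l: "F : l2 mu" "H : l2 mu" using F H isrep_l2 by auto
 have "complex_of_real (lsq mu (%z. F z - H z)) = lip mu (%z. F z - H z) (%z. F z - H z)"
  by (rule lip_self[symmetric]) (simp add: l2_diff l)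
 also have "... = 0"
  using isrep_cip[OF F F] isrep_cip[OF F H] isrep_cip[OF H F] isrep_cip[OF H H]
  by (simp add: lip_diff_left lip_diff_right l l2_diff)
 finally have "AE z in mu. F z - H z = 0" by (intro lsq_0_AE l2_diff l) simp
 thus ?thesis by simp
qed

lemma isrep_add: assumes F: "isrep x F" and H: "isrep y H" shows "isrep (x + c *C y) (%z. F z + c * H z)"
proof -
 obtain X G where XG: "!!k. trigp (X k) (G k)" "X ----> x" "(%k. lsq mu (%z. G k z - F z)) ----> 0"
  using F unfolding isrep_def by blast
 obtain Y I where YI: "!!k. trigp (Y k) (I k)" "Y ----> y" "(%k. lsq mu (%z. I k z - H z)) ----> 0"
  using H unfolding isrep_def by blast
 have l: "F : l2 mu" "H : l2 mu" "G k : l2 mu" "I k : l2 mu" for k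
  using F H isrep_l2 trigp_l2[OF XG(1)] trigp_l2[OF YI(1)] by auto
 have b: "lsq mu (%z. (G k z + c * I k z) - (F z + c * H z))
  <= 2 * lsq mu (%z. G k z - F z) + 2 * ((cmod c)^2 * lsq mu (%z. I k z - H z))" for k
 proof -
  have "lsq mu (%z. (G k z + c * I k z) - (F z + c * H z)) = lsq mu (%z. (G k z - F z) + c * (I k z - H z))"
   by (simp add: algebra_simps)
  also have "... <= 2 * lsq mu (%z. G k z - F z) + 2 * lsq mu (%z. c * (I k z - H z))"
   by (intro lsq_add_le l2_diff l2_cmult l)
  also have "lsq mu (%z. c * (I k z - H z)) = (cmod c)^2 * lsq mu (%z. I k z - H z)"
   by (simp add: lsq_def norm_mult power_mult_distrib)
  finally show ?thesis .
 qed
 have "(%k. 2 * lsq mu (%z. G k z - F z) + 2 * ((cmod c)^2 * lsq mu (%z. I k z - H z))) ----> 2 * 0 + 2 * ((cmod c)^2 * 0)"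
  by (intro tendsto_intros XG YI)
 hence "(%k. 2 * lsq mu (%z. G k z - F z) + 2 * ((cmod c)^2 * lsq mu (%z. I k z - H z))) ----> 0" by simp
 hence lim: "(%k. lsq mu (%z. (G k z + c * I k z) - (F z + c * H z))) ----> 0"
  by (rule tendsto_sandwich[OF _ _ tendsto_const, rotated 2]) (simp_all add: lsq_nonneg b)
 show ?thesis
  unfolding isrep_def
 proof (intro conjI exI[of _ "%k. X k + c *C Y k"] exI[of _ "%k z. G k z + c * I k z"] allI)
  show "(%z. F z + c * H z) : l2 mu" by (intro l2_add l2_cmult l)
  show "trigp (X k + c *C Y k) (%z. G k z + c * I k z)" for k by (rule trigp_add[OF YI(1) XG(1)])
  show "(%k. X k + c *C Y k) ----> x + c *C y" by (intro tendsto_add tendsto_scaleC XG YI)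
 qed (rule lim)
qed

lemma isrep_T: assumes F: "isrep x F" shows "isrep (T x) (%z. z * F z)"
proof -
 obtain X G where XG: "!!k. trigp (X k) (G k)" "X ----> x" "(%k. lsq mu (%z. G k z - F z)) ----> 0"
  using F unfolding isrep_def by blast
 have "lsq mu (%z. z * G k z - z * F z) = lsq mu (%z. G k z - F z)" for k
  unfolding lsq_def
  by (rule integral_eqI) (auto simp: space_mu right_diff_distrib[symmetric] norm_mult)
 thus ?thesis
  unfolding isrep_def using XG(3)
  by (intro conjI l2_mult_z isrep_l2[OF F] exI[of _ "%k. T (X k)"] exI[of _ "%k z. z * G k z"] allI trigp_T XG(1)
   tendsto_bcl[OF bcl_mS] XG(2)) simp_all
qed

text \<open>The unitary from \<open>K\<close> onto the square integrable functions of
  \<open>mu\<close>, with one representative chosen for each vector; identities for it hold almost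
  everywhere.\<close>

definition Th :: "hl2 => complex => complex" where "Th x = (SOME F. isrep x F)"

lemma Th: "x : K ==> isrep x (Th x)" unfolding Th_def by (rule someI_ex[OF isrep_ex])
lemma Th_l2: "x : K ==> Th x : l2 mu" by (rule isrep_l2[OF Th])
lemma Th_measurable: "x : K ==> Th x : borel_measurable mu" by (rule l2_measurable[OF Th_l2])
lemma Th_cip: "x : K ==> y : K ==> cip x y = lip mu (Th x) (Th y)" by (rule isrep_cip[OF Th Th])

lemma Th_eq: "x : K ==> isrep x F ==> AE z in mu. Th x z = F z" by (rule isrep_unique[OF Th])

lemma Th_add: "x : K ==> y : K ==> AE z in mu. Th (x + c *C y) z = Th x z + c * Th y z"
 by (rule Th_eq[OF _ isrep_add[OF Th Th]]) (simp_all add: K_sub)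

lemma Th_T: "x : K ==> AE z in mu. Th (T x) z = z * Th x z"
 by (rule Th_eq[OF mS_K isrep_T[OF Th]])

lemma Th_tk: "AE z in mu. Th (tk n) z = z ^ n" by (rule Th_eq[OF tk_K isrep_trigp[OF trigp_pow]])

lemma Th_T_pow: "x : K ==> AE z in mu. Th ((T ^^ n) x) z = z ^ n * Th x z"
proof (induction n)
 case (Suc n)
 have "AE z in mu. Th (T ((T ^^ n) x)) z = z * Th ((T ^^ n) x) z" by (rule Th_T[OF T_pow_K[OF Suc.prems]])
 thus ?case using Suc.IH[OF Suc.prems] by eventually_elim (simp add: mult.assoc)
qed simp

lemma T_T'_pow: "x : K ==> (T ^^ n) ((T' ^^ n) x) = x"
proof (induction n arbitrary: x)
 case (Suc n)
 have "(T ^^ Suc n) ((T' ^^ Suc n) x) = T ((T ^^ n) ((T' ^^ n) (T' x)))" by (simp add: funpow_swap1[of T'])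
 thus ?case using Suc by (simp add: mL_K T_T')
qed simp

lemma mu_unimod: "z : space mu ==> cnj z ^ n * z ^ n = 1"
 by (simp add: space_mu power_mult_distrib[symmetric] complex_norm_square[symmetric] mult.commute)

lemma Th_T'_pow: assumes x: "x : K" shows "AE z in mu. Th ((T' ^^ n) x) z = cnj z ^ n * Th x z"
 using Th_T_pow[OF T'_pow_K[OF x], of n n] AE_space
proof eventually_elim
 case (elim z)
 have "cnj z ^ n * Th x z = (cnj z ^ n * z ^ n) * Th ((T' ^^ n) x) z" using elim by (simp add: T_T'_pow x)
 thus ?case by (simp add: mu_unimod elim)
qed

lemma l2_mu_zero:
 assumes F: "integrable mu F" and 1: "!!n. (LINT z|mu. F z * z ^ n) = 0" "!!n. (LINT z|mu. F z * cnj z ^ n) = 0"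
 shows "AE z in mu. F z = 0"
 by (rule AE_zero_moments[OF mu(1,2) F 1])

lemma l2_mu_integrable: "f : l2 mu ==> integrable mu f"
 using l2_mult_integrable[OF _ l2_pow(3)[of 1], of f] by simp

text \<open>Riesz representation yields \<open>y\<close> such that the difference of
  \<open>F\<close> and \<open>Th y\<close> is orthogonal to the whole range. The range contains all
  powers of z and of its conjugate, so the difference has vanishing moments.\<close>

lemma Th_onto: assumes F: "F : l2 mu" shows "EX y:K. AE z in mu. Th y z = F z"
proof -
 \<comment> \<open>The functional is extended from \<open>K\<close> to the whole space through
   \<open>PM K\<close>, as \<open>riesz\<close> prescribes.\<close>
 have bd: "cmod (lip mu (Th (PM K x)) F) <= sqrt (lsq mu F) * norm x" for x
 proof -
  have k: "PM K x : K" by (rule PM_in[OF csub_K])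
  have "lsq mu (Th (PM K x)) = (norm (PM K x))^2"
  proof -
   have "complex_of_real (lsq mu (Th (PM K x))) = of_real ((norm (PM K x))^2)"
    unfolding lip_self[OF Th_l2[OF k], symmetric] cip_self[symmetric] by (rule Th_cip[OF k k, symmetric])
   thus ?thesis by (simp only: of_real_eq_iff)
  qed
  hence "(cmod (lip mu (Th (PM K x)) F))^2 <= (norm (PM K x))^2 * lsq mu F"
   using l2_CS[OF Th_l2[OF k] F] by simp
  also have "... <= (norm x)^2 * lsq mu F"
   by (intro mult_right_mono power_mono PM_norm csub_K lsq_nonneg) simp
  also have "... = (sqrt (lsq mu F) * norm x)^2" by (simp add: power_mult_distrib lsq_nonneg)
  finally show ?thesis by (rule power2_le_imp_le) (simp add: lsq_nonneg)
 qed
 have lin: "lip mu (Th (PM K (x + c *C y))) F = lip mu (Th (PM K x)) F + c * lip mu (Th (PM K y)) F" for x y c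
 proof -
  have k: "PM K x : K" "PM K y : K" by (simp_all add: PM_in csub_K)
  have "lip mu (Th (PM K x + c *C PM K y)) F = lip mu (%z. Th (PM K x) z + c * Th (PM K y) z) F"
   by (rule lip_cong[OF Th_l2 _ F F Th_add[OF k]]) (simp_all add: k K_sub l2_add l2_cmult Th_l2)
  thus ?thesis
   by (simp add: PM_add PM_scaleC csub_K lip_add_left lip_scale_left Th_l2 k l2_cmult F)
 qed
 obtain h where h: "!!x. lip mu (Th (PM K x)) F = cip x h"
 proof (rule riesz[of "%x. lip mu (Th (PM K x)) F" "sqrt (lsq mu F)"])
  show "lip mu (Th (PM K (x + y))) F = lip mu (Th (PM K x)) F + lip mu (Th (PM K y)) F" for x y using lin[of x 1 y] by simp
  show "lip mu (Th (PM K (c *C y))) F = c * lip mu (Th (PM K y)) F" for c y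
   using lin[of 0 c y] lin[of 0 1 0] by simp
 qed (use bd in auto)
 define y where "y = PM K h"
 have y: "y : K" by (simp add: y_def PM_in csub_K)
 define g where "g z = F z - Th y z" for z
 have g: "g : l2 mu" unfolding g_def by (intro l2_diff F Th_l2 y)
 have 0: "lip mu (Th x) g = 0" if x: "x : K" for x
 proof -
  have "lip mu (Th x) F = cip x y" using h[of x] x by (simp add: PM_id csub_K y_def PM_cip_right)
  thus ?thesis unfolding g_def by (simp add: lip_diff_right Th_l2 x y F Th_cip)
 qed
 have "AE z in mu. cnj (g z) = 0"
 proof (rule l2_mu_zero)
  show "integrable mu (%z. cnj (g z))" by (rule l2_mu_integrable[OF l2_cnj[OF g]])
  fix n
  have "lip mu (%z. z ^ n) g = lip mu (Th (tk n)) g"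
   by (rule lip_cong[OF l2_pow(1) Th_l2[OF tk_K] g g]) (use Th_tk[of n] in \<open>auto elim: eventually_mono\<close>)
  thus "(LINT z|mu. cnj (g z) * z ^ n) = 0" using 0[OF tk_K] by (simp add: lip_def mult.commute)
  have "AE z in mu. cnj z ^ n = Th ((T' ^^ n) k0) z"
   using Th_T'_pow[OF k0_K, of n] Th_tk[of 0] by eventually_elim (simp add: tk_def)
  hence "lip mu (%z. cnj z ^ n) g = lip mu (Th ((T' ^^ n) k0)) g"
   by (intro lip_cong[OF l2_pow(2) Th_l2[OF T'_pow_K[OF k0_K]] g g]) simp_all
  thus "(LINT z|mu. cnj (g z) * cnj z ^ n) = 0" using 0[OF T'_pow_K[OF k0_K]] by (simp add: lip_def mult.commute)
 qed
 hence "AE z in mu. Th y z = F z" by eventually_elim (simp add: g_def)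
 thus ?thesis using y by blast
qed

lemma Th_inj: assumes x: "x : K" and y: "y : K" and e: "AE z in mu. Th x z = Th y z" shows "x = y"
proof (rule csub_eqI[OF csub_K x y])
 fix v assume v: "v : K"
 show "cip x v = cip y v"
  unfolding Th_cip[OF x v] Th_cip[OF y v] by (rule lip_cong[OF Th_l2 Th_l2 Th_l2 Th_l2 e]) (simp_all add: x y v)
qed

end

section \<open>Multiplication operators and the commutant of the unitary modification\<close>

context clark
begin

text \<open>Bounded at every point of the circle and not just almost everywhere for
  \<open>mu\<close>, so that such a function is admissible for every measure on the circle at
  once.\<close>

definition bB :: "(complex => complex) => bool" where
 "bB \<Phi> <-> \<Phi> : Bm & (EX C. ALL z:sph. cmod (\<Phi> z) <= C)"

lemma bB_measurable: "bB \<Phi> ==> \<Phi> : borel_measurable mu"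
 unfolding bB_def using measurable_cong_sets[OF mu(1) refl] by blast

lemma bB_bound: assumes "bB \<Phi>" obtains C where "C >= 0" "AE z in mu. cmod (\<Phi> z) <= C" "!!z. z : sph ==> cmod (\<Phi> z) <= C"
proof -
 obtain C where C: "ALL z:sph. cmod (\<Phi> z) <= C" using assms unfolding bB_def by blast
 have "0 <= cmod (\<Phi> 1)" by simp
 also have "... <= C" using C by simp
 finally have "C >= 0" .
 moreover have "AE z in mu. cmod (\<Phi> z) <= C" using C by (intro AE_I2) (simp add: space_mu)
 ultimately show ?thesis using that[of C] C by simp
qed

lemma bB_mult: assumes "bB \<Phi>" "bB \<Psi>" shows "bB (%z. \<Phi> z * \<Psi> z)"
proof -
 obtain C D where C: "!!z. z : sph ==> cmod (\<Phi> z) <= C" "C >= 0" "!!z. z : sph ==> cmod (\<Psi> z) <= D"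
  using bB_bound[OF assms(1)] bB_bound[OF assms(2)] by metis
 hence "ALL z:sph. cmod (\<Phi> z * \<Psi> z) <= C * D"
  by (auto simp: norm_mult intro!: mult_mono)
 moreover have "(%z. \<Phi> z * \<Psi> z) : Bm" using assms unfolding bB_def by (intro borel_measurable_times) simp_all
 ultimately show ?thesis unfolding bB_def by blast
qed

lemma bB_indicator: "A : sets circle ==> bB (indicator A)"
 unfolding bB_def by (auto intro!: exI[of _ 1] simp: indicator_def)

lemma bB_cont: "continuous_on UNIV \<Phi> ==> bB \<Phi>"
proof -
 assume c: "continuous_on UNIV \<Phi>"
 obtain C where "!!z. z : sph ==> cmod (\<Phi> z) <= C"
  using sphere_continuous_bounded[OF continuous_on_subset[OF c subset_UNIV]] by blast
 thus ?thesis unfolding bB_def using continuous_measurable_circle[OF c refl] by (intro conjI exI[of _ C]) simp_all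
qed

lemma l2_bB: "bB \<Phi> ==> f : l2 mu ==> (%z. \<Phi> z * f z) : l2 mu"
proof -
 assume b: "bB \<Phi>" and f: "f : l2 mu"
 obtain C where "AE z in mu. cmod (\<Phi> z) <= C" using bB_bound[OF b] .
 thus ?thesis by (rule l2_bounded_mult[OF f bB_measurable[OF b]])
qed

definition mop :: "(complex => complex) => hl2 => hl2" where
 "mop \<Phi> x = (SOME y. y : K & (AE z in mu. Th y z = \<Phi> z * Th (PM K x) z))"

lemma mop: assumes "bB \<Phi>" shows "mop \<Phi> x : K" "AE z in mu. Th (mop \<Phi> x) z = \<Phi> z * Th (PM K x) z"
proof -
 have "EX y. y : K & (AE z in mu. Th y z = \<Phi> z * Th (PM K x) z)"
  using Th_onto[OF l2_bB[OF assms Th_l2[OF PM_in[OF csub_K, of x]]]] by blast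
 from someI_ex[OF this] show "mop \<Phi> x : K" "AE z in mu. Th (mop \<Phi> x) z = \<Phi> z * Th (PM K x) z"
  unfolding mop_def by blast+
qed

lemma mop_K: "bB \<Phi> ==> x : K ==> AE z in mu. Th (mop \<Phi> x) z = \<Phi> z * Th x z"
 using mop(2)[of \<Phi> x] by (simp add: PM_id csub_K)

lemma mop_eqI: "bB \<Phi> ==> y : K ==> AE z in mu. Th y z = \<Phi> z * Th (PM K x) z ==> mop \<Phi> x = y"
proof (rule Th_inj[OF mop(1)])
 assume b: "bB \<Phi>" and e: "AE z in mu. Th y z = \<Phi> z * Th (PM K x) z"
 show "AE z in mu. Th (mop \<Phi> x) z = Th y z" using mop(2)[OF b, of x] e by eventually_elim simp
qed

lemma cip_mop:
 assumes b: "bB \<Phi>" and x: "x : K" and y: "y : K"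
 shows "cip (mop \<Phi> x) y = (LINT z|mu. \<Phi> z * (Th x z * cnj (Th y z)))"
proof -
 have "cip (mop \<Phi> x) y = lip mu (%z. \<Phi> z * Th x z) (Th y)"
  unfolding Th_cip[OF mop(1)[OF b] y]
  by (rule lip_cong[OF Th_l2[OF mop(1)[OF b]] l2_bB[OF b Th_l2[OF x]] Th_l2[OF y] Th_l2[OF y] mop_K[OF b x]]) simp
 thus ?thesis by (simp add: lip_def mult.assoc)
qed

lemma lsq_Th: "x : K ==> lsq mu (Th x) = (norm x)^2"
 using Th_cip[of x x] by (simp add: cip_self lip_self Th_l2 of_real_eq_iff del: of_real_power)

lemma opK_mop: assumes b: "bB \<Phi>" shows "opK (mop \<Phi>)"
proof -
 obtain C where C: "C >= 0" "!!z. z : sph ==> cmod (\<Phi> z) <= C" using bB_bound[OF b] by metis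
 have lin: "mop \<Phi> (x + c *C y) = mop \<Phi> x + c *C mop \<Phi> y" for x y c
 proof (rule mop_eqI[OF b])
  have k: "PM K x : K" "PM K y : K" by (simp_all add: PM_in csub_K)
  show "mop \<Phi> x + c *C mop \<Phi> y : K" by (simp add: K_sub mop b)
  show "AE z in mu. Th (mop \<Phi> x + c *C mop \<Phi> y) z = \<Phi> z * Th (PM K (x + c *C y)) z"
   using Th_add[OF mop(1)[OF b] mop(1)[OF b], of x c y] Th_add[OF k, of c] mop(2)[OF b, of x] mop(2)[OF b, of y]
   unfolding PM_add[OF csub_K] PM_scaleC[OF csub_K]
   by eventually_elim (simp add: distrib_left mult.left_commute)
 qed
 have bd: "norm (mop \<Phi> x) <= C * norm x" for x
 proof -
  have k: "PM K x : K" by (simp add: PM_in csub_K)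
  have "(norm (mop \<Phi> x))^2 = lsq mu (Th (mop \<Phi> x))" by (simp add: lsq_Th mop b)
  also have "... <= (LINT z|mu. C\<^sup>2 * (cmod (Th (PM K x) z))^2)"
   unfolding lsq_def
  proof (rule integral_mono_AE)
   show "AE z in mu. (cmod (Th (mop \<Phi> x) z))\<^sup>2 <= C\<^sup>2 * (cmod (Th (PM K x) z))^2"
    using mop(2)[OF b, of x] AE_space
    by eventually_elim (auto simp: norm_mult power_mult_distrib space_mu C power_mono intro!: mult_right_mono)
  qed (use l2_integrable[OF Th_l2] k mop(1)[OF b] in auto)
  also have "... = C\<^sup>2 * (norm (PM K x))^2" using lsq_Th[OF k] by (simp add: lsq_def)
  also have "... <= (C * norm x)^2"
   unfolding power_mult_distrib by (intro mult_left_mono power_mono PM_norm csub_K) simp_all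
  finally show ?thesis by (rule power2_le_imp_le) (simp add: C)
 qed
 have "mop \<Phi> 0 = 0" using bd[of 0] by simp
 thus ?thesis
  unfolding opK_def using lin[of _ 1] lin[of 0] bd mop(1)[OF b] by (auto intro!: bclI[where C=C])
qed

lemma mop_mop: assumes b: "bB \<Phi>" "bB \<Psi>" and x: "x : K" shows "mop \<Phi> (mop \<Psi> x) = mop (%z. \<Phi> z * \<Psi> z) x"
proof (rule mop_eqI[OF b(1) mop(1)[OF bB_mult[OF b]]])
 show "AE z in mu. Th (mop (%z. \<Phi> z * \<Psi> z) x) z = \<Phi> z * Th (PM K (mop \<Psi> x)) z"
  unfolding PM_id[OF csub_K mop(1)[OF b(2)]]
  using mop_K[OF bB_mult[OF b] x] mop_K[OF b(2) x] by eventually_elim simp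
qed

lemma mop_z: "x : K ==> mop (%z. z) x = T x"
 by (rule mop_eqI) (simp_all add: bB_cont mS_K PM_id csub_K Th_T)

lemma mop_one: "x : K ==> mop (%z. 1) x = x"
 by (rule mop_eqI) (simp_all add: bB_cont PM_id csub_K)

text \<open>The adjoint of \<open>A\<close> commutes with both \<open>T\<close> and
  \<open>T'\<close>, so its values on the orbit of \<open>k0\<close> are determined by its value at
  \<open>k0\<close>. Comparing moments shows that \<open>A\<close> multiplies by the conjugate of
  the function representing that value.\<close>

theorem commutant:
 assumes A: "opK A" and c: "!!x. x : K ==> A (T x) = T (A x)"
 obtains \<Phi> where "bB \<Phi>" "!!x. x : K ==> A x = mop \<Phi> x"
proof -
 let ?B = "adK A"
 have BK: "x : K ==> ?B x : K" for x by (rule opK_K[OF opK_adK[OF A]])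
 have BT': "?B (T' x) = T' (?B x)" if x: "x : K" for x
 proof (rule csub_eqI[OF csub_K BK[OF mL_K[OF x]] mL_K[OF BK[OF x]]])
  fix v assume v: "v : K"
  have "cip (?B (T' x)) v = cip x (T (A v))" by (simp add: cip_adK A v cip_mS_right x opK_K)
  also have "... = cip (?B x) (T v)" by (simp add: cip_adK A v mS_K c)
  finally show "cip (?B (T' x)) v = cip (T' (?B x)) v" by (simp add: cip_mS_right v BK x)
 qed
 \<comment> \<open>\<open>T\<close> is the inverse of \<open>T'\<close> on \<open>K\<close>, so
   commuting with one gives commuting with the other.\<close>
 have BT: "?B (T x) = T (?B x)" if x: "x : K" for x
  using BT'[OF mS_K[OF x, of a]] T_T'[OF BK[OF mS_K[OF x, of a]]] by (simp add: T'_T x)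
 have BTn: "?B ((T ^^ n) x) = (T ^^ n) (?B x)" "?B ((T' ^^ n) x) = (T' ^^ n) (?B x)" if "x : K" for x n
  by (induction n) (simp_all add: BT BT' T_pow_K T'_pow_K that)
 define \<phi> where "\<phi> z = cnj (Th (?B k0) z)" for z
 have bk: "?B k0 : K" by (rule BK[OF k0_K])
 have ml: "\<phi> : l2 mu" unfolding \<phi>_def by (rule l2_cnj[OF Th_l2[OF bk]])
 have eq: "AE z in mu. Th (A x) z = \<phi> z * Th x z" if x: "x : K" for x
 proof -
  have Ax: "A x : K" by (rule opK_K[OF A x])
  have i1: "integrable mu (%z. Th (A x) z * g z)" "integrable mu (%z. \<phi> z * Th x z * g z)"
   if "g = (%z. z ^ n) \<or> g = (%z. cnj z ^ n)" for g n
  proof -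
   have g: "g : borel_measurable mu" "AE z in mu. cmod (g z) <= 1"
    using that l2_measurable[OF l2_pow(1)] l2_measurable[OF l2_pow(2)]
    by (auto intro!: AE_I2 simp: space_mu norm_power)
   have "(%z. g z * Th x z) : l2 mu" by (rule l2_bounded_mult[OF Th_l2[OF x] g])
   from l2_mult_integrable[OF ml this] show "integrable mu (%z. \<phi> z * Th x z * g z)" by (simp add: ac_simps)
   have "(%z. g z * Th (A x) z) : l2 mu" by (rule l2_bounded_mult[OF Th_l2[OF Ax] g])
   from l2_mu_integrable[OF this] show "integrable mu (%z. Th (A x) z * g z)" by (simp add: mult.commute)
  qed
  have "AE z in mu. Th (A x) z - \<phi> z * Th x z = 0"
  proof (rule l2_mu_zero)
   show "integrable mu (%z. Th (A x) z - \<phi> z * Th x z)"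
    using i1(1)[of "%z. z ^ 0" 0] i1(2)[of "%z. z ^ 0" 0] by simp
   fix n
   have "(LINT z|mu. Th (A x) z * cnj z ^ n) = lip mu (Th (A x)) (%z. z ^ n)" by (simp add: lip_def)
   also have "... = lip mu (Th (A x)) (Th (tk n))"
    by (rule lip_cong[OF Th_l2[OF Ax] Th_l2[OF Ax] l2_pow(1) Th_l2[OF tk_K]]) (use Th_tk[of n] in \<open>auto elim: eventually_mono\<close>)
   also have "... = cip x (?B (tk n))" unfolding Th_cip[OF Ax tk_K, symmetric] by (simp add: cip_adK' A x)
   also have "?B (tk n) = (T ^^ n) (?B k0)" unfolding tk_def by (rule BTn(1)[OF k0_K])
   also have "cip x ((T ^^ n) (?B k0)) = lip mu (Th x) (%z. z ^ n * Th (?B k0) z)"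
    unfolding Th_cip[OF x T_pow_K[OF bk]]
    by (rule lip_cong[OF Th_l2[OF x] Th_l2[OF x] Th_l2[OF T_pow_K[OF bk]] _ _ Th_T_pow[OF bk]])
     (rule l2_bB[OF bB_cont Th_l2[OF bk]], intro continuous_intros, simp)
   also have "... = (LINT z|mu. \<phi> z * Th x z * cnj z ^ n)" by (simp add: lip_def \<phi>_def ac_simps)
   finally show "(LINT z|mu. (Th (A x) z - \<phi> z * Th x z) * cnj z ^ n) = 0"
    using i1(1)[of "%z. cnj z ^ n" n] i1(2)[of "%z. cnj z ^ n" n] by (simp add: left_diff_distrib)
   have "AE z in mu. cnj z ^ n = Th ((T' ^^ n) k0) z"
    using Th_T'_pow[OF k0_K, of n] Th_tk[of 0] by eventually_elim (simp add: tk_def)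
   have "(LINT z|mu. Th (A x) z * z ^ n) = lip mu (Th (A x)) (%z. cnj z ^ n)" by (simp add: lip_def)
   also have "... = lip mu (Th (A x)) (Th ((T' ^^ n) k0))"
    by (rule lip_cong[OF Th_l2[OF Ax] Th_l2[OF Ax] l2_pow(2) Th_l2[OF T'_pow_K[OF k0_K]]]) (simp, fact)
   also have "... = cip x (?B ((T' ^^ n) k0))" unfolding Th_cip[OF Ax T'_pow_K[OF k0_K], symmetric] by (simp add: cip_adK' A x)
   also have "?B ((T' ^^ n) k0) = (T' ^^ n) (?B k0)" by (rule BTn(2)[OF k0_K])
   also have "cip x ((T' ^^ n) (?B k0)) = lip mu (Th x) (%z. cnj z ^ n * Th (?B k0) z)"
    unfolding Th_cip[OF x T'_pow_K[OF bk]]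
    by (rule lip_cong[OF Th_l2[OF x] Th_l2[OF x] Th_l2[OF T'_pow_K[OF bk]] _ _ Th_T'_pow[OF bk]])
     (rule l2_bB[OF bB_cont Th_l2[OF bk]], intro continuous_intros, simp)
   also have "... = (LINT z|mu. \<phi> z * Th x z * z ^ n)" by (simp add: lip_def \<phi>_def ac_simps)
   finally show "(LINT z|mu. (Th (A x) z - \<phi> z * Th x z) * z ^ n) = 0"
    using i1(1)[of "%z. z ^ n" n] i1(2)[of "%z. z ^ n" n] by (simp add: left_diff_distrib)
  qed
  thus ?thesis by simp
 qed
 obtain C where C: "C > 0" "!!x. norm (A x) <= C * norm x" using bcl_bound[OF opK_bcl[OF A]] by blast
 have \<phi>m: "\<phi> : borel_measurable mu" by (rule l2_measurable[OF ml])
 have bd: "AE z in mu. cmod (\<phi> z) <= C"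
 proof -
  \<comment> \<open>Testing \<open>A\<close> on the indicator of the set where \<phi> exceeds the
    norm bound: the norm inequality forces this set to be null.\<close>
  define E where "E = {z : space mu. C < cmod (\<phi> z)}"
  have E: "E : sets mu" unfolding E_def using \<phi>m by measurable
  have i: "(indicator E :: complex => complex) : l2 mu"
   by (rule l2_mu_bounded[where C=1]) (use E in \<open>auto simp: indicator_def\<close>)
  obtain y where y: "y : K" "AE z in mu. Th y z = indicator E z" using Th_onto[OF i] by blast
  have Ay: "A y : K" by (rule opK_K[OF A y(1)])
  have "lsq mu (Th (A y)) <= C\<^sup>2 * lsq mu (Th y)"
   unfolding lsq_Th[OF Ay] lsq_Th[OF y(1)] power_mult_distrib[symmetric] by (intro power_mono C) simp
  moreover have "C\<^sup>2 * lsq mu (Th y) = (LINT z|mu. C\<^sup>2 * (cmod (Th y z))^2)" by (simp add: lsq_def)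
  ultimately have le: "(LINT z|mu. (cmod (Th (A y) z))^2 - C\<^sup>2 * (cmod (Th y z))^2) <= 0"
   using l2_integrable[OF Th_l2[OF Ay]] l2_integrable[OF Th_l2[OF y(1)]] by (simp add: lsq_def)
  have nn: "AE z in mu. 0 <= (cmod (Th (A y) z))^2 - C\<^sup>2 * (cmod (Th y z))^2"
   using eq[OF y(1)] y(2) by eventually_elim (use C(1) in \<open>auto simp: E_def indicator_def intro!: power_mono\<close>)
  have "AE z in mu. (cmod (Th (A y) z))\<^sup>2 - C\<^sup>2 * (cmod (Th y z))^2 = 0"
   using le integral_nonneg_AE[OF nn]
   by (subst integral_nonneg_eq_0_iff_AE[OF _ nn, symmetric])
    (use l2_integrable[OF Th_l2[OF Ay]] l2_integrable[OF Th_l2[OF y(1)]] in auto)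
  thus ?thesis
   using eq[OF y(1)] y(2) AE_space
  proof eventually_elim
   case (elim z)
   show ?case
   proof (rule ccontr)
    assume n: "\<not> cmod (\<phi> z) <= C"
    hence "(cmod (\<phi> z))^2 = C\<^sup>2" using elim by (simp add: E_def)
    thus False using n C(1) by (simp add: power2_eq_iff_nonneg)
   qed
  qed
 qed
 \<comment> \<open>A change on a null set makes the multiplier bounded everywhere, as
   \<open>bB\<close> demands.\<close>
 define \<Phi> where "\<Phi> z = (if cmod (\<phi> z) <= C then \<phi> z else 0)" for z
 have "\<Phi> : borel_measurable mu" unfolding \<Phi>_def using \<phi>m by measurable
 hence b: "bB \<Phi>" unfolding bB_def measurable_cong_sets[OF mu(1) refl]
  using C(1) by (auto simp: \<Phi>_def intro!: exI[of _ C])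
 have "A x = mop \<Phi> x" if x: "x : K" for x
 proof (rule mop_eqI[OF b opK_K[OF A x], symmetric])
  show "AE z in mu. Th (A x) z = \<Phi> z * Th (PM K x) z"
   unfolding PM_id[OF csub_K x] using eq[OF x] bd by eventually_elim (simp add: \<Phi>_def)
 qed
 with b show ?thesis by (rule that)
qed

end

section \<open>Passage between operators on functions and operators on classes\<close>

lemma ip_eq_cip: "f : L2 ==> g : L2 ==> ip f g = cip (cls f) (cls g)"
 by (simp add: cip_cls)

text \<open>The choice in \<open>proj\<close> is harmless: orthogonality determines the class of the
  chosen function.\<close>

lemma proj_cls:
 assumes M: "csub M'" "M = {f : L2. cls f : M'}" and f: "f : L2"
 shows "Defs.proj M f : M" "cls (Defs.proj M f) = PM M' (cls f)"
proof -
 let ?P = "%g. g : M & (ALL h:M. ip (%z. f z - g z) h = 0)"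
 have ip: "ip (%z. f z - g z) h = cip (cls f - cls g) (cls h)" if "g : M" "h : M" for g h
  using that f by (simp add: M(2) ip_eq_cip L2_diff cls_diff)
 have "?P (rp (PM M' (cls f)))"
  by (auto simp: ip M(2) PM_in M(1) PM_orth)
 from someI[of ?P, OF this] have P: "?P (Defs.proj M f)" unfolding Defs.proj_def .
 thus "Defs.proj M f : M" by blast
 show "cls (Defs.proj M f) = PM M' (cls f)"
 proof (rule PM_unique[OF M(1), symmetric])
  show "cls (Defs.proj M f) : M'" using P by (auto simp: M(2))
  fix v assume v: "v : M'"
  hence "rp v : M" by (simp add: M(2))
  hence "cip (cls f - cls (Defs.proj M f)) v = 0" using P ip[of "Defs.proj M f" "rp v"] by auto
  thus "cip (cls (Defs.proj M f)) v = cip (cls f) v" by (simp add: cip_diff_left)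
 qed
qed

context inner_fn
begin

lemma Ku_iff: "f : Ku u <-> f : L2 & cls f : K"
proof -
 have ip: "ip f (%z. U z * g z) = cip (cls f) (Mu (cls g))" if "f : L2" "g : L2" for f g
  using that by (simp add: mul_cls U_Li ip_eq_cip Li_mult_L2)
 show ?thesis
 proof
  assume "f : Ku u"
  hence f: "f : L2" "cls f : HH" and o: "!!g. g : H2 ==> ip f (%z. U z * g z) = 0"
   by (auto simp: Ku_def H2_iff)
  have "cip (cls f) (Mu y) = 0" if "y : HH" for y
   using o[of "rp y"] ip[OF f(1), of "rp y"] that by (simp add: H2_iff)
  thus "f : L2 & cls f : K" using f by (simp add: K_iff)
 next
  assume "f : L2 & cls f : K"
  thus "f : Ku u" using ip by (auto simp: Ku_def H2_iff K_iff)
 qed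
qed

lemma Ku_eq: "Ku u = {f : L2. cls f : K}" using Ku_iff by blast

lemmas proj_Ku = proj_cls[OF csub_K Ku_eq, folded Ku_eq]

lemma rp_Ku: "x : K ==> rp x : Ku u" by (simp add: Ku_iff)

text \<open>Composition with \<open>PM K\<close> extends an operator on the model space to all of
  \<open>hl2\<close>, so that the theory of \<open>bcl\<close> applies.\<close>

definition opr :: "oper => hl2 => hl2" where "opr A x = cls (A (rp (PM K x)))"
definition fn :: "(hl2 => hl2) => oper" where "fn A f = rp (A (cls f))"

lemma cls_fn: "cls (fn A f) = A (cls f)" by (simp add: fn_def)

lemma bounded_opD:
 assumes A: "bounded_op u A"
 shows "f : Ku u ==> A f : L2" "f : Ku u ==> cls (A f) : K"
  "f : Ku u ==> g : Ku u ==> cls (A (%z. f z + g z)) = cls (A f) + cls (A g)"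
  "f : Ku u ==> cls (A (%z. c * f z)) = c *C cls (A f)"
  "EX C. ALL f:Ku u. norm (cls (A f)) <= C * norm (cls f)"
proof -
 have L: "f : Ku u ==> f : L2" for f by (simp add: Ku_iff)
 have AK: "f : Ku u ==> A f : Ku u" for f using A by (simp add: bounded_op_def)
 thus L': "A f : L2" "cls (A f) : K" if "f : Ku u" for f using that by (simp_all add: Ku_iff)
 show "cls (A (%z. f z + g z)) = cls (A f) + cls (A g)" if f: "f : Ku u" and g: "g : Ku u"
 proof -
  have "(%z. f z + g z) : Ku u" using f g by (simp add: Ku_iff L2_add cls_add K_sub)
  hence "cls (A (%z. f z + g z)) = cls (%z. A f z + A g z)"
   using A f g L' by (intro cls_cong) (auto simp: bounded_op_def L2_add)
  thus ?thesis by (simp add: cls_add L' f g)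
 qed
 show "cls (A (%z. c * f z)) = c *C cls (A f)" if f: "f : Ku u"
 proof -
  have "(%z. c * f z) : Ku u" using f by (simp add: Ku_iff cls_scaleC K_sub Li_mult_L2 Li_const)
  hence "cls (A (%z. c * f z)) = cls (%z. c * A f z)"
   using A f L' by (intro cls_cong) (auto simp: bounded_op_def Li_mult_L2 Li_const)
  thus ?thesis by (simp add: cls_scaleC L' f)
 qed
 obtain C where "ALL f:Ku u. L2norm (A f) <= C * L2norm f" using A unfolding bounded_op_def by blast
 thus "EX C. ALL f:Ku u. norm (cls (A f)) <= C * norm (cls f)"
  by (intro exI[of _ C]) (simp add: norm_cls L L')
qed

text \<open>Linearity up to null sets and boundedness are applied to the difference of the two
  functions, whose norm is 0.\<close>

lemma bounded_op_cong:
 assumes A: "bounded_op u A" and f: "f : Ku u" and g: "g : Ku u" and e: "cls f = cls g"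
 shows "cls (A f) = cls (A g)"
proof -
 have L: "f : L2" "g : L2" using f g by (auto simp: Ku_iff)
 let ?g = "%z. -1 * g z"
 have g': "?g : Ku u" using g by (simp only: Ku_iff cls_scaleC) (simp add: K_sub Li_mult_L2 Li_const scaleC_minus_one L2_eq_l2 l2_uminus)
 let ?d = "%z. f z + ?g z"
 have d: "?d : Ku u" using f g' unfolding Ku_iff by (simp only: L2_add cls_add K_sub simp_thms)
 have "cls ?d = cls f + (-1) *C cls g"
  using L g' by (simp only: cls_add cls_scaleC Ku_iff)
 hence "cls ?d = 0" by (simp add: e scaleC_minus_one)
 moreover have "cls (A ?d) = cls (A f) - cls (A g)"
  unfolding bounded_opD(3)[OF A f g'] bounded_opD(4)[OF A g] by (simp add: scaleC_minus_one)
 moreover obtain C where "norm (cls (A ?d)) <= C * norm (cls ?d)" using bounded_opD(5)[OF A] d by blast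
 ultimately show ?thesis by simp
qed

lemma cls_bounded_op: "bounded_op u A ==> f : Ku u ==> cls (A f) = opr A (cls f)"
 using bounded_op_cong[of A f "rp (PM K (cls f))"] by (simp add: opr_def Ku_iff PM_id csub_K)

lemma opK_opr: assumes A: "bounded_op u A" shows "opK (opr A)"
proof -
 have k: "rp (PM K x) : Ku u" for x by (rule rp_Ku[OF PM_in[OF csub_K]])
 have kk: "PM K x : K" for x by (rule PM_in[OF csub_K])
 have add: "opr A (x + y) = opr A x + opr A y" for x y
 proof -
  have s: "(%z. rp (PM K x) z + rp (PM K y) z) : Ku u" by (simp add: Ku_iff L2_add cls_add K_sub kk)
  have "opr A (x + y) = cls (A (%z. rp (PM K x) z + rp (PM K y) z))"
   unfolding opr_def by (rule bounded_op_cong[OF A k s]) (simp add: cls_add PM_add csub_K)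
  also have "... = opr A x + opr A y" unfolding opr_def by (rule bounded_opD(3)[OF A k k])
  finally show ?thesis .
 qed
 have sc: "opr A (c *C x) = c *C opr A x" for c x
 proof -
  have s: "(%z. c * rp (PM K x) z) : Ku u" by (simp add: Ku_iff Li_mult_L2 Li_const cls_scaleC K_sub kk)
  have "opr A (c *C x) = cls (A (%z. c * rp (PM K x) z))"
   unfolding opr_def by (rule bounded_op_cong[OF A k s]) (simp add: cls_scaleC PM_scaleC csub_K)
  also have "... = c *C opr A x" unfolding opr_def by (rule bounded_opD(4)[OF A k])
  finally show ?thesis .
 qed
 obtain C where C: "!!f. f : Ku u ==> norm (cls (A f)) <= C * norm (cls f)" using bounded_opD(5)[OF A] by blast
 have "norm (opr A x) <= \<bar>C\<bar> * norm x" for x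
 proof -
  have "norm (opr A x) <= C * norm (PM K x)" using C[OF k[of x]] by (simp add: opr_def)
  also have "... <= \<bar>C\<bar> * norm (PM K x)" by (rule mult_right_mono) simp_all
  also have "... <= \<bar>C\<bar> * norm x" by (intro mult_left_mono PM_norm csub_K) simp
  finally show ?thesis .
 qed
 with add sc have "bcl (opr A)" by (rule bclI)
 moreover have "opr A x : K" for x unfolding opr_def by (rule bounded_opD(2)[OF A k])
 ultimately show ?thesis by (simp add: opK_def)
qed

lemma bounded_op_fn: assumes A: "opK A" shows "bounded_op u (fn A)"
 unfolding bounded_op_def
proof (intro conjI ballI allI)
 have B: "bcl A" by (rule opK_bcl[OF A])
 fix f assume f: "f : Ku u"
 hence f': "f : L2" "cls f : K" by (auto simp: Ku_iff)
 show "fn A f : Ku u" unfolding fn_def by (rule rp_Ku[OF opK_K[OF A f'(2)]])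
 show "fn A (%z. f z + g z) \<doteq> (%z. fn A f z + fn A g z)" if g: "g : Ku u" for g
  using g f' rp_cls[of "%z. rp (A (cls f)) z + rp (A (cls g)) z"] by (simp add: fn_def Ku_iff cls_add bcl_add[OF B] L2_add)
 show "fn A (%z. c * f z) \<doteq> (%z. c * fn A f z)" for c
  using rp_cls[of "%z. c * rp (A (cls f)) z"] f'
  by (simp add: fn_def cls_scaleC bcl_scaleC[OF B] Li_mult_L2 Li_const)
next
 obtain C where C: "!!x. norm (A x) <= C * norm x" using bcl_bound[OF opK_bcl[OF A]] by blast
 have "L2norm (fn A f) <= C * L2norm f" if "f : Ku u" for f
  using C[of "cls f"] that norm_cls[of "fn A f"] norm_cls[of f] by (simp add: cls_fn Ku_iff) (simp add: fn_def)
 thus "EX C. ALL f:Ku u. L2norm (fn A f) <= C * L2norm f" by blast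
qed

lemma opr_fn: "opK A ==> x : K ==> opr (fn A) x = A x"
 by (simp add: opr_def cls_fn PM_id csub_K)

lemma op_eq_cls:
 assumes "!!f. f : Ku u ==> A f : L2" "!!f. f : Ku u ==> B f : L2"
 shows "op_eq u A B <-> (ALL f:Ku u. cls (A f) = cls (B f))"
 unfolding op_eq_def using assms by (simp add: cls_eq_iff)

lemma conj_op_cls: assumes f: "f : L2" shows "conj_op u f : L2" "cls (conj_op u f) = Cc (cls f)"
proof -
 have eq: "conj_op u f = (%z. U z * (cnj z * cnj (f z)))" by (simp add: conj_op_def fun_eq_iff)
 have l: "(%z. cnj z * cnj (f z)) : L2" by (intro Li_mult_L2 Li_pow L2_cnj f)
 show "conj_op u f : L2" unfolding eq by (rule Li_mult_L2[OF U_Li l])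
 show "cls (conj_op u f) = Cc (cls f)"
  unfolding eq Cc_def by (simp add: cj_cls f mul_cls Li_pow L2_cnj U_Li l)
qed

lemma k0_cls: "Defs.k0 u : L2" "cls (Defs.k0 u) = k0"
proof -
 have eq: "Defs.k0 u = (%z. 1 - cnj (u 0) * U z)" by (simp add: Defs.k0_def fun_eq_iff)
 show "Defs.k0 u : L2" unfolding eq by (intro Li_L2 Li_diff Li_mult Li_const U_Li)
 show "cls (Defs.k0 u) = k0"
  unfolding eq local.k0_def
  by (simp add: cls_diff Li_L2 Li_const Li_mult U_Li cls_scaleC e_def mul_cls)
qed

lemma k0_tilde_cls: "k0_tilde u : L2" "cls (k0_tilde u) = kt"
 unfolding k0_tilde_def by (simp_all add: conj_op_cls k0_cls Cc_k0)

lemma shift_cls: assumes f: "f : L2" shows "Defs.shift u f : L2" "cls (Defs.shift u f) = S (cls f)"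
proof -
 have l: "(%z. z * f z) : L2" by (intro Li_mult_L2 Li_pow f)
 show "Defs.shift u f : L2" unfolding Defs.shift_def using proj_Ku(1)[OF l] by (simp add: Ku_iff)
 show "cls (Defs.shift u f) = S (cls f)" unfolding Defs.shift_def S_def by (simp add: proj_Ku l mul_cls Li_pow f)
qed

lemma mod_shift_cls: assumes f: "f : L2" shows "mod_shift u a f : L2" "cls (mod_shift u a f) = mS a (cls f)"
proof -
 let ?c = "a / (1 - a * cnj (u 0)) * ip f (k0_tilde u)"
 have eq: "mod_shift u a f = (%z. Defs.shift u f z + ?c * Defs.k0 u z)"
  by (simp add: mod_shift_def tensor_def fun_eq_iff)
 have l: "(%z. ?c * Defs.k0 u z) : L2" by (rule Li_mult_L2[OF Li_const k0_cls(1)])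
 show "mod_shift u a f : L2" unfolding eq by (rule L2_add[OF shift_cls(1)[OF f] l])
 show "cls (mod_shift u a f) = mS a (cls f)"
  unfolding eq mS_def cls_add[OF shift_cls(1)[OF f] l] cls_scaleC[OF k0_cls(1)] k0_cls(2)
  by (simp only: shift_cls f ip_eq_cip k0_tilde_cls)
qed

text \<open>With \<open>\<epsilon> = 0\<close> a quadratic form determines the operator.\<close>

lemma numerical_radius:
 assumes B: "opK B" and q: "!!x. x : K ==> cmod (cip (B x) x) <= \<epsilon> * (norm x)^2" and x: "x : K"
 shows "norm (B x) <= 2 * \<epsilon> * norm x"
proof -
 have b: "bcl B" by (rule opK_bcl[OF B])
 have pol: "cmod (cip (B x) y) <= \<epsilon> * ((norm x)^2 + (norm y)^2)" if y: "y : K" for y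
 proof -
  define Qf where "Qf c = cip (B (x + c *C y)) (x + c *C y)" for c
  have Qb: "cmod (Qf c) <= \<epsilon> * (norm (x + c *C y))^2" for c unfolding Qf_def by (rule q) (simp add: K_sub x y)
  have n: "complex_of_real ((norm (x + c *C y))^2) = of_real ((norm x)^2) + cnj c * cip x y + c * cip y x + c * cnj c * of_real ((norm y)^2)" for c
   unfolding cip_self[symmetric] by (simp add: cip_add_left cip_add_right cip_cl cip_cr algebra_simps)
  have par: "(norm (x + 1 *C y))^2 + (norm (x + (-1) *C y))^2 = 2 * (norm x)^2 + 2 * (norm y)^2"
   "(norm (x + \<i> *C y))^2 + (norm (x + (-\<i>) *C y))^2 = 2 * (norm x)^2 + 2 * (norm y)^2"
  proof -
   have "complex_of_real ((norm (x + 1 *C y))^2 + (norm (x + (-1) *C y))^2) = of_real (2 * (norm x)^2 + 2 * (norm y)^2)"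
    "complex_of_real ((norm (x + \<i> *C y))^2 + (norm (x + (-\<i>) *C y))^2) = of_real (2 * (norm x)^2 + 2 * (norm y)^2)"
    unfolding of_real_add n by (simp_all add: algebra_simps)
   thus "(norm (x + 1 *C y))^2 + (norm (x + (-1) *C y))^2 = 2 * (norm x)^2 + 2 * (norm y)^2"
    "(norm (x + \<i> *C y))^2 + (norm (x + (-\<i>) *C y))^2 = 2 * (norm x)^2 + 2 * (norm y)^2"
    unfolding of_real_eq_iff by blast+
  qed
  \<comment> \<open>Polarization over the fourth roots of unity.\<close>
  have "4 * cip (B x) y = Qf 1 - Qf (-1) + \<i> * Qf \<i> - \<i> * Qf (-\<i>)"
   unfolding Qf_def
   by (simp add: bcl_add[OF b] bcl_scaleC[OF b] cip_add_left cip_add_right cip_cl cip_cr algebra_simps)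
  hence "cmod (4 * cip (B x) y) = cmod (Qf 1 - Qf (-1) + \<i> * Qf \<i> - \<i> * Qf (-\<i>))" by simp
  also have "... <= cmod (Qf 1) + cmod (Qf (-1)) + cmod (Qf \<i>) + cmod (Qf (-\<i>))"
   using norm_triangle_ineq4[of "Qf 1 - Qf (-1) + \<i> * Qf \<i>" "\<i> * Qf (-\<i>)"]
    norm_triangle_ineq[of "Qf 1 - Qf (-1)" "\<i> * Qf \<i>"] norm_triangle_ineq4[of "Qf 1" "Qf (-1)"]
   by (simp add: norm_mult)
  also have "... <= \<epsilon> * ((norm (x + 1 *C y))^2 + (norm (x + (-1) *C y))^2) + \<epsilon> * ((norm (x + \<i> *C y))^2 + (norm (x + (-\<i>) *C y))^2)"
   unfolding distrib_left using Qb[of 1] Qb[of "-1"] Qb[of \<i>] Qb[of "-\<i>"] by linarith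
  also have "... = 4 * (\<epsilon> * ((norm x)^2 + (norm y)^2))" unfolding par by (simp add: algebra_simps)
  finally show ?thesis by (simp add: norm_mult)
 qed
 show ?thesis
 proof (cases "B x = 0")
  case False
  hence x0: "x ~= 0" using bcl_zero[OF b] by auto
  \<comment> \<open>Rescales \<open>B x\<close> to the norm of \<open>x\<close>; with this second
    vector the polarized bound is homogeneous of degree two in \<open>norm x\<close>.\<close>
  define t where "t = norm x / norm (B x)"
  define y where "y = complex_of_real t *C B x"
  have y: "y : K" by (simp add: y_def K_sub opK_K[OF B x])
  have ny: "norm y = norm x" using False by (simp add: y_def norm_scaleC t_def norm_divide)
  have "cip (B x) y = of_real (t * (norm (B x))^2)" by (simp add: y_def cip_cr cip_self)
  also have "t * (norm (B x))^2 = norm x * norm (B x)" using False by (simp add: t_def power2_eq_square)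
  finally have "cmod (cip (B x) y) = norm x * norm (B x)" by (simp add: norm_mult)
  hence "norm x * norm (B x) <= norm x * (2 * \<epsilon> * norm x)" using pol[OF y] by (simp add: ny power2_eq_square algebra_simps)
  thus ?thesis using x0 by simp
 next
  case True
  have "0 <= \<epsilon> * (norm x)^2" using q[OF x] norm_ge_zero[of "cip (B x) x"] by linarith
  hence "0 <= \<epsilon> * norm x" by (cases "x = 0") (simp_all add: zero_le_mult_iff)
  thus ?thesis using True by simp
 qed
qed

lemma quadratic_form_eq:
 assumes A: "opK A" and B: "opK B" and q: "!!x. x : K ==> cip (A x) x = cip (B x) x" and x: "x : K"
 shows "A x = B x"
proof -
 have "opK (%x. A x - B x)" using A B by (auto simp: opK_def K_sub intro: bcl_minus2)
 from numerical_radius[OF this, of 0 x] x q show ?thesis by (simp add: cip_diff_left)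
qed

end

section \<open>Functional calculus\<close>

text \<open>Rounds both coordinates down to multiples of \<open>1 / (j + 1)\<close>: a function with
  finitely many values on the circle that tends uniformly to the identity.\<close>

definition grid :: "nat => complex => complex" where
 "grid j z = Complex (of_int \<lfloor>real (Suc j) * Re z\<rfloor> / real (Suc j)) (of_int \<lfloor>real (Suc j) * Im z\<rfloor> / real (Suc j))"

lemma grid_dist: "cmod (grid j z - z) <= 2 / real (Suc j)"
proof -
 have *: "\<bar>of_int \<lfloor>real (Suc j) * x\<rfloor> / real (Suc j) - x\<bar> <= 1 / real (Suc j)" for x
 proof -
  have "\<bar>of_int \<lfloor>real (Suc j) * x\<rfloor> - real (Suc j) * x\<bar> <= 1" by linarith
  hence "\<bar>(of_int \<lfloor>real (Suc j) * x\<rfloor> - real (Suc j) * x) / real (Suc j)\<bar> <= 1 / real (Suc j)"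
   unfolding abs_divide by (simp add: divide_right_mono)
  thus ?thesis by (simp add: diff_divide_distrib)
 qed
 have "cmod (grid j z - z) <= \<bar>Re (grid j z - z)\<bar> + \<bar>Im (grid j z - z)\<bar>" by (rule cmod_le)
 also have "... <= 1 / real (Suc j) + 1 / real (Suc j)" using *[of "Re z"] *[of "Im z"] by (simp add: grid_def)
 finally show ?thesis by simp
qed

lemma grid_measurable: "grid j : borel_measurable borel"
proof -
 have "grid j = (%z. of_real (of_int \<lfloor>real (Suc j) * Re z\<rfloor> / real (Suc j)) + \<i> * of_real (of_int \<lfloor>real (Suc j) * Im z\<rfloor> / real (Suc j)))"
  by (simp add: grid_def fun_eq_iff complex_eq_iff)
 also have "... : borel_measurable borel" by measurable
 finally show ?thesis .
qed

lemma grid_finite: "finite (grid j ` sph)"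
proof -
 let ?N = "int (Suc j)"
 have "grid j ` sph \<subseteq> (%(m, n). Complex (of_int m / real (Suc j)) (of_int n / real (Suc j))) ` ({-?N..?N} \<times> {-?N..?N})"
 proof
  fix w assume "w : grid j ` sph"
  then obtain z where z: "cmod z = 1" "w = grid j z" by auto
  have r: "\<lfloor>real (Suc j) * x\<rfloor> : {-?N..?N}" if "\<bar>x\<bar> <= 1" for x
  proof -
   have "\<bar>real (Suc j) * x\<bar> <= real (Suc j) * 1" unfolding abs_mult by (intro mult_mono) (use that in auto)
   hence b: "\<bar>real (Suc j) * x\<bar> <= real (Suc j)" by (simp only: mult_1_right)
   have "- real (Suc j) <= real (Suc j) * x" using b by linarith
   moreover have "real (Suc j) * x < real (Suc j) + 1" using b by linarith
   ultimately have "- real (Suc j) <= real (Suc j) * x" "real (Suc j) * x < real (Suc j) + 1" .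
   thus ?thesis by (simp add: le_floor_iff floor_le_iff del: of_nat_Suc)
  qed
  have "\<bar>Re z\<bar> <= 1" "\<bar>Im z\<bar> <= 1" using abs_Re_le_cmod[of z] abs_Im_le_cmod[of z] z by auto
  thus "w : (%(m, n). Complex (of_int m / real (Suc j)) (of_int n / real (Suc j))) ` ({-?N..?N} \<times> {-?N..?N})"
   using r[of "Re z"] r[of "Im z"] z(2) by (intro image_eqI[of _ _ "(\<lfloor>real (Suc j) * Re z\<rfloor>, \<lfloor>real (Suc j) * Im z\<rfloor>)"]) (auto simp: grid_def)
 qed
 thus ?thesis by (rule finite_subset) simp
qed

definition cell :: "nat => complex => complex set" where "cell j v = {z : sph. grid j z = v}"

lemma cell_sets: "cell j v : sets circle"
proof -
 have "grid j -` {v} \<inter> space borel : sets borel" by (rule measurable_sets[OF grid_measurable]) simp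
 hence "sph \<inter> grid j -` {v} : sets borel" by (intro sets.Int) simp_all
 also have "sph \<inter> grid j -` {v} = cell j v" by (auto simp: cell_def)
 finally show ?thesis by (auto simp: sets_circle_iff) (simp add: cell_def)
qed

lemma cell_disjoint: "v ~= w ==> cell j v \<inter> cell j w = {}" by (auto simp: cell_def)

lemma integral_grid_pow:
 assumes s: "sets M = sets circle" and fin: "finite_measure M"
 shows "(LINT z|M. grid j z ^ n) = (\<Sum>v\<in>grid j ` sph. v ^ n * of_real (measure M (cell j v)))"
proof -
 interpret finite_measure M by (rule fin)
 have c: "cell j v : sets M" for v by (simp add: s cell_sets)
 have "(LINT z|M. grid j z ^ n) = (LINT z|M. (\<Sum>v\<in>grid j ` sph. indicator (cell j v) z *\<^sub>R v ^ n))"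
 proof (rule integral_eqI)
  fix z assume "z : space M"
  hence z: "z : sph" by (simp add: space_sphere[OF s fin])
  have "(\<Sum>v\<in>grid j ` sph. indicator (cell j v) z *\<^sub>R v ^ n) = (\<Sum>v\<in>grid j ` sph. if v = grid j z then v ^ n else 0)"
   by (rule sum.cong) (use z in \<open>auto simp: cell_def indicator_def\<close>)
  also have "... = grid j z ^ n" using z by (simp add: grid_finite)
  finally show "grid j z ^ n = (\<Sum>v\<in>grid j ` sph. indicator (cell j v) z *\<^sub>R v ^ n)" by simp
 qed simp
 also have "... = (\<Sum>v\<in>grid j ` sph. LINT z|M. indicator (cell j v) z *\<^sub>R v ^ n)"
  by (rule Bochner_Integration.integral_sum) (simp add: c integrable_indicator_iff emeasure_finite less_top[symmetric])
 also have "... = (\<Sum>v\<in>grid j ` sph. v ^ n * of_real (measure M (cell j v)))"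
  by (rule sum.cong) (use c sets.sets_into_space[OF c] in \<open>auto simp: scaleR_conv_of_real mult.commute Int_absorb2\<close>)
 finally show ?thesis .
qed

context clark
begin

lemma sph_sets: "sph : sets circle" using sets.top[of circle] by (simp add: space_circle)

context
 fixes E assumes E: "spectral_measure u (mod_shift u a) E"
begin

definition P where "P A = opr (E A)"

lemma bE: "A : sets circle ==> bounded_op u (E A)" using E by (simp add: spectral_measure_def)
lemma opK_P: "A : sets circle ==> opK (P A)" unfolding P_def by (rule opK_opr[OF bE])
lemma P_K: "A : sets circle ==> x : K ==> P A x : K" by (rule opK_K[OF opK_P])

lemma cls_E: "A : sets circle ==> x : K ==> cls (E A (rp x)) = P A x"
 unfolding P_def using cls_bounded_op[OF bE rp_Ku] by simp

lemma E_L2: "A : sets circle ==> x : K ==> E A (rp x) : L2" by (rule bounded_opD(1)[OF bE rp_Ku])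

lemma ip_E: "A : sets circle ==> x : K ==> y : K ==> ip (E A (rp x)) (rp y) = cip (P A x) y"
 by (simp add: ip_eq_cip E_L2 cls_E)

lemma cip_P: "A : sets circle ==> x : K ==> y : K ==> cip (P A x) y = cip x (P A y)"
proof -
 assume A: "A : sets circle" and x: "x : K" and y: "y : K"
 have "ip (E A (rp x)) (rp y) = ip (rp x) (E A (rp y))"
  using E A rp_Ku[OF x] rp_Ku[OF y] unfolding spectral_measure_def by blast
 thus ?thesis by (simp add: ip_eq_cip E_L2 cls_E A x y)
qed

lemma P_P: assumes A: "A : sets circle" and B: "B : sets circle" and x: "x : K" shows "P A (P B x) = P (A \<inter> B) x"
proof -
 have "op_eq u (E A o E B) (E (A \<inter> B))" using E A B unfolding spectral_measure_def by blast
 hence e: "E A (E B (rp x)) \<doteq> E (A \<inter> B) (rp x)" using rp_Ku[OF x] by (auto simp: op_eq_def)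
 have k: "E B (rp x) : Ku u" using E_L2[OF B x] cls_E[OF B x] P_K[OF B x] by (simp add: Ku_iff)
 have "cls (E A (E B (rp x))) = cls (E (A \<inter> B) (rp x))"
  by (rule cls_cong[OF e bounded_opD(1)[OF bE[OF A] k] E_L2[OF _ x]]) (use A B in auto)
 thus ?thesis using cls_bounded_op[OF bE[OF A] k] by (simp add: cls_E B A x P_def sets.Int)
qed

lemma P_sph: assumes x: "x : K" shows "P sph x = x"
proof -
 have "E sph (rp x) \<doteq> rp x" using E rp_Ku[OF x] by (auto simp: spectral_measure_def op_eq_def)
 from cls_cong[OF this E_L2[OF sph_sets x] rp_L2] show ?thesis by (simp add: cls_E sph_sets x)
qed

definition m where "m x A = Re (cip (P A x) x)"

lemma cip_P_self: assumes A: "A : sets circle" and x: "x : K" shows "cip (P A x) x = of_real ((norm (P A x))^2)"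
proof -
 have "cip (P A (P A x)) x = cip (P A x) (P A x)" by (rule cip_P[OF A P_K[OF A x] x])
 thus ?thesis using P_P[OF A A x] by (simp add: cip_self)
qed

lemma m_nonneg: "A : sets circle ==> x : K ==> m x A >= 0" by (simp add: m_def cip_P_self)
lemma m_cip: "A : sets circle ==> x : K ==> cip (P A x) x = of_real (m x A)" by (simp add: m_def cip_P_self)

lemma m_sums:
 assumes x: "x : K" and A: "range A \<subseteq> sets circle" "disjoint_family A" shows "(%n::nat. m x (A n)) sums m x (\<Union>n. A n)"
proof -
 have *: "A n : sets circle" "(\<Union>n. A n) : sets circle" for n using A(1) by auto
 have "(%n. ip (E (A n) (rp x)) (rp x)) sums ip (E (\<Union>n. A n) (rp x)) (rp x)"
  using E A rp_Ku[OF x] unfolding spectral_measure_def by blast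
 hence "(%n. complex_of_real (m x (A n))) sums of_real (m x (\<Union>n. A n))" by (simp only: ip_E * x m_cip)
 thus ?thesis by (simp only: sums_of_real_iff)
qed

lemma m_empty: "x : K ==> m x {} = 0"
 using m_sums[of x "%_. {}"] by (auto simp: disjoint_family_on_def sums_iff summable_const_iff)

lemma P_empty: assumes x: "x : K" shows "P {} x = 0"
 using cip_P_self[of "{}" x] m_empty[OF x] m_cip[of "{}" x] x by simp

definition \<sigma> where "\<sigma> x = scalar_measure E (rp x)"

lemma \<sigma>: assumes x: "x : K"
 shows "sets (\<sigma> x) = sets circle" "A : sets circle ==> emeasure (\<sigma> x) A = ennreal (m x A)" "finite_measure (\<sigma> x)"
proof -
 interpret c: sigma_algebra sph "sets circle"
  using sets.sigma_algebra_axioms[of circle] by (simp add: space_circle)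
 have s: "\<sigma> x = measure_of sph (sets circle) (%A. ennreal (Re (ip (E A (rp x)) (rp x))))"
  by (simp add: \<sigma>_def scalar_measure_def)
 have eq: "ennreal (Re (ip (E A (rp x)) (rp x))) = ennreal (m x A)" if "A : sets circle" for A
  by (simp add: ip_E that x m_def)
 show st: "sets (\<sigma> x) = sets circle" unfolding s by (rule c.sets_measure_of_eq)
 show em: "emeasure (\<sigma> x) A = ennreal (m x A)" if A: "A : sets circle" for A
  unfolding s eq[OF A, symmetric]
 proof (rule emeasure_measure_of_sigma[OF c.sigma_algebra_axioms])
  show "positive (sets circle) (%A. ennreal (Re (ip (E A (rp x)) (rp x))))"
   unfolding positive_def by (simp add: eq m_empty x)
  show "countably_additive (sets circle) (%A. ennreal (Re (ip (E A (rp x)) (rp x))))"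
  proof (rule countably_additiveI)
   fix F :: "nat => _" assume F: "range F \<subseteq> sets circle" "disjoint_family F" "\<Union>(range F) : sets circle"
   have *: "F n : sets circle" for n using F(1) by auto
   have "(\<Sum>n. ennreal (m x (F n))) = ennreal (m x (\<Union>n. F n))"
    by (rule suminf_ennreal_eq[OF m_nonneg[OF * x] m_sums[OF x F(1,2)]])
   thus "(\<Sum>n. ennreal (Re (ip (E (F n) (rp x)) (rp x)))) = ennreal (Re (ip (E (\<Union>(range F)) (rp x)) (rp x)))"
    by (simp add: eq * F(3))
  qed
 qed (rule A)
 show "finite_measure (\<sigma> x)"
  by (rule finite_measureI) (use em[OF sph_sets] sets_eq_imp_space_eq[OF st] in \<open>simp add: space_circle\<close>)
qed

lemma measure_\<sigma>: "x : K ==> A : sets circle ==> measure (\<sigma> x) A = m x A"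
 by (simp add: measure_def \<sigma> m_nonneg)

lemma \<sigma>_sph: "x : K ==> measure (\<sigma> x) sph = (norm x)^2"
 using m_cip[OF sph_sets] by (simp add: measure_\<sigma> sph_sets P_sph cip_self of_real_eq_iff del: of_real_power)

lemma \<sigma>_T: "x : K ==> (LINT z|\<sigma> x. z) = cip (T x) x"
proof -
 assume x: "x : K"
 have "ip (mod_shift u a (rp x)) (rp x) = (LINT z|scalar_measure E (rp x). z)"
  using E rp_Ku[OF x] unfolding spectral_measure_def by blast
 thus ?thesis by (simp add: \<sigma>_def ip_eq_cip mod_shift_cls)
qed

text \<open>The Riemann sum of z dE(z) over the cells of the grid.\<close>

definition Sg where "Sg j x = (\<Sum>v\<in>grid j ` sph. v *C P (cell j v) x)"

lemma opK_Sg: "opK (Sg j)"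
proof -
 have "opK (%x. \<Sum>v\<in>I. v *C P (cell j v) x)" if "finite I" for I
  using that
 proof (induction I)
  case empty
  have "bcl (%x. 0)" by (rule bclI[where C=0]) simp_all
  thus ?case by (simp add: opK_def K_sub)
 next
  case (insert v I)
  thus ?case using opK_P[OF cell_sets, of j v] by (auto simp: opK_def K_sub intro!: bcl_plus bcl_scale)
 qed
 thus ?thesis unfolding Sg_def[abs_def] using grid_finite by blast
qed

text \<open>Projections belonging to disjoint cells annihilate each other, so taking powers only
  raises the values. Exponent 0 is left out, where the sum gives the identity by additivity
  instead.\<close>

lemma Sg_pow: assumes x: "x : K" shows "(Sg j ^^ Suc n) x = (\<Sum>v\<in>grid j ` sph. v ^ Suc n *C P (cell j v) x)"
proof (induction n)
 case 0 thus ?case by (simp add: Sg_def)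
next
 case (Suc n)
 have "P (cell j v) (\<Sum>w\<in>grid j ` sph. w ^ Suc n *C P (cell j w) x) = v ^ Suc n *C P (cell j v) x" if v: "v : grid j ` sph" for v
 proof -
  have b: "bcl (P (cell j v))" by (rule opK_bcl[OF opK_P[OF cell_sets]])
  have "P (cell j v) (\<Sum>w\<in>grid j ` sph. w ^ Suc n *C P (cell j w) x) = (\<Sum>w\<in>grid j ` sph. w ^ Suc n *C P (cell j v) (P (cell j w) x))"
   unfolding bcl_sum[OF b] by (simp only: bcl_scaleC[OF b])
  also have "... = (\<Sum>w\<in>grid j ` sph. if w = v then v ^ Suc n *C P (cell j v) x else 0)"
  proof (rule sum.cong[OF refl])
   fix w
   show "w ^ Suc n *C P (cell j v) (P (cell j w) x) = (if w = v then v ^ Suc n *C P (cell j v) x else 0)"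
    using cell_disjoint[of v w j] by (auto simp: P_P cell_sets x P_empty simp del: power_Suc)
  qed
  also have "... = v ^ Suc n *C P (cell j v) x" using v by (simp add: grid_finite del: power_Suc)
  finally show ?thesis .
 qed
 hence "Sg j (\<Sum>w\<in>grid j ` sph. w ^ Suc n *C P (cell j w) x) = (\<Sum>v\<in>grid j ` sph. v *C v ^ Suc n *C P (cell j v) x)"
  unfolding Sg_def by (intro sum.cong) (simp_all del: power_Suc)
 thus ?case unfolding funpow.simps comp_def Suc[unfolded funpow.simps comp_def] by simp
qed

lemma cip_Sg_pow: assumes x: "x : K" shows "cip ((Sg j ^^ Suc n) x) x = (LINT z|\<sigma> x. grid j z ^ Suc n)"
 unfolding Sg_pow[OF x] integral_grid_pow[OF \<sigma>(1,3)[OF x]] cip_sum_left cip_cl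
 by (rule sum.cong) (simp_all add: m_cip cell_sets x measure_\<sigma>)

lemma grid_bound: "z : sph ==> cmod (grid j z) <= 3"
proof -
 assume z: "z : sph"
 have "2 / real (Suc j) <= 2" by (simp add: field_simps)
 thus ?thesis using z grid_dist[of j z] norm_triangle_ineq[of "grid j z - z" z] by simp
qed

text \<open>The only known relation between \<open>E\<close> and \<open>T\<close> is the first
  moment of the quadratic forms. It bounds the form of the difference by the mesh
  \<open>2 / (j + 1)\<close>, and passing from the form to the operator costs a factor 2.\<close>

lemma Sg_T: assumes x: "x : K" shows "norm (Sg j x - T x) <= 4 / real (Suc j) * norm x"
proof -
 have o: "opK (%x. Sg j x - T x)" using opK_Sg[of j] opK_mS[of a] by (auto simp: opK_def K_sub intro: bcl_minus2)
 have "cmod (cip (Sg j x - T x) x) <= 2 / real (Suc j) * (norm x)^2" if x: "x : K" for x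
 proof -
  interpret finite_measure "\<sigma> x" by (rule \<sigma>(3)[OF x])
  note s = \<sigma>(1)[OF x]
  have i1: "integrable (\<sigma> x) (grid j)"
   by (rule integrable_bounded_circle[OF \<sigma>(3,1)[OF x] borel_measurable_circle[OF grid_measurable s] grid_bound])
  have i2: "integrable (\<sigma> x) (%z. z)" using integrable_power[OF \<sigma>(1,3)[OF x], of 1] by simp
  have "cip (Sg j x - T x) x = (LINT z|\<sigma> x. grid j z - z)"
   using cip_Sg_pow[OF x, where j=j and n=0] i1 i2 by (simp add: cip_diff_left \<sigma>_T x)
  also have "cmod ... <= (LINT z|\<sigma> x. cmod (grid j z - z))" by (rule integral_norm_bound)
  also have "... <= (LINT z|\<sigma> x. 2 / real (Suc j))"
   by (rule integral_mono) (use i1 i2 grid_dist in auto)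
  also have "... = 2 / real (Suc j) * (norm x)^2" by (simp add: space_sphere[OF \<sigma>(1,3)[OF x]] \<sigma>_sph x)
  finally show ?thesis .
 qed
 from numerical_radius[OF o this x] show ?thesis by simp
qed

lemma Sg_pow_K: "x : K ==> (Sg j ^^ n) x : K" by (induction n) (simp_all add: opK_K[OF opK_Sg])

lemma Sg_pow_tendsto: assumes x: "x : K" shows "(%j. (Sg j ^^ n) x) ----> (T ^^ n) x"
proof (induction n)
 case (Suc n)
 let ?y = "%j. (Sg j ^^ n) x"
 have "(%j. Sg j (?y j) - T (?y j)) ----> 0"
 proof (rule Lim_null_comparison)
  show "\<forall>\<^sub>F j in sequentially. norm (Sg j (?y j) - T (?y j)) <= 4 / real (Suc j) * norm (?y j)"
   by (intro always_eventually allI Sg_T Sg_pow_K x)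
  have "(%j. 4 / real (Suc j) * norm (?y j)) ----> 0 * norm ((T ^^ n) x)"
   by (intro tendsto_mult tendsto_norm Suc LIMSEQ_Suc[OF lim_const_over_n])
  thus "(%j. 4 / real (Suc j) * norm (?y j)) ----> 0" by simp
 qed
 from tendsto_add[OF this tendsto_bcl[OF bcl_mS[of a] Suc]] show ?case by simp
qed simp

text \<open>For the Riemann sums the identity is exact. On one side the grid values converge under
  domination, on the other side the powers of the sums converge strongly.\<close>

lemma \<sigma>_moment: assumes x: "x : K" shows "(LINT z|\<sigma> x. z ^ n) = cip ((T ^^ n) x) x"
proof (cases n)
 case 0
 thus ?thesis using space_sphere[OF \<sigma>(1,3)[OF x]] by (simp add: \<sigma>_sph x cip_self scaleR_conv_of_real)
next
 case (Suc k)
 interpret finite_measure "\<sigma> x" by (rule \<sigma>(3)[OF x])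
 have "(%j. LINT z|\<sigma> x. grid j z ^ Suc k) ----> (LINT z|\<sigma> x. z ^ Suc k)"
 proof (rule integral_dominated_convergence[where w="%_. 3 ^ Suc k"])
  show "(%z. z ^ Suc k) : borel_measurable (\<sigma> x)" by (rule measurable_power[OF \<sigma>(1,3)[OF x]])
  show "(%z. grid j z ^ Suc k) : borel_measurable (\<sigma> x)" for j
   using borel_measurable_circle[OF grid_measurable \<sigma>(1)[OF x]] by (intro borel_measurable_power)
  show "AE z in \<sigma> x. (%j. grid j z ^ Suc k) ----> z ^ Suc k"
  proof (rule AE_I2)
   fix z
   have "(%j. grid j z - z) ----> 0"
   proof (rule Lim_null_comparison)
    show "\<forall>\<^sub>F j in sequentially. norm (grid j z - z) <= 2 / real (Suc j)" by (simp add: grid_dist del: of_nat_Suc)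
    show "(%j. 2 / real (Suc j)) ----> 0" by (rule LIMSEQ_Suc[OF lim_const_over_n])
   qed
   thus "(%j. grid j z ^ Suc k) ----> z ^ Suc k" by (intro tendsto_power) (rule LIM_zero_cancel)
  qed
  show "AE z in \<sigma> x. norm (grid j z ^ Suc k) <= 3 ^ Suc k" for j
   by (rule AE_I2) (simp only: norm_power, rule power_mono, rule grid_bound, simp_all add: space_sphere[OF \<sigma>(1,3)[OF x]])
 qed simp
 moreover have "(%j. LINT z|\<sigma> x. grid j z ^ Suc k) ----> cip ((T ^^ Suc k) x) x"
  unfolding cip_Sg_pow[OF x, symmetric] by (intro tendsto_cip Sg_pow_tendsto x tendsto_const)
 ultimately show ?thesis unfolding Suc by (rule LIMSEQ_unique)
qed

end

text \<open>The scalar spectral measure at \<open>x\<close> as the spectral representation predicts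
  it.\<close>

definition nu :: "hl2 => complex measure" where "nu x = density mu (%z. ennreal ((cmod (Th x z))^2))"

lemma nu: assumes x: "x : K" shows "sets (nu x) = sets circle" "finite_measure (nu x)"
proof -
 show "sets (nu x) = sets circle" by (simp add: nu_def mu)
 have m: "(%z. ennreal ((cmod (Th x z))^2)) : borel_measurable mu" using Th_measurable[OF x] by measurable
 have "(\<integral>\<^sup>+z. ennreal ((cmod (Th x z))^2) \<partial>mu) = ennreal (lsq mu (Th x))"
  unfolding lsq_def by (rule nn_integral_eq_integral[OF l2_integrable[OF Th_l2[OF x]]]) simp
 hence "emeasure (nu x) (space (nu x)) < \<infinity>"
  unfolding nu_def by (subst emeasure_density[OF m]) (auto simp: space_density cong: nn_integral_cong)
 thus "finite_measure (nu x)" by (intro finite_measureI) simp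
qed

lemma integral_nu: assumes x: "x : K" and b: "bB \<Phi>" shows "(LINT z|nu x. \<Phi> z) = cip (mop \<Phi> x) x"
proof -
 have "(LINT z|nu x. \<Phi> z) = (LINT z|mu. (cmod (Th x z))^2 *\<^sub>R \<Phi> z)"
  unfolding nu_def by (rule integral_density) (use Th_measurable[OF x] bB_measurable[OF b] in auto)
 also have "... = (LINT z|mu. \<Phi> z * (Th x z * cnj (Th x z)))"
  by (simp add: scaleR_conv_of_real complex_norm_square[symmetric] mult.commute)
 finally show ?thesis by (simp add: cip_mop b x)
qed

lemma mop_pow: "x : K ==> mop (%z. z ^ n) x = (T ^^ n) x"
proof (induction n)
 case 0 thus ?case by (simp add: mop_one)
next
 case (Suc n)
 have "mop (%z. z) (mop (%z. z ^ n) x) = mop (%z. z * z ^ n) x"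
  by (rule mop_mop[OF _ _ Suc.prems]) (intro bB_cont continuous_intros)+
 thus ?case using Suc mop(1)[of "%z. z ^ n" x] by (simp add: mop_z T_pow_K)
qed

text \<open>Both measures have the moments of \<open>T\<close> at \<open>x\<close>, so all spectral
  measures of \<open>T\<close> have the same scalar measures.\<close>

lemma scalar_measure_unique:
 assumes E: "spectral_measure u (mod_shift u a) E" and x: "x : K"
 shows "scalar_measure E (rp x) = nu x"
proof -
 have mom: "(LINT z|nu x. z ^ n) = cip ((T ^^ n) x) x" for n
  unfolding mop_pow[OF x, symmetric] by (rule integral_nu[OF x]) (intro bB_cont continuous_intros)
 show ?thesis
  unfolding \<sigma>_def[OF E, symmetric]
  by (rule measure_eq_moments[OF \<sigma>(1)[OF E x] nu(1)[OF x] \<sigma>(3)[OF E x] nu(2)[OF x]])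
   (simp only: \<sigma>_moment[OF E x] mom)
qed

definition sE :: "complex set => oper" where "sE A = fn (mop (indicator A))"

lemma sE_cls: "cls (sE A f) = mop (indicator A) (cls f)" by (simp add: sE_def cls_fn)

lemma sE_L2: "sE A f : L2" by (simp add: sE_def fn_def)

lemma ip_sE: "A : sets circle ==> f : Ku u ==> ip (sE A f) f = of_real (measure (nu (cls f)) A)"
proof -
 assume A: "A : sets circle" and f: "f : Ku u"
 have x: "f : L2" "cls f : K" using f by (auto simp: Ku_iff)
 have "ip (sE A f) f = (LINT z|nu (cls f). indicator A z)"
  by (simp add: ip_eq_cip sE_L2 x sE_cls integral_nu[OF x(2) bB_indicator[OF A]])
 also have "... = (LINT z|nu (cls f). of_real (indicator A z))"
  by (rule integral_eqI) (simp_all add: indicator_def)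
 also have "... = of_real (LINT z|nu (cls f). indicator A z)" by (rule integral_complex_of_real)
 also have "(LINT z|nu (cls f). indicator A z) = measure (nu (cls f)) A"
  using A sets.sets_into_space[OF A] by (simp add: nu(1)[OF x(2)] space_sphere[OF nu[OF x(2)]] space_circle Int_absorb2)
 finally show ?thesis .
qed

lemma spectral_measure_sE: "spectral_measure u (mod_shift u a) sE"
 unfolding spectral_measure_def
proof (intro conjI ballI allI impI)
 fix A assume A: "A : sets circle"
 note bA = bB_indicator[OF A]
 show "bounded_op u (sE A)" unfolding sE_def by (rule bounded_op_fn[OF opK_mop[OF bA]])
 show "ip (sE A f) g = ip f (sE A g)" if "f : Ku u" "g : Ku u" for f g
 proof -
  have f: "f : L2" "cls f : K" and g: "g : L2" "cls g : K" using that by (auto simp: Ku_iff)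
  have "cip (cls f) (mop (indicator A) (cls g)) = cnj (cip (mop (indicator A) (cls g)) (cls f))" by (rule cip_commute)
  also have "... = cip (mop (indicator A) (cls f)) (cls g)"
   unfolding cip_mop[OF bA g(2) f(2)] cip_mop[OF bA f(2) g(2)] LINT_cnj[symmetric]
   by (rule integral_eqI) (simp_all add: indicator_def mult.commute)
  finally show ?thesis by (simp add: ip_eq_cip sE_L2 f g sE_cls)
 qed
 show "op_eq u (sE A o sE A') (sE (A \<inter> A'))" if A': "A' : sets circle" for A'
 proof (subst op_eq_cls)
  have "mop (indicator A) (mop (indicator A') x) = mop (indicator (A \<inter> A')) x" if "x : K" for x
   using mop_mop[OF bA bB_indicator[OF A'] that] by (simp add: indicator_inter_arith[abs_def])
  thus "ALL f:Ku u. cls ((sE A o sE A') f) = cls (sE (A \<inter> A') f)" by (simp add: sE_cls Ku_iff)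
 qed (simp_all add: sE_L2)
next
 show "op_eq u (sE sph) id"
 proof (subst op_eq_cls)
  have "mop (indicator sph) x = x" if x: "x : K" for x
  proof (rule mop_eqI[OF bB_indicator[OF sph_sets] x])
   show "AE z in mu. Th x z = indicator sph z * Th (PM K x) z"
    by (rule AE_I2) (simp add: space_mu PM_id csub_K x indicator_def)
  qed
  thus "ALL f:Ku u. cls (sE sph f) = cls (id f)" by (simp add: sE_cls Ku_iff)
 qed (simp_all add: sE_L2 Ku_iff)
next
 fix f and A :: "nat => complex set" assume f: "f : Ku u" and "range A \<subseteq> sets circle & disjoint_family A"
 hence A: "range A \<subseteq> sets circle" "disjoint_family A" by auto
 have x: "cls f : K" using f by (simp add: Ku_iff)
 interpret finite_measure "nu (cls f)" by (rule nu(2)[OF x])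
 have "(%n. measure (nu (cls f)) (A n)) sums measure (nu (cls f)) (\<Union>n. A n)"
  by (rule finite_measure_UNION) (use A in \<open>simp_all add: nu(1)[OF x]\<close>)
 moreover have "A n : sets circle" "(\<Union>n. A n) : sets circle" for n using A(1) by auto
 ultimately show "(%n. ip (sE (A n) f) f) sums ip (sE (\<Union>n. A n) f) f"
  by (simp only: ip_sE f sums_of_real_iff)
next
 fix f assume f: "f : Ku u"
 hence x: "f : L2" "cls f : K" by (auto simp: Ku_iff)
 have "scalar_measure sE f = measure_of sph (sets circle) (%A. emeasure (nu (cls f)) A)"
  unfolding scalar_measure_def
 proof (rule measure_of_eq)
  show "sets circle \<subseteq> Pow sph" using sets.space_closed[of circle] by (simp add: space_circle)
  interpret finite_measure "nu (cls f)" by (rule nu(2)[OF x(2)])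
  fix A assume "A : sigma_sets sph (sets circle)"
  hence "A : sets circle" using sets.sigma_sets_eq[of circle] by (simp add: space_circle)
  thus "ennreal (Re (ip (sE A f) f)) = emeasure (nu (cls f)) A" by (simp add: ip_sE f emeasure_eq_measure)
 qed
 also have "... = nu (cls f)"
  using measure_of_of_measure[of "nu (cls f)"] by (simp add: nu(1)[OF x(2)] space_sphere[OF nu[OF x(2)]])
 finally show "ip (mod_shift u a f) f = (LINT z|scalar_measure sE f. z)"
  using integral_nu[OF x(2), of "%z. z"] by (simp add: ip_eq_cip mod_shift_cls x mop_z bB_cont)
qed

lemma scalar_measure_Ku:
 assumes E: "spectral_measure u (mod_shift u a) E" and f: "f : Ku u"
 shows "scalar_measure E f = nu (cls f)"
proof -
 have x: "f : L2" "cls f : K" using f by (auto simp: Ku_iff)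
 have "ip (E A f) f = ip (E A (rp (cls f))) (rp (cls f))" if A: "A : sets circle" for A
 proof -
  have b: "bounded_op u (E A)" using E A by (simp add: spectral_measure_def)
  have "cls (E A f) = cls (E A (rp (cls f)))" by (rule bounded_op_cong[OF b f rp_Ku[OF x(2)]]) simp
  thus ?thesis using bounded_opD(1)[OF b f] bounded_opD(1)[OF b rp_Ku[OF x(2)]] x by (simp add: ip_eq_cip)
 qed
 hence "scalar_measure E f = scalar_measure E (rp (cls f))"
  unfolding scalar_measure_def
  by (intro measure_of_eq) (use sets.space_closed[of circle] sets.sigma_sets_eq[of circle] in \<open>simp_all add: space_circle\<close>)
 thus ?thesis using scalar_measure_unique[OF E x(2)] by simp
qed

text \<open>\<open>fun_calc\<close> selects an operator together with some spectral measure. The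
  measure \<open>sE\<close> shows that the selection is possible; uniqueness of scalar measures and
  of operators with a given quadratic form identifies whatever was selected.\<close>

theorem fun_calc_mop:
 assumes b: "bB \<Phi>" and f: "f : Ku u"
 shows "fun_calc u (mod_shift u a) \<Phi> f : L2" "cls (fun_calc u (mod_shift u a) \<Phi> f) = mop \<Phi> (cls f)"
proof -
 let ?S = "mod_shift u a"
 let ?P = "%T. bounded_op u T & (EX E. spectral_measure u ?S E & (ALL f:Ku u. ip (T f) f = (LINT z|scalar_measure E f. \<Phi> z)))"
 have "?P (fn (mop \<Phi>))"
 proof (intro conjI exI[of _ sE] ballI)
  show "bounded_op u (fn (mop \<Phi>))" by (rule bounded_op_fn[OF opK_mop[OF b]])
  fix f assume f: "f : Ku u"
  hence x: "f : L2" "cls f : K" by (auto simp: Ku_iff)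
  have "fn (mop \<Phi>) f : L2" by (simp add: fn_def)
  thus "ip (fn (mop \<Phi>) f) f = (LINT z|scalar_measure sE f. \<Phi> z)"
   by (simp add: ip_eq_cip x cls_fn scalar_measure_Ku[OF spectral_measure_sE f] integral_nu b)
 qed (rule spectral_measure_sE)
 from someI[of ?P, OF this] have P: "?P (fun_calc u ?S \<Phi>)" unfolding fun_calc_def .
 then obtain E where B: "bounded_op u (fun_calc u ?S \<Phi>)" and E: "spectral_measure u ?S E"
  and q: "!!f. f : Ku u ==> ip (fun_calc u ?S \<Phi> f) f = (LINT z|scalar_measure E f. \<Phi> z)" by blast
 show "fun_calc u ?S \<Phi> f : L2" by (rule bounded_opD(1)[OF B f])
 have "opr (fun_calc u ?S \<Phi>) (cls f) = mop \<Phi> (cls f)"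
 proof (rule quadratic_form_eq[OF opK_opr[OF B] opK_mop[OF b]])
  show "cls f : K" using f by (simp add: Ku_iff)
  fix x assume x: "x : K"
  have k: "rp x : Ku u" by (rule rp_Ku[OF x])
  have "cip (opr (fun_calc u ?S \<Phi>) x) x = ip (fun_calc u ?S \<Phi> (rp x)) (rp x)"
   using cls_bounded_op[OF B k] bounded_opD(1)[OF B k] by (simp add: ip_eq_cip)
  also have "... = cip (mop \<Phi> x) x" unfolding q[OF k] scalar_measure_Ku[OF E k] by (simp add: integral_nu b x)
  finally show "cip (opr (fun_calc u ?S \<Phi>) x) x = cip (mop \<Phi> x) x" .
 qed
 thus "cls (fun_calc u ?S \<Phi> f) = mop \<Phi> (cls f)" using cls_bounded_op[OF B f] by simp
qed

end

section \<open>Symbols\<close>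

context inner_fn
begin

text \<open>The vectors of \<open>K\<close> with a bounded representative. On these a square
  integrable symbol acts, and they are dense because the projections of the monomials are
  bounded.\<close>

definition bK :: "hl2 set" where "bK = {x : K. EX f:Li. cls f = x}"

lemma bK_K: "x : bK ==> x : K" by (simp add: bK_def)

lemma bK_lin: assumes x: "x : bK" and y: "y : bK" shows "x + c *C y : bK"
proof -
 obtain f g where f: "f : Li" "cls f = x" and g: "g : Li" "cls g = y" using x y by (auto simp: bK_def)
 have "cls (%z. f z + c * g z) = x + c *C y"
  using f g by (simp add: cls_add cls_scaleC Li_L2 Li_mult Li_const)
 moreover have "(%z. f z + c * g z) : Li" by (intro Li_add Li_mult Li_const f g)
 ultimately show ?thesis using x y by (auto simp: bK_def K_sub)
qed

lemma bK_k0: "k0 : bK"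
proof -
 have "Defs.k0 u = (%z. 1 - cnj (u 0) * U z)" by (simp add: Defs.k0_def fun_eq_iff)
 moreover have "(%z. 1 - cnj (u 0) * U z) : Li" by (intro Li_diff Li_mult Li_const U_Li)
 ultimately show ?thesis using k0_cls(2) k0_K by (auto simp: bK_def)
qed

lemma bK_S: assumes x: "x : bK" shows "S x : bK"
proof -
 obtain f where f: "f : Li" "cls f = x" and k: "x : K" using x by (auto simp: bK_def)
 have "cls (%z. z * f z - cip x kt * U z) = S x"
  using f k U_Li
  by (simp add: S_eq cls_diff cls_scaleC Li_L2 Li_mult Li_const Li_pow mul_cls[symmetric] e_def)
   (simp add: mul_cls Li_L2 Li_const U_Li)
 moreover have "(%z. z * f z - cip x kt * U z) : Li" by (intro Li_diff Li_mult Li_const Li_pow f U_Li)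
 ultimately show ?thesis by (auto simp: bK_def S_K)
qed

lemma PM_e0: "PM K (e 0) = k0"
 by (rule PM_unique[OF csub_K k0_K]) (simp add: k0_def cip_diff_left cip_cl Mu_K e_HH)

lemma PM_e_bK: "PM K (e n) : bK"
proof (induction n)
 case 0 show ?case by (simp add: PM_e0 bK_k0)
next
 case (Suc n)
 have "PM K (e (Suc n)) = S (PM K (e n))"
 proof (rule PM_unique[OF csub_K S_K])
  fix v assume v: "v : K"
  have "cip (S (PM K (e n))) v = cip (e n) (L v)" by (simp add: cip_S v PM_in csub_K PM_cip L_K)
  also have "... = cip (e (Suc n)) v" by (simp add: cip_zmul_HH[symmetric] e_HH zmul_e)
  finally show "cip (S (PM K (e n))) v = cip (e (Suc n)) v" .
 qed
 thus ?case by (simp add: bK_S Suc)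
qed

lemma bK_dense: assumes x: "x : K" obtains X where "!!n. X n : bK" "X ----> x"
proof
 show "PM K (fsum (coef x) n) : bK" for n
 proof (induction n)
  case 0
  have "k0 + (-1) *C k0 : bK" by (rule bK_lin[OF bK_k0 bK_k0])
  thus ?case by (simp add: fsum_def bcl_zero[OF bcl_PM[OF csub_K]] scaleC_minus_one)
 next
  case (Suc n)
  from bK_lin[OF Suc PM_e_bK, of "coef x n" n] show ?case by (simp add: fsum_def PM_add PM_scaleC csub_K)
 qed
 have "(%n. PM K (fsum (coef x) n)) ----> PM K x" by (rule tendsto_bcl[OF bcl_PM[OF csub_K] fsum_tendsto[OF K_HH[OF x]]])
 thus "(%n. PM K (fsum (coef x) n)) ----> x" by (simp add: PM_id csub_K x)
qed

lemma bK_cases: "x : bK ==> (!!f. f : Ku u ==> f : Li ==> x = cls f ==> P) ==> P"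
 by (auto simp: bK_def Ku_iff Li_L2)

lemma bK_zero: assumes y: "y : K" and 0: "!!v. v : bK ==> cip y v = 0" shows "y = 0"
proof (rule csub_eqI[OF csub_K y K_sub(1)])
 fix v assume "v : K"
 then obtain X where X: "!!n. X n : bK" "X ----> v" using bK_dense by blast
 have "(%n. cip y (X n)) ----> cip y v" by (intro tendsto_cip tendsto_const X)
 thus "cip y v = cip 0 v" using 0[OF X(1)] by (simp add: LIMSEQ_const_iff)
qed

text \<open>The bounded function is the multiplier and the symbol \<open>x\<close> the vector, so
  \<open>mul\<close> covers symbols that are merely square integrable.\<close>

definition symb :: "(hl2 => hl2) => hl2 => bool" where
 "symb A x <-> (ALL f:Ku u. f : Li --> A (cls f) = PM K (mul f x))"

lemma mul_cj_swap: assumes f: "f : Li" and g: "g : Li" shows "cip (mul f (cj x)) (cls g) = cip (cls f) (mul g x)"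
proof -
 have "cip (mul f (cj x)) (cls g) = ip (%z. f z * cnj (rp x z)) g"
  unfolding cj_def by (simp add: mul_cls f L2_cnj cip_cls Li_mult_L2 Li_L2 g)
 also have "... = ip f (%z. g z * rp x z)" by (simp add: ip_def ac_simps)
 also have "... = cip (cls f) (mul g x)" by (simp add: mul_def cip_cls Li_L2 f g Li_mult_L2)
 finally show ?thesis .
qed

lemma symb_form:
 assumes s: "symb A (\<phi> + cj \<eta>)" and f: "f : Ku u" "f : Li" and g: "g : Ku u" "g : Li"
 shows "cip (A (cls f)) (cls g) = cip (mul f \<phi>) (cls g) + cnj (cip (mul g \<eta>) (cls f))"
proof -
 have "cip (A (cls f)) (cls g) = cip (mul f (\<phi> + cj \<eta>)) (cls g)"
  using s f g by (simp add: symb_def PM_cip csub_K Ku_iff)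
 also have "... = cip (mul f \<phi>) (cls g) + cip (cls f) (mul g \<eta>)"
  by (simp add: mul_add f cip_add_left mul_cj_swap g)
 also have "cip (cls f) (mul g \<eta>) = cnj (cip (mul g \<eta>) (cls f))" by (rule cip_commute)
 finally show ?thesis .
qed

text \<open>The backward shift on representatives, where boundedness is visible.\<close>

definition Lf :: "(complex => complex) => complex => complex" where
 "Lf f z = cnj z * (f z - coef (cls f) 0)"

lemma Lf: assumes f: "f : Li" shows "Lf f : Li" "cls (Lf f) = L (cls f)" "mul (Lf f) x = zbmul (mul f x - coef (cls f) 0 *C x)"
proof -
 have d: "(%z. f z - coef (cls f) 0) : Li" by (intro Li_diff Li_const f)
 show l: "Lf f : Li" unfolding Lf_def by (rule Li_mult[OF Li_pow(4) d])
 show m: "mul (Lf f) x = zbmul (mul f x - coef (cls f) 0 *C x)" for x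
  unfolding Lf_def mul_mul[OF Li_pow(4) d, symmetric] mul_minus[OF f Li_const] mul_const ..
 have one: "mul h (e 0) = cls h" if "h : Li" for h using that by (simp add: e_def mul_cls Li_L2 Li_const)
 show "cls (Lf f) = L (cls f)" using m[of "e 0"] by (simp add: one l f L_def)
qed

lemma cip_L_pow_right: assumes x: "x : HH" and y: "y : HH" shows "cip x (mul (%z. cnj z ^ k) y) = cip x ((L ^^ k) y)"
proof -
 have p: "(zmul ^^ k) x = mul (%z. z ^ k) x"
 proof (induction k)
  case 0 thus ?case by (simp add: mul_one)
 next
  case (Suc k) thus ?case by (simp add: mul_mul Li_pow)
 qed
 have "cip x (mul (%z. cnj z ^ k) y) = cip (mul (%z. z ^ k) x) y" by (simp add: cip_mul Li_pow)
 also have "... = cnj (cip y ((zmul ^^ k) x))" unfolding p by (rule cip_commute)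
 also have "... = cnj (cip ((L ^^ k) y) x)" by (simp only: cip_L_pow[OF y x])
 also have "... = cip x ((L ^^ k) y)" by (rule cip_commute[symmetric])
 finally show ?thesis .
qed

text \<open>Expand \<open>f\<close> in its Fourier series. For \<open>x\<close> in the Hardy space,
  multiplying the other argument by \<open>cnj z ^ k\<close> has the same effect as applying
  \<open>L\<close> k times.\<close>

lemma half_sums:
 assumes f: "f : Li" "cls f : HH" and g: "g : Li" "cls g : HH" and x: "x : HH"
 shows "(%k. coef (cls f) k * cip x ((L ^^ k) (cls g))) sums cip (mul f x) (cls g)"
proof -
 have "(%N. cip (fsum (coef (cls f)) N) (mul g (cj x))) ----> cip (cls f) (mul g (cj x))" by (intro tendsto_intros fsum_tendsto f)
 moreover have "cip (e k) (mul g (cj x)) = cip x ((L ^^ k) (cls g))" for k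
  using mul_cj_swap[OF Li_pow(1) g(1), of k "cj x"] by (simp add: e_def[symmetric] cip_mul Li_pow cip_L_pow_right x g)
 ultimately show ?thesis
  using mul_cj_swap[OF f(1) g(1), of "cj x"] by (simp add: sums_def fsum_def cip_sum_left cip_cl)
qed

lemma half_form:
 assumes f: "f : Li" "cls f : HH" and g: "g : Li" "cls g : HH" and x: "x : HH"
 shows "cip (mul (Lf f) x) (L (cls g)) = cip (mul f x) (cls g) - coef (cls f) 0 * cip x (cls g)"
proof -
 have "(%k. coef (cls f) (Suc k) * cip x ((L ^^ Suc k) (cls g))) sums cip (mul (Lf f) x) (L (cls g))"
  using half_sums[of "Lf f" "Lf g" x] Lf f g x by (simp add: L_HH coef_L funpow_swap1)
 thus ?thesis using sums_unique2[OF half_sums[OF f g x]] by (subst (asm) sums_Suc_iff) simp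
qed

text \<open>Each half of the symbol contributes a series in which passing to \<open>L f\<close> and
  \<open>L g\<close> drops exactly the first term; the two dropped terms make up the form. Density
  of \<open>bK\<close> extends this to all of \<open>K\<close>.\<close>

lemma tform_of_symb:
 assumes A: "opK A" and H: "\<phi> : HH" "\<eta> : HH" and s: "symb A (\<phi> + cj \<eta>)"
 shows "tform A (PM K \<phi>) (PM K \<eta>)"
 unfolding tform_def
proof (intro conjI ballI)
 have B: "bcl A" by (rule opK_bcl[OF A])
 show "PM K \<phi> : K" "PM K \<eta> : K" by (simp_all add: PM_in csub_K)
 fix x y assume x: "x : K" and y: "y : K"
 have eq: "dA A x y = coef x 0 * cip \<phi> y + cnj (coef y 0) * cip x \<eta>" if xy: "x : bK" "y : bK" for x y
 proof -
  obtain f where f: "f : Ku u" "f : Li" "x = cls f" by (rule bK_cases[OF xy(1)])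
  obtain g where g: "g : Ku u" "g : Li" "y = cls g" by (rule bK_cases[OF xy(2)])
  have k: "cls f : K" "cls g : K" using f g by (auto simp: Ku_iff)
  have l: "Lf f : Ku u" "Lf g : Ku u" using Lf[OF f(2)] Lf[OF g(2)] k by (auto simp: Ku_iff Li_L2 L_K)
  have "cip (A (L x)) (L y) = cip (mul (Lf f) \<phi>) (L y) + cnj (cip (mul (Lf g) \<eta>) (L x))"
   using symb_form[OF s l(1) Lf(1)[OF f(2)] l(2) Lf(1)[OF g(2)]] by (simp add: Lf f g)
  moreover have "cip (A x) y = cip (mul f \<phi>) y + cnj (cip (mul g \<eta>) x)"
   using symb_form[OF s f(1,2) g(1,2)] by (simp add: f g)
  moreover have "cip x \<eta> = cnj (cip \<eta> x)" by (rule cip_commute)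
  ultimately show ?thesis
   unfolding dA_def
   using half_form[OF f(2) K_HH[OF k(1)] g(2) K_HH[OF k(2)] H(1)] half_form[OF g(2) K_HH[OF k(2)] f(2) K_HH[OF k(1)] H(2)]
   by (simp add: f(3)[symmetric] g(3)[symmetric])
 qed
 obtain X where X: "!!n. X n : bK" "X ----> x" using bK_dense[OF x] by blast
 obtain Y' where Y': "!!n. Y' n : bK" "Y' ----> y" using bK_dense[OF y] by blast
 have "(%n. dA A (X n) (Y' n)) ----> dA A x y"
  unfolding dA_def by (intro tendsto_diff tendsto_cip tendsto_bcl[OF B] tendsto_bcl[OF bcl_L] X Y')
 moreover have "(%n. coef (X n) 0 * cip \<phi> (Y' n) + cnj (coef (Y' n) 0) * cip (X n) \<eta>) ----> coef x 0 * cip \<phi> y + cnj (coef y 0) * cip x \<eta>"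
  by (intro tendsto_add tendsto_mult tendsto_cnj tendsto_cip tendsto_const X Y')
 ultimately have "dA A x y = coef x 0 * cip \<phi> y + cnj (coef y 0) * cip x \<eta>"
  using LIMSEQ_unique by (simp only: eq[OF X(1) Y'(1)])
 thus "dA A x y = coef x 0 * cip (PM K \<phi>) y + cnj (coef y 0) * cip x (PM K \<eta>)"
  by (simp add: PM_cip PM_cip_right csub_K x y)
qed

text \<open>Summing the form along the iterates of \<open>L\<close> telescopes to
  \<open>cip (A f) g\<close>, and the summed right-hand sides are the series of the two halves of
  the symbol.\<close>

lemma symb_of_tform:
 assumes A: "opK A" and H: "\<phi> : HH" "\<eta> : HH" and T: "tform A (PM K \<phi>) (PM K \<eta>)"
 shows "symb A (\<phi> + cj \<eta>)"
 unfolding symb_def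
proof (intro ballI impI)
 fix f assume f: "f : Ku u" "f : Li"
 have fK: "cls f : K" using f by (simp add: Ku_iff)
 have B: "bcl A" by (rule opK_bcl[OF A])
 have "A (cls f) - PM K (mul f (\<phi> + cj \<eta>)) = 0"
 proof (rule bK_zero)
  show "A (cls f) - PM K (mul f (\<phi> + cj \<eta>)) : K" by (simp add: K_sub opK_K[OF A] fK PM_in csub_K)
  fix v assume "v : bK"
  then obtain g where g: "g : Ku u" "g : Li" "v = cls g" by (rule bK_cases)
  have gK: "cls g : K" using g by (simp add: Ku_iff)
  let ?F = "cls f" and ?G = "cls g"
  define d where "d k = cip (A ((L ^^ k) ?F)) ((L ^^ k) ?G)" for k
  have "cip (A ?F) ?G = d 0" by (simp add: d_def)
  also have "d 0 = cip (mul f \<phi>) ?G + cnj (cip (mul g \<eta>) ?F)"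
  proof -
   have "d ----> cip (A 0) 0" unfolding d_def[abs_def]
    by (intro tendsto_cip tendsto_bcl[OF B] L_pow_tendsto K_HH fK gK)
   hence "(%k. d k - d (Suc k)) sums d 0" using telescope_sums' by fastforce
   moreover have "d k - d (Suc k) = coef ?F k * cip \<phi> ((L ^^ k) ?G) + cnj (coef ?G k * cip \<eta> ((L ^^ k) ?F))" for k
   proof -
    have fk: "(L ^^ k) ?F : K" and gk: "(L ^^ k) ?G : K" by (simp_all add: L_pow_K fK gK)
    show ?thesis using tform_D[OF T fk gk] cip_commute[of \<eta> "(L ^^ k) ?F"]
     by (simp add: d_def PM_cip PM_cip_right csub_K fk gk coef_L_pow)
   qed
   moreover have "(%k. coef ?F k * cip \<phi> ((L ^^ k) ?G) + cnj (coef ?G k * cip \<eta> ((L ^^ k) ?F))) sums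
     (cip (mul f \<phi>) ?G + cnj (cip (mul g \<eta>) ?F))"
    by (intro sums_add sums_cnj[THEN iffD2] half_sums f g H K_HH fK gK)
   ultimately show ?thesis using sums_unique2 by simp
  qed
  also have "... = cip (PM K (mul f (\<phi> + cj \<eta>))) ?G"
  proof -
   have "cip (mul f (\<phi> + cj \<eta>)) ?G = cip (mul f \<phi>) ?G + cip ?F (mul g \<eta>)"
    by (simp add: mul_add f cip_add_left mul_cj_swap g)
   also have "cip ?F (mul g \<eta>) = cnj (cip (mul g \<eta>) ?F)" by (rule cip_commute)
   finally show ?thesis by (simp add: PM_cip csub_K gK)
  qed
  finally show "cip (A (cls f) - PM K (mul f (\<phi> + cj \<eta>))) v = 0" by (simp add: cip_diff_left g)
 qed
 thus "A (cls f) = PM K (mul f (\<phi> + cj \<eta>))" by simp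
qed

lemma cj_HH_split: obtains \<phi> \<eta> where "\<phi> : HH" "\<eta> : HH" "x = \<phi> + cj \<eta>"
proof
 let ?y = "x - PM HH x"
 show "PM HH x : HH" by (simp add: PM_in csub_HH)
 show "cj ?y : HH"
  unfolding HH_iff
 proof
  fix n
  have "cip (cj ?y) (em (Suc n)) = cip (e (Suc n)) ?y" unfolding cj_e[symmetric] by (rule cip_cj)
  also have "... = cnj (cip ?y (e (Suc n)))" by (rule cip_commute)
  also have "cip ?y (e (Suc n)) = 0" by (rule PM_orth[OF csub_HH e_HH])
  finally show "cip (cj ?y) (em (Suc n)) = 0" by simp
 qed
 show "x = PM HH x + cj (cj ?y)" by simp
qed

lemma tendsto_Cc: "(f ---> x) F ==> ((%t. Cc (f t)) ---> Cc x) F"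
 unfolding Cc_def by (intro tendsto_bcl[OF bcl_Mu] tendsto_bcl[OF bcl_mul[OF Li_pow(4)]] tendsto_cj)

text \<open>For bounded functions both sides are the same integral, since the two conjugations
  contribute the factor \<bar>u z\<bar>^2 = 1; density does the rest.\<close>

lemma Csym_of_symb:
 assumes A: "opK A" and s: "symb A x" shows "Csym A"
 unfolding Csym_def
proof (intro ballI)
 fix p q assume p: "p : K" and q: "q : K"
 have eq: "cip (A (Cc p)) (Cc q) = cip (A q) p" if xy: "p : bK" "q : bK" for p q
 proof -
  obtain f where f: "f : Ku u" "f : Li" "p = cls f" by (rule bK_cases[OF xy(1)])
  obtain g where g: "g : Ku u" "g : Li" "q = cls g" by (rule bK_cases[OF xy(2)])
  have L: "f : L2" "g : L2" by (simp_all add: Li_L2 f g)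
  have k: "p : K" "q : K" using xy bK_K by auto
  have eqf: "conj_op u f = (%z. U z * (cnj z * cnj (f z)))" by (simp add: conj_op_def fun_eq_iff)
  have cf: "conj_op u f : Li" "cls (conj_op u f) = Cc p" "conj_op u f : Ku u"
   unfolding eqf[symmetric] using conj_op_cls[OF L(1)] f Cc_K[OF k(1)]
   by (auto simp: Ku_iff) (auto simp: eqf intro!: Li_mult U_Li Li_pow Li_cnj f(2))
  have Af: "A (Cc p) = PM K (mul (conj_op u f) x)" using s cf unfolding symb_def by metis
  have Ag: "A q = PM K (mul g x)" using s g unfolding symb_def by metis
  have cg: "cls (conj_op u g) = Cc q" by (simp only: conj_op_cls(2)[OF L(2)] g(3))
  have "cip (A (Cc p)) (Cc q) = cip (mul (conj_op u f) x) (Cc q)"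
   unfolding Af by (rule PM_cip[OF csub_K Cc_K[OF k(2)]])
  also have "... = ip (%z. conj_op u f z * rp x z) (conj_op u g)"
   unfolding cg[symmetric] mul_def by (rule cip_cls[OF Li_mult_L2[OF cf(1) rp_L2] conj_op_cls(1)[OF L(2)]])
  also have "... = ip (%z. g z * rp x z) f"
   unfolding ip_def
  proof (rule integral_cong_AE)
   show "AE z in circle. conj_op u f z * rp x z * cnj (conj_op u g z) = g z * rp x z * cnj (f z)"
    using U_unim AE_norm1
   proof eventually_elim
    case (elim z)
    hence "U z * cnj (U z) = 1" "cnj z * z = 1" by (simp_all add: complex_norm_square[symmetric] mult.commute)
    have "conj_op u f z * rp x z * cnj (conj_op u g z) = (U z * cnj (U z)) * (cnj z * z) * (g z * rp x z * cnj (f z))"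
     by (simp add: conj_op_def ac_simps)
    thus ?case unfolding \<open>U z * cnj (U z) = 1\<close> \<open>cnj z * z = 1\<close> by simp
   qed
   have m: "f : Bm" "g : Bm" "conj_op u f : Bm" "conj_op u g : Bm"
    using L conj_op_cls(1)[OF L(1)] conj_op_cls(1)[OF L(2)] by (auto simp: L2_eq_l2)
   show "(%z. conj_op u f z * rp x z * cnj (conj_op u g z)) : Bm"
    "(%z. g z * rp x z * cnj (f z)) : Bm" using m by measurable
  qed
  also have "... = cip (mul g x) p"
   unfolding f(3) mul_def by (rule cip_cls[OF Li_mult_L2[OF g(2) rp_L2] L(1), symmetric])
  also have "... = cip (A q) p" unfolding Ag by (rule PM_cip[OF csub_K k(1), symmetric])
  finally show ?thesis .
 qed
 have B: "bcl A" by (rule opK_bcl[OF A])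
 obtain X where X: "!!n. X n : bK" "X ----> p" using bK_dense[OF p] by blast
 obtain Y' where Y': "!!n. Y' n : bK" "Y' ----> q" using bK_dense[OF q] by blast
 have "(%n. cip (A (Cc (X n))) (Cc (Y' n))) ----> cip (A (Cc p)) (Cc q)"
  by (intro tendsto_cip tendsto_bcl[OF B] tendsto_Cc X Y')
 moreover have "(%n. cip (A (Y' n)) (X n)) ----> cip (A q) p" by (intro tendsto_cip tendsto_bcl[OF B] X Y')
 ultimately show "cip (A (Cc p)) (Cc q) = cip (A q) p"
  using LIMSEQ_unique by (simp only: eq[OF X(1) Y'(1)])
qed

lemma tform_shift:
 assumes A: "tform A \<phi> \<eta>" shows "tform A (\<phi> + t *C k0) (\<eta> - cnj t *C k0)"
 using A unfolding tform_def
 by (simp add: K_sub k0_K cip_add_left cip_diff_right cip_cl cip_cr k0_coef coef_k0 algebra_simps)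

text \<open>The two vectors fit the class up to a multiple of \<open>k0\<close>. That multiple is
  moved from \<eta> to \<phi>, where it becomes the constant in the symbol, because
  \<open>k0\<close> is the projection of the constant 1.\<close>

lemma sedA_iff_symb:
 assumes A: "opK A"
 shows "sedA \<alpha> A <-> (EX \<phi>:K. EX c. symb A (\<phi> + \<alpha> *C cj (S (Cc \<phi>)) + c *C e 0))"
proof
 assume "sedA \<alpha> A"
 then obtain \<phi> \<eta> where T: "tform A \<phi> \<eta>" and s: "!!g. g : K ==> coef g 0 = 0 ==> cip (S (Cc \<eta>)) g = \<alpha> * cip \<phi> g"
  unfolding sedA_def by blast
 have K: "\<phi> : K" "\<eta> : K" using T by (auto simp: tform_def)
 let ?x = "\<eta> - cnj \<alpha> *C S (Cc \<phi>)"
 have xK: "?x : K" by (simp add: K_sub K S_K)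
 define t where "t = coef ?x 0 / n0"
 have "cip ?x g = 0" if g: "g : K" "coef g 0 = 0" for g
 proof -
  have "cip g \<eta> = \<alpha> * cip g (S (Cc \<phi>))"
   using s[OF S_K coef_SC_0[OF g]] by (simp only: SC_dual[OF K(2) g] cip_SC_swap[OF K(1) g(1)])
  hence "cip g ?x = 0" by (simp add: cip_diff_right cip_cr)
  thus ?thesis by (metis cip_commute complex_cnj_zero)
 qed
 from mod_k0_zero[OF xK this] have "\<eta> = cnj \<alpha> *C S (Cc \<phi>) + t *C k0" by (simp add: t_def algebra_simps)
 moreover have "tform A (\<phi> + cnj t *C k0) (\<eta> - t *C k0)" using tform_shift[OF T, of "cnj t"] by simp
 ultimately have "tform A (\<phi> + cnj t *C k0) (cnj \<alpha> *C S (Cc \<phi>))" by simp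
 hence "tform A (PM K (\<phi> + cnj t *C e 0)) (PM K (cnj \<alpha> *C S (Cc \<phi>)))"
  by (simp add: PM_add PM_scaleC PM_id csub_K K S_K PM_e0)
 hence "symb A ((\<phi> + cnj t *C e 0) + cj (cnj \<alpha> *C S (Cc \<phi>)))"
  by (intro symb_of_tform[OF A]) (simp_all add: K_HH K S_K K_sub csubD[OF csub_HH] e_HH)
 hence "symb A (\<phi> + \<alpha> *C cj (S (Cc \<phi>)) + cnj t *C e 0)" by (simp add: cj_scaleC add_ac)
 thus "EX \<phi>:K. EX c. symb A (\<phi> + \<alpha> *C cj (S (Cc \<phi>)) + c *C e 0)" using K(1) by blast
next
 assume "EX \<phi>:K. EX c. symb A (\<phi> + \<alpha> *C cj (S (Cc \<phi>)) + c *C e 0)"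
 then obtain \<phi> c where K: "\<phi> : K" and s: "symb A (\<phi> + \<alpha> *C cj (S (Cc \<phi>)) + c *C e 0)" by blast
 have "symb A ((\<phi> + c *C e 0) + cj (cnj \<alpha> *C S (Cc \<phi>)))" using s by (simp add: cj_scaleC add_ac)
 hence "tform A (PM K (\<phi> + c *C e 0)) (PM K (cnj \<alpha> *C S (Cc \<phi>)))"
  by (intro tform_of_symb[OF A]) (simp_all add: K_HH K S_K K_sub csubD[OF csub_HH] e_HH)
 hence T: "tform A (\<phi> + c *C k0) (cnj \<alpha> *C S (Cc \<phi>))"
  by (simp add: PM_add PM_scaleC PM_id csub_K K S_K PM_e0)
 moreover have "cip (S (Cc (cnj \<alpha> *C S (Cc \<phi>)))) g = \<alpha> * cip (\<phi> + c *C k0) g" if g: "g : K" "coef g 0 = 0" for g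
  using cip_S[OF L_K[OF K] g(1)] cip_L_L[OF K_HH[OF K] K_HH[OF g(1)]] by (simp add: S_Cc K g Cc_scaleC bcl_scaleC[OF bcl_S] cip_cl cip_add_left k0_coef g)
 ultimately show "sedA \<alpha> A" unfolding sedA_def by blast
qed

lemma sedInf_iff_symb:
 assumes A: "opK A" shows "sedInf A <-> (EX \<eta>:K. symb A (cj \<eta>))"
proof
 assume "sedInf A"
 then obtain \<phi> \<eta> where T: "tform A \<phi> \<eta>" and s: "!!g. g : K ==> coef g 0 = 0 ==> cip \<phi> g = 0"
  unfolding sedInf_def by blast
 have K: "\<phi> : K" "\<eta> : K" using T by (auto simp: tform_def)
 define t where "t = coef \<phi> 0 / n0"
 have p: "\<phi> = t *C k0" unfolding t_def by (rule mod_k0_zero[OF K(1) s])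
 have "tform A (\<phi> + (- t) *C k0) (\<eta> - cnj (- t) *C k0)" by (rule tform_shift[OF T])
 hence "tform A 0 (\<eta> + cnj t *C k0)" by (simp add: p scaleC_minus_left)
 moreover have k: "\<eta> + cnj t *C k0 : K" by (simp add: K_sub K k0_K)
 ultimately have "tform A (PM K 0) (PM K (\<eta> + cnj t *C k0))" by (simp add: PM_id csub_K K_sub)
 hence "symb A (0 + cj (\<eta> + cnj t *C k0))" by (intro symb_of_tform[OF A]) (simp_all add: K_HH k csubD[OF csub_HH])
 hence "symb A (cj (\<eta> + cnj t *C k0))" by simp
 thus "EX \<eta>:K. symb A (cj \<eta>)" using k by blast
next
 assume "EX \<eta>:K. symb A (cj \<eta>)"
 then obtain \<eta> where k: "\<eta> : K" and s: "symb A (0 + cj \<eta>)" by auto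
 have "tform A (PM K 0) (PM K \<eta>)" by (rule tform_of_symb[OF A _ _ s]) (simp_all add: K_HH k csubD[OF csub_HH])
 hence "tform A 0 \<eta>" by (simp add: PM_id csub_K K_sub k)
 thus "sedInf A" unfolding sedInf_def by (intro exI conjI) auto
qed

lemma tform_iff_symb:
 assumes A: "opK A" shows "(EX \<phi> \<eta>. tform A \<phi> \<eta>) <-> (EX x. symb A x)"
proof
 assume "EX \<phi> \<eta>. tform A \<phi> \<eta>"
 then obtain \<phi> \<eta> where T: "tform A \<phi> \<eta>" by blast
 hence K: "\<phi> : K" "\<eta> : K" by (auto simp: tform_def)
 have "symb A (\<phi> + cj \<eta>)" using T K by (intro symb_of_tform[OF A]) (simp_all add: K_HH PM_id csub_K)
 thus "EX x. symb A x" by blast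
next
 assume "EX x. symb A x"
 then obtain x where s: "symb A x" by blast
 obtain \<phi> \<eta> where "\<phi> : HH" "\<eta> : HH" "x = \<phi> + cj \<eta>" using cj_HH_split .
 thus "EX \<phi> \<eta>. tform A \<phi> \<eta>" using tform_of_symb[OF A] s by blast
qed

lemma TTO_cls: "f : Ku u ==> f : Li ==> \<psi> : L2 ==> TTO u \<psi> f : L2 & cls (TTO u \<psi> f) = PM K (mul f (cls \<psi>))"
proof -
 assume f: "f : Ku u" "f : Li" and p: "\<psi> : L2"
 have e: "(%z. \<psi> z * f z) = (%z. f z * \<psi> z)" by (simp add: mult.commute)
 have l: "(%z. \<psi> z * f z) : L2" unfolding e by (rule Li_mult_L2[OF f(2) p])
 show ?thesis unfolding TTO_def using proj_Ku[OF l] by (simp add: Ku_iff e mul_cls f p)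
qed

lemma extends_to_symb:
 assumes p: "\<psi> : L2" shows "extends_to u (TTO u \<psi>) A <-> bounded_op u A & symb (opr A) (cls \<psi>)"
proof -
 have "A f \<doteq> TTO u \<psi> f <-> opr A (cls f) = PM K (mul f (cls \<psi>))" if A: "bounded_op u A" and f: "f : Ku u" "f : Li" for f
  using TTO_cls[OF f p] cls_bounded_op[OF A f(1)] cls_eq_iff[OF bounded_opD(1)[OF A f(1)], of "TTO u \<psi> f"] by auto
 thus ?thesis unfolding extends_to_def symb_def by blast
qed

theorem toeplitz_iff: "A : toeplitz_space u <-> bounded_op u A & (EX x. symb (opr A) x)"
proof -
 have "A : toeplitz_space u <-> (EX \<psi>:L2. bounded_op u A & symb (opr A) (cls \<psi>))"
  by (auto simp: toeplitz_space_def extends_to_symb)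
 also have "... <-> bounded_op u A & (EX x. symb (opr A) x)" using rp_L2 cls_rp by metis
 finally show ?thesis .
qed

definition sedop :: "ext_complex => (hl2 => hl2) => bool" where
 "sedop \<alpha> A = (case \<alpha> of Fin a => sedA a A | Infty => sedInf A)"

theorem sedlock_iff: "A : sedlock u \<alpha> <-> bounded_op u A & sedop \<alpha> (opr A)"
proof (cases \<alpha>)
 case (Fin a)
 have L: "(%z. \<phi> z + a * cnj (Defs.shift u (conj_op u \<phi>) z) + c) : L2"
   "cls (%z. \<phi> z + a * cnj (Defs.shift u (conj_op u \<phi>) z) + c) = cls \<phi> + a *C cj (S (Cc (cls \<phi>))) + c *C e 0"
  if "\<phi> : Ku u" for \<phi> c
 proof -
  have f: "\<phi> : L2" using that by (simp add: Ku_iff)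
  have s: "Defs.shift u (conj_op u \<phi>) : L2" by (intro shift_cls conj_op_cls f)
  have c: "cls (%z. c) = c *C e 0" using cls_scaleC[OF Li_L2[OF Li_const[of 1]], of c] by (simp add: e_def)
  have l: "(%z. a * cnj (Defs.shift u (conj_op u \<phi>) z)) : L2" by (intro Li_mult_L2 Li_const L2_cnj s)
  show "(%z. \<phi> z + a * cnj (Defs.shift u (conj_op u \<phi>) z) + c) : L2"
   by (intro L2_add f l Li_L2 Li_const)
  show "cls (%z. \<phi> z + a * cnj (Defs.shift u (conj_op u \<phi>) z) + c) = cls \<phi> + a *C cj (S (Cc (cls \<phi>))) + c *C e 0"
   by (simp add: cls_add[OF L2_add[OF f l] Li_L2[OF Li_const]] cls_add[OF f l] cls_scaleC L2_cnj s cj_cls[symmetric] shift_cls conj_op_cls f c)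
 qed
 have "A : sedlock u (Fin a) <-> bounded_op u A & (EX \<phi>:Ku u. EX c. symb (opr A) (cls \<phi> + a *C cj (S (Cc (cls \<phi>))) + c *C e 0))"
  by (auto simp: extends_to_symb L)
 also have "... <-> bounded_op u A & (EX \<phi>:K. EX c. symb (opr A) (\<phi> + a *C cj (S (Cc \<phi>)) + c *C e 0))"
  using rp_Ku by (metis Ku_iff cls_rp)
 finally show ?thesis using sedA_iff_symb[OF opK_opr] by (auto simp: Fin sedop_def)
next
 case Infty
 have "A : sedlock u Infty <-> bounded_op u A & (EX \<phi>:Ku u. symb (opr A) (cj (cls \<phi>)))"
  by (auto simp: extends_to_symb Ku_iff L2_cnj cj_cls)
 also have "... <-> bounded_op u A & (EX \<phi>:K. symb (opr A) (cj \<phi>))" using rp_Ku by (metis Ku_iff cls_rp)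
 finally show ?thesis using sedInf_iff_symb[OF opK_opr] by (auto simp: Infty sedop_def)
qed

end

section \<open>Truncated Hankel operators\<close>

lemma J_op_L2: assumes f: "f : L2" shows "J_op f : L2"
proof -
 have m: "f : Bm" and i: "integrable circle (%z. (cmod (f z))^2)"
  using f by (simp_all add: L2_def)
 have "integrable (distr circle circle cnj) (%z. (cmod (f z))^2)" unfolding distr_cnj_circle by (rule i)
 hence "integrable circle (%z. (cmod (f (cnj z)))^2)"
  by (subst (asm) integrable_distr_eq[OF measurable_cnj_circle]) (use m in measurable)
 moreover have "(%z. f (cnj z)) : Bm" by (rule measurable_compose[OF measurable_cnj_circle m])
 ultimately have "(%z. f (cnj z)) : L2" by (simp add: L2_def)
 thus ?thesis unfolding J_op_def[abs_def] by (rule Li_mult_L2[OF Li_pow(4)])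
qed

definition Jx :: "hl2 => hl2" where "Jx x = cls (J_op (rp x))"

lemma Jx_cls: assumes f: "f : L2" shows "cls (J_op f) = Jx (cls f)"
 unfolding Jx_def
proof (rule cls_cong)
 have "AE z in circle. rp (cls f) z = f z" using rp_cls[OF f] by (simp add: ae_eq_def)
 from AE_circle_cnj[OF this] show "J_op f \<doteq> J_op (rp (cls f))"
  unfolding ae_eq_def J_op_def by eventually_elim simp
qed (simp_all add: J_op_L2 f)

lemma Jx_lin: "Jx (x + c *C y) = Jx x + c *C Jx y"
proof -
 have l: "(%z. c * rp y z) : L2" by (rule Li_mult_L2[OF Li_const rp_L2])
 have "Jx (x + c *C y) = Jx (cls (%z. rp x z + c * rp y z))" by (simp add: cls_add l cls_scaleC)
 also have "... = cls (J_op (%z. rp x z + c * rp y z))" by (rule Jx_cls[OF L2_add[OF rp_L2 l], symmetric])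
 also have "J_op (%z. rp x z + c * rp y z) = (%z. J_op (rp x) z + c * J_op (rp y) z)"
  by (simp add: J_op_def fun_eq_iff algebra_simps)
 also have "cls ... = Jx x + c *C Jx y"
  by (simp add: cls_add J_op_L2 Li_mult_L2 Li_const cls_scaleC Jx_def)
 finally show ?thesis .
qed

lemma Jx_Jx [simp]: "Jx (Jx x) = x"
proof -
 have "Jx (Jx x) = cls (J_op (J_op (rp x)))" unfolding Jx_cls[OF J_op_L2[OF rp_L2]] by (simp add: Jx_def)
 also have "... = cls (rp x)"
 proof (rule cls_cong)
  show "J_op (J_op (rp x)) \<doteq> rp x"
   unfolding ae_eq_def using AE_norm1
  proof eventually_elim
   case (elim z)
   hence "cnj z * z = 1" by (simp add: complex_norm_square[symmetric] mult.commute)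
   thus ?case by (simp add: J_op_def mult.assoc[symmetric])
  qed
 qed (simp_all add: J_op_L2)
 finally show ?thesis by simp
qed

lemma cip_Jx_Jx: "cip (Jx x) (Jx y) = cip x y"
proof -
 have m: "(%z. rp x z * cnj (rp y z)) : Bm" by measurable
 have "cip (Jx x) (Jx y) = (LINT z|circle. J_op (rp x) z * cnj (J_op (rp y) z))"
  unfolding Jx_def by (simp add: cip_cls J_op_L2 ip_def)
 also have "... = (LINT z|circle. rp x (cnj z) * cnj (rp y (cnj z)))"
 proof (rule integral_eqI)
  fix z assume "z : space circle"
  hence "cnj z * z = 1" by (simp add: space_circle complex_norm_square[symmetric] mult.commute)
  moreover have "J_op (rp x) z * cnj (J_op (rp y) z) = (cnj z * z) * (rp x (cnj z) * cnj (rp y (cnj z)))"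
   by (simp add: J_op_def ac_simps)
  ultimately show "J_op (rp x) z * cnj (J_op (rp y) z) = rp x (cnj z) * cnj (rp y (cnj z))" by simp
 qed simp
 also have "... = cip x y" using integral_circle_cnj[OF m] by (simp add: cip_def ip_def)
 finally show ?thesis .
qed

lemma bcl_Jx: "bcl Jx"
proof (rule bclI[where C=1])
 show "Jx (x + y) = Jx x + Jx y" for x y using Jx_lin[of x 1 y] by simp
 have n: "norm (Jx x) = norm x" for x
 proof -
  have "complex_of_real ((norm (Jx x))^2) = of_real ((norm x)^2)" unfolding cip_self[symmetric] by (rule cip_Jx_Jx)
  hence "(norm (Jx x))^2 = (norm x)^2" by (simp only: of_real_eq_iff)
  thus ?thesis by (rule power2_eq_imp_eq) simp_all
 qed
 thus "norm (Jx x) <= 1 * norm x" for x by simp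
 have "norm (Jx 0) = 0" unfolding n by simp
 thus "Jx (c *C x) = c *C Jx x" for c x using Jx_lin[of 0 c x] by simp
qed

lemma Jx_mul: assumes p: "\<phi> : Li" shows "Jx (mul \<phi> x) = mul (%z. \<phi> (cnj z)) (Jx x)"
proof -
 have "Jx (mul \<phi> x) = cls (J_op (%z. \<phi> z * rp x z))" unfolding mul_def by (rule Jx_cls[symmetric, OF Li_mult_L2[OF p rp_L2]])
 also have "J_op (%z. \<phi> z * rp x z) = (%z. \<phi> (cnj z) * J_op (rp x) z)" by (simp add: J_op_def fun_eq_iff ac_simps)
 also have "cls ... = mul (%z. \<phi> (cnj z)) (Jx x)"
  unfolding Jx_def by (rule mul_cls[symmetric, OF Li_reflect[OF p] J_op_L2[OF rp_L2]])
 finally show ?thesis .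
qed

lemma Jx_e: "Jx (e n) = em (Suc n)"
proof -
 have "Jx (e n) = cls (J_op (%z. z ^ n))" unfolding e_def by (rule Jx_cls[symmetric]) (simp add: Li_L2 Li_pow)
 thus ?thesis by (simp add: J_op_def[abs_def] em_def)
qed

text \<open>\<open>Jx\<close> sends \<open>e n\<close> to \<open>em (Suc n)\<close>, hence the Hardy
  space into its orthogonal complement.\<close>

lemma Jx_HH_orth: assumes x: "x : HH" and y: "y : HH" shows "cip (Jx x) y = 0"
proof -
 have "cip (em (Suc n)) y = 0" for n using y cip_commute[of y "em (Suc n)"] by (simp add: HH_iff)
 hence z: "cip (Jx (fsum (coef x) N)) y = 0" for N
  by (simp add: fsum_def bcl_sum[OF bcl_Jx] bcl_scaleC[OF bcl_Jx] Jx_e cip_sum_left cip_cl)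
 have "(%N. cip (Jx (fsum (coef x) N)) y) ----> cip (Jx x) y"
  by (intro tendsto_cip tendsto_bcl[OF bcl_Jx] fsum_tendsto x tendsto_const)
 thus ?thesis unfolding z by (simp add: LIMSEQ_const_iff)
qed

lemma Li_cong: assumes "t : Bm" "s : Li" "AE z in circle. t z = s z" shows "t : Li"
proof -
 obtain C where "AE z in circle. cmod (s z) <= C" using Li_bound[OF assms(2)] .
 hence "AE z in circle. cmod (t z) <= C" using assms(3) by eventually_elim simp
 thus ?thesis by (rule LiI[OF assms(1)])
qed

context inner_fn
begin

lemma tform_cong: assumes "!!x. x : K ==> A x = B x" shows "tform A \<phi> \<eta> <-> tform B \<phi> \<eta>"
 unfolding tform_def dA_def using assms L_K by simp

lemma sedop_cong: assumes "!!x. x : K ==> A x = B x" shows "sedop \<alpha> A <-> sedop \<alpha> B"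
 using tform_cong[of A B, OF assms] by (simp add: sedop_def sedA_def sedInf_def split: ext_complex.split)

lemma bounded_opI:
 assumes R: "opK R" and T: "!!f. f : Ku u ==> F f : L2" "!!f. f : Ku u ==> cls (F f) = R (cls f)"
 shows "bounded_op u F"
 unfolding bounded_op_def
proof (intro conjI ballI allI)
 have B: "bcl R" by (rule opK_bcl[OF R])
 fix f assume f: "f : Ku u"
 hence f': "f : L2" "cls f : K" by (auto simp: Ku_iff)
 show "F f : Ku u" using T[OF f] opK_K[OF R f'(2)] by (simp add: Ku_iff)
 show "F (%z. f z + g z) \<doteq> (%z. F f z + F g z)" if g: "g : Ku u" for g
 proof -
  have g': "g : L2" "cls g : K" using g by (auto simp: Ku_iff)
  have s: "(%z. f z + g z) : Ku u" by (simp add: Ku_iff L2_add cls_add f' g' K_sub)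
  have "cls (F (%z. f z + g z)) = cls (%z. F f z + F g z)"
   by (simp add: T(2)[OF s] cls_add f' g' bcl_add[OF B] T f g)
  thus ?thesis using cls_eq_iff[OF T(1)[OF s] L2_add[OF T(1)[OF f] T(1)[OF g]]] by blast
 qed
 show "F (%z. c * f z) \<doteq> (%z. c * F f z)" for c
 proof -
  have s: "(%z. c * f z) : Ku u" by (simp add: Ku_iff Li_mult_L2 Li_const cls_scaleC f' K_sub)
  have "cls (F (%z. c * f z)) = cls (%z. c * F f z)"
   by (simp add: T(2)[OF s] cls_scaleC f' bcl_scaleC[OF B] T f)
  thus ?thesis using cls_eq_iff[OF T(1)[OF s] Li_mult_L2[OF Li_const T(1)[OF f]]] by blast
 qed
next
 obtain C where C: "!!x. norm (R x) <= C * norm x" using bcl_bound[OF opK_bcl[OF R]] by blast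
 have "L2norm (F f) <= C * L2norm f" if f: "f : Ku u" for f
  using C[of "cls f"] f norm_cls[OF T(1)[OF f]] norm_cls[of f] T(2)[OF f] by (simp add: Ku_iff)
 thus "EX C. ALL f:Ku u. L2norm (F f) <= C * L2norm f" by blast
qed

lemma op_eqI:
 assumes B: "bounded_op u B" and T: "!!f. f : Ku u ==> F f : L2" "!!f. f : Ku u ==> cls (F f) = opr B (cls f)"
 shows "op_eq u B F"
proof (subst op_eq_cls)
 show "ALL f:Ku u. cls (B f) = cls (F f)" using T(2) cls_bounded_op[OF B] by simp
qed (simp_all add: T(1) bounded_opD(1)[OF B])

lemma TTO_Li: assumes f: "f : L2" and p: "\<phi> : Li" shows "TTO u \<phi> f : L2" "cls (TTO u \<phi> f) = PM K (mul \<phi> (cls f))"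
 unfolding TTO_def using proj_Ku[OF Li_mult_L2[OF p f]] by (simp_all add: Ku_iff mul_cls p f)

end

locale real_inner_fn = inner_fn +
 assumes sym: "real_symmetric u"
begin

text \<open>The symmetry of \<open>u\<close> is known in the disc; it reaches the circle by
  comparing the radial limits at \<open>z\<close> and at \<open>cnj z\<close>, both of which exist
  almost everywhere.\<close>

lemma U_cnj: "AE z in circle. U (cnj z) = cnj (U z)"
 using bv_tendsto[OF uH] AE_circle_cnj[OF bv_tendsto[OF uH]] AE_norm1
proof eventually_elim
 case (elim z)
 have "((%r. cnj (u (of_real r * z))) ---> cnj (U z)) (at_left 1)" by (intro tendsto_cnj elim(1))
 moreover have "\<forall>\<^sub>F r in at_left (1::real). cnj (u (of_real r * z)) = u (of_real r * cnj z)"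
 proof -
  have "\<forall>\<^sub>F r in at_left (1::real). 0 < r & r < 1" using eventually_at_left[of "0::real" 1] by (auto intro!: exI[of _ "0::real"])
  thus ?thesis
  proof eventually_elim
   case (elim r)
   hence "of_real r * cnj z : ball 0 1" using \<open>cmod z = 1\<close> by (simp add: norm_mult)
   hence "u (of_real r * cnj z) = hat u (of_real r * cnj z)" using sym unfolding real_symmetric_def by blast
   thus ?case by (simp add: hat_def)
  qed
 qed
 ultimately have "((%r. u (of_real r * cnj z)) ---> cnj (U z)) (at_left 1)" by (rule Lim_transform_eventually)
 thus ?case using tendsto_unique[OF _ elim(2)] by simp
qed

lemma Jx_Mu: "Jx (Mu x) = Mub (Jx x)"
 unfolding Jx_mul[OF U_Li]
 by (rule mul_cong[OF Li_reflect[OF U_Li] Ub_Li]) (use U_cnj in \<open>simp add: ae_eq_def\<close>)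

text \<open>The operator D written as u times J, which is visibly linear and makes sense on the
  whole space.\<close>

definition Dx :: "hl2 => hl2" where "Dx x = Mu (Jx x)"

lemma bcl_Dx: "bcl Dx" unfolding Dx_def by (rule bcl_compose[OF bcl_Mu bcl_Jx])

lemma Dx_Mu: "Dx (Mu x) = Jx x" by (simp add: Dx_def Jx_Mu)

lemma Dx_Dx [simp]: "Dx (Dx x) = x" by (simp add: Dx_Mu Dx_def[of x])

lemma cip_Dx_Dx: "cip (Dx x) (Dx y) = cip x y" by (simp add: Dx_def cip_Mu_Mu cip_Jx_Jx)

lemma cip_Dx: "cip (Dx x) y = cip x (Dx y)" using cip_Dx_Dx[of x "Dx y"] by simp

lemma Dx_K: assumes x: "x : K" shows "Dx x : K"
 unfolding K_iff HH_iff
proof (intro conjI allI ballI)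
 have "Dx (em (Suc n)) = Mu (e n)" for n by (simp add: Dx_def Jx_e[symmetric])
 thus "cip (Dx x) (em (Suc n)) = 0" for n by (simp add: cip_Dx K_Mu x e_HH)
 fix y assume "y : HH"
 thus "cip (Dx x) (Mu y) = 0" by (simp add: Dx_def cip_Mu_Mu Jx_HH_orth K_HH x)
qed

lemma opK_Dx: "opK Dx" by (simp add: opK_def bcl_Dx Dx_K)

lemma PM_Dx: "PM K (Dx x) = Dx (PM K x)"
proof (rule PM_unique[OF csub_K Dx_K[OF PM_in[OF csub_K]]])
 fix v assume v: "v : K"
 show "cip (Dx (PM K x)) v = cip (Dx x) v" by (simp add: cip_Dx PM_cip csub_K Dx_K v)
qed

lemma Dx_mul: assumes p: "\<phi> : Li" shows "Dx (mul \<phi> x) = mul (%z. \<phi> (cnj z)) (Dx x)"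
 unfolding Dx_def Jx_mul[OF p] by (simp add: mul_mul U_Li Li_reflect p mult.commute)

lemma D_op_eq: "D_op u f = (%z. U z * J_op f z)"
 by (simp add: D_op_def conj_op_def hat_def J_op_def fun_eq_iff)

lemma D_op_cls: assumes f: "f : L2" shows "D_op u f : L2" "cls (D_op u f) = Dx (cls f)"
 unfolding D_op_eq by (simp_all add: Li_mult_L2 U_Li J_op_L2 f mul_cls[symmetric] Jx_cls Dx_def)

lemma D_op_Ku: "f : Ku u ==> D_op u f : Ku u" by (simp add: Ku_iff D_op_cls Dx_K)

text \<open>A truncated Hankel operator is D times the truncated Toeplitz operator with symbol u
  times \<phi>: the Hardy part is sent by \<open>Jx\<close> into the complement and disappears under
  \<open>PM K\<close>, and \<open>Jx\<close> is \<open>Dx\<close> after \<open>Mu\<close>.\<close>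

lemma THO_cls:
 assumes h: "(%z. \<phi> z * f z) : L2"
 shows "THO u \<phi> f : L2" "cls (THO u \<phi> f) = Dx (PM K (Mu (cls (%z. \<phi> z * f z))))"
proof -
 let ?h = "%z. \<phi> z * f z"
 have H: "H2 = {f : L2. cls f : HH}" using H2_iff by blast
 note p = proj_cls[OF csub_HH H h]
 have p2: "Defs.proj H2 ?h : L2" using p(1) by (simp add: H2_iff)
 have d: "(%z. ?h z - Defs.proj H2 ?h z) : L2" by (rule L2_diff[OF h p2])
 note q = proj_Ku[OF J_op_L2[OF d]]
 show "THO u \<phi> f : L2" unfolding THO_def using q(1) by (simp add: Ku_iff)
 have "cls (THO u \<phi> f) = PM K (Jx (cls ?h - PM HH (cls ?h)))"
  unfolding THO_def q(2) Jx_cls[OF d] cls_diff[OF h p2] p(2) ..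
 also have "... = PM K (Jx (cls ?h)) - PM K (Jx (PM HH (cls ?h)))"
  by (simp only: bcl_diff[OF bcl_Jx] bcl_diff[OF bcl_PM[OF csub_K]])
 also have "PM K (Jx (PM HH (cls ?h))) = 0"
  by (rule PM_eq_0[OF csub_K]) (rule Jx_HH_orth[OF PM_in[OF csub_HH] K_HH])
 also have "Jx (cls ?h) = Dx (Mu (cls ?h))" by (simp add: Dx_Mu)
 finally show "cls (THO u \<phi> f) = Dx (PM K (Mu (cls ?h)))" by (simp add: PM_Dx)
qed

lemma THO_Li:
 assumes f: "f : L2" and p: "\<phi> : Li"
 shows "THO u \<phi> f : L2" "cls (THO u \<phi> f) = Dx (PM K (Mu (mul \<phi> (cls f))))"
 using THO_cls[OF Li_mult_L2[OF p f]] by (simp_all add: mul_cls p f)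

lemma hankel_symb_left:
 assumes B: "B : hankel_space u" shows "bounded_op u B" "EX x. symb (%x. Dx (opr B x)) x"
proof -
 obtain \<phi> where p: "\<phi> : L2" and e: "extends_to u (THO u \<phi>) B" using B by (auto simp: hankel_space_def)
 show b: "bounded_op u B" using e by (simp add: extends_to_def)
 have "symb (%x. Dx (opr B x)) (Mu (cls \<phi>))"
  unfolding symb_def
 proof (intro ballI impI)
  fix f assume f: "f : Ku u" "f : Li"
  have eq: "(%z. \<phi> z * f z) = (%z. f z * \<phi> z)" by (simp add: mult.commute)
  have l: "(%z. \<phi> z * f z) : L2" unfolding eq by (rule Li_mult_L2[OF f(2) p])
  have "B f \<doteq> THO u \<phi> f" using e f by (simp add: extends_to_def)
  hence "opr B (cls f) = cls (THO u \<phi> f)"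
   using cls_bounded_op[OF b f(1)] cls_cong[OF _ bounded_opD(1)[OF b f(1)] THO_cls(1)[OF l]] by simp
  also have "... = Dx (PM K (Mu (mul f (cls \<phi>))))" unfolding THO_cls(2)[OF l] eq mul_cls[OF f(2) p] ..
  finally show "Dx (opr B (cls f)) = PM K (mul f (Mu (cls \<phi>)))" by (simp add: mul_mul U_Li f mult.commute)
 qed
 thus "EX x. symb (%x. Dx (opr B x)) x" by blast
qed

text \<open>Moving D from the left to the right reflects the symbol, because \<open>D_op\<close>
  applied to a product with the reflected symbol is the product of \<open>D_op u f\<close> with the
  original one.\<close>

lemma hankel_symb_right:
 assumes B: "B : hankel_space u" shows "EX x. symb (%x. opr B (Dx x)) x"
proof -
 obtain y where s: "symb (%x. Dx (opr B x)) y" using hankel_symb_left(2)[OF B] by blast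
 \<comment> \<open>The reflection of \<open>y\<close>: the factor \<open>z\<close> cancels the
   \<open>cnj z\<close> in \<open>J_op\<close>.\<close>
 define y' where "y' = cls (%z. z * J_op (rp y) z)"
 have yl: "(%z. z * J_op (rp y) z) : L2" by (rule Li_mult_L2[OF Li_pow(3) J_op_L2[OF rp_L2]])
 have "symb (%x. opr B (Dx x)) y'"
  unfolding symb_def
 proof (intro ballI impI)
  fix f assume f: "f : Ku u" "f : Li"
  have f2: "f : L2" by (rule Li_L2[OF f(2)])
  have D: "D_op u f : Li"
   unfolding D_op_eq J_op_def by (intro Li_mult U_Li Li_pow Li_reflect f)
  have "Dx (opr B (Dx (cls f))) = PM K (mul (D_op u f) y)"
   using s D D_op_Ku[OF f(1)] D_op_cls(2)[OF f2] unfolding symb_def by metis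
  also have "mul (D_op u f) y = Dx (mul f y')"
  proof -
   have l: "(%z. f z * (z * J_op (rp y) z)) : L2" by (rule Li_mult_L2[OF f(2) yl])
   have "Dx (mul f y') = cls (D_op u (%z. f z * (z * J_op (rp y) z)))"
    unfolding y'_def mul_cls[OF f(2) yl] by (rule D_op_cls(2)[OF l, symmetric])
   also have "... = cls (%z. D_op u f z * rp y z)"
   proof (rule cls_cong[OF _ D_op_cls(1)[OF l] Li_mult_L2[OF D rp_L2]])
    show "D_op u (%z. f z * (z * J_op (rp y) z)) \<doteq> (%z. D_op u f z * rp y z)"
     unfolding ae_eq_def using AE_norm1
    proof eventually_elim
     case (elim z)
     hence "cnj z * z = 1" by (simp add: complex_norm_square[symmetric] mult.commute)
     moreover have "D_op u (%z. f z * (z * J_op (rp y) z)) z = D_op u f z * ((cnj z * z) * rp y z)"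
      by (simp add: D_op_eq J_op_def ac_simps)
     ultimately show ?case by simp
    qed
   qed
   finally show ?thesis by (simp add: mul_def)
  qed
  also have "PM K (Dx (mul f y')) = Dx (PM K (mul f y'))" by (rule PM_Dx)
  finally have "Dx (Dx (opr B (Dx (cls f)))) = Dx (Dx (PM K (mul f y')))" by (rule arg_cong)
  thus "opr B (Dx (cls f)) = PM K (mul f y')" by simp
 qed
 thus ?thesis by blast
qed

text \<open>D is its own inverse, so the only candidate for the operator in the class is
  \<open>B\<close> followed, on the right, by another D.\<close>

lemma times_D_iff:
 assumes B: "bounded_op u B" shows "B : times_D u (sedlock u \<alpha>) <-> sedop \<alpha> (%x. opr B (Dx x))"
proof
 assume "B : times_D u (sedlock u \<alpha>)"
 then obtain A where A: "bounded_op u A" "sedop \<alpha> (opr A)" and e: "op_eq u B (A o D_op u)"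
  by (auto simp: times_D_def sedlock_iff)
 have "opr A x = opr B (Dx x)" if x: "x : K" for x
 proof -
  have k: "rp (Dx x) : Ku u" by (rule rp_Ku[OF Dx_K[OF x]])
  have "cls (B (rp (Dx x))) = cls (A (D_op u (rp (Dx x))))"
   using e k cls_cong[OF _ bounded_opD(1)[OF B k] bounded_opD(1)[OF A(1) D_op_Ku[OF k]]] by (simp add: op_eq_def)
  thus ?thesis
   using cls_bounded_op[OF B k] cls_bounded_op[OF A(1) D_op_Ku[OF k]] by (simp add: D_op_cls)
 qed
 thus "sedop \<alpha> (%x. opr B (Dx x))" using A(2) sedop_cong[of "opr A" "%x. opr B (Dx x)"] by blast
next
 assume s: "sedop \<alpha> (%x. opr B (Dx x))"
 let ?A = "%x. opr B (Dx x)"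
 have o: "opK ?A" by (rule opK_compose[OF opK_opr[OF B] opK_Dx])
 have "fn ?A : sedlock u \<alpha>"
  using s sedop_cong[OF opr_fn[OF o]] by (simp add: sedlock_iff bounded_op_fn[OF o])
 moreover have "op_eq u B (fn ?A o D_op u)"
  by (rule op_eqI[OF B]) (simp add: fn_def, simp add: cls_fn D_op_cls Ku_iff)
 ultimately show "B : times_D u (sedlock u \<alpha>)" by (auto simp: times_D_def)
qed

lemma D_times_iff:
 assumes B: "bounded_op u B" shows "B : D_times u (sedlock u \<alpha>) <-> sedop \<alpha> (%x. Dx (opr B x))"
proof
 assume "B : D_times u (sedlock u \<alpha>)"
 then obtain A where A: "bounded_op u A" "sedop \<alpha> (opr A)" and e: "op_eq u B (D_op u o A)"
  by (auto simp: D_times_def sedlock_iff)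
 have "opr A x = Dx (opr B x)" if x: "x : K" for x
 proof -
  have k: "rp x : Ku u" by (rule rp_Ku[OF x])
  have AL: "A (rp x) : L2" by (rule bounded_opD(1)[OF A(1) k])
  have "cls (B (rp x)) = cls (D_op u (A (rp x)))"
   using e k cls_cong[OF _ bounded_opD(1)[OF B k] D_op_cls(1)[OF AL]] by (simp add: op_eq_def)
  hence "opr B x = Dx (opr A x)"
   using cls_bounded_op[OF B k] cls_bounded_op[OF A(1) k] by (simp add: D_op_cls AL)
  thus ?thesis by simp
 qed
 thus "sedop \<alpha> (%x. Dx (opr B x))" using A(2) sedop_cong[of "opr A" "%x. Dx (opr B x)"] by blast
next
 assume s: "sedop \<alpha> (%x. Dx (opr B x))"
 let ?A = "%x. Dx (opr B x)"
 have o: "opK ?A" by (rule opK_compose[OF opK_Dx opK_opr[OF B]])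
 have "fn ?A : sedlock u \<alpha>"
  using s sedop_cong[OF opr_fn[OF o]] by (simp add: sedlock_iff bounded_op_fn[OF o])
 moreover have "op_eq u B (D_op u o fn ?A)"
  by (rule op_eqI[OF B]) (simp add: D_op_cls fn_def, simp add: D_op_cls fn_def)
 ultimately show "B : D_times u (sedlock u \<alpha>)" by (auto simp: D_times_def)
qed

end

section \<open>Products of two truncated Hankel operators\<close>

locale hankel_pair = real_inner_fn +
 fixes B1 B2 :: oper
 assumes B1: "B1 : hankel_space u" and B2: "B2 : hankel_space u"
begin

text \<open>The two factors D cancel in the product, so \<open>B1 o B2\<close> is the product of the
  truncated Toeplitz operators \<open>A1\<close> and \<open>A2\<close>.\<close>

definition A1 :: "hl2 => hl2" where "A1 x = opr B1 (Dx x)"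
definition A2 :: "hl2 => hl2" where "A2 x = Dx (opr B2 x)"

lemma b1: "bounded_op u B1" and b2: "bounded_op u B2" by (rule hankel_symb_left(1)[OF B1] hankel_symb_left(1)[OF B2])+

lemma o1: "opK A1" and o2: "opK A2"
 unfolding A1_def[abs_def] A2_def[abs_def]
 by (rule opK_compose[OF opK_opr[OF b1] opK_Dx] opK_compose[OF opK_Dx opK_opr[OF b2]])+

lemma o12: "opK (%x. A1 (A2 x))" by (rule opK_compose[OF o1 o2])

lemma s1: "EX x. symb A1 x" and s2: "EX x. symb A2 x"
 unfolding A1_def[abs_def] A2_def[abs_def] by (rule hankel_symb_right[OF B1] hankel_symb_left(2)[OF B2])+

lemma C1: "Csym A1" and C2: "Csym A2"
 using Csym_of_symb[OF o1] Csym_of_symb[OF o2] s1 s2 by blast+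

lemma opr_B1: "opr B1 x = A1 (Dx x)" and opr_B2: "opr B2 x = Dx (A2 x)"
 by (simp_all add: A1_def A2_def)

lemma B12_cls: assumes f: "f : Ku u" shows "(B1 o B2) f : L2" "cls ((B1 o B2) f) = A1 (A2 (cls f))"
proof -
 have k: "B2 f : Ku u" using bounded_opD(1,2)[OF b2 f] by (simp add: Ku_iff)
 show "(B1 o B2) f : L2" using bounded_opD(1)[OF b1 k] by simp
 show "cls ((B1 o B2) f) = A1 (A2 (cls f))"
  using cls_bounded_op[OF b1 k] cls_bounded_op[OF b2 f] by (simp add: opr_B1 opr_B2)
qed

lemma b12: "bounded_op u (B1 o B2)" by (rule bounded_opI[OF o12 B12_cls])

lemma opr_B12: "x : K ==> opr (B1 o B2) x = A1 (A2 x)"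
 using B12_cls(2)[OF rp_Ku, of x] cls_bounded_op[OF b12 rp_Ku, of x] by simp

lemma toeplitz_product: "B1 o B2 : toeplitz_space u <-> (EX \<phi> \<eta>. tform (%x. A1 (A2 x)) \<phi> \<eta>)"
proof -
 have "B1 o B2 : toeplitz_space u <-> (EX x. symb (opr (B1 o B2)) x)" by (simp add: toeplitz_iff b12)
 also have "... <-> (EX \<phi> \<eta>. tform (opr (B1 o B2)) \<phi> \<eta>)" by (rule tform_iff_symb[OF opK_opr[OF b12], symmetric])
 also have "... <-> (EX \<phi> \<eta>. tform (%x. A1 (A2 x)) \<phi> \<eta>)"
  using tform_cong[of "opr (B1 o B2)" "%x. A1 (A2 x)", OF opr_B12] by simp
 finally show ?thesis .
qed

lemma sedlock_conditions:
 "B1 : times_D u (sedlock u \<alpha>) & B2 : D_times u (sedlock u \<alpha>) <-> sedop \<alpha> A1 & sedop \<alpha> A2"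
 unfolding times_D_iff[OF b1] D_times_iff[OF b2] A1_def[abs_def] A2_def[abs_def] ..

lemma scalar1: assumes "ALL f:K. A1 f = c *C f" shows "op_eq u B1 (%f z. c * D_op u f z)"
proof (rule op_eqI[OF b1])
 fix f assume "f : Ku u"
 hence f: "f : L2" "cls f : K" by (auto simp: Ku_iff)
 show "(%z. c * D_op u f z) : L2" by (intro Li_mult_L2 Li_const D_op_cls f)
 show "cls (%z. c * D_op u f z) = opr B1 (cls f)" using assms by (simp add: cls_scaleC D_op_cls f opr_B1 Dx_K)
qed

lemma scalar2: assumes "ALL f:K. A2 f = c *C f" shows "op_eq u B2 (%f z. c * D_op u f z)"
proof (rule op_eqI[OF b2])
 fix f assume "f : Ku u"
 hence f: "f : L2" "cls f : K" by (auto simp: Ku_iff)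
 show "(%z. c * D_op u f z) : L2" by (intro Li_mult_L2 Li_const D_op_cls f)
 show "cls (%z. c * D_op u f z) = opr B2 (cls f)" using assms by (simp add: cls_scaleC D_op_cls f opr_B2 bcl_scaleC[OF bcl_Dx])
qed

theorem product_iff:
 assumes n1: "\<not> (EX c. op_eq u B1 (%f z. c * D_op u f z))" and n2: "\<not> (EX c. op_eq u B2 (%f z. c * D_op u f z))"
 shows "B1 o B2 : toeplitz_space u <-> (EX \<alpha>. sedop \<alpha> A1 & sedop \<alpha> A2)"
proof
 assume "B1 o B2 : toeplitz_space u"
 then obtain \<phi> \<eta> where T: "tform (%x. A1 (A2 x)) \<phi> \<eta>" unfolding toeplitz_product by blast
 obtain \<phi>1 \<eta>1 where T1: "tform A1 \<phi>1 \<eta>1" using tform_iff_symb[OF o1] s1 by blast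
 obtain \<phi>2 \<eta>2 where T2: "tform A2 \<phi>2 \<eta>2" using tform_iff_symb[OF o2] s2 by blast
 have "(EX a. sedA a A1 & sedA a A2) \<or> (sedInf A1 & sedInf A2)"
  by (rule sedlock_product[OF o1 T1 C1 o2 T2 C2 _ _ T]) (use n1 n2 scalar1 scalar2 in blast)+
 thus "EX \<alpha>. sedop \<alpha> A1 & sedop \<alpha> A2"
 proof
  assume "EX a. sedA a A1 & sedA a A2"
  then obtain a where "sedA a A1 & sedA a A2" by blast
  thus ?thesis by (intro exI[of _ "Fin a"]) (simp add: sedop_def)
 next
  assume "sedInf A1 & sedInf A2"
  thus ?thesis by (intro exI[of _ Infty]) (simp add: sedop_def)
 qed
next
 assume "EX \<alpha>. sedop \<alpha> A1 & sedop \<alpha> A2"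
 then obtain \<alpha> where "sedop \<alpha> A1" "sedop \<alpha> A2" by blast
 \<comment> \<open>For \<open>Infty\<close> the number \<open>a\<close> is a placeholder and the
   second alternative holds.\<close>
 hence "(sedA a A1 & sedA a A2) \<or> (sedInf A1 & sedInf A2)" if "a = (case \<alpha> of Fin a => a | Infty => 0)" for a
  by (cases \<alpha>) (simp_all add: sedop_def that)
 thus "B1 o B2 : toeplitz_space u"
  unfolding toeplitz_product by (intro sedlock_product_converse[OF o1 C1 o2 C2]) blast
qed

text \<open>Both operators commute with the unitary modification, hence are multiplication operators
  in its spectral representation, where the product is the pointwise one.\<close>

theorem unimodular_case:
 assumes s: "sedA a A1" "sedA a A2" and a: "cmod a = 1"
 shows "EX \<Phi> : Linfty (clark_measure u a). EX \<Psi> : Linfty (clark_measure u a).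
  op_eq u B1 (fun_calc u (mod_shift u a) \<Phi> o D_op u) \<and>
  op_eq u B2 (D_op u o fun_calc u (mod_shift u a) \<Psi>) \<and>
  op_eq u (B1 o B2) (fun_calc u (mod_shift u a) (%z. \<Phi> z * \<Psi> z))"
proof -
 interpret c: clark u a by unfold_locales (rule a)
 obtain \<Phi> where \<Phi>: "c.bB \<Phi>" "!!x. x : K ==> A1 x = c.mop \<Phi> x"
  using c.commutant[OF o1 sedA_commute[OF o1 C1 s(1)]] a by auto
 obtain \<Psi> where \<Psi>: "c.bB \<Psi>" "!!x. x : K ==> A2 x = c.mop \<Psi> x"
  using c.commutant[OF o2 sedA_commute[OF o2 C2 s(2)]] a by auto
 have Linf: "f : Linfty (clark_measure u a)" if bf: "c.bB f" for f
 proof -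
  obtain C where C: "!!z. z : sph ==> cmod (f z) <= C" using c.bB_bound[OF bf] by blast
  have "f : borel_measurable (clark_measure u a)"
   using bf measurable_cong_sets[OF c.sets_clark refl] by (auto simp: c.bB_def)
  moreover have "AE z in clark_measure u a. cmod (f z) <= C"
   using C sets_eq_imp_space_eq[OF c.sets_clark] by (intro AE_I2) (simp add: space_circle)
  ultimately show ?thesis unfolding Linfty_def by blast
 qed
 have e1: "op_eq u B1 (fun_calc u (mod_shift u a) \<Phi> o D_op u)"
 proof (rule op_eqI[OF b1])
  fix f assume f: "f : Ku u"
  note m = c.fun_calc_mop[OF \<Phi>(1) D_op_Ku[OF f]]
  show "(fun_calc u (mod_shift u a) \<Phi> o D_op u) f : L2" using m by simp
  show "cls ((fun_calc u (mod_shift u a) \<Phi> o D_op u) f) = opr B1 (cls f)"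
   using m f by (simp add: opr_B1 \<Phi>(2) Dx_K Ku_iff D_op_cls)
 qed
 have e2: "op_eq u B2 (D_op u o fun_calc u (mod_shift u a) \<Psi>)"
 proof (rule op_eqI[OF b2])
  fix f assume f: "f : Ku u"
  note m = c.fun_calc_mop[OF \<Psi>(1) f]
  show "(D_op u o fun_calc u (mod_shift u a) \<Psi>) f : L2" using m by (simp add: D_op_cls)
  show "cls ((D_op u o fun_calc u (mod_shift u a) \<Psi>) f) = opr B2 (cls f)"
   using m f by (simp add: opr_B2 \<Psi>(2) Ku_iff D_op_cls)
 qed
 have e12: "op_eq u (B1 o B2) (fun_calc u (mod_shift u a) (%z. \<Phi> z * \<Psi> z))"
 proof (rule op_eqI[OF b12])
  fix f assume f: "f : Ku u"
  hence x: "cls f : K" by (simp add: Ku_iff)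
  note m = c.fun_calc_mop[OF c.bB_mult[OF \<Phi>(1) \<Psi>(1)] f]
  show "fun_calc u (mod_shift u a) (%z. \<Phi> z * \<Psi> z) f : L2" by (rule m(1))
  show "cls (fun_calc u (mod_shift u a) (%z. \<Phi> z * \<Psi> z) f) = opr (B1 o B2) (cls f)"
   unfolding m(2) opr_B12[OF x] \<Psi>(2)[OF x] \<Phi>(2)[OF c.mop(1)[OF \<Psi>(1)]]
   by (rule c.mop_mop[OF \<Phi>(1) \<Psi>(1) x, symmetric])
 qed
 show ?thesis using Linf[OF \<Phi>(1)] Linf[OF \<Psi>(1)] e1 e2 e12 by blast
qed

text \<open>Shared by the cases inside and outside the circle: from bounded Toeplitz symbols it
  produces the Hankel symbols. These carry an additional conjugate of u, and for \<open>B1\<close>,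
  where D stands on the right, the symbol is also reflected.\<close>

lemma symbol_equations:
 assumes s1: "s1 : Li" "!!x. x : K ==> A1 x = PM K (mul s1 x)"
  and s2: "s2 : Li" "!!x. x : K ==> A2 x = PM K (mul s2 x)"
  and s12: "s12 : Li" "!!x. x : K ==> A1 (A2 x) = PM K (mul s12 x)"
  and t1: "t1 : Bm" "AE z in circle. t1 z = cnj (U z) * s1 (cnj z)"
  and t2: "t2 : Bm" "AE z in circle. t2 z = cnj (U z) * s2 z"
 shows "op_eq u B1 (TTO u s1 o D_op u)" "op_eq u B1 (THO u t1)"
  "op_eq u B2 (D_op u o TTO u s2)" "op_eq u B2 (THO u t2)" "op_eq u (B1 o B2) (TTO u s12)"
proof -
 have UU: "AE z in circle. U z * cnj (U z) = 1"
  using U_unim by eventually_elim (simp add: complex_norm_square[symmetric])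
 have l1: "t1 : Li" by (rule Li_cong[OF t1(1) Li_mult[OF Ub_Li Li_reflect[OF s1(1)]] t1(2)])
 have l2: "t2 : Li" by (rule Li_cong[OF t2(1) Li_mult[OF Ub_Li s2(1)] t2(2)])
 have u1: "Mu (mul t1 x) = mul (%z. s1 (cnj z)) x" for x
  unfolding mul_mul[OF U_Li l1]
 proof (rule mul_cong[OF Li_mult[OF U_Li l1] Li_reflect[OF s1(1)]])
  show "(%z. U z * t1 z) \<doteq> (%z. s1 (cnj z))"
   unfolding ae_eq_def using t1(2) UU by eventually_elim (simp add: mult.assoc[symmetric])
 qed
 have u2: "Mu (mul t2 x) = mul s2 x" for x
  unfolding mul_mul[OF U_Li l2]
 proof (rule mul_cong[OF Li_mult[OF U_Li l2] s2(1)])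
  show "(%z. U z * t2 z) \<doteq> s2"
   unfolding ae_eq_def using t2(2) UU by eventually_elim (simp add: mult.assoc[symmetric])
 qed
 show "op_eq u B1 (TTO u s1 o D_op u)"
  by (rule op_eqI[OF b1]) (simp_all add: TTO_Li D_op_cls s1 opr_B1 Dx_K Ku_iff)
 show "op_eq u B1 (THO u t1)"
  by (rule op_eqI[OF b1])
   (simp_all add: THO_Li l1 s1 opr_B1 Dx_K Ku_iff u1 PM_Dx[symmetric] Dx_mul[OF Li_reflect[OF s1(1)]])
 show "op_eq u B2 (D_op u o TTO u s2)"
  by (rule op_eqI[OF b2]) (simp_all add: TTO_Li D_op_cls s2 opr_B2 Ku_iff)
 show "op_eq u B2 (THO u t2)"
  by (rule op_eqI[OF b2]) (simp_all add: THO_Li l2 s2 opr_B2 Ku_iff u2)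
 show "op_eq u (B1 o B2) (TTO u s12)"
  by (rule op_eqI[OF b12]) (simp_all add: TTO_Li s12 opr_B12 Ku_iff)
qed

lemma symbol_of_form:
 assumes "y : K" "!!g. g : K ==> cip y g = cip (mul s x) g"
 shows "y = PM K (mul s x)"
 by (rule PM_unique[OF csub_K assms, symmetric])

lemma measurable_reflect: "f : Bm ==> (%z. f (cnj z)) : Bm"
 by (rule measurable_compose[OF measurable_cnj_circle])

text \<open>Moving the multiplier \<open>X a\<close> from \<open>g\<close> to the other argument
  conjugates it, which produces the denominator 1 - a conj(u).\<close>

theorem inside_case:
 assumes s: "sedA a A1" "sedA a A2" and a: "cmod a < 1"
 shows "EX \<Psi>1 : Hinfty. EX \<Psi>2 : Hinfty.
  op_eq u B1 (TTO u (%z. bv \<Psi>1 z / (1 - a * cnj (U z))) o D_op u) \<and>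
  op_eq u B1 (THO u (%z. cnj (U z * hat (bv \<Psi>1) z) / (1 - a * U z))) \<and>
  op_eq u B2 (D_op u o TTO u (%z. bv \<Psi>2 z / (1 - a * cnj (U z)))) \<and>
  op_eq u B2 (THO u (%z. cnj (U z) * bv \<Psi>2 z / (1 - a * cnj (U z)))) \<and>
  op_eq u (B1 o B2) (TTO u (%z. bv \<Psi>1 z * bv \<Psi>2 z / (1 - a * cnj (U z))))"
proof -
 obtain \<Psi>1 where 1: "\<Psi>1 : Hinfty" "!!f g. f : K ==> g : K ==> cip (A1 f) g = cip (mul (bv \<Psi>1) f) (X a g)"
  using sedA_symbol[OF o1 C1 s(1) a] by blast
 obtain \<Psi>2 where 2: "\<Psi>2 : Hinfty" "!!f g. f : K ==> g : K ==> cip (A2 f) g = cip (mul (bv \<Psi>2) f) (X a g)"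
  using sedA_symbol[OF o2 C2 s(2) a] by blast
 note l1 = bv_Li[OF 1(1)] and l2 = bv_Li[OF 2(1)]
 have sym: "(%z. h z / (1 - a * cnj (U z))) : Li" "cip (mul h x) (X a g) = cip (mul (%z. h z / (1 - a * cnj (U z))) x) g"
  if h: "h : Li" for h x g
 proof -
  have e: "(%z. h z / (1 - a * cnj (U z))) = (%z. cnj (rsv a z) * h z)" by (simp add: rsv_def fun_eq_iff)
  show "(%z. h z / (1 - a * cnj (U z))) : Li" unfolding e by (rule Li_mult[OF rsvb_Li[OF a] h])
  show "cip (mul h x) (X a g) = cip (mul (%z. h z / (1 - a * cnj (U z))) x) g"
   unfolding e mul_mul[OF rsvb_Li[OF a] h, symmetric] by (simp add: cip_mul rsvb_Li a)
 qed
 let ?s1 = "%z. bv \<Psi>1 z / (1 - a * cnj (U z))"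
 let ?s2 = "%z. bv \<Psi>2 z / (1 - a * cnj (U z))"
 let ?s12 = "%z. bv \<Psi>1 z * bv \<Psi>2 z / (1 - a * cnj (U z))"
 note lp = Li_mult[OF l1 l2]
 have e1: "A1 x = PM K (mul ?s1 x)" if x: "x : K" for x
  by (rule symbol_of_form[OF opK_K[OF o1 x]]) (simp add: 1 x sym(2)[OF l1])
 have e2: "A2 x = PM K (mul ?s2 x)" if x: "x : K" for x
  by (rule symbol_of_form[OF opK_K[OF o2 x]]) (simp add: 2 x sym(2)[OF l2])
 have e12: "A1 (A2 x) = PM K (mul ?s12 x)" if x: "x : K" for x
  by (rule symbol_of_form[OF opK_K[OF o12 x]])
   (simp add: sedA_symbol_mult[OF a 1(1) 2(1) opK_K[OF o2] 1(2) 2(2) x] sym(2)[OF lp])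
 have mU: "U : Bm" and m1: "bv \<Psi>1 : Bm" and m2: "bv \<Psi>2 : Bm"
  using U_Li l1 l2 by (auto intro: Li_measurable)
 have t1: "(%z. cnj (U z * hat (bv \<Psi>1) z) / (1 - a * U z)) : Bm"
  unfolding hat_def using mU measurable_reflect[OF m1] by measurable
 have t2: "(%z. cnj (U z) * bv \<Psi>2 z / (1 - a * cnj (U z))) : Bm"
  using mU m2 by measurable
 have a1: "AE z in circle. cnj (U z * hat (bv \<Psi>1) z) / (1 - a * U z) = cnj (U z) * (bv \<Psi>1 (cnj z) / (1 - a * cnj (U (cnj z))))"
  using U_cnj by eventually_elim (simp add: hat_def)
 have a2: "AE z in circle. cnj (U z) * bv \<Psi>2 z / (1 - a * cnj (U z)) = cnj (U z) * (bv \<Psi>2 z / (1 - a * cnj (U z)))"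
  by simp
 show ?thesis
  using symbol_equations[OF sym(1)[OF l1] e1 sym(1)[OF l2] e2 sym(1)[OF lp] e12 t1 a1 t2 a2] 1(1) 2(1) by blast
qed

text \<open>The adjoints belong to a class inside the disc and have analytic symbols; taking
  adjoints back conjugates these and leaves the unconjugated \<open>rsv b\<close>, which is the
  quotient \<open>quot \<alpha>\<close>.\<close>

theorem outside_case:
 assumes s: "sedop \<alpha> A1" "sedop \<alpha> A2" and a: "outside_disc \<alpha>"
 shows "EX \<Psi>1 : Hinfty. EX \<Psi>2 : Hinfty.
  op_eq u B1 (TTO u (%z. quot \<alpha> (U z) * cnj (bv \<Psi>1 z)) o D_op u) \<and>
  op_eq u B1 (THO u (%z. quot \<alpha> (cnj (U z)) * cnj (U z) * hat (bv \<Psi>1) z)) \<and>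
  op_eq u B2 (D_op u o TTO u (%z. quot \<alpha> (U z) * cnj (bv \<Psi>2 z))) \<and>
  op_eq u B2 (THO u (%z. quot \<alpha> (U z) * cnj (U z) * cnj (bv \<Psi>2 z))) \<and>
  op_eq u (B1 o B2) (TTO u (%z. quot \<alpha> (U z) * cnj (bv \<Psi>1 z * bv \<Psi>2 z)))"
proof -
 \<comment> \<open>The parameter of the adjoint class; the class of \<infinity> goes to the class of
   0.\<close>
 define b where "b = (case \<alpha> of Fin a => 1 / cnj a | Infty => 0)"
 have b: "cmod b < 1" using a by (cases \<alpha>) (auto simp: b_def norm_divide divide_less_eq_1)
 have q: "quot \<alpha> (U z) = rsv b z" for z
 proof (cases \<alpha>)
  case (Fin a)
  hence "a ~= 0" using a by auto
  hence "1 - U z / a = (a - U z) / a" by (simp add: field_simps)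
  thus ?thesis by (simp add: Fin b_def rsv_def)
 qed (simp add: b_def rsv_def)
 have qm: "(%z. quot \<alpha> (g z)) : Bm" if "g : Bm" for g
  using that by (cases \<alpha>) simp_all
 have sA: "sedA b (adK A)" if A: "opK A" "sedop \<alpha> A" for A
 proof (cases \<alpha>)
  case (Fin c)
  hence "c ~= 0" using a by auto
  thus ?thesis using sedA_adK[OF A(1), of c] A(2) by (simp add: Fin sedop_def b_def)
 next
  case Infty thus ?thesis using sedInf_adK[OF A(1)] A(2) by (simp add: sedop_def b_def)
 qed
 obtain \<Psi>1 where 1: "\<Psi>1 : Hinfty" "!!f g. f : K ==> g : K ==> cip (adK A1 f) g = cip (mul (bv \<Psi>1) f) (X b g)"
  using sedA_symbol[OF opK_adK[OF o1] Csym_adK[OF o1 C1] sA[OF o1 s(1)] b] by blast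
 obtain \<Psi>2 where 2: "\<Psi>2 : Hinfty" "!!f g. f : K ==> g : K ==> cip (adK A2 f) g = cip (mul (bv \<Psi>2) f) (X b g)"
  using sedA_symbol[OF opK_adK[OF o2] Csym_adK[OF o2 C2] sA[OF o2 s(2)] b] by blast
 note l1 = bv_Li[OF 1(1)] and l2 = bv_Li[OF 2(1)]
 have sym: "(%z. quot \<alpha> (U z) * cnj (h z)) : Li" "cip (X b x) (mul h g) = cip (mul (%z. quot \<alpha> (U z) * cnj (h z)) x) g"
  if h: "h : Li" for h x g
 proof -
  have e: "(%z. quot \<alpha> (U z) * cnj (h z)) = (%z. cnj (h z) * rsv b z)" by (simp add: q fun_eq_iff mult.commute)
  show "(%z. quot \<alpha> (U z) * cnj (h z)) : Li" unfolding e by (rule Li_mult[OF Li_cnj[OF h] rsv_Li[OF b]])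
  show "cip (X b x) (mul h g) = cip (mul (%z. quot \<alpha> (U z) * cnj (h z)) x) g"
   unfolding e mul_mul[OF Li_cnj[OF h] rsv_Li[OF b], symmetric] by (simp add: cip_mul Li_cnj h)
 qed
 let ?s1 = "%z. quot \<alpha> (U z) * cnj (bv \<Psi>1 z)"
 let ?s2 = "%z. quot \<alpha> (U z) * cnj (bv \<Psi>2 z)"
 let ?s12 = "%z. quot \<alpha> (U z) * cnj (bv \<Psi>1 z * bv \<Psi>2 z)"
 note lp = Li_mult[OF l1 l2]
 have e: "y = PM K (mul (%z. quot \<alpha> (U z) * cnj (h z)) x)"
  if "h : Li" "y : K" "!!g. g : K ==> cip g y = cip (mul h g) (X b x)" for y x h
  using that(3) by (intro symbol_of_form that(2)) (metis cip_commute sym(2)[OF that(1)])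
 have e1: "A1 x = PM K (mul ?s1 x)" if x: "x : K" for x
  by (rule e[OF l1 opK_K[OF o1 x]]) (simp add: 1(2)[OF _ x, symmetric] cip_adK[OF o1 x])
 have e2: "A2 x = PM K (mul ?s2 x)" if x: "x : K" for x
  by (rule e[OF l2 opK_K[OF o2 x]]) (simp add: 2(2)[OF _ x, symmetric] cip_adK[OF o2 x])
 have e12: "A1 (A2 x) = PM K (mul ?s12 x)" if x: "x : K" for x
 proof (rule e[OF lp opK_K[OF o12 x]])
  fix g assume g: "g : K"
  have "cip g (A1 (A2 x)) = cip (adK A2 (adK A1 g)) x"
   by (simp add: cip_adK[OF o1] cip_adK[OF o2] opK_K[OF o2] x)
  \<comment> \<open>Adjoints reverse the order of the factors; the symbols commute.\<close>
  also have "... = cip (mul (%z. bv \<Psi>2 z * bv \<Psi>1 z) g) (X b x)"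
   by (rule sedA_symbol_mult[OF b 2(1) 1(1) opK_K[OF opK_adK[OF o1]] 2(2) 1(2) g x])
  finally show "cip g (A1 (A2 x)) = cip (mul (%z. bv \<Psi>1 z * bv \<Psi>2 z) g) (X b x)" by (simp only: mult.commute)
 qed
 have mU: "U : Bm" and m1: "bv \<Psi>1 : Bm" and m2: "bv \<Psi>2 : Bm"
  using U_Li l1 l2 by (auto intro: Li_measurable)
 have mUb: "(%z. cnj (U z)) : Bm" using mU by measurable
 have t1: "(%z. quot \<alpha> (cnj (U z)) * cnj (U z) * hat (bv \<Psi>1) z) : Bm"
  unfolding hat_def using qm[OF mUb] mUb measurable_reflect[OF m1] by measurable
 have t2: "(%z. quot \<alpha> (U z) * cnj (U z) * cnj (bv \<Psi>2 z)) : Bm"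
  using qm[OF mU] mUb m2 by measurable
 have a1: "AE z in circle. quot \<alpha> (cnj (U z)) * cnj (U z) * hat (bv \<Psi>1) z = cnj (U z) * (quot \<alpha> (U (cnj z)) * cnj (bv \<Psi>1 (cnj z)))"
  using U_cnj by eventually_elim (simp add: hat_def ac_simps)
 have a2: "AE z in circle. quot \<alpha> (U z) * cnj (U z) * cnj (bv \<Psi>2 z) = cnj (U z) * (quot \<alpha> (U z) * cnj (bv \<Psi>2 z))"
  by (simp add: ac_simps)
 show ?thesis
  using symbol_equations[OF sym(1)[OF l1] e1 sym(1)[OF l2] e2 sym(1)[OF lp] e12 t1 a1 t2 a2] 1(1) 2(1) by blast
qed

end

theorem theorem5p4:
  fixes u :: "complex \<Rightarrow> complex" and B1 B2 :: oper
  assumes "inner_function u" and "\<not> u constant_on ball 0 1" and "real_symmetric u"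
    and "B1 \<in> hankel_space u" and "B2 \<in> hankel_space u"
    and "\<not> (\<exists>c. op_eq u B1 (\<lambda>f z. c * D_op u f z))"
    and "\<not> (\<exists>c. op_eq u B2 (\<lambda>f z. c * D_op u f z))"
  shows
    "(B1 \<circ> B2 \<in> toeplitz_space u \<longleftrightarrow>
        (\<exists>\<alpha>. B1 \<in> times_D u (sedlock u \<alpha>) \<and> B2 \<in> D_times u (sedlock u \<alpha>)))
     \<and>
     (\<forall>\<alpha>. B1 \<in> times_D u (sedlock u \<alpha>) \<and> B2 \<in> D_times u (sedlock u \<alpha>) \<longrightarrow>
        (\<forall>a. \<alpha> = Fin a \<and> cmod a = 1 \<longrightarrow>
           (\<exists>\<Phi> \<in> Linfty (clark_measure u a). \<exists>\<Psi> \<in> Linfty (clark_measure u a).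
              op_eq u B1 (fun_calc u (mod_shift u a) \<Phi> \<circ> D_op u) \<and>
              op_eq u B2 (D_op u \<circ> fun_calc u (mod_shift u a) \<Psi>) \<and>
              op_eq u (B1 \<circ> B2) (fun_calc u (mod_shift u a) (\<lambda>z. \<Phi> z * \<Psi> z)))) \<and>
        (\<forall>a. \<alpha> = Fin a \<and> cmod a < 1 \<longrightarrow>
           (\<exists>\<Psi>1 \<in> Hinfty. \<exists>\<Psi>2 \<in> Hinfty.
              op_eq u B1 (TTO u (\<lambda>z. bv \<Psi>1 z / (1 - a * cnj (bv u z))) \<circ> D_op u) \<and>
              op_eq u B1 (THO u (\<lambda>z. cnj (bv u z * hat (bv \<Psi>1) z) / (1 - a * bv u z))) \<and>
              op_eq u B2 (D_op u \<circ> TTO u (\<lambda>z. bv \<Psi>2 z / (1 - a * cnj (bv u z)))) \<and>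
              op_eq u B2 (THO u (\<lambda>z. cnj (bv u z) * bv \<Psi>2 z / (1 - a * cnj (bv u z)))) \<and>
              op_eq u (B1 \<circ> B2)
                (TTO u (\<lambda>z. bv \<Psi>1 z * bv \<Psi>2 z / (1 - a * cnj (bv u z)))))) \<and>
        (outside_disc \<alpha> \<longrightarrow>
           (\<exists>\<Psi>1 \<in> Hinfty. \<exists>\<Psi>2 \<in> Hinfty.
              op_eq u B1 (TTO u (\<lambda>z. quot \<alpha> (bv u z) * cnj (bv \<Psi>1 z)) \<circ> D_op u) \<and>
              op_eq u B1 (THO u (\<lambda>z. quot \<alpha> (cnj (bv u z)) * cnj (bv u z) * hat (bv \<Psi>1) z)) \<and>
              op_eq u B2 (D_op u \<circ> TTO u (\<lambda>z. quot \<alpha> (bv u z) * cnj (bv \<Psi>2 z))) \<and>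
              op_eq u B2 (THO u (\<lambda>z. quot \<alpha> (bv u z) * cnj (bv u z) * cnj (bv \<Psi>2 z))) \<and>
              op_eq u (B1 \<circ> B2)
                (TTO u (\<lambda>z. quot \<alpha> (bv u z) * cnj (bv \<Psi>1 z * bv \<Psi>2 z))))))"
proof -
 interpret hankel_pair u B1 B2 by unfold_locales (fact assms)+
 show ?thesis
  unfolding sedlock_conditions
  using product_iff[OF assms(6,7)] unimodular_case inside_case outside_case
  by (auto simp: sedop_def)
qed

end
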